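(* There holds the operator bound $$\|\mathcal{T}_4(f_1,f_2,f_3)\|_X\le C_X\prod_{k=1}^3\|f_k\|_X$$ (with $C_X$ a constant depending only on $X$, and for all $f_1,f_2,f_3\in X$) for each of the following spaces $X$: (i) $X=L^2$, with $C_X=\sqrt{8/\pi}$; (ii) $X=L^{2,\sigma}$, for any $\sigma\ge0$; (iii) $X=H^\sigma$, for any $\sigma\ge0$; (iv) $X=L^{\infty,s}$, for any $s>1/2$; (v) $X=L^{p,s}$, for any $p\ge2$ and $s>1/2-1/p$.
   Context: All functions are $\mathbb{R}\to\mathbb{C}$. $H=-\Delta+x^2$ on $L^2(\mathbb{R})$, and $e^{itH}$ is the unitary propagator of $iu_t+Hu=0$ (so $e^{itH}\phi_n=e^{it(2n+1)}\phi_n$ for the Hermite functions $\phi_n$, $H\phi_n=(2n+1)\phi_n$). Define $$\mathcal{T}_4(f_1,f_2,f_3)=\frac{8}{\pi}\int_{-\pi/4}^{\pi/4}e^{-itH}\left[(e^{itH}f_1)(e^{itH}f_2)\overline{(e^{itH}f_3)}\right]dt ,$$ equivalently, by duality, $\int_{\mathbb{R}}\mathcal{T}_4(f_1,f_2,f_3)\overline{g}\,dx=4\cdot\frac{2}{\pi}\int_0^{\pi/2}\int_{\mathbb{R}}(e^{itH}f_1)(e^{itH}f_2)\overline{(e^{itH}f_3)(e^{itH}g)}\,dx\,dt$ for $g\in L^2$. With $\langle x\rangle=\sqrt{1+x^2}$: $\|f\|_{L^{p,s}}=\|\langle x\rangle^sf\|_{L^p}$ for $2\le p\le\infty$, and $\|f\|_{H^\sigma}=\|\langle\xi\rangle^\sigma\widehat{f}\|_{L^2}$,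 where $\widehat{f}(\xi)=(2\pi)^{-1/2}\int_{\mathbb{R}} e^{-ix\xi}f(x)\,dx$. *)

theory Defs
  imports "HOL-Analysis.Analysis" "HOL-Probability.Essential_Supremum"
begin

text \<open>
  Elements of the function spaces are Lebesgue measurable representatives of type
  \<^typ>\<open>real \<Rightarrow> complex\<close>. An operator that is only determined up to almost-everywhere equality
  returns a representative picked by \<open>SOME\<close>; spaces and (semi)norms below do not depend on it.
\<close>

section \<open>Function spaces\<close>

definition Lp_space :: "real \<Rightarrow> (real \<Rightarrow> complex) set" where
  "Lp_space p = {f \<in> borel_measurable lebesgue. integrable lebesgue (\<lambda>x. norm (f x) powr p)}"

definition Lp_norm :: "real \<Rightarrow> (real \<Rightarrow> complex) \<Rightarrow> real" where
  "Lp_norm p f = (LINT x|lebesgue. norm (f x) powr p) powr (1 / p)"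

definition Linf_space :: "(real \<Rightarrow> complex) set" where
  "Linf_space = {f \<in> borel_measurable lebesgue. esssup lebesgue (\<lambda>x. ereal (norm (f x))) < \<infinity>}"

definition Linf_norm :: "(real \<Rightarrow> complex) \<Rightarrow> real" where
  "Linf_norm f = real_of_ereal (esssup lebesgue (\<lambda>x. ereal (norm (f x))))"

definition japanese :: "real \<Rightarrow> real" where
  "japanese x = sqrt (1 + x\<^sup>2)"

definition weighted :: "real \<Rightarrow> (real \<Rightarrow> complex) \<Rightarrow> real \<Rightarrow> complex" where
  "weighted s f = (\<lambda>x. of_real (japanese x powr s) * f x)"

definition wLp_space :: "real \<Rightarrow> real \<Rightarrow> (real \<Rightarrow> complex) set" where
  "wLp_space p s = {f. weighted s f \<in> Lp_space p}"

definition wLp_norm :: "real \<Rightarrow> real \<Rightarrow> (real \<Rightarrow> complex) \<Rightarrow> real" where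
  "wLp_norm p s f = Lp_norm p (weighted s f)"

definition wLinf_space :: "real \<Rightarrow> (real \<Rightarrow> complex) set" where
  "wLinf_space s = {f. weighted s f \<in> Linf_space}"

definition wLinf_norm :: "real \<Rightarrow> (real \<Rightarrow> complex) \<Rightarrow> real" where
  "wLinf_norm s f = Linf_norm (weighted s f)"

definition L2_inner :: "(real \<Rightarrow> complex) \<Rightarrow> (real \<Rightarrow> complex) \<Rightarrow> complex" where
  "L2_inner f g = (LINT x|lebesgue. f x * cnj (g x))"

text \<open>
  For square-integrable \<open>f\<close> the integral defining the Fourier transform need not converge
  absolutely; as in Plancherel's theorem, \<open>fourier f\<close> is the \<open>L\<^sup>2\<close> limit of the transforms of
  the truncations of \<open>f\<close>.
\<close>

definition fourier_trunc :: "real \<Rightarrow> (real \<Rightarrow> complex) \<Rightarrow> real \<Rightarrow> complex" where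
  "fourier_trunc R f \<xi> =
     of_real (1 / sqrt (2 * pi)) * (LINT x:{-R..R}|lebesgue. cis (- (x * \<xi>)) * f x)"

definition fourier :: "(real \<Rightarrow> complex) \<Rightarrow> real \<Rightarrow> complex" where
  "fourier f = (SOME F. F \<in> Lp_space 2 \<and>
     ((\<lambda>R. Lp_norm 2 (\<lambda>\<xi>. F \<xi> - fourier_trunc R f \<xi>)) \<longlongrightarrow> 0) at_top)"

text \<open>Used for \<open>\<sigma> \<ge> 0\<close> only, where Sobolev functions are square integrable.\<close>

definition Hs_space :: "real \<Rightarrow> (real \<Rightarrow> complex) set" where
  "Hs_space \<sigma> = {f \<in> Lp_space 2. fourier f \<in> wLp_space 2 \<sigma>}"

definition Hs_norm :: "real \<Rightarrow> (real \<Rightarrow> complex) \<Rightarrow> real" where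
  "Hs_norm \<sigma> f = wLp_norm 2 \<sigma> (fourier f)"

section \<open>Hermite functions and the harmonic oscillator\<close>

text \<open>Hermite polynomials in the normalisation with leading coefficient \<open>2 ^ n\<close>.\<close>

fun hermite_poly :: "nat \<Rightarrow> real \<Rightarrow> real" where
  "hermite_poly 0 x = 1"
| "hermite_poly (Suc 0) x = 2 * x"
| "hermite_poly (Suc (Suc n)) x =
     2 * x * hermite_poly (Suc n) x - 2 * real (Suc n) * hermite_poly n x"

definition hermite_fun :: "nat \<Rightarrow> real \<Rightarrow> real" where
  "hermite_fun n x = hermite_poly n x * exp (- (x\<^sup>2) / 2) / sqrt (2 ^ n * fact n * sqrt pi)"

lemma hermite_poly_has_deriv:
  "(hermite_poly n has_real_derivative 2 * x * hermite_poly n x - hermite_poly (Suc n) x) (at x)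
   \<and> (hermite_poly (Suc n) has_real_derivative 2 * real (Suc n) * hermite_poly n x) (at x)"
proof (induction n)
  case 0
  have "(hermite_poly 0) = (\<lambda>x. 1)" "hermite_poly (Suc 0) = (\<lambda>x. 2 * x)"
    by auto
  then show ?case by (auto intro!: derivative_eq_intros)
next
  case (Suc n)
  have eq: "hermite_poly (Suc (Suc n)) =
      (\<lambda>x. 2 * x * hermite_poly (Suc n) x - 2 * real (Suc n) * hermite_poly n x)"
    by auto
  note d = Suc.IH[THEN conjunct1] Suc.IH[THEN conjunct2]
  have "(hermite_poly (Suc (Suc n)) has_real_derivative
      2 * real (Suc (Suc n)) * hermite_poly (Suc n) x) (at x)"
    unfolding eq
    by (rule derivative_eq_intros d refl | simp add: algebra_simps)+
  moreover have "2 * x * hermite_poly (Suc n) x - hermite_poly (Suc (Suc n)) x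
      = 2 * real (Suc n) * hermite_poly n x"
    by simp
  ultimately show ?case using d(2) by metis
qed

lemma hermite_fun_has_deriv:
  "(hermite_fun n has_real_derivative
     (x * hermite_poly n x - hermite_poly (Suc n) x) * exp (- (x\<^sup>2) / 2)
       / sqrt (2 ^ n * fact n * sqrt pi)) (at x)"
proof -
  have "((\<lambda>x. hermite_poly n x * exp (- (x\<^sup>2) / 2)) has_real_derivative
     (x * hermite_poly n x - hermite_poly (Suc n) x) * exp (- (x\<^sup>2) / 2)) (at x)"
    by (rule derivative_eq_intros hermite_poly_has_deriv[THEN conjunct1] refl
        | simp add: algebra_simps)+
  from DERIV_cdivide[OF this] show ?thesis
    unfolding hermite_fun_def .
qed

text \<open>The eigenvalue equation \<open>H \<phi>\<^sub>n = (2n+1) \<phi>\<^sub>n\<close> for \<open>H = - \<Delta> + x\<^sup>2\<close>.\<close>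

lemma hermite_fun_eigen:
  "- deriv (deriv (hermite_fun n)) x + x\<^sup>2 * hermite_fun n x
     = (2 * real n + 1) * hermite_fun n x"
proof -
  let ?c = "sqrt (2 ^ n * fact n * sqrt pi)"
  have d1: "deriv (hermite_fun n) = (\<lambda>x.
      (x * hermite_poly n x - hermite_poly (Suc n) x) * exp (- (x\<^sup>2) / 2) / ?c)"
    by (rule ext, rule DERIV_imp_deriv, rule hermite_fun_has_deriv)
  have "((\<lambda>x. (x * hermite_poly n x - hermite_poly (Suc n) x) * exp (- (x\<^sup>2) / 2))
     has_real_derivative (x\<^sup>2 - (2 * real n + 1)) * hermite_poly n x * exp (- (x\<^sup>2) / 2)) (at x)"
    by (rule derivative_eq_intros hermite_poly_has_deriv[THEN conjunct1]
          hermite_poly_has_deriv[THEN conjunct2] refl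
        | simp add: algebra_simps power2_eq_square)+
  from DERIV_imp_deriv[OF DERIV_cdivide[OF this, of ?c]]
  have "deriv (deriv (hermite_fun n)) x = (x\<^sup>2 - (2 * real n + 1)) * hermite_fun n x"
    unfolding d1 by (simp add: hermite_fun_def)
  then show ?thesis by (simp add: algebra_simps)
qed

text \<open>
  The Hermite functions are an orthonormal eigenbasis of \<open>H\<close>, so the functional calculus
  gives \<open>exp (i t H) f = (\<Sum>n. exp (i t (2n+1)) \<langle>f, \<phi>\<^sub>n\<rangle> \<phi>\<^sub>n)\<close> with convergence in \<open>L\<^sup>2\<close>.
\<close>

definition propagator_partial :: "nat \<Rightarrow> real \<Rightarrow> (real \<Rightarrow> complex) \<Rightarrow> real \<Rightarrow> complex" where
  "propagator_partial N t f x =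
     (\<Sum>n<N. cis (t * (2 * real n + 1)) * L2_inner f (\<lambda>y. of_real (hermite_fun n y))
        * of_real (hermite_fun n x))"

definition propagator :: "real \<Rightarrow> (real \<Rightarrow> complex) \<Rightarrow> real \<Rightarrow> complex" where
  "propagator t f = (SOME u. u \<in> Lp_space 2 \<and>
     (\<lambda>N. Lp_norm 2 (\<lambda>x. u x - propagator_partial N t f x)) \<longlonglongrightarrow> 0)"

section \<open>The trilinear operator\<close>

text \<open>
  The \<open>L\<^sup>2\<close>-valued time integral defining the operator is taken in the weak sense: the result
  is the (almost everywhere unique) \<open>L\<^sup>2\<close> function with the prescribed pairings. The space-time
  integral is iterated, with the space integral inside, because only then is it independent of
  the representatives of the propagated functions, which are chosen separately for each time.
\<close>

definition \<T>4_form ::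
  "(real \<Rightarrow> complex) \<Rightarrow> (real \<Rightarrow> complex) \<Rightarrow> (real \<Rightarrow> complex) \<Rightarrow> (real \<Rightarrow> complex) \<Rightarrow> complex" where
  "\<T>4_form f1 f2 f3 g = 4 * of_real (2 / pi) *
     (LINT t:{0..pi/2}|lebesgue. LINT x|lebesgue.
        propagator t f1 x * propagator t f2 x * cnj (propagator t f3 x * propagator t g x))"

definition \<T>4 ::
  "(real \<Rightarrow> complex) \<Rightarrow> (real \<Rightarrow> complex) \<Rightarrow> (real \<Rightarrow> complex) \<Rightarrow> real \<Rightarrow> complex" where
  "\<T>4 f1 f2 f3 = (SOME h. h \<in> Lp_space 2 \<and>
     (\<forall>g \<in> Lp_space 2. L2_inner h g = \<T>4_form f1 f2 f3 g))"

definition trilinear_bound ::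
  "((real \<Rightarrow> complex) \<Rightarrow> (real \<Rightarrow> complex) \<Rightarrow> (real \<Rightarrow> complex) \<Rightarrow> (real \<Rightarrow> complex))
   \<Rightarrow> (real \<Rightarrow> complex) set \<Rightarrow> ((real \<Rightarrow> complex) \<Rightarrow> real) \<Rightarrow> real \<Rightarrow> bool" where
  "trilinear_bound T X nrm C \<longleftrightarrow>
     (\<forall>f1\<in>X. \<forall>f2\<in>X. \<forall>f3\<in>X. T f1 f2 f3 \<in> X \<and> nrm (T f1 f2 f3) \<le> C * (nrm f1 * nrm f2 * nrm f3))"

end

theory Submission
  imports Defs "HOL-Probability.Probability"
begin

text \<open>
  Up to a constant, \<open>\<integral>\<T>4 (f1, f2, f3) g\<close> is the integral of
  \<open>f1(x') f2(y') \<phi>\<^sub>0(c') f3(y) g(x) \<phi>\<^sub>0(c)\<close> (with the conjugates on \<open>f3\<close> and \<open>g\<close>) over \<open>(x, y, c)\<close> and over a uniform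
  angle, where \<open>(x', y', c')\<close> is \<open>(x, y, c)\<close> rotated about \<open>(1, 1, 0)\<close> and \<open>\<phi>\<^sub>0\<close> is the Gaussian ground
  state. For Hermite functions both sides vanish unless \<open>n1 + n2 = n3 + n4\<close> and agree otherwise;
  density extends the identity to \<open>L\<^sup>2\<close>. Cauchy-Schwarz for the rotation-invariant measure then gives the
  \<open>L\<^sup>2\<close> bound. Since \<open>x\<^sup>2 + y\<^sup>2 + c\<^sup>2 = x'\<^sup>2 + y'\<^sup>2 + c'\<^sup>2\<close>, the weight at \<open>x\<close> is dominated by the sum of the
  weights at \<open>x'\<close>, \<open>y'\<close>, \<open>c'\<close>, the last being absorbed by the Gaussian; this gives weighted \<open>L\<^sup>2\<close>, and together
  with a kernel bound at the other endpoint and interpolation also weighted \<open>L\<^sup>p\<close>. The Fourier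
  transform is \<open>(-\<i>) ^ n\<close> on the \<open>n\<close>-th Hermite function, so by the same resonance it commutes with the
  operator, and Sobolev spaces reduce to weighted \<open>L\<^sup>2\<close>.
\<close>

section \<open>Hermite functions\<close>

text \<open>On each level N = n1 + n2 of the two-dimensional oscillator the time integral pairs two
  eigenfunctions restricted to the diagonal x = y. In the basis of products
  \<open>H_k(ra) H_{N-k}(rb)\<close> this pairing is diagonal, with multiplier proportional to
  \<open>H_l(0)^2 / hermite_norm l\<close> for l = N - k. These numbers are the moments of the
  cosine of a uniform angle, and cos^l is the eigenvalue on H_l of Gaussian averaging after a planar
  rotation; hence the extra variable c and its ground state. The gain is a positive kernel: absolute
  values may be put inside, which the oscillating time integral does not permit. The constant
  sqrt(8/pi) is 4 times the integral of phi_0^4, the value of the form at four ground states. The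
  obstacle is that propagated functions are chosen separately for each time, and that L^2 theory
  alone does not make their fourfold product integrable. One subsequence valid at all times gives
  joint measurability; the identity for finite Hermite sums, taken with four equal arguments, gives
  its own L^4 space-time estimate, and that permits the passage to the limit.\<close>

lemma abs_le_exp_square:
  assumes "\<epsilon> > (0::real)"
  shows "\<bar>x\<bar> \<le> (1 + 1/\<epsilon>) * exp (\<epsilon> * x\<^sup>2)"
proof -
  have "\<bar>x\<bar> \<le> 1 + x\<^sup>2"
  proof -
    have "0 \<le> (\<bar>x\<bar> - 1)\<^sup>2" by simp
    then have "2 * \<bar>x\<bar> \<le> 1 + x\<^sup>2" by (simp add: power2_eq_square algebra_simps abs_mult_self_eq)
    then show ?thesis by linarith
  qed
  also have "\<dots> \<le> (1 + 1/\<epsilon>) * (1 + \<epsilon> * x\<^sup>2)"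
    using assms by (simp add: field_simps)
  also have "\<dots> \<le> (1 + 1/\<epsilon>) * exp (\<epsilon> * x\<^sup>2)"
    using assms by (intro mult_left_mono exp_ge_add_one_self) auto
  finally show ?thesis .
qed

lemma abs_power_le_exp_square:
  assumes "\<epsilon> > (0::real)"
  shows "\<exists>C\<ge>0. \<forall>x. \<bar>x\<bar> ^ k \<le> C * exp (\<epsilon> * x\<^sup>2)"
  using assms
proof (induction k arbitrary: \<epsilon>)
  case 0
  then show ?case by (intro exI[of _ 1]) auto
next
  case (Suc k)
  from Suc.IH[of "\<epsilon>/2"] Suc.prems obtain C where C: "C \<ge> 0" "\<And>x. \<bar>x\<bar> ^ k \<le> C * exp (\<epsilon>/2 * x\<^sup>2)"
    by auto
  have "\<bar>x\<bar> ^ Suc k \<le> ((1 + 1/(\<epsilon>/2)) * C) * exp (\<epsilon> * x\<^sup>2)" for x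
  proof -
    have "\<bar>x\<bar> ^ Suc k \<le> ((1 + 1/(\<epsilon>/2)) * exp (\<epsilon>/2 * x\<^sup>2)) * (C * exp (\<epsilon>/2 * x\<^sup>2))"
      unfolding power_Suc using Suc.prems C by (intro mult_mono abs_le_exp_square) auto
    also have "\<dots> = ((1 + 1/(\<epsilon>/2)) * C) * (exp (\<epsilon>/2 * x\<^sup>2) * exp (\<epsilon>/2 * x\<^sup>2))" by simp
    also have "exp (\<epsilon>/2 * x\<^sup>2) * exp (\<epsilon>/2 * x\<^sup>2) = exp (\<epsilon> * x\<^sup>2)"
      by (simp add: exp_add[symmetric])
    finally show ?thesis .
  qed
  then show ?case using C(1) Suc.prems by (intro exI[of _ "(1 + 1/(\<epsilon>/2)) * C"]) auto
qed

text \<open>Any rate epsilon is allowed because the recurrence costs one factor x: half of the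
  exponent pays for x and half for the previous polynomial, so the induction must range over all
  epsilon.\<close>

lemma hermite_poly_bound:
  assumes "\<epsilon> > (0::real)"
  shows "\<exists>C\<ge>0. \<forall>x. \<bar>hermite_poly n x\<bar> \<le> C * exp (\<epsilon> * x\<^sup>2)"
  using assms
proof (induction n arbitrary: \<epsilon> rule: induct_nat_012)
  case 0
  then show ?case by (intro exI[of _ 1]) auto
next
  case 1
  have "\<bar>hermite_poly 1 x\<bar> \<le> (2 * (1 + 1/\<epsilon>)) * exp (\<epsilon> * x\<^sup>2)" for x
    using mult_left_mono[OF abs_le_exp_square[OF 1, of x], of 2] by (simp add: abs_mult algebra_simps)
  then show ?case using 1 by (intro exI[of _ "2 * (1 + 1/\<epsilon>)"]) auto
next
  case (ge2 n)
  from ge2.IH(1)[of "\<epsilon>"] ge2.prems obtain C where C: "C \<ge> 0" "\<And>x. \<bar>hermite_poly n x\<bar> \<le> C * exp (\<epsilon> * x\<^sup>2)"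
    by auto
  from ge2.IH(2)[of "\<epsilon>/2"] ge2.prems obtain D where D: "D \<ge> 0" "\<And>x. \<bar>hermite_poly (Suc n) x\<bar> \<le> D * exp (\<epsilon>/2 * x\<^sup>2)"
    by auto
  let ?K = "2 * (1 + 1/(\<epsilon>/2)) * D + 2 * real (Suc n) * C"
  have "\<bar>hermite_poly (Suc (Suc n)) x\<bar> \<le> ?K * exp (\<epsilon> * x\<^sup>2)" for x
  proof -
    have "\<bar>x\<bar> * \<bar>hermite_poly (Suc n) x\<bar> \<le> ((1 + 1/(\<epsilon>/2)) * exp (\<epsilon>/2 * x\<^sup>2)) * (D * exp (\<epsilon>/2 * x\<^sup>2))"
      using ge2.prems D by (intro mult_mono abs_le_exp_square) auto
    also have "\<dots> = ((1 + 1/(\<epsilon>/2)) * D) * (exp (\<epsilon>/2 * x\<^sup>2) * exp (\<epsilon>/2 * x\<^sup>2))" by simp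
    also have "exp (\<epsilon>/2 * x\<^sup>2) * exp (\<epsilon>/2 * x\<^sup>2) = exp (\<epsilon> * x\<^sup>2)"
      by (simp add: exp_add[symmetric])
    finally have 1: "2 * (\<bar>x\<bar> * \<bar>hermite_poly (Suc n) x\<bar>) \<le> 2 * ((1 + 1/(\<epsilon>/2)) * D * exp (\<epsilon> * x\<^sup>2))"
      by simp
    have "\<bar>hermite_poly (Suc (Suc n)) x\<bar> \<le> \<bar>2 * x * hermite_poly (Suc n) x\<bar> + \<bar>2 * real (Suc n) * hermite_poly n x\<bar>"
      unfolding hermite_poly.simps by (rule abs_triangle_ineq4)
    also have "\<dots> = 2 * (\<bar>x\<bar> * \<bar>hermite_poly (Suc n) x\<bar>) + 2 * real (Suc n) * \<bar>hermite_poly n x\<bar>"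
      by (simp add: abs_mult)
    also have "\<dots> \<le> 2 * ((1 + 1/(\<epsilon>/2)) * D * exp (\<epsilon> * x\<^sup>2)) + 2 * real (Suc n) * (C * exp (\<epsilon> * x\<^sup>2))"
      by (intro add_mono 1 mult_left_mono C) auto
    finally show ?thesis by (simp add: algebra_simps)
  qed
  then show ?case using C(1) D(1) ge2.prems by (intro exI[of _ ?K]) auto
qed

lemma continuous_on_hermite_poly [continuous_intros]: "continuous_on A (hermite_poly n)"
  by (rule DERIV_continuous_on[OF DERIV_subset[OF hermite_poly_has_deriv[THEN conjunct1]]]) auto

lemma measurable_hermite_poly [measurable]: "hermite_poly n \<in> borel_measurable borel"
  by (rule borel_measurable_continuous_onI[OF continuous_on_hermite_poly])

text \<open>The squared norm of \<open>hermite_poly n\<close> for the weight exp(-x^2), as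
  \<open>integral_hermite_product\<close> confirms.\<close>

definition hermite_norm :: "nat \<Rightarrow> real" where
  "hermite_norm n = 2 ^ n * fact n * sqrt pi"

lemma hermite_norm_pos [simp]: "hermite_norm n > 0"
  by (simp add: hermite_norm_def)

lemma hermite_norm_neq_0 [simp]: "hermite_norm n \<noteq> 0"
  by (metis hermite_norm_pos less_irrefl)

lemma hermite_fun_eq: "hermite_fun n x = hermite_poly n x * exp (- (x\<^sup>2) / 2) / sqrt (hermite_norm n)"
  by (simp add: hermite_fun_def hermite_norm_def)

lemma measurable_hermite_fun [measurable]: "hermite_fun n \<in> borel_measurable borel"
  unfolding hermite_fun_eq[abs_def] by measurable

lemma hermite_fun_bound: "\<exists>C\<ge>0. \<forall>x. \<bar>hermite_fun n x\<bar> \<le> C * exp (- (x\<^sup>2) / 4)"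
proof -
  obtain C where C: "C \<ge> 0" "\<And>x. \<bar>hermite_poly n x\<bar> \<le> C * exp (1/4 * x\<^sup>2)"
    using hermite_poly_bound[of "1/4" n] by auto
  have "\<bar>hermite_fun n x\<bar> \<le> (C / sqrt (hermite_norm n)) * exp (- (x\<^sup>2) / 4)" for x
  proof -
    have "\<bar>hermite_fun n x\<bar> = \<bar>hermite_poly n x\<bar> * exp (- (x\<^sup>2) / 2) / sqrt (hermite_norm n)"
      by (simp add: hermite_fun_eq abs_mult less_imp_le)
    also have "\<dots> \<le> (C * exp (1/4 * x\<^sup>2)) * exp (- (x\<^sup>2) / 2) / sqrt (hermite_norm n)"
      using C by (intro divide_right_mono mult_right_mono) (auto simp: less_imp_le)
    also have "(C * exp (1/4 * x\<^sup>2)) * exp (- (x\<^sup>2) / 2) = C * exp (- (x\<^sup>2) / 4)"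
      by (simp add: exp_add[symmetric])
    finally show ?thesis by simp
  qed
  then show ?thesis using C(1) by (intro exI[of _ "C / sqrt (hermite_norm n)"]) (auto simp: less_imp_le)
qed

section \<open>Orthonormality of the Hermite functions\<close>

lemma gaussian_has_integral:
  assumes "a > (0::real)"
  shows "integrable lborel (\<lambda>x. exp (- a * x\<^sup>2))" "(LINT x|lborel. exp (- a * x\<^sup>2)) = sqrt (pi / a)"
proof -
  define \<sigma> where "\<sigma> = sqrt (1 / (2 * a))"
  have s: "\<sigma>\<^sup>2 = 1 / (2 * a)" "\<sigma> > 0" using assms by (auto simp: \<sigma>_def)
  have eq: "exp (- a * x\<^sup>2) = sqrt (pi / a) * normal_density 0 \<sigma> x" for x
  proof -
    have "2 * pi * \<sigma>\<^sup>2 = pi / a" using assms by (simp add: s)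
    moreover have "(x - 0)\<^sup>2 / (2 * \<sigma>\<^sup>2) = a * x\<^sup>2" using assms by (simp add: s)
    ultimately show ?thesis
      using assms by (simp add: normal_density_def)
  qed
  have int: "integrable lborel (normal_density 0 \<sigma>)" using s by simp
  show "integrable lborel (\<lambda>x. exp (- a * x\<^sup>2))"
    unfolding eq using int by (rule integrable_mult_right)
  show "(LINT x|lborel. exp (- a * x\<^sup>2)) = sqrt (pi / a)"
    unfolding eq using s(2) integral_normal_density[of \<sigma> 0]
    by (subst integral_mult_right_zero) simp
qed

text \<open>Stands in for integration by parts: each recurrence between Hermite integrals below says
  that one explicit derivative has integral 0.\<close>

lemma integral_derivative_eq_0:
  fixes F f :: "real \<Rightarrow> real"
  assumes "\<And>x. (F has_real_derivative f x) (at x)" "\<And>x. isCont f x" "integrable lborel f"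
    and "(F \<longlongrightarrow> 0) at_top" "(F \<longlongrightarrow> 0) at_bot"
  shows "(LINT x|lborel. f x) = 0"
proof -
  have "(LBINT x=-\<infinity>..\<infinity>. f x) = 0 - 0"
  proof (rule interval_integral_FTC_integrable[of _ _ F])
    show "((F \<circ> real_of_ereal) \<longlongrightarrow> 0) (at_right (-\<infinity>))" "((F \<circ> real_of_ereal) \<longlongrightarrow> 0) (at_left \<infinity>)"
      using assms(4,5) by (simp_all add: ereal_tendsto_simps)
  qed (use assms in \<open>auto simp: has_real_derivative_iff_has_vector_derivative[symmetric] set_integrable_def\<close>)
  then show ?thesis
    by (simp add: interval_lebesgue_integral_def set_lebesgue_integral_def)
qed

lemma integrable_gaussian_bound:
  fixes f :: "real \<Rightarrow> 'a::{banach, second_countable_topology}"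
  assumes "f \<in> borel_measurable borel" "a > 0" "\<And>x. norm (f x) \<le> C * exp (- a * x\<^sup>2)"
  shows "integrable lborel f"
  by (rule Bochner_Integration.integrable_bound[OF integrable_mult_right[OF gaussian_has_integral(1)[OF assms(2)], of C]])
     (use assms(1,3) in \<open>auto intro!: AE_I2 order_trans[OF assms(3)]\<close>)

lemma hermite_product_bound:
  "\<exists>C\<ge>0. \<forall>x. \<bar>hermite_poly n x * hermite_poly m x * exp (- (x\<^sup>2))\<bar> \<le> C * exp (- (1/2) * x\<^sup>2)"
proof -
  obtain C where C: "C \<ge> 0" "\<And>x. \<bar>hermite_poly n x\<bar> \<le> C * exp (1/4 * x\<^sup>2)"
    using hermite_poly_bound[of "1/4" n] by auto
  obtain D where D: "D \<ge> 0" "\<And>x. \<bar>hermite_poly m x\<bar> \<le> D * exp (1/4 * x\<^sup>2)"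
    using hermite_poly_bound[of "1/4" m] by auto
  have "\<bar>hermite_poly n x * hermite_poly m x * exp (- (x\<^sup>2))\<bar> \<le> (C * D) * exp (- (1/2) * x\<^sup>2)" for x
  proof -
    have "\<bar>hermite_poly n x * hermite_poly m x * exp (- (x\<^sup>2))\<bar>
        \<le> (C * exp (1/4 * x\<^sup>2)) * (D * exp (1/4 * x\<^sup>2)) * exp (- (x\<^sup>2))"
      unfolding abs_mult using C D by (intro mult_mono) auto
    also have "\<dots> = (C * D) * (exp (1/4 * x\<^sup>2) * exp (1/4 * x\<^sup>2) * exp (- (x\<^sup>2)))" by simp
    also have "exp (1/4 * x\<^sup>2) * exp (1/4 * x\<^sup>2) * exp (- (x\<^sup>2)) = exp (- (1/2) * x\<^sup>2)"
      by (simp add: exp_add[symmetric])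
    finally show ?thesis .
  qed
  then show ?thesis using C(1) D(1) by (intro exI[of _ "C * D"]) auto
qed

lemma integrable_hermite_product:
  "integrable lborel (\<lambda>x. hermite_poly n x * hermite_poly m x * exp (- (x\<^sup>2)))"
proof -
  obtain C where "\<And>x. \<bar>hermite_poly n x * hermite_poly m x * exp (- (x\<^sup>2))\<bar> \<le> C * exp (- (1/2) * x\<^sup>2)"
    using hermite_product_bound by blast
  then show ?thesis by (intro integrable_gaussian_bound[where a="1/2" and C=C]) auto
qed

lemma hermite_product_tendsto:
  "((\<lambda>x. hermite_poly n x * hermite_poly m x * exp (- (x\<^sup>2))) \<longlongrightarrow> 0) at_top"
  "((\<lambda>x. hermite_poly n x * hermite_poly m x * exp (- (x\<^sup>2))) \<longlongrightarrow> 0) at_bot"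
proof -
  obtain C where C: "\<And>x. \<bar>hermite_poly n x * hermite_poly m x * exp (- (x\<^sup>2))\<bar> \<le> C * exp (- (1/2) * x\<^sup>2)"
    using hermite_product_bound by blast
  have "filterlim (\<lambda>x::real. x\<^sup>2) at_top at_top" "filterlim (\<lambda>x::real. x\<^sup>2) at_top at_bot"
    by (auto intro: filterlim_pow_at_top filterlim_pow_at_bot_even filterlim_ident)
  then have *: "((\<lambda>x::real. C * exp (- (1/2) * x\<^sup>2)) \<longlongrightarrow> 0) F" if "F = at_top \<or> F = at_bot" for F
    using that
    by (intro tendsto_mult_right_zero filterlim_compose[OF exp_at_bot] filterlim_tendsto_neg_mult_at_bot[OF tendsto_const])
      auto
  show "((\<lambda>x. hermite_poly n x * hermite_poly m x * exp (- (x\<^sup>2))) \<longlongrightarrow> 0) at_top"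
    "((\<lambda>x. hermite_poly n x * hermite_poly m x * exp (- (x\<^sup>2))) \<longlongrightarrow> 0) at_bot"
    using C by (auto intro!: Lim_null_comparison[OF _ *] always_eventually)
qed

text \<open>The derivative of H_n H_{m+1} exp(-x^2) is exactly the difference of the two integrands:
  the term 2x coming from H_n cancels the derivative of the weight, and H_{m+1} is lowered to
  H_m.\<close>

lemma integral_hermite_product_Suc:
  "(LINT x|lborel. hermite_poly (Suc n) x * hermite_poly (Suc m) x * exp (- (x\<^sup>2)))
     = 2 * real (Suc m) * (LINT x|lborel. hermite_poly n x * hermite_poly m x * exp (- (x\<^sup>2)))"
proof -
  let ?f = "\<lambda>n m x. hermite_poly n x * hermite_poly m x * exp (- (x\<^sup>2))"
  have "(LINT x|lborel. 2 * real (Suc m) * ?f n m x - ?f (Suc n) (Suc m) x) = 0"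
  proof (rule integral_derivative_eq_0[where F = "?f n (Suc m)"])
    fix x
    show "(?f n (Suc m) has_real_derivative 2 * real (Suc m) * ?f n m x - ?f (Suc n) (Suc m) x) (at x)"
      by (rule derivative_eq_intros hermite_poly_has_deriv[THEN conjunct1]
          hermite_poly_has_deriv[THEN conjunct2] refl
        | simp add: algebra_simps del: hermite_poly.simps(3))+
    show "isCont (\<lambda>x. 2 * real (Suc m) * ?f n m x - ?f (Suc n) (Suc m) x) x"
      by (rule continuous_on_interior[of UNIV]) (auto intro!: continuous_intros)
  qed (intro hermite_product_tendsto Bochner_Integration.integrable_diff integrable_mult_right integrable_hermite_product)+
  then show ?thesis
    by (simp add: Bochner_Integration.integral_diff integrable_hermite_product del: hermite_poly.simps)
qed

lemma integral_hermite_product_0: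
  "(LINT x|lborel. hermite_poly (Suc n) x * hermite_poly 0 x * exp (- (x\<^sup>2))) = 0"
proof -
  let ?f = "\<lambda>n m x. hermite_poly n x * hermite_poly m x * exp (- (x\<^sup>2))"
  have "(LINT x|lborel. - ?f (Suc n) 0 x) = 0"
  proof (rule integral_derivative_eq_0[where F = "?f n 0"])
    fix x
    have eq: "?f n 0 = (\<lambda>x. hermite_poly n x * exp (- (x\<^sup>2)))" by simp
    show "(?f n 0 has_real_derivative - ?f (Suc n) 0 x) (at x)"
      unfolding eq
      by (rule derivative_eq_intros hermite_poly_has_deriv[THEN conjunct1] refl
        | simp add: algebra_simps del: hermite_poly.simps(3))+
    show "isCont (\<lambda>x. - ?f (Suc n) 0 x) x"
      by (rule continuous_on_interior[of UNIV]) (auto intro!: continuous_intros simp del: hermite_poly.simps)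
  qed (intro hermite_product_tendsto Bochner_Integration.integrable_minus integrable_hermite_product)+
  then show ?thesis by simp
qed

text \<open>Both indices are lowered together until one of them is 0, where the integral against H_0
  decides.\<close>

lemma integral_hermite_product:
  "(LINT x|lborel. hermite_poly n x * hermite_poly m x * exp (- (x\<^sup>2))) = (if n = m then hermite_norm n else 0)"
proof (induction n arbitrary: m)
  case 0
  show ?case
  proof (cases m)
    case 0
    then show ?thesis using gaussian_has_integral(2)[of 1] by (simp add: hermite_norm_def)
  next
    case (Suc k)
    then show ?thesis using integral_hermite_product_0[of k] by (simp add: mult.commute mult.left_commute del: hermite_poly.simps(2,3))
  qed
next
  case (Suc n)
  show ?case
  proof (cases m)
    case 0
    then show ?thesis using integral_hermite_product_0[of n] by (simp del: hermite_poly.simps(2,3))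
  next
    case (Suc k)
    then show ?thesis using Suc.IH[of k] unfolding Suc integral_hermite_product_Suc
      by (simp add: hermite_norm_def del: hermite_poly.simps)
  qed
qed

lemma hermite_fun_mult:
  "hermite_fun n x * hermite_fun m x = (hermite_poly n x * hermite_poly m x * exp (- (x\<^sup>2))) / (sqrt (hermite_norm n) * sqrt (hermite_norm m))"
proof -
  have "exp (- (x\<^sup>2)) = exp (- (x\<^sup>2) / 2) * exp (- (x\<^sup>2) / 2)"
    by (simp add: exp_add[symmetric])
  then show ?thesis by (simp add: hermite_fun_eq)
qed

lemma integrable_hermite_fun_mult: "integrable lborel (\<lambda>x. hermite_fun n x * hermite_fun m x)"
  unfolding hermite_fun_mult by (intro integrable_divide integrable_hermite_product)

lemma hermite_fun_orthonormal:
  "(LINT x|lborel. hermite_fun n x * hermite_fun m x) = (if n = m then 1 else 0)"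
  unfolding hermite_fun_mult by (auto simp add: integral_hermite_product less_imp_le)

section \<open>Fourier transform of the Hermite functions\<close>

lemma has_vector_derivative_fourier_integral:
  fixes f :: "real \<Rightarrow> real"
  assumes f: "integrable lborel f" and f1: "integrable lborel (\<lambda>x. x * f x)"
    and f2: "integrable lborel (\<lambda>x. x\<^sup>2 * f x)"
  shows "((\<lambda>\<xi>. LINT x|lborel. cis (- (x * \<xi>)) * of_real (f x)) has_vector_derivative
     (LINT x|lborel. - \<i> * (cis (- (x * \<xi>)) * of_real (x * f x)))) (at \<xi>)"
proof -
  let ?J = "\<lambda>\<xi>. LINT x|lborel. cis (- (x * \<xi>)) * of_real (f x)"
  let ?D = "LINT x|lborel. - \<i> * (cis (- (x * \<xi>)) * of_real (x * f x))"
  let ?K = "LINT x|lborel. norm (x\<^sup>2 * f x)"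
  have [measurable]: "f \<in> borel_measurable borel" using f by auto
  have cm: "(\<lambda>x. cis (a * x)) \<in> borel_measurable borel" for a
    by (intro borel_measurable_continuous_onI continuous_intros)
  have cm' [measurable]: "(\<lambda>x. cis (- (x * a))) \<in> borel_measurable borel" for a
    using cm[of "-a"] by (simp add: mult.commute)
  have i0: "integrable lborel (\<lambda>x. cis (- (x * a)) * of_real (f x))" for a
    by (rule Bochner_Integration.integrable_bound[OF f]) (auto simp: norm_mult)
  have i1: "integrable lborel (\<lambda>x. - \<i> * (cis (- (x * a)) * of_real (x * f x)))" for a
    by (rule Bochner_Integration.integrable_bound[OF f1]) (auto simp: norm_mult abs_mult)
  \<comment> \<open>The Taylor remainder of exp(i u) after the linear term is at most u^2/2. With u
    = -x (y - xi) the second moment of f turns it into an error quadratic in y - xi, which is all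
    that differentiability requires.\<close>
  have bnd: "norm (?J y - ?J \<xi> - (y - \<xi>) *\<^sub>R ?D) \<le> (y - \<xi>)\<^sup>2 / 2 * ?K" for y
  proof -
    have eq: "?J y - ?J \<xi> - (y - \<xi>) *\<^sub>R ?D = (LINT x|lborel. cis (- (x * y)) * of_real (f x)
       - cis (- (x * \<xi>)) * of_real (f x) - (y - \<xi>) *\<^sub>R (- \<i> * (cis (- (x * \<xi>)) * of_real (x * f x))))"
      using i0 i1 by (simp add: Bochner_Integration.integral_diff integral_scaleR_right integrable_diff integrable_scaleR_right del: mult_minus_left)
    have "norm (?J y - ?J \<xi> - (y - \<xi>) *\<^sub>R ?D) \<le> (LINT x|lborel. (y - \<xi>)\<^sup>2 / 2 * norm (x\<^sup>2 * f x))"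
      unfolding eq
    proof (rule order_trans[OF integral_norm_bound integral_mono])
      show "integrable lborel (\<lambda>x. norm (cis (- (x * y)) * complex_of_real (f x) -
                     cis (- (x * \<xi>)) * complex_of_real (f x) -
                     (y - \<xi>) *\<^sub>R (- \<i> * (cis (- (x * \<xi>)) * complex_of_real (x * f x)))))"
        by (intro integrable_norm Bochner_Integration.integrable_diff integrable_scaleR_right i0 i1)
      show "integrable lborel (\<lambda>x. (y - \<xi>)\<^sup>2 / 2 * norm (x\<^sup>2 * f x))"
        using f2 by (intro integrable_mult_right integrable_norm)
      fix x
      let ?u = "- (x * (y - \<xi>))"
      have e: "cis (- (x * y)) = cis (- (x * \<xi>)) * cis ?u"
        by (simp add: cis_mult algebra_simps)
      have "cis (- (x * y)) * of_real (f x) - cis (- (x * \<xi>)) * of_real (f x)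
          - (y - \<xi>) *\<^sub>R (- \<i> * (cis (- (x * \<xi>)) * of_real (x * f x)))
        = cis (- (x * \<xi>)) * of_real (f x) * (cis ?u - (1 + \<i> * of_real ?u))"
        unfolding e by (simp add: scaleR_conv_of_real algebra_simps)
      also have "norm \<dots> = \<bar>f x\<bar> * norm (cis ?u - (1 + \<i> * of_real ?u))"
        by (simp add: norm_mult)
      also have "\<dots> \<le> \<bar>f x\<bar> * (\<bar>?u\<bar> ^ 2 / 2)"
        using iexp_approx1[of ?u 1]
        by (intro mult_left_mono) (auto simp: cis_conv_exp power2_eq_square fact_numeral numeral_eq_Suc)
      also have "\<dots> = (y - \<xi>)\<^sup>2 / 2 * norm (x\<^sup>2 * f x)"
        by (simp add: power_mult_distrib abs_mult)
      finally show "norm (cis (- (x * y)) * of_real (f x) - cis (- (x * \<xi>)) * of_real (f x)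
          - (y - \<xi>) *\<^sub>R (- \<i> * (cis (- (x * \<xi>)) * of_real (x * f x)))) \<le> (y - \<xi>)\<^sup>2 / 2 * norm (x\<^sup>2 * f x)" .
    qed
    also have "\<dots> = (y - \<xi>)\<^sup>2 / 2 * ?K" by (simp only: integral_mult_right_zero)
    finally show ?thesis .
  qed
  show ?thesis
    unfolding has_vector_derivative_def
  proof (rule has_derivativeI_sandwich[where e=1])
    show "bounded_linear (\<lambda>x. x *\<^sub>R ?D)" by (rule bounded_linear_scaleR_left)
    show "((\<lambda>y. \<bar>y - \<xi>\<bar> / 2 * ?K) \<longlongrightarrow> 0) (at \<xi>)"
      by (intro tendsto_mult_left_zero tendsto_divide_zero tendsto_rabs_zero) (simp add: LIM_zero_iff)
    fix y assume y: "y \<noteq> \<xi>"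
    have "(y - \<xi>)\<^sup>2 / 2 * ?K = (\<bar>y - \<xi>\<bar> / 2 * ?K) * norm (y - \<xi>)"
      unfolding power2_abs[of "y - \<xi>", symmetric] by (simp only: power2_eq_square real_norm_def) simp
    with bnd[of y] have "norm (?J y - ?J \<xi> - (y - \<xi>) *\<^sub>R ?D) \<le> (\<bar>y - \<xi>\<bar> / 2 * ?K) * norm (y - \<xi>)"
      by (simp only:)
    moreover have "norm (y - \<xi>) > 0" using y by simp
    ultimately show "norm (?J y - ?J \<xi> - (y - \<xi>) *\<^sub>R ?D) / norm (y - \<xi>) \<le> \<bar>y - \<xi>\<bar> / 2 * ?K"
      by (simp only: pos_divide_le_eq)
  qed auto
qed

lemma power_hermite_bound:
  "\<exists>C\<ge>0. \<forall>x. \<bar>x ^ k * (hermite_poly n x * exp (- (x\<^sup>2) / 2))\<bar> \<le> C * exp (- (1/4) * x\<^sup>2)"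
proof -
  obtain C where C: "C \<ge> 0" "\<And>x. \<bar>hermite_poly n x\<bar> \<le> C * exp (1/8 * x\<^sup>2)"
    using hermite_poly_bound[of "1/8" n] by auto
  obtain D where D: "D \<ge> 0" "\<And>x::real. \<bar>x\<bar> ^ k \<le> D * exp (1/8 * x\<^sup>2)"
    using abs_power_le_exp_square[of "1/8" k] by auto
  have "\<bar>x ^ k * (hermite_poly n x * exp (- (x\<^sup>2) / 2))\<bar> \<le> (C * D) * exp (- (1/4) * x\<^sup>2)" for x
  proof -
    have "\<bar>x ^ k * (hermite_poly n x * exp (- (x\<^sup>2) / 2))\<bar>
        \<le> (D * exp (1/8 * x\<^sup>2)) * ((C * exp (1/8 * x\<^sup>2)) * exp (- (x\<^sup>2) / 2))"
      unfolding abs_mult power_abs[symmetric] using C D by (intro mult_mono) (auto simp: power_abs)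
    also have "\<dots> = (C * D) * (exp (1/8 * x\<^sup>2) * exp (1/8 * x\<^sup>2) * exp (- (x\<^sup>2) / 2))" by simp
    also have "exp (1/8 * x\<^sup>2) * exp (1/8 * x\<^sup>2) * exp (- (x\<^sup>2) / 2) = exp (- (1/4) * x\<^sup>2)"
      by (simp add: exp_add[symmetric])
    finally show ?thesis .
  qed
  then show ?thesis using C(1) D(1) by (intro exI[of _ "C * D"]) auto
qed

lemma integrable_power_hermite:
  "integrable lborel (\<lambda>x. x ^ k * (hermite_poly n x * exp (- (x\<^sup>2) / 2)))"
proof -
  obtain C where "\<And>x. \<bar>x ^ k * (hermite_poly n x * exp (- (x\<^sup>2) / 2))\<bar> \<le> C * exp (- (1/4) * x\<^sup>2)"
    using power_hermite_bound by blast
  then show ?thesis by (intro integrable_gaussian_bound[where a="1/4" and C=C]) auto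
qed

text \<open>Multiplication by x corresponds to differentiating the transform. Once the transform of
  h_n is known, its derivative, computed from h_n' = x h_n - h_{n+1}, yields the transform of x h_n,
  and the three-term recurrence leads to the next index.\<close>

lemma fourier_hermite_unnormalised:
  "(LINT x|lborel. cis (- (x * \<xi>)) * of_real (hermite_poly n x * exp (- (x\<^sup>2) / 2)))
     = of_real (sqrt (2 * pi)) * (- \<i>) ^ n * of_real (hermite_poly n \<xi> * exp (- (\<xi>\<^sup>2) / 2))"
proof -
  define h where "h n x = hermite_poly n x * exp (- (x\<^sup>2) / 2)" for n x
  define J where "J n \<xi> = (LINT x|lborel. cis (- (x * \<xi>)) * of_real (h n x))" for n and \<xi> :: real
  have cm' [measurable]: "(\<lambda>x. cis (- (x * a))) \<in> borel_measurable borel" for a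
    by (intro borel_measurable_continuous_onI continuous_intros)
  have hm [measurable]: "h n \<in> borel_measurable borel" for n unfolding h_def[abs_def] by measurable
  have int0: "integrable lborel (h n)" for n
    using integrable_power_hermite[of 0 n] by (simp add: h_def[abs_def])
  have int1: "integrable lborel (\<lambda>x. x * h n x)" for n
    using integrable_power_hermite[of 1 n] by (simp add: h_def[abs_def])
  have int2: "integrable lborel (\<lambda>x. x\<^sup>2 * h n x)" for n
    using integrable_power_hermite[of 2 n] by (simp add: h_def[abs_def])
  have c0: "integrable lborel (\<lambda>x. cis (- (x * a)) * complex_of_real (h n x))" for a n
    by (rule Bochner_Integration.integrable_bound[OF int0[of n]]) (auto simp: norm_mult)
  have c1: "integrable lborel (\<lambda>x. cis (- (x * a)) * complex_of_real (x * h n x))" for a n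
    by (rule Bochner_Integration.integrable_bound[OF int1[of n]]) (auto simp: norm_mult abs_mult)
  have dJ: "(J n has_vector_derivative - \<i> * (LINT x|lborel. cis (- (x * \<xi>)) * of_real (x * h n x))) (at \<xi>)" for n \<xi>
    using has_vector_derivative_fourier_integral[OF int0 int1 int2, of n \<xi>]
    unfolding J_def[abs_def] by (subst (asm) integral_mult_right_zero)
  have dh: "(h n has_real_derivative x * h n x - h (Suc n) x) (at x)" for n x
    unfolding h_def[abs_def]
    by (rule derivative_eq_intros hermite_poly_has_deriv[THEN conjunct1] refl
        | simp add: algebra_simps)+
  let ?s = "of_real (sqrt (2 * pi)) :: complex"
  have key: "(LINT x|lborel. cis (- (x * \<xi>)) * of_real (x * h n x))
      = \<i> * ?s * (- \<i>) ^ n * of_real (\<xi> * h n \<xi> - h (Suc n) \<xi>)"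
    if "\<And>\<xi>. J n \<xi> = ?s * (- \<i>) ^ n * of_real (h n \<xi>)" for n \<xi>
  proof -
    have "J n = (\<lambda>\<xi>. ?s * (- \<i>) ^ n * of_real (h n \<xi>))" using that by auto
    then have "(J n has_vector_derivative ?s * (- \<i>) ^ n * of_real (\<xi> * h n \<xi> - h (Suc n) \<xi>)) (at \<xi>)"
      using has_vector_derivative_mult_right[OF has_vector_derivative_of_real[OF dh[of n \<xi>]], of "?s * (- \<i>) ^ n"]
      by (simp only:)
    from vector_derivative_unique_at[OF this dJ]
    have "?s * (- \<i>) ^ n * of_real (\<xi> * h n \<xi> - h (Suc n) \<xi>) = - \<i> * (LINT x|lborel. cis (- (x * \<xi>)) * of_real (x * h n x))" .
    from arg_cong[OF this, of "\<lambda>z. \<i> * z"] show ?thesis by (simp add: mult.assoc)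
  qed
  \<comment> \<open>The base case is the characteristic function of the standard normal law.\<close>
  have J0: "J 0 \<xi> = ?s * of_real (h 0 \<xi>)" for \<xi>
  proof -
    have "complex_of_real (exp (- (\<xi>\<^sup>2) / 2)) = char std_normal_distribution (- \<xi>)"
      by (simp add: char_std_normal_distribution)
    also have "\<dots> = (LINT x|lborel. std_normal_density x *\<^sub>R iexp (- \<xi> * x))"
      unfolding char_def by (subst integral_density) auto
    also have "\<dots> = (LINT x|lborel. of_real (1 / sqrt (2 * pi)) * (cis (- (x * \<xi>)) * of_real (h 0 x)))"
      by (intro Bochner_Integration.integral_cong refl)
        (simp add: std_normal_density_def h_def cis_conv_exp scaleR_conv_of_real mult_ac)
    also have "\<dots> = of_real (1 / sqrt (2 * pi)) * J 0 \<xi>"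
      unfolding J_def by (rule integral_mult_right_zero)
    finally have "?s * complex_of_real (exp (- (\<xi>\<^sup>2) / 2)) = (?s * of_real (1 / sqrt (2 * pi))) * J 0 \<xi>" by simp
    also have "?s * of_real (1 / sqrt (2 * pi)) = 1" by (simp flip: of_real_mult)
    finally show ?thesis by (simp add: h_def)
  qed
  have "\<forall>\<xi>. J n \<xi> = ?s * (- \<i>) ^ n * of_real (h n \<xi>)" for n
  proof (induction n rule: induct_nat_012)
    case 0
    then show ?case using J0 by simp
  next
    case 1
    show ?case
    proof
      fix \<xi>
      have "J 1 \<xi> = 2 * (LINT x|lborel. cis (- (x * \<xi>)) * of_real (x * h 0 x))"
        unfolding J_def integral_mult_right_zero[symmetric] by (intro Bochner_Integration.integral_cong refl) (simp add: h_def)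
      also have "\<dots> = 2 * (\<i> * ?s * of_real (\<xi> * h 0 \<xi> - h 1 \<xi>))"
        by (subst key) (simp_all add: J0)
      also have "\<xi> * h 0 \<xi> - h 1 \<xi> = - h 1 \<xi> / 2" by (simp add: h_def)
      finally show "J (Suc 0) \<xi> = ?s * (- \<i>) ^ Suc 0 * of_real (h (Suc 0) \<xi>)" by simp
    qed
  next
    case (ge2 n)
    show ?case
    proof
      fix \<xi>
      have rec: "h (Suc (Suc n)) x = 2 * (x * h (Suc n) x) - 2 * real (Suc n) * h n x" for x
        by (simp add: h_def algebra_simps)
      have "J (Suc (Suc n)) \<xi> = (LINT x|lborel. 2 * (cis (- (x * \<xi>)) * of_real (x * h (Suc n) x))
             - of_real (2 * real (Suc n)) * (cis (- (x * \<xi>)) * of_real (h n x)))"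
        unfolding J_def rec by (intro Bochner_Integration.integral_cong refl) (simp add: algebra_simps)
      also have "\<dots> = 2 * (LINT x|lborel. cis (- (x * \<xi>)) * of_real (x * h (Suc n) x))
           - of_real (2 * real (Suc n)) * J n \<xi>"
        unfolding J_def integral_mult_right_zero[symmetric]
        by (intro Bochner_Integration.integral_diff integrable_mult_right c0 c1)
      also have "\<dots> = 2 * (\<i> * ?s * (- \<i>) ^ Suc n * of_real (\<xi> * h (Suc n) \<xi> - h (Suc (Suc n)) \<xi>))
           - of_real (2 * real (Suc n)) * (?s * (- \<i>) ^ n * of_real (h n \<xi>))"
        by (subst key[OF ge2.IH(2)[rule_format]]) (simp only: ge2.IH(1)[rule_format])
      also have "\<dots> = ?s * (- \<i>) ^ n * of_real (2 * (\<xi> * h (Suc n) \<xi> - h (Suc (Suc n)) \<xi>) - 2 * real (Suc n) * h n \<xi>)"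
        by (simp add: algebra_simps del: of_nat_Suc)
      also have "2 * (\<xi> * h (Suc n) \<xi> - h (Suc (Suc n)) \<xi>) - 2 * real (Suc n) * h n \<xi> = - h (Suc (Suc n)) \<xi>"
        using rec[of \<xi>] by (simp add: algebra_simps)
      finally show "J (Suc (Suc n)) \<xi> = ?s * (- \<i>) ^ Suc (Suc n) * of_real (h (Suc (Suc n)) \<xi>)" by simp
    qed
  qed
  then show ?thesis by (simp add: J_def h_def)
qed

lemma fourier_hermite_fun:
  "(LINT x|lborel. cis (- (x * \<xi>)) * of_real (hermite_fun n x))
     = of_real (sqrt (2 * pi)) * (- \<i>) ^ n * of_real (hermite_fun n \<xi>)"
proof -
  have "(LINT x|lborel. cis (- (x * \<xi>)) * of_real (hermite_fun n x))
    = (LINT x|lborel. of_real (1 / sqrt (hermite_norm n)) * (cis (- (x * \<xi>)) * of_real (hermite_poly n x * exp (- (x\<^sup>2) / 2))))"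
    by (intro Bochner_Integration.integral_cong refl) (simp add: hermite_fun_eq)
  also have "\<dots> = of_real (1 / sqrt (hermite_norm n)) * (LINT x|lborel. cis (- (x * \<xi>)) * of_real (hermite_poly n x * exp (- (x\<^sup>2) / 2)))"
    by (rule integral_mult_right_zero)
  finally show ?thesis unfolding fourier_hermite_unnormalised by (simp add: hermite_fun_eq)
qed

section \<open>Completeness\<close>

text \<open>Positive and negative part have the same mass (the case t = 0) and the same Fourier
  transform. Unless the mass is 0, dividing by it gives two probability densities with one
  characteristic function, which Levy's theorem identifies.\<close>

lemma density_char_unique:
  fixes g :: "real \<Rightarrow> real"
  assumes g: "integrable lborel g" and z: "\<And>t. (CLINT x|lborel. iexp (t * x) * of_real (g x)) = 0"
  shows "AE x in lborel. g x = 0"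
proof -
  have [measurable]: "g \<in> borel_measurable borel" using g by auto
  define p where "p x = max 0 (g x)" for x
  define q where "q x = max 0 (- g x)" for x
  have [measurable]: "p \<in> borel_measurable borel" "q \<in> borel_measurable borel"
    unfolding p_def[abs_def] q_def[abs_def] by measurable
  have ip: "integrable lborel p" and iq: "integrable lborel q"
    unfolding p_def q_def using g by auto
  have gpq: "g x = p x - q x" for x by (simp add: p_def q_def)
  have nonneg: "p x \<ge> 0" "q x \<ge> 0" for x by (auto simp: p_def q_def)
  define m where "m = (LINT x|lborel. p x)"
  have "(CLINT x|lborel. iexp (0 * x) * of_real (g x)) = of_real (LINT x|lborel. g x)" by simp
  then have "(LINT x|lborel. g x) = 0" using z[of 0] by simp
  then have mq: "m = (LINT x|lborel. q x)"
    unfolding m_def gpq using ip iq by simp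
  show ?thesis
  proof (cases "m = 0")
    case True
    have "AE x in lborel. p x = 0" "AE x in lborel. q x = 0"
      using True mq m_def integral_nonneg_eq_0_iff_AE[OF ip] integral_nonneg_eq_0_iff_AE[OF iq] nonneg by auto
    then show ?thesis by eventually_elim (simp add: gpq)
  next
    case False
    then have m: "m > 0" unfolding m_def using nonneg by (simp add: integral_nonneg_AE order_less_le)
    have rd: "real_distribution (density lborel (\<lambda>x. ennreal (r x / m)))"
      if [measurable]: "r \<in> borel_measurable borel" and r: "integrable lborel r" "\<And>x. r x \<ge> 0" "(LINT x|lborel. r x) = m" for r
    proof -
      have "prob_space (density lborel (\<lambda>x. ennreal (r x / m)))"
      proof
        have "(\<integral>\<^sup>+x. ennreal (r x / m) \<partial>lborel) = ennreal (LINT x|lborel. r x / m)"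
          using r m by (intro nn_integral_eq_integral) auto
        then show "emeasure (density lborel (\<lambda>x. ennreal (r x / m))) (space (density lborel (\<lambda>x. ennreal (r x / m)))) = 1"
          using r m by (simp add: emeasure_density)
      qed
      then show ?thesis
        by (simp add: real_distribution_def real_distribution_axioms_def)
    qed
    have ch: "char (density lborel (\<lambda>x. ennreal (r x / m))) t = (CLINT x|lborel. iexp (t * x) * of_real (r x)) / of_real m"
      if [measurable]: "r \<in> borel_measurable borel" and r: "\<And>x. r x \<ge> 0" for r t
    proof -
      have "char (density lborel (\<lambda>x. ennreal (r x / m))) t = (CLINT x|lborel. (r x / m) *\<^sub>R iexp (t * x))"
        unfolding char_def using r m by (subst integral_density) auto
      also have "\<dots> = (CLINT x|lborel. iexp (t * x) * of_real (r x) / of_real m)"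
        by (intro Bochner_Integration.integral_cong refl) (simp add: scaleR_conv_of_real)
      finally show ?thesis by simp
    qed
    have ii: "integrable lborel (\<lambda>x. iexp (t * x) * complex_of_real (r x))" if "integrable lborel r" for r and t :: real
      using that by (rule Bochner_Integration.integrable_bound) (use that in \<open>auto simp: norm_mult\<close>)
    have "(CLINT x|lborel. iexp (t * x) * of_real (p x)) - (CLINT x|lborel. iexp (t * x) * of_real (q x)) = 0" for t
      using z[of t] unfolding gpq of_real_diff right_diff_distrib
      by (subst (asm) Bochner_Integration.integral_diff[OF ii[OF ip] ii[OF iq]])
    then have "char (density lborel (\<lambda>x. ennreal (p x / m))) = char (density lborel (\<lambda>x. ennreal (q x / m)))"
      using nonneg by (intro ext) (simp add: ch)
    then have "density lborel (\<lambda>x. ennreal (p x / m)) = density lborel (\<lambda>x. ennreal (q x / m))"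
      using nonneg ip iq mq m_def by (intro Levy_uniqueness rd) auto
    then have "AE x in lborel. ennreal (p x / m) = ennreal (q x / m)"
      by (subst (asm) sigma_finite_measure.density_unique_iff[OF lborel.sigma_finite_measure_axioms]) auto
    then show ?thesis
    proof eventually_elim
      case (elim x)
      then have "p x / m = q x / m" using m nonneg[of x] by (subst (asm) ennreal_inj) auto
      then show ?case using m by (simp add: gpq)
    qed
  qed
qed

text \<open>Vanishing Hermite integrals give vanishing power moments of g = f exp(-x^2/2), and the
  exponential series then makes the Fourier transform of g vanish. Integrability is asked only under
  a Gaussian weight, so that the lemma also reaches functions that are merely bounded.\<close>

lemma hermite_complete_real:
  fixes f :: "real \<Rightarrow> real"
  assumes fm [measurable]: "f \<in> borel_measurable borel"
    and int: "integrable lborel (\<lambda>x. f x * exp (- (1/4) * x\<^sup>2))"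
    and z: "\<And>n. (LINT x|lborel. f x * hermite_fun n x) = 0"
  shows "AE x in lborel. f x = 0"
proof -
  have intk: "integrable lborel (\<lambda>x. f x * (x ^ k * (hermite_poly n x * exp (- (x\<^sup>2) / 2))))" for k n
  proof -
    obtain C where C: "C \<ge> 0" "\<And>x. \<bar>x ^ k * (hermite_poly n x * exp (- (x\<^sup>2) / 2))\<bar> \<le> C * exp (- (1/4) * x\<^sup>2)"
      using power_hermite_bound by blast
    show ?thesis
    proof (rule Bochner_Integration.integrable_bound[OF integrable_mult_right[OF int, of C]])
      show "AE x in lborel. norm (f x * (x ^ k * (hermite_poly n x * exp (- (x\<^sup>2) / 2)))) \<le> norm (C * (f x * exp (- (1/4) * x\<^sup>2)))"
      proof (rule AE_I2)
        fix x
        have "norm (f x * (x ^ k * (hermite_poly n x * exp (- (x\<^sup>2) / 2)))) \<le> \<bar>f x\<bar> * (C * exp (- (1/4) * x\<^sup>2))"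
          unfolding real_norm_def abs_mult[of "f x"] using C(2) by (intro mult_left_mono) auto
        then show "norm (f x * (x ^ k * (hermite_poly n x * exp (- (x\<^sup>2) / 2)))) \<le> norm (C * (f x * exp (- (1/4) * x\<^sup>2)))"
          using C(1) by (simp add: abs_mult mult_ac)
      qed
    qed measurable
  qed
  \<comment> \<open>Each factor x is traded for a change of index: x H_n = H_{n+1}/2 + n H_{n-1},
    where the last term is absent for n = 0.\<close>
  have z0: "(LINT x|lborel. f x * (x ^ k * (hermite_poly n x * exp (- (x\<^sup>2) / 2)))) = 0" for k n
  proof (induction k arbitrary: n)
    case 0
    have "(LINT x|lborel. f x * (x ^ 0 * (hermite_poly n x * exp (- (x\<^sup>2) / 2)))) = (LINT x|lborel. sqrt (hermite_norm n) * (f x * hermite_fun n x))"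
      by (intro Bochner_Integration.integral_cong refl) (simp add: hermite_fun_eq)
    also have "\<dots> = sqrt (hermite_norm n) * (LINT x|lborel. f x * hermite_fun n x)"
      by (rule integral_mult_right_zero)
    finally show ?case using z by simp
  next
    case (Suc k)
    let ?h = "\<lambda>n x. f x * (x ^ k * (hermite_poly n x * exp (- (x\<^sup>2) / 2)))"
    show ?case
    proof (cases n)
      case 0
      have "(LINT x|lborel. f x * (x ^ Suc k * (hermite_poly n x * exp (- (x\<^sup>2) / 2)))) = (LINT x|lborel. (1/2) * ?h 1 x)"
        unfolding 0 by (intro Bochner_Integration.integral_cong refl) simp
      also have "\<dots> = (1/2) * (LINT x|lborel. ?h 1 x)" by (rule integral_mult_right_zero)
      finally show ?thesis using Suc.IH[of 1] by simp
    next
      case (Suc m)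
      have "(LINT x|lborel. f x * (x ^ Suc k * (hermite_poly n x * exp (- (x\<^sup>2) / 2))))
         = (LINT x|lborel. (1/2) * ?h (Suc (Suc m)) x + real (Suc m) * ?h m x)"
        unfolding Suc by (intro Bochner_Integration.integral_cong refl) (simp add: algebra_simps)
      also have "\<dots> = (1/2) * (LINT x|lborel. ?h (Suc (Suc m)) x) + real (Suc m) * (LINT x|lborel. ?h m x)"
        unfolding integral_mult_right_zero[symmetric]
        by (intro Bochner_Integration.integral_add integrable_mult_right intk)
      finally show ?thesis by (simp only: Suc.IH)
    qed
  qed
  define g where "g x = f x * exp (- (x\<^sup>2) / 2)" for x
  have [measurable]: "g \<in> borel_measurable borel" unfolding g_def[abs_def] by measurable
  have gk: "integrable lborel (\<lambda>x. g x * x ^ k)" "(LINT x|lborel. g x * x ^ k) = 0" for k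
    using intk[of k 0] z0[of k 0] by (simp_all add: g_def mult_ac)
  have "(CLINT x|lborel. iexp (t * x) * of_real (g x)) = 0" for t
  proof -
    let ?s = "\<lambda>N x. (\<Sum>k<N. (\<i> * of_real (t * x)) ^ k /\<^sub>R fact k) * complex_of_real (g x)"
    have "(\<lambda>N. CLINT x|lborel. ?s N x) \<longlonglongrightarrow> (CLINT x|lborel. iexp (t * x) * of_real (g x))"
    \<comment> \<open>The majorant comes from |t x| <= t^2 + x^2/4: half of the exponent of
      exp(-x^2/2) survives, and this is the weight in the integrability assumption.\<close>
    proof (rule integral_dominated_convergence[where w="\<lambda>x. exp (t\<^sup>2) * \<bar>f x * exp (- (1/4) * x\<^sup>2)\<bar>"])
      show "integrable lborel (\<lambda>x. exp (t\<^sup>2) * \<bar>f x * exp (- (1/4) * x\<^sup>2)\<bar>)"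
        using int by (intro integrable_mult_right integrable_abs)
      show "AE x in lborel. (\<lambda>N. ?s N x) \<longlonglongrightarrow> iexp (t * x) * of_real (g x)"
        using exp_converges[where 'a=complex] unfolding sums_def by (intro AE_I2 tendsto_mult_right) auto
      fix N
      show "AE x in lborel. norm (?s N x) \<le> exp (t\<^sup>2) * \<bar>f x * exp (- (1/4) * x\<^sup>2)\<bar>"
      proof (rule AE_I2)
        fix x
        have "norm (\<Sum>k<N. (\<i> * of_real (t * x)) ^ k /\<^sub>R fact k) \<le> (\<Sum>k<N. \<bar>t * x\<bar> ^ k /\<^sub>R fact k)"
          by (rule order_trans[OF norm_sum]) (simp add: norm_power norm_mult abs_mult power_mult_distrib divide_inverse mult_ac)
        also have "\<dots> \<le> exp \<bar>t * x\<bar>"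
          unfolding exp_def by (intro sum_le_suminf summable_exp_generic) auto
        also have "\<dots> \<le> exp (t\<^sup>2 + x\<^sup>2 / 4)"
        proof -
          have "0 \<le> (\<bar>t\<bar> - \<bar>x\<bar> / 2)\<^sup>2" by simp
          then have "\<bar>t * x\<bar> \<le> t\<^sup>2 + x\<^sup>2 / 4"
            by (simp add: power2_eq_square algebra_simps abs_mult abs_mult_self_eq)
          then show ?thesis by simp
        qed
        finally have "norm (?s N x) \<le> exp (t\<^sup>2 + x\<^sup>2 / 4) * \<bar>g x\<bar>"
          unfolding norm_mult by (intro mult_mono) auto
        also have "\<dots> = exp (t\<^sup>2) * (\<bar>f x\<bar> * (exp (x\<^sup>2 / 4) * exp (- (x\<^sup>2) / 2)))"
          by (simp add: g_def abs_mult exp_add)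
        also have "exp (x\<^sup>2 / 4) * exp (- (x\<^sup>2) / 2) = exp (- (1/4) * x\<^sup>2)"
          by (simp add: exp_add[symmetric])
        finally show "norm (?s N x) \<le> exp (t\<^sup>2) * \<bar>f x * exp (- (1/4) * x\<^sup>2)\<bar>"
          by (simp add: abs_mult)
      qed
    qed auto
    moreover have "(CLINT x|lborel. ?s N x) = 0" for N
    proof -
      have eq: "?s N x = (\<Sum>k<N. ((\<i> * of_real t) ^ k /\<^sub>R fact k) * of_real (g x * x ^ k))" for x
        unfolding sum_distrib_right by (intro sum.cong refl) (simp add: power_mult_distrib scaleR_conv_of_real)
      have "(CLINT x|lborel. ?s N x) = (\<Sum>k<N. CLINT x|lborel. ((\<i> * of_real t) ^ k /\<^sub>R fact k) * of_real (g x * x ^ k))"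
        unfolding eq by (intro Bochner_Integration.integral_sum integrable_mult_right integrable_of_real gk)
      also have "\<dots> = 0"
        by (intro sum.neutral ballI) (simp only: integral_mult_right_zero integral_complex_of_real gk of_real_0 mult_zero_right)
      finally show ?thesis .
    qed
    ultimately show ?thesis using LIMSEQ_unique tendsto_const by (metis (no_types, lifting) ext)
  qed
  moreover have "integrable lborel g" using gk(1)[of 0] by simp
  ultimately have "AE x in lborel. g x = 0" by (intro density_char_unique)
  then show ?thesis by eventually_elim (simp add: g_def)
qed

lemma hermite_complete:
  fixes f :: "real \<Rightarrow> complex"
  assumes fm [measurable]: "f \<in> borel_measurable borel"
    and int: "integrable lborel (\<lambda>x. f x * of_real (exp (- (1/4) * x\<^sup>2)))"
    and z: "\<And>n. (LINT x|lborel. f x * of_real (hermite_fun n x)) = 0"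
  shows "AE x in lborel. f x = 0"
proof -
  have intn: "integrable lborel (\<lambda>x. f x * of_real (hermite_fun n x))" for n
  proof -
    obtain C where C: "C \<ge> 0" "\<And>x. \<bar>hermite_fun n x\<bar> \<le> C * exp (- (x\<^sup>2) / 4)"
      using hermite_fun_bound by blast
    show ?thesis
    proof (rule Bochner_Integration.integrable_bound[OF integrable_mult_right[OF int, of "of_real C"]])
      have "norm (f x * of_real (hermite_fun n x)) \<le> norm (of_real C * (f x * of_real (exp (- (1/4) * x\<^sup>2))))" for x
        using mult_left_mono[OF C(2)[of x], of "norm (f x)"] C(1) by (simp add: norm_mult mult_ac)
      then show "AE x in lborel. norm (f x * of_real (hermite_fun n x)) \<le> norm (of_real C * (f x * of_real (exp (- (1/4) * x\<^sup>2))))"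
        by simp
    qed measurable
  qed
  have "AE x in lborel. Re (f x) = 0"
  proof (rule hermite_complete_real)
    show "integrable lborel (\<lambda>x. Re (f x) * exp (- (1/4) * x\<^sup>2))"
      using integrable_Re[OF int] by simp
    show "(LINT x|lborel. Re (f x) * hermite_fun n x) = 0" for n
      using integral_Re[OF intn[of n]] z[of n] by simp
  qed measurable
  moreover have "AE x in lborel. Im (f x) = 0"
  proof (rule hermite_complete_real)
    show "integrable lborel (\<lambda>x. Im (f x) * exp (- (1/4) * x\<^sup>2))"
      using integrable_Im[OF int] by simp
    show "(LINT x|lborel. Im (f x) * hermite_fun n x) = 0" for n
      using integral_Im[OF intn[of n]] z[of n] by simp
  qed measurable
  ultimately show ?thesis by eventually_elim (simp add: complex_eq_iff)
qed

section \<open>Hermite expansions of square-integrable functions\<close>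

text \<open>Borel functions and \<open>lborel\<close> replace the Lebesgue measurable functions of
  the statement so that product measures and Fubini apply; almost-everywhere representatives lead
  back.\<close>

definition L2 :: "(real \<Rightarrow> complex) set" where
  "L2 = {f \<in> borel_measurable borel. integrable lborel (\<lambda>x. (norm (f x))\<^sup>2)}"

definition sqnorm :: "(real \<Rightarrow> complex) \<Rightarrow> real" where
  "sqnorm f = (LINT x|lborel. (norm (f x))\<^sup>2)"

definition coef :: "(real \<Rightarrow> complex) \<Rightarrow> nat \<Rightarrow> complex" where
  "coef f n = (LINT x|lborel. f x * of_real (hermite_fun n x))"

definition hermite_sum :: "nat \<Rightarrow> (nat \<Rightarrow> complex) \<Rightarrow> real \<Rightarrow> complex" where
  "hermite_sum N c x = (\<Sum>n<N. c n * of_real (hermite_fun n x))"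

lemma L2_measurable [measurable_dest]: "f \<in> L2 \<Longrightarrow> f \<in> borel_measurable borel"
  by (simp add: L2_def)

lemma L2_integrable: "f \<in> L2 \<Longrightarrow> integrable lborel (\<lambda>x. (norm (f x))\<^sup>2)"
  by (simp add: L2_def)

lemma sqnorm_nonneg [simp]: "sqnorm f \<ge> 0"
  by (simp add: sqnorm_def)

lemma nn_integral_L2: "f \<in> L2 \<Longrightarrow> (\<integral>\<^sup>+x. ennreal ((norm (f x))\<^sup>2) \<partial>lborel) = ennreal (sqnorm f)"
  unfolding sqnorm_def by (intro nn_integral_eq_integral L2_integrable) auto

lemma L2_I:
  assumes [measurable]: "f \<in> borel_measurable borel" and "(\<integral>\<^sup>+x. ennreal ((norm (f x))\<^sup>2) \<partial>lborel) \<le> ennreal B" "B \<ge> 0"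
  shows "f \<in> L2" "sqnorm f \<le> B"
proof -
  have "(\<integral>\<^sup>+x. ennreal ((norm (f x))\<^sup>2) \<partial>lborel) < \<infinity>"
    using assms(2) by (rule order_le_less_trans) simp
  then show f: "f \<in> L2"
    unfolding L2_def by (auto intro!: integrableI_bounded)
  show "sqnorm f \<le> B" using assms(2,3) nn_integral_L2[OF f] by simp
qed

lemma norm_add_sq_le: "(norm (a + b :: complex))\<^sup>2 \<le> 2 * (norm a)\<^sup>2 + 2 * (norm b)\<^sup>2"
proof -
  have "(norm (a + b))\<^sup>2 \<le> (norm a + norm b)\<^sup>2" by (intro power_mono norm_triangle_ineq) auto
  also have "\<dots> \<le> 2 * (norm a)\<^sup>2 + 2 * (norm b)\<^sup>2"
    using sum_squares_bound[of "norm a" "norm b"] by (simp add: power2_sum)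
  finally show ?thesis .
qed

lemma L2_add [intro]: assumes "f \<in> L2" "g \<in> L2" shows "(\<lambda>x. f x + g x) \<in> L2"
proof -
  note [measurable] = L2_measurable[OF assms(1)] L2_measurable[OF assms(2)]
  have "integrable lborel (\<lambda>x. 2 * (norm (f x))\<^sup>2 + 2 * (norm (g x))\<^sup>2)"
    using assms by (intro Bochner_Integration.integrable_add integrable_mult_right L2_integrable)
  then have "integrable lborel (\<lambda>x. (norm (f x + g x))\<^sup>2)"
    by (rule Bochner_Integration.integrable_bound) (use norm_add_sq_le in auto)
  then show ?thesis by (simp add: L2_def)
qed

lemma L2_cmult [intro]: assumes "f \<in> L2" shows "(\<lambda>x. c * f x) \<in> L2"
proof -
  note [measurable] = L2_measurable[OF assms]
  have "integrable lborel (\<lambda>x. (norm c)\<^sup>2 * (norm (f x))\<^sup>2)"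
    using assms by (intro integrable_mult_right L2_integrable)
  then show ?thesis by (simp add: L2_def norm_mult power_mult_distrib)
qed

lemma L2_diff [intro]: assumes "f \<in> L2" "g \<in> L2" shows "(\<lambda>x. f x - g x) \<in> L2"
  using L2_add[OF assms(1) L2_cmult[OF assms(2), of "-1"]] by simp

lemma L2_sum [intro]: "(\<And>i. i \<in> A \<Longrightarrow> f i \<in> L2) \<Longrightarrow> (\<lambda>x. \<Sum>i\<in>A. f i x) \<in> L2"
proof (induction A rule: infinite_finite_induct)
  case (insert i A)
  then show ?case using L2_add[of "f i" "\<lambda>x. \<Sum>i\<in>A. f i x"] by simp
qed (auto simp: L2_def)

lemma L2_mult_integrable: assumes "f \<in> L2" "g \<in> L2" shows "integrable lborel (\<lambda>x. f x * g x)"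
proof -
  note [measurable] = L2_measurable[OF assms(1)] L2_measurable[OF assms(2)]
  have "integrable lborel (\<lambda>x. (norm (f x))\<^sup>2 + (norm (g x))\<^sup>2)"
    using assms by (intro Bochner_Integration.integrable_add L2_integrable)
  then show ?thesis
  proof (rule Bochner_Integration.integrable_bound)
    have "norm (f x * g x) \<le> (norm (f x))\<^sup>2 + (norm (g x))\<^sup>2" for x
    proof -
      have "2 * norm (f x) * norm (g x) \<le> (norm (f x))\<^sup>2 + (norm (g x))\<^sup>2"
        by (rule sum_squares_bound)
      moreover have "0 \<le> norm (f x) * norm (g x)" by simp
      ultimately show ?thesis unfolding norm_mult by linarith
    qed
    then show "AE x in lborel. norm (f x * g x) \<le> norm ((norm (f x))\<^sup>2 + (norm (g x))\<^sup>2)"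
      by simp
  qed measurable
qed

lemma borel_measurable_cnj [measurable (raw)]:
  "f \<in> borel_measurable M \<Longrightarrow> (\<lambda>x. cnj (f x)) \<in> borel_measurable M"
  by (rule borel_measurable_continuous_on[of cnj]) (intro continuous_intros)

lemma L2_cnj [intro]: "f \<in> L2 \<Longrightarrow> (\<lambda>x. cnj (f x)) \<in> L2"
  by (auto simp: L2_def)

lemma hermite_fun_L2 [intro]: "(\<lambda>x. of_real (hermite_fun n x)) \<in> L2"
  using integrable_hermite_fun_mult[of n n] by (auto simp: L2_def power2_eq_square)

lemma hermite_sum_L2 [intro]: "hermite_sum N c \<in> L2"
  unfolding hermite_sum_def[abs_def] by (intro L2_sum L2_cmult hermite_fun_L2)

lemma measurable_hermite_sum [measurable]: "hermite_sum N c \<in> borel_measurable borel"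
  using hermite_sum_L2 by (rule L2_measurable)

lemma coef_add: "f \<in> L2 \<Longrightarrow> g \<in> L2 \<Longrightarrow> coef (\<lambda>x. f x + g x) n = coef f n + coef g n"
  unfolding coef_def distrib_right
  by (intro Bochner_Integration.integral_add L2_mult_integrable) auto

lemma coef_cmult: "coef (\<lambda>x. c * f x) n = c * coef f n"
  unfolding coef_def mult.assoc by (simp only: integral_mult_right_zero)

lemma coef_diff: "f \<in> L2 \<Longrightarrow> g \<in> L2 \<Longrightarrow> coef (\<lambda>x. f x - g x) n = coef f n - coef g n"
  using coef_add[of f "\<lambda>x. -1 * g x" n] coef_cmult[of "-1" g n] L2_cmult[of g "-1"] by simp

lemma coef_hermite_sum: "coef (hermite_sum N c) n = (if n < N then c n else 0)"
proof -
  have "coef (hermite_sum N c) n = (LINT x|lborel. (\<Sum>m<N. c m * of_real (hermite_fun m x * hermite_fun n x)))"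
    unfolding coef_def hermite_sum_def sum_distrib_right by (simp add: mult.assoc)
  also have "\<dots> = (\<Sum>m<N. c m * of_real (LINT x|lborel. hermite_fun m x * hermite_fun n x))"
    by (subst Bochner_Integration.integral_sum)
      (simp_all only: integral_mult_right_zero integral_complex_of_real integrable_mult_right integrable_of_real integrable_hermite_fun_mult)
  also have "\<dots> = (\<Sum>m<N. if m = n then c m else 0)"
    by (intro sum.cong refl) (simp add: hermite_fun_orthonormal)
  finally show ?thesis by simp
qed

lemma sqnorm_diff_expand:
  assumes "f \<in> L2" "g \<in> L2"
  shows "sqnorm (\<lambda>x. f x - g x) = sqnorm f + sqnorm g - 2 * Re (LINT x|lborel. f x * cnj (g x))"
proof -
  have i: "integrable lborel (\<lambda>x. f x * cnj (g x))" using assms by (intro L2_mult_integrable) auto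
  have "sqnorm (\<lambda>x. f x - g x) = (LINT x|lborel. ((norm (f x))\<^sup>2 + (norm (g x))\<^sup>2) - 2 * Re (f x * cnj (g x)))"
    unfolding sqnorm_def by (intro Bochner_Integration.integral_cong refl) (simp add: cmod_power2, simp add: power2_eq_square algebra_simps)
  also have "\<dots> = (sqnorm f + sqnorm g) - 2 * (LINT x|lborel. Re (f x * cnj (g x)))"
    unfolding sqnorm_def using assms i
    by (simp add: L2_integrable Bochner_Integration.integral_diff Bochner_Integration.integral_add del: times_complex.sel)
  finally show ?thesis using integral_Re[OF i] by simp
qed

lemma L2_inner_hermite_sum:
  assumes "f \<in> L2"
  shows "(LINT x|lborel. f x * cnj (hermite_sum N c x)) = (\<Sum>n<N. cnj (c n) * coef f n)"
proof -
  have "(LINT x|lborel. f x * cnj (hermite_sum N c x))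
    = (LINT x|lborel. (\<Sum>n<N. cnj (c n) * (f x * of_real (hermite_fun n x))))"
    unfolding hermite_sum_def by (simp add: sum_distrib_left mult_ac)
  also have "\<dots> = (\<Sum>n<N. LINT x|lborel. cnj (c n) * (f x * of_real (hermite_fun n x)))"
    using assms by (intro Bochner_Integration.integral_sum integrable_mult_right L2_mult_integrable) auto
  finally show ?thesis by (simp only: integral_mult_right_zero coef_def)
qed

lemma sqnorm_hermite_sum: "sqnorm (hermite_sum N c) = (\<Sum>n<N. (norm (c n))\<^sup>2)"
proof -
  have "complex_of_real (sqnorm (hermite_sum N c)) = (LINT x|lborel. hermite_sum N c x * cnj (hermite_sum N c x))"
    unfolding sqnorm_def integral_complex_of_real[symmetric] complex_norm_square ..
  also have "\<dots> = (\<Sum>n<N. cnj (c n) * c n)"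
    by (subst L2_inner_hermite_sum) (auto simp: coef_hermite_sum)
  also have "\<dots> = of_real (\<Sum>n<N. (norm (c n))\<^sup>2)"
    unfolding of_real_sum complex_norm_square by (simp add: mult.commute)
  finally show ?thesis by (simp only: of_real_eq_iff)
qed

lemma sqnorm_diff_hermite_sum:
  assumes "f \<in> L2"
  shows "sqnorm (\<lambda>x. f x - hermite_sum N (coef f) x) = sqnorm f - (\<Sum>n<N. (norm (coef f n))\<^sup>2)"
proof -
  have "(\<Sum>n<N. cnj (coef f n) * coef f n) = of_real (\<Sum>n<N. (norm (coef f n))\<^sup>2)"
    unfolding of_real_sum complex_norm_square by (simp add: mult.commute)
  then show ?thesis
    using assms by (simp add: sqnorm_diff_expand hermite_sum_L2 L2_inner_hermite_sum sqnorm_hermite_sum)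
qed

lemma Bessel: "f \<in> L2 \<Longrightarrow> (\<Sum>n<N. (norm (coef f n))\<^sup>2) \<le> sqnorm f"
  using sqnorm_diff_hermite_sum[of f N] sqnorm_nonneg[of "\<lambda>x. f x - hermite_sum N (coef f) x"] by linarith

lemma coef_summable: "f \<in> L2 \<Longrightarrow> summable (\<lambda>n. (norm (coef f n))\<^sup>2)"
  by (rule summableI_nonneg_bounded[where x="sqnorm f"]) (auto intro: Bessel)

lemma coef_bound: assumes "f \<in> L2" shows "(norm (coef f n))\<^sup>2 \<le> sqnorm f"
proof -
  have "(norm (coef f n))\<^sup>2 \<le> (\<Sum>m<Suc n. (norm (coef f m))\<^sup>2)"
    by (rule member_le_sum) auto
  with Bessel[OF assms, of "Suc n"] show ?thesis by linarith
qed

definition tail :: "(nat \<Rightarrow> complex) \<Rightarrow> nat \<Rightarrow> real" where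
  "tail c N = (\<Sum>n. (norm (c (n + N)))\<^sup>2)"

lemma tail_tendsto: "summable (\<lambda>n. (norm (c n))\<^sup>2) \<Longrightarrow> tail c \<longlonglongrightarrow> 0"
  unfolding tail_def[abs_def] by (rule suminf_exist_split2)

lemma tail_nonneg: "summable (\<lambda>n. (norm (c n))\<^sup>2) \<Longrightarrow> tail c N \<ge> 0"
  unfolding tail_def by (intro suminf_nonneg) (auto simp: summable_iff_shift[of "\<lambda>n. (norm (c n))\<^sup>2"])

lemma tail_eq:
  assumes "summable (\<lambda>n. (norm (c n))\<^sup>2)"
  shows "tail c N = (\<Sum>n. (norm (c n))\<^sup>2) - (\<Sum>n<N. (norm (c n))\<^sup>2)"
  unfolding tail_def using suminf_minus_initial_segment[OF assms, of N] by simp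

lemma sqnorm_hermite_sum_diff:
  assumes "summable (\<lambda>n. (norm (c n))\<^sup>2)" "N \<le> M"
  shows "sqnorm (\<lambda>x. hermite_sum M c x - hermite_sum N c x) \<le> tail c N"
proof -
  have "hermite_sum N c = hermite_sum N (coef (hermite_sum M c))"
    using assms(2) by (intro ext) (simp add: hermite_sum_def coef_hermite_sum)
  then have "sqnorm (\<lambda>x. hermite_sum M c x - hermite_sum N c x)
      = (\<Sum>n<M. (norm (c n))\<^sup>2) - (\<Sum>n<N. (norm (c n))\<^sup>2)"
    using sqnorm_diff_hermite_sum[OF hermite_sum_L2[of M c], of N] assms(2)
    by (simp add: coef_hermite_sum sqnorm_hermite_sum)
  also have "(\<Sum>n<M. (norm (c n))\<^sup>2) \<le> (\<Sum>n. (norm (c n))\<^sup>2)"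
    by (intro sum_le_suminf assms(1)) auto
  finally show ?thesis using tail_eq[OF assms(1), of N] by linarith
qed

text \<open>
  Along a subsequence with geometrically decaying tails the Hermite expansion converges almost
  everywhere. The condition only involves the moduli of the coefficients, so one subsequence serves
  all times of the evolution, and the limit is jointly measurable in time and space.
\<close>

definition good_seq :: "(nat \<Rightarrow> complex) \<Rightarrow> (nat \<Rightarrow> nat) \<Rightarrow> bool" where
  "good_seq c N \<longleftrightarrow> strict_mono N \<and> (\<forall>k. tail c (N k) \<le> (1/4) ^ k)"

lemma good_seq_exists:
  assumes "summable (\<lambda>n. (norm (c n))\<^sup>2)"
  shows "\<exists>N. good_seq c N"
proof -
  have "\<exists>M. \<forall>m\<ge>M. tail c m < (1/4) ^ k" for k
    using order_tendstoD(2)[OF tail_tendsto[OF assms], of "(1/4)^k"] by (simp add: eventually_sequentially)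
  then obtain M where M: "\<And>k m. m \<ge> M k \<Longrightarrow> tail c m < (1/4) ^ k" by metis
  define N where "N = rec_nat (M 0) (\<lambda>k n. max (Suc n) (M (Suc k)))"
  have "strict_mono N" by (rule strict_mono_Suc_iff[THEN iffD2]) (auto simp: N_def)
  moreover have "N k \<ge> M k" for k by (cases k) (auto simp: N_def)
  ultimately show ?thesis using M unfolding good_seq_def by (metis less_imp_le)
qed

definition hermite_series :: "(nat \<Rightarrow> nat) \<Rightarrow> (nat \<Rightarrow> complex) \<Rightarrow> real \<Rightarrow> complex" where
  "hermite_series N c x = lim (\<lambda>k. hermite_sum (N k) c x)"

lemma measurable_hermite_series [measurable]: "hermite_series N c \<in> borel_measurable borel"
  unfolding hermite_series_def[abs_def] by measurable

text \<open>The increments satisfy ||D_k||^2 <= 4^-k, so the sum of 2^k |D_k|^2 has finite integral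
  and is finite almost everywhere. Since |D_k| <= 2^k |D_k|^2 + 2^-k, the increments are then
  absolutely summable.\<close>

lemma hermite_series_AE:
  assumes s: "summable (\<lambda>n. (norm (c n))\<^sup>2)" and N: "good_seq c N"
  shows "AE x in lborel. (\<lambda>k. hermite_sum (N k) c x) \<longlonglongrightarrow> hermite_series N c x"
proof -
  define D where "D k x = hermite_sum (N (Suc k)) c x - hermite_sum (N k) c x" for k x
  have DL: "D k \<in> L2" for k unfolding D_def[abs_def] by auto
  note [measurable] = L2_measurable[OF DL]
  have Nk: "N k \<le> N (Suc k)" for k using N by (simp add: good_seq_def strict_mono_leD)
  have Dn: "sqnorm (D k) \<le> (1/4) ^ k" for k
    using sqnorm_hermite_sum_diff[OF s Nk, of k] N unfolding D_def[abs_def] good_seq_def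
    by (meson order_trans)
  have "(\<integral>\<^sup>+x. (\<Sum>k. ennreal (2 ^ k * (norm (D k x))\<^sup>2)) \<partial>lborel) = (\<Sum>k. \<integral>\<^sup>+x. ennreal (2 ^ k * (norm (D k x))\<^sup>2) \<partial>lborel)"
    by (rule nn_integral_suminf) measurable
  also have "\<dots> = (\<Sum>k. ennreal (2 ^ k * sqnorm (D k)))"
    by (simp add: ennreal_mult nn_integral_cmult nn_integral_L2[OF DL])
  also have "\<dots> \<le> (\<Sum>k. ennreal ((1/2) ^ k))"
  proof (intro suminf_le ennreal_leI summableI)
    fix k
    have "2 ^ k * sqnorm (D k) \<le> 2 ^ k * (1/4) ^ k" by (intro mult_left_mono Dn) auto
    also have "\<dots> = (1/2) ^ k" unfolding power_mult_distrib[symmetric] by simp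
    finally show "2 ^ k * sqnorm (D k) \<le> (1/2) ^ k" .
  qed
  also have "\<dots> = ennreal (\<Sum>k. (1/2) ^ k)"
    by (intro suminf_ennreal2 summable_geometric) auto
  finally have "(\<integral>\<^sup>+x. (\<Sum>k. ennreal (2 ^ k * (norm (D k x))\<^sup>2)) \<partial>lborel) \<noteq> \<infinity>"
    by (auto simp: top_unique)
  then have "AE x in lborel. (\<Sum>k. ennreal (2 ^ k * (norm (D k x))\<^sup>2)) \<noteq> \<infinity>"
    by (intro nn_integral_PInf_AE) measurable
  then show ?thesis
  proof eventually_elim
    case (elim x)
    have s1: "summable (\<lambda>k. 2 ^ k * (norm (D k x))\<^sup>2)"
      using elim by (intro summable_suminf_not_top) auto
    have "summable (\<lambda>k. 2 ^ k * (norm (D k x))\<^sup>2 + (1/2) ^ k)"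
      by (intro summable_add s1 summable_geometric) auto
    then have "summable (\<lambda>k. D k x)"
    proof (rule summable_comparison_test')
      fix k
      have "2 * (sqrt (2 ^ k) * norm (D k x)) * sqrt ((1/2) ^ k) \<le> (sqrt (2 ^ k) * norm (D k x))\<^sup>2 + (sqrt ((1/2) ^ k))\<^sup>2"
        by (rule sum_squares_bound)
      also have "2 * (sqrt (2 ^ k) * norm (D k x)) * sqrt ((1/2) ^ k) = 2 * norm (D k x) * sqrt (2 ^ k * (1/2) ^ k)"
        by (simp only: real_sqrt_mult mult_ac)
      also have "(2::real) ^ k * (1/2) ^ k = 1" unfolding power_mult_distrib[symmetric] by simp
      finally have "2 * norm (D k x) \<le> 2 ^ k * (norm (D k x))\<^sup>2 + (1/2) ^ k"
        by (simp add: power_mult_distrib)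
      then show "norm (D k x) \<le> 2 ^ k * (norm (D k x))\<^sup>2 + (1/2) ^ k"
        using norm_ge_zero[of "D k x"] by linarith
    qed
    then have "convergent (\<lambda>n. \<Sum>k<n. D k x)" by (simp add: summable_iff_convergent)
    moreover have "(\<Sum>k<n. D k x) = hermite_sum (N n) c x - hermite_sum (N 0) c x" for n
      unfolding D_def by (rule sum_lessThan_telescope)
    ultimately have "convergent (\<lambda>n. hermite_sum (N n) c x - hermite_sum (N 0) c x)" by simp
    then have "convergent (\<lambda>n. hermite_sum (N n) c x)" by (simp add: convergent_diff_const_right_iff)
    then show ?case unfolding hermite_series_def by (simp add: convergent_LIMSEQ_iff)
  qed
qed

lemma good_seq_ge: "good_seq c N \<Longrightarrow> k \<le> N k"
  by (simp add: good_seq_def strict_mono_imp_increasing)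

text \<open>Fatou along the subsequence: the squared distance of the limit from a fixed partial sum
  is at most the lower limit of the squared distances between partial sums, and those are bounded by
  the tail.\<close>

lemma hermite_series_L2:
  assumes s: "summable (\<lambda>n. (norm (c n))\<^sup>2)" and N: "good_seq c N"
  shows "hermite_series N c \<in> L2"
    and "sqnorm (\<lambda>x. hermite_series N c x - hermite_sum M c x) \<le> tail c M"
proof -
  let ?u = "hermite_series N c"
  have le: "(\<integral>\<^sup>+x. ennreal ((norm (?u x - hermite_sum M c x))\<^sup>2) \<partial>lborel) \<le> ennreal (tail c M)" for M
  proof -
    have "(\<integral>\<^sup>+x. ennreal ((norm (?u x - hermite_sum M c x))\<^sup>2) \<partial>lborel)
      = (\<integral>\<^sup>+x. liminf (\<lambda>k. ennreal ((norm (hermite_sum (N k) c x - hermite_sum M c x))\<^sup>2)) \<partial>lborel)"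
      using hermite_series_AE[OF s N]
    proof (intro nn_integral_cong_AE, eventually_elim)
      case (elim x)
      then have "(\<lambda>k. ennreal ((norm (hermite_sum (N k) c x - hermite_sum M c x))\<^sup>2))
        \<longlonglongrightarrow> ennreal ((norm (?u x - hermite_sum M c x))\<^sup>2)"
        by (intro tendsto_intros)
      then show ?case by (intro lim_imp_Liminf[symmetric]) auto
    qed
    also have "\<dots> \<le> liminf (\<lambda>k. \<integral>\<^sup>+x. ennreal ((norm (hermite_sum (N k) c x - hermite_sum M c x))\<^sup>2) \<partial>lborel)"
      by (rule nn_integral_liminf) measurable
    also have "\<dots> \<le> ennreal (tail c M)"
    proof (rule Liminf_le)
      show "\<forall>\<^sub>F k in sequentially. (\<integral>\<^sup>+x. ennreal ((norm (hermite_sum (N k) c x - hermite_sum M c x))\<^sup>2) \<partial>lborel) \<le> ennreal (tail c M)"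
        using eventually_ge_at_top[of M]
      proof eventually_elim
        case (elim k)
        then have "M \<le> N k" using good_seq_ge[OF N, of k] by linarith
        then show ?case
          using sqnorm_hermite_sum_diff[OF s, of M "N k"] nn_integral_L2[OF L2_diff[OF hermite_sum_L2[of "N k" c] hermite_sum_L2[of M c]]]
          by (simp add: ennreal_leI)
      qed
    qed simp
    finally show ?thesis .
  qed
  have d: "(\<lambda>x. ?u x - hermite_sum M c x) \<in> L2" "sqnorm (\<lambda>x. ?u x - hermite_sum M c x) \<le> tail c M" for M
    by (rule L2_I[OF _ le tail_nonneg[OF s]]; measurable)+
  show "sqnorm (\<lambda>x. ?u x - hermite_sum M c x) \<le> tail c M" by (rule d)
  have "(\<lambda>x. (?u x - hermite_sum 0 c x) + hermite_sum 0 c x) \<in> L2"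
    using d(1)[of 0] hermite_sum_L2[of 0 c] by (rule L2_add)
  then show "?u \<in> L2" by simp
qed

lemma coef_hermite_series:
  assumes s: "summable (\<lambda>n. (norm (c n))\<^sup>2)" and N: "good_seq c N"
  shows "coef (hermite_series N c) n = c n"
proof -
  note h = hermite_series_L2[OF s N]
  have "(\<lambda>M. norm (coef (hermite_series N c) n - c n)) \<longlonglongrightarrow> sqrt 0"
  proof (rule tendsto_sandwich[OF _ _ _ tendsto_real_sqrt[OF tail_tendsto[OF s]]])
    show "\<forall>\<^sub>F M in sequentially. norm (coef (hermite_series N c) n - c n) \<le> sqrt (tail c M)"
      using eventually_gt_at_top[of n]
    proof eventually_elim
      case (elim M)
      have "coef (\<lambda>x. hermite_series N c x - hermite_sum M c x) n = coef (hermite_series N c) n - c n"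
        using elim h(1) by (subst coef_diff) (auto simp: coef_hermite_sum)
      moreover have "(norm (coef (\<lambda>x. hermite_series N c x - hermite_sum M c x) n))\<^sup>2 \<le> tail c M"
        using h by (intro order_trans[OF coef_bound]) auto
      ultimately show ?case by (simp add: real_le_rsqrt)
    qed
  qed (auto)
  then show ?thesis by (simp add: LIMSEQ_const_iff)
qed

lemma gauss_L2: "(\<lambda>x. complex_of_real (exp (- (1/4) * x\<^sup>2))) \<in> L2"
proof -
  have "(exp (- (1/4) * x\<^sup>2))\<^sup>2 = exp (- (1/2) * x\<^sup>2)" for x :: real
    by (simp add: power2_eq_square exp_add[symmetric])
  then show ?thesis using gaussian_has_integral(1)[of "1/2"] by (simp add: L2_def)
qed

lemma L2_coef_unique:
  assumes f: "f \<in> L2" and g: "g \<in> L2" and eq: "\<And>n. coef f n = coef g n"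
  shows "AE x in lborel. f x = g x"
proof -
  have d: "(\<lambda>x. f x - g x) \<in> L2" using f g by auto
  have "AE x in lborel. f x - g x = 0"
  proof (rule hermite_complete)
    show "(\<lambda>x. f x - g x) \<in> borel_measurable borel" using d by (rule L2_measurable)
    show "integrable lborel (\<lambda>x. (f x - g x) * of_real (exp (- (1/4) * x\<^sup>2)))"
      by (rule L2_mult_integrable[OF d gauss_L2])
    show "(LINT x|lborel. (f x - g x) * of_real (hermite_fun n x)) = 0" for n
      using coef_diff[OF f g, of n] eq unfolding coef_def by simp
  qed
  then show ?thesis by simp
qed

lemma sqnorm_cong_AE:
  assumes "AE x in lborel. f x = g x" "f \<in> borel_measurable borel" "g \<in> borel_measurable borel"
  shows "sqnorm f = sqnorm g"
  unfolding sqnorm_def using assms by (intro integral_cong_AE) auto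

text \<open>By completeness f agrees with the sum of its own expansion, which bounds the error by
  the tail; Bessel's inequality gives the reverse bound.\<close>

lemma sqnorm_diff_partial:
  assumes f: "f \<in> L2"
  shows "sqnorm (\<lambda>x. f x - hermite_sum M (coef f) x) = tail (coef f) M"
proof -
  note s = coef_summable[OF f]
  obtain N where N: "good_seq (coef f) N" using good_seq_exists[OF s] by blast
  note h = hermite_series_L2[OF s N]
  have ae: "AE x in lborel. f x = hermite_series N (coef f) x"
    using f h(1) by (intro L2_coef_unique) (simp_all add: coef_hermite_series[OF s N])
  have [measurable]: "f \<in> borel_measurable borel" using f by auto
  have le: "sqnorm (\<lambda>x. f x - hermite_sum M (coef f) x) \<le> tail (coef f) M" for M
  proof -
    have "sqnorm (\<lambda>x. f x - hermite_sum M (coef f) x) = sqnorm (\<lambda>x. hermite_series N (coef f) x - hermite_sum M (coef f) x)"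
      using ae by (intro sqnorm_cong_AE) (auto elim: AE_mp)
    then show ?thesis using h(2) by simp
  qed
  have "sqnorm f \<le> (\<Sum>n. (norm (coef f n))\<^sup>2)"
    using le[of 0] by (simp add: hermite_sum_def tail_def)
  then show ?thesis
    using le[of M] sqnorm_diff_hermite_sum[OF f, of M] tail_eq[OF s, of M] Bessel[OF f]
      suminf_le_const[OF s, of "sqnorm f"] by force
qed

lemma Parseval: "f \<in> L2 \<Longrightarrow> sqnorm f = (\<Sum>n. (norm (coef f n))\<^sup>2)"
  using sqnorm_diff_partial[of f 0] by (simp add: hermite_sum_def tail_def)

lemma tail_cong: "(\<And>n. norm (c n) = norm (d n)) \<Longrightarrow> tail c = tail d"
  by (intro ext) (simp add: tail_def)

lemma good_seq_cong: "(\<And>n. norm (c n) = norm (d n)) \<Longrightarrow> good_seq c = good_seq d"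
  by (intro ext) (simp add: good_seq_def tail_cong[of c d])

section \<open>Hermite polynomials under rotations\<close>

text \<open>Raising one index or the other in a sum of total degree N gives a sum of total degree N
  + 1. The induction steps of both expansions below end in the left-hand shape; the guards handle
  the two ends, where only one neighbour contributes.\<close>

lemma sum_shift_pair:
  fixes u :: "nat \<Rightarrow> nat \<Rightarrow> real"
  shows "(\<Sum>k\<le>N. \<alpha> k * (p * u (Suc k) (N - k) + q * u k (Suc (N - k))))
    = (\<Sum>k\<le>Suc N. ((if k = 0 then 0 else p * \<alpha> (k - 1)) + (if k \<le> N then q * \<alpha> k else 0)) * u k (Suc N - k))"
proof -
  have 1: "(\<Sum>k\<le>Suc N. (if k = 0 then 0 else p * \<alpha> (k - 1)) * u k (Suc N - k)) = (\<Sum>k\<le>N. p * \<alpha> k * u (Suc k) (N - k))"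
    unfolding sum.atMost_Suc_shift by simp
  have 2: "(\<Sum>k\<le>Suc N. (if k \<le> N then q * \<alpha> k else 0) * u k (Suc N - k)) = (\<Sum>k\<le>N. q * \<alpha> k * u k (Suc (N - k)))"
    unfolding sum.atMost_Suc by (auto intro!: sum.cong simp: Suc_diff_le)
  show ?thesis
    unfolding distrib_right sum.distrib 1 2 by (simp add: distrib_left sum.distrib mult_ac)
qed

lemma has_deriv_hermite: "(hermite_poly n has_real_derivative 2 * x * hermite_poly n x - hermite_poly (Suc n) x) (at x)"
  by (rule hermite_poly_has_deriv[THEN conjunct1])

text \<open>The raising operator 2z - d/dz in z = C x + S y is C times the one in x plus S times the
  one in y, so degree l + 1 follows from degree l. The leading coefficient is the only one recorded
  because integration against the Gaussian in y removes all other terms.\<close>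

lemma hermite_addition:
  assumes CS: "C\<^sup>2 + S\<^sup>2 = (1::real)"
  shows "\<exists>\<beta>. \<beta> l = C ^ l \<and> (\<forall>x y. hermite_poly l (C * x + S * y) = (\<Sum>j\<le>l. \<beta> j * (hermite_poly j x * hermite_poly (l - j) y)))"
proof (induction l)
  case 0
  show ?case by (intro exI[of _ "\<lambda>_. 1"]) simp
next
  case (Suc l)
  then obtain \<beta> where b: "\<beta> l = C ^ l"
    and e: "\<And>x y. hermite_poly l (C * x + S * y) = (\<Sum>j\<le>l. \<beta> j * (hermite_poly j x * hermite_poly (l - j) y))"
    by blast
  let ?H = hermite_poly
  have "?H (Suc l) (C * x + S * y)
    = (\<Sum>j\<le>Suc l. ((if j = 0 then 0 else C * \<beta> (j - 1)) + (if j \<le> l then S * \<beta> j else 0)) * (?H j x * ?H (Suc l - j) y))" for x y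
  proof -
    let ?z = "C * x + S * y"
    let ?d = "2 * ?z * ?H l ?z - ?H (Suc l) ?z"
    have "((\<lambda>x. ?H l (C * x + S * y)) has_real_derivative ?d * C) (at x)"
      by (rule DERIV_chain2[OF has_deriv_hermite]) (auto intro!: derivative_eq_intros)
    moreover have "((\<lambda>x. ?H l (C * x + S * y)) has_real_derivative
       (\<Sum>j\<le>l. \<beta> j * ((2 * x * ?H j x - ?H (Suc j) x) * ?H (l - j) y))) (at x)"
      unfolding e by (intro DERIV_sum DERIV_cmult DERIV_cmult_right has_deriv_hermite)
    ultimately have dx: "?d * C = (\<Sum>j\<le>l. \<beta> j * ((2 * x * ?H j x - ?H (Suc j) x) * ?H (l - j) y))"
      by (rule DERIV_unique)
    have "((\<lambda>y. ?H l (C * x + S * y)) has_real_derivative ?d * S) (at y)"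
      by (rule DERIV_chain2[OF has_deriv_hermite]) (auto intro!: derivative_eq_intros)
    moreover have "((\<lambda>y. ?H l (C * x + S * y)) has_real_derivative
       (\<Sum>j\<le>l. \<beta> j * (?H j x * (2 * y * ?H (l - j) y - ?H (Suc (l - j)) y)))) (at y)"
      unfolding e by (intro DERIV_sum DERIV_cmult DERIV_cmult_right has_deriv_hermite)
    ultimately have dy: "?d * S = (\<Sum>j\<le>l. \<beta> j * (?H j x * (2 * y * ?H (l - j) y - ?H (Suc (l - j)) y)))"
      by (rule DERIV_unique)
    \<comment> \<open>Here C^2 + S^2 = 1 enters: it splits the derivative term between the two
      directions.\<close>
    have "?H (Suc l) ?z = 2 * ?z * ?H l ?z - ?d * (C\<^sup>2 + S\<^sup>2)" unfolding CS by simp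
    also have "\<dots> = C * (2 * x * ?H l ?z - ?d * C) + S * (2 * y * ?H l ?z - ?d * S)"
      by (simp add: power2_eq_square algebra_simps)
    also have "2 * x * ?H l ?z - ?d * C = (\<Sum>j\<le>l. \<beta> j * (?H (Suc j) x * ?H (l - j) y))"
      unfolding dx unfolding e sum_distrib_left sum_subtractf[symmetric] by (intro sum.cong refl) (simp add: algebra_simps)
    also have "2 * y * ?H l ?z - ?d * S = (\<Sum>j\<le>l. \<beta> j * (?H j x * ?H (Suc (l - j)) y))"
      unfolding dy unfolding e sum_distrib_left sum_subtractf[symmetric] by (intro sum.cong refl) (simp add: algebra_simps)
    also have "C * (\<Sum>j\<le>l. \<beta> j * (?H (Suc j) x * ?H (l - j) y)) + S * (\<Sum>j\<le>l. \<beta> j * (?H j x * ?H (Suc (l - j)) y))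
      = (\<Sum>j\<le>l. \<beta> j * (C * (?H (Suc j) x * ?H (l - j) y) + S * (?H j x * ?H (Suc (l - j)) y)))"
      unfolding sum_distrib_left sum.distrib[symmetric] by (intro sum.cong refl) (simp add: algebra_simps)
    finally show ?thesis
      unfolding sum_shift_pair[of \<beta> C "\<lambda>i j. ?H i x * ?H j y" l S] .
  qed
  then show ?case
    using b by (intro exI[of _ "\<lambda>j. (if j = 0 then 0 else C * \<beta> (j - 1)) + (if j \<le> l then S * \<beta> j else 0)"]) auto
qed

text \<open>Coordinates along and across the diagonal x = y, on which \<open>rb\<close> vanishes.
  The change of variables is its own inverse, so the same two functions lead back.\<close>

definition ra :: "real \<Rightarrow> real \<Rightarrow> real" where "ra x y = (x + y) / sqrt 2"
definition rb :: "real \<Rightarrow> real \<Rightarrow> real" where "rb x y = (x - y) / sqrt 2"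

lemma ra_rb_involution: "ra (ra x y) (rb x y) = x" "rb (ra x y) (rb x y) = y"
  by (simp_all add: ra_def rb_def field_simps)

lemma ra_rb_sq: "(ra x y)\<^sup>2 + (rb x y)\<^sup>2 = x\<^sup>2 + y\<^sup>2"
  by (simp add: ra_def rb_def power_divide power2_sum power2_diff field_simps)

lemma DERIV_hermite_product_45:
  shows "((\<lambda>x. \<Sum>k\<le>N. \<alpha> k * (hermite_poly k (ra x y) * hermite_poly (N - k) (rb x y))) has_real_derivative
       (\<Sum>k\<le>N. \<alpha> k * ((2 * ra x y * hermite_poly k (ra x y) - hermite_poly (Suc k) (ra x y)) * (1 / sqrt 2) * hermite_poly (N - k) (rb x y)
         + hermite_poly k (ra x y) * ((2 * rb x y * hermite_poly (N - k) (rb x y) - hermite_poly (Suc (N - k)) (rb x y)) * (1 / sqrt 2))))) (at x)"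
  and "((\<lambda>y. \<Sum>k\<le>N. \<alpha> k * (hermite_poly k (ra x y) * hermite_poly (N - k) (rb x y))) has_real_derivative
       (\<Sum>k\<le>N. \<alpha> k * ((2 * ra x y * hermite_poly k (ra x y) - hermite_poly (Suc k) (ra x y)) * (1 / sqrt 2) * hermite_poly (N - k) (rb x y)
         + hermite_poly k (ra x y) * ((2 * rb x y * hermite_poly (N - k) (rb x y) - hermite_poly (Suc (N - k)) (rb x y)) * (- 1 / sqrt 2))))) (at y)"
proof -
  have d: "((\<lambda>x. ra x y) has_real_derivative 1 / sqrt 2) (at x)" "((\<lambda>x. rb x y) has_real_derivative 1 / sqrt 2) (at x)"
    "((\<lambda>y. ra x y) has_real_derivative 1 / sqrt 2) (at y)" "((\<lambda>y. rb x y) has_real_derivative - 1 / sqrt 2) (at y)"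
    unfolding ra_def rb_def by (auto intro!: derivative_eq_intros simp: real_div_sqrt)
  show "((\<lambda>x. \<Sum>k\<le>N. \<alpha> k * (hermite_poly k (ra x y) * hermite_poly (N - k) (rb x y))) has_real_derivative
       (\<Sum>k\<le>N. \<alpha> k * ((2 * ra x y * hermite_poly k (ra x y) - hermite_poly (Suc k) (ra x y)) * (1 / sqrt 2) * hermite_poly (N - k) (rb x y)
         + hermite_poly k (ra x y) * ((2 * rb x y * hermite_poly (N - k) (rb x y) - hermite_poly (Suc (N - k)) (rb x y)) * (1 / sqrt 2))))) (at x)"
    by (intro DERIV_sum DERIV_cmult DERIV_cong[OF DERIV_mult[OF DERIV_chain2[OF has_deriv_hermite d(1)] DERIV_chain2[OF has_deriv_hermite d(2)]]])
      (simp add: algebra_simps)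
  show "((\<lambda>y. \<Sum>k\<le>N. \<alpha> k * (hermite_poly k (ra x y) * hermite_poly (N - k) (rb x y))) has_real_derivative
       (\<Sum>k\<le>N. \<alpha> k * ((2 * ra x y * hermite_poly k (ra x y) - hermite_poly (Suc k) (ra x y)) * (1 / sqrt 2) * hermite_poly (N - k) (rb x y)
         + hermite_poly k (ra x y) * ((2 * rb x y * hermite_poly (N - k) (rb x y) - hermite_poly (Suc (N - k)) (rb x y)) * (- 1 / sqrt 2))))) (at y)"
    by (intro DERIV_sum DERIV_cmult DERIV_cong[OF DERIV_mult[OF DERIV_chain2[OF has_deriv_hermite d(3)] DERIV_chain2[OF has_deriv_hermite d(4)]]])
      (simp add: algebra_simps)
qed

text \<open>Raising in x or in y is a combination of raising in \<open>ra\<close> and in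
  \<open>rb\<close>, so products of total degree m + n stay within that degree. The coefficients are
  never computed: both sides of \<open>hermite_form_identity\<close> are expressed through the same
  unknowns.\<close>

lemma hermite_product_45:
  "\<exists>\<alpha>. \<forall>x y. hermite_poly m x * hermite_poly n y
     = (\<Sum>k\<le>m+n. \<alpha> k * (hermite_poly k (ra x y) * hermite_poly (m + n - k) (rb x y)))"
proof -
  let ?H = hermite_poly
  let ?P = "\<lambda>m n. \<exists>\<alpha>. \<forall>x y. ?H m x * ?H n y = (\<Sum>k\<le>m+n. \<alpha> k * (?H k (ra x y) * ?H (m + n - k) (rb x y)))"
  have xe: "2 * x = (2 * ra x y + 2 * rb x y) * (1 / sqrt 2)" "2 * y = (2 * ra x y - 2 * rb x y) * (1 / sqrt 2)" for x y
    by (simp_all add: ra_def rb_def field_simps)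
  have stepx: "?P (Suc m) n" if mn: "?P m n" for m n
  proof -
    from mn obtain \<alpha> where e: "\<And>x y. ?H m x * ?H n y = (\<Sum>k\<le>m+n. \<alpha> k * (?H k (ra x y) * ?H (m + n - k) (rb x y)))"
      by blast
    let ?N = "m + n"
    have "?H (Suc m) x * ?H n y = (\<Sum>k\<le>?N. \<alpha> k * ((1 / sqrt 2) * (?H (Suc k) (ra x y) * ?H (?N - k) (rb x y))
          + (1 / sqrt 2) * (?H k (ra x y) * ?H (Suc (?N - k)) (rb x y))))" for x y
    proof -
      have "((\<lambda>x. ?H m x * ?H n y) has_real_derivative (2 * x * ?H m x - ?H (Suc m) x) * ?H n y) (at x)"
        by (intro DERIV_cmult_right has_deriv_hermite)
      from DERIV_unique[OF this DERIV_hermite_product_45(1)[where \<alpha>=\<alpha> and N="?N" and x=x and y=y, folded e]]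
      have "?H (Suc m) x * ?H n y = 2 * x * (?H m x * ?H n y)
          - (\<Sum>k\<le>?N. \<alpha> k * ((2 * ra x y * ?H k (ra x y) - ?H (Suc k) (ra x y)) * (1 / sqrt 2) * ?H (?N - k) (rb x y)
           + ?H k (ra x y) * ((2 * rb x y * ?H (?N - k) (rb x y) - ?H (Suc (?N - k)) (rb x y)) * (1 / sqrt 2))))"
        by (simp add: left_diff_distrib mult.assoc)
      then show ?thesis
        unfolding xe(1)[of x y] e sum_distrib_left sum_subtractf[symmetric]
        by (elim trans) (intro sum.cong refl, simp add: algebra_simps)
    qed
    then show ?thesis
      unfolding sum_shift_pair[of \<alpha> "1 / sqrt 2" "\<lambda>i j. ?H i (ra _ _) * ?H j (rb _ _)" ?N "1 / sqrt 2"] add_Suc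
      by (intro exI[of _ "\<lambda>k. (if k = 0 then 0 else 1 / sqrt 2 * \<alpha> (k - 1)) + (if k \<le> ?N then 1 / sqrt 2 * \<alpha> k else 0)"] allI)
  qed
  have stepy: "?P m (Suc n)" if mn: "?P m n" for m n
  proof -
    from mn obtain \<alpha> where e: "\<And>x y. ?H m x * ?H n y = (\<Sum>k\<le>m+n. \<alpha> k * (?H k (ra x y) * ?H (m + n - k) (rb x y)))"
      by blast
    let ?N = "m + n"
    have "?H m x * ?H (Suc n) y = (\<Sum>k\<le>?N. \<alpha> k * ((1 / sqrt 2) * (?H (Suc k) (ra x y) * ?H (?N - k) (rb x y))
          + (- 1 / sqrt 2) * (?H k (ra x y) * ?H (Suc (?N - k)) (rb x y))))" for x y
    proof -
      have "((\<lambda>y. ?H m x * ?H n y) has_real_derivative ?H m x * (2 * y * ?H n y - ?H (Suc n) y)) (at y)"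
        by (intro DERIV_cmult has_deriv_hermite)
      from DERIV_unique[OF this DERIV_hermite_product_45(2)[where \<alpha>=\<alpha> and N="?N" and x=x and y=y, folded e]]
      have "?H m x * ?H (Suc n) y = 2 * y * (?H m x * ?H n y)
          - (\<Sum>k\<le>?N. \<alpha> k * ((2 * ra x y * ?H k (ra x y) - ?H (Suc k) (ra x y)) * (1 / sqrt 2) * ?H (?N - k) (rb x y)
           + ?H k (ra x y) * ((2 * rb x y * ?H (?N - k) (rb x y) - ?H (Suc (?N - k)) (rb x y)) * (- 1 / sqrt 2))))"
        by (simp add: right_diff_distrib mult_ac)
      then show ?thesis
        unfolding xe(2)[of y x] e sum_distrib_left sum_subtractf[symmetric]
        by (elim trans) (intro sum.cong refl, simp add: algebra_simps)
    qed
    then show ?thesis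
      unfolding sum_shift_pair[of \<alpha> "1 / sqrt 2" "\<lambda>i j. ?H i (ra _ _) * ?H j (rb _ _)" ?N "- 1 / sqrt 2"] add_Suc_right
      by (intro exI[of _ "\<lambda>k. (if k = 0 then 0 else 1 / sqrt 2 * \<alpha> (k - 1)) + (if k \<le> ?N then - 1 / sqrt 2 * \<alpha> k else 0)"] allI)
  qed
  have "?P m 0" for m
  proof (induction m)
    case 0
    show ?case by (intro exI[of _ "\<lambda>_. 1"]) simp
  qed (rule stepx)
  note base = this
  show ?thesis
  proof (induction n)
    case 0
    then show ?case using base by (simp only:)
  qed (rule stepy)
qed

text \<open>Integrates the derivative of cos^(l+1) sin, which vanishes at both ends of the
  interval.\<close>

lemma cos_power_integral:
  "(LINT \<theta>:{0..pi}|lborel. cos \<theta> ^ (l + 2)) = real (l + 1) / real (l + 2) * (LINT \<theta>:{0..pi}|lborel. cos \<theta> ^ l)"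
proof -
  have i: "set_integrable lborel {0..pi} (\<lambda>\<theta>. cos \<theta> ^ l)" for l
    by (intro borel_integrable_atLeastAtMost' continuous_intros)
  have "(LINT \<theta>:{0..pi}|lborel. real (l + 2) * cos \<theta> ^ (l + 2) - real (l + 1) * cos \<theta> ^ l) =
    cos pi ^ (l + 1) * sin pi - cos 0 ^ (l + 1) * sin 0"
    unfolding set_lebesgue_integral_def real_scaleR_def
  proof (subst mult.commute, rule integral_FTC_Icc_real)
    fix \<theta> :: real
    have "((\<lambda>\<theta>. cos \<theta> ^ (l + 1) * sin \<theta>) has_real_derivative
        (real (l + 1) * cos \<theta> ^ l * (- sin \<theta>)) * sin \<theta> + cos \<theta> ^ (l + 1) * cos \<theta>) (at \<theta>)"
      by (rule derivative_eq_intros refl | simp)+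
    also have "(real (l + 1) * cos \<theta> ^ l * (- sin \<theta>)) * sin \<theta> + cos \<theta> ^ (l + 1) * cos \<theta>
       = cos \<theta> ^ (l + 2) - real (l + 1) * cos \<theta> ^ l * (sin \<theta>)\<^sup>2"
      by (simp add: power2_eq_square algebra_simps)
    also have "\<dots> = real (l + 2) * cos \<theta> ^ (l + 2) - real (l + 1) * cos \<theta> ^ l"
      unfolding sin_squared_eq by (simp add: power2_eq_square algebra_simps)
    finally show "((\<lambda>\<theta>. cos \<theta> ^ (l + 1) * sin \<theta>) has_real_derivative real (l + 2) * cos \<theta> ^ (l + 2) - real (l + 1) * cos \<theta> ^ l) (at \<theta>)" .
    show "isCont (\<lambda>\<theta>. real (l + 2) * cos \<theta> ^ (l + 2) - real (l + 1) * cos \<theta> ^ l) \<theta>"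
      by (intro continuous_intros)
  qed simp
  then have "real (l + 2) * (LINT \<theta>:{0..pi}|lborel. cos \<theta> ^ (l + 2)) - real (l + 1) * (LINT \<theta>:{0..pi}|lborel. cos \<theta> ^ l) = 0"
    by (subst (asm) set_integral_diff(2)) (auto intro: i simp del: power_Suc)
  then show ?thesis by (simp add: field_simps)
qed

section \<open>Rotations about the axis (1, 1, 0)\<close>

text \<open>Half a turn suffices: odd powers of the cosine already average to 0, and the sine is
  nonnegative, so that its real powers behave well later.\<close>

definition Theta :: "real measure" where "Theta = uniform_measure lborel {0..pi}"

lemma sets_Theta [simp, measurable_cong]: "sets Theta = sets borel"
  by (simp add: Theta_def)

lemma space_Theta [simp]: "space Theta = UNIV"
  by (simp add: Theta_def)

interpretation Theta: prob_space Theta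
  unfolding Theta_def by (rule prob_space_uniform_measure) auto

lemma nn_integral_Theta:
  "f \<in> borel_measurable borel \<Longrightarrow> (\<integral>\<^sup>+\<theta>. f \<theta> \<partial>Theta) = ennreal (1/pi) * (\<integral>\<^sup>+\<theta>. f \<theta> * indicator {0..pi} \<theta> \<partial>lborel)"
  unfolding Theta_def
  by (subst nn_integral_uniform_measure) (auto simp: divide_ennreal_def inverse_ennreal mult.commute inverse_eq_divide)

lemma integral_Theta:
  fixes f :: "real \<Rightarrow> real"
  assumes [measurable]: "f \<in> borel_measurable borel"
  shows "(LINT \<theta>|Theta. f \<theta>) = (1/pi) * (LINT \<theta>:{0..pi}|lborel. f \<theta>)"
proof -
  have "Theta = density lborel (\<lambda>x. ennreal (indicator {0..pi} x / pi))"
    unfolding Theta_def uniform_measure_def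
    by (intro arg_cong2[where f=density] refl ext) (auto simp: indicator_def divide_ennreal[symmetric])
  then have "(LINT \<theta>|Theta. f \<theta>) = integral\<^sup>L (density lborel (\<lambda>x. ennreal (indicator {0..pi} x / pi))) f"
    by (simp only:)
  also have "\<dots> = (LINT \<theta>|lborel. (indicator {0..pi} \<theta> / pi) *\<^sub>R f \<theta>)"
    by (subst integral_density) auto
  also have "\<dots> = (LINT \<theta>|lborel. (1/pi) * (indicator {0..pi} \<theta> *\<^sub>R f \<theta>))"
    by (intro Bochner_Integration.integral_cong) auto
  finally show ?thesis unfolding set_lebesgue_integral_def by (simp only: integral_mult_right_zero)
qed

text \<open>This is why an angle is introduced: relative to the norms, the values H_l(0)^2 are
  moments of a cosine. Both sides obey the same two-step recursion, because H_{l+2}(0) = -2 (l + 1)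
  H_l(0), and both vanish for odd l.\<close>

lemma cos_power_Theta: "(LINT \<theta>|Theta. cos \<theta> ^ l) * hermite_norm l = sqrt pi * (hermite_poly l 0)\<^sup>2"
proof -
  have eq: "(LINT \<theta>|Theta. cos \<theta> ^ l) = (1/pi) * (LINT \<theta>:{0..pi}|lborel. cos \<theta> ^ l)" for l
    by (intro integral_Theta) measurable
  have "(LINT \<theta>|Theta. cos \<theta> ^ l) * hermite_norm l = sqrt pi * (hermite_poly l 0)\<^sup>2" for l
  proof (induction l rule: induct_nat_012)
    case 0
    then show ?case by (simp add: hermite_norm_def Theta.prob_space[unfolded space_Theta])
  next
    case 1
    have "(LINT \<theta>:{0..pi}|lborel. cos \<theta>) = sin pi - sin 0"
      unfolding set_lebesgue_integral_def real_scaleR_def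
      by (subst mult.commute, rule integral_FTC_Icc_real) (auto intro!: derivative_eq_intros)
    then show ?case using eq[of 1] by simp
  next
    case (ge2 l)
    have "(LINT \<theta>|Theta. cos \<theta> ^ Suc (Suc l)) = real (l + 1) / real (l + 2) * (LINT \<theta>|Theta. cos \<theta> ^ l)"
      unfolding eq using cos_power_integral[of l] by simp
    moreover have "hermite_norm (Suc (Suc l)) = 4 * real (l + 1) * real (l + 2) * hermite_norm l"
      by (simp add: hermite_norm_def algebra_simps)
    ultimately have "(LINT \<theta>|Theta. cos \<theta> ^ Suc (Suc l)) * hermite_norm (Suc (Suc l))
       = (real (l + 1) / real (l + 2) * (LINT \<theta>|Theta. cos \<theta> ^ l)) * (4 * real (l + 1) * real (l + 2) * hermite_norm l)"
      by (simp only:)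
    also have "\<dots> = 4 * (real (l + 1))\<^sup>2 * ((LINT \<theta>|Theta. cos \<theta> ^ l) * hermite_norm l)"
      by (simp add: power2_eq_square)
    also have "\<dots> = sqrt pi * (hermite_poly (Suc (Suc l)) 0)\<^sup>2"
      unfolding ge2.IH(1) by (simp add: power_mult_distrib power2_eq_square algebra_simps)
    finally show ?case .
  qed
  then show ?thesis .
qed

section \<open>Product integrals and linear changes of variables\<close>

lemma (in pair_sigma_finite) integrable_pair_mult:
  fixes f :: "'a \<Rightarrow> real" and g :: "'b \<Rightarrow> real"
  assumes f: "integrable M1 f" and g: "integrable M2 g"
  shows "integrable (M1 \<Otimes>\<^sub>M M2) (\<lambda>(x, y). f x * g y)"
    and "integral\<^sup>L (M1 \<Otimes>\<^sub>M M2) (\<lambda>(x, y). f x * g y) = (LINT x|M1. f x) * (LINT y|M2. g y)"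
proof -
  have [measurable]: "f \<in> borel_measurable M1" "g \<in> borel_measurable M2" using f g by auto
  show *: "integrable (M1 \<Otimes>\<^sub>M M2) (\<lambda>(x, y). f x * g y)"
  proof (rule Fubini_integrable)
    have "integrable M1 (\<lambda>x. norm (f x) * (LINT y|M2. norm (g y)))"
      using f by (intro integrable_mult_left integrable_norm)
    then show "integrable M1 (\<lambda>x. LINT y|M2. norm (case (x, y) of (x, y) \<Rightarrow> f x * g y))"
      by (simp add: abs_mult)
    show "AE x in M1. integrable M2 (\<lambda>y. case (x, y) of (x, y) \<Rightarrow> f x * g y)"
      using g by (intro AE_I2) simp
  qed measurable
  show "integral\<^sup>L (M1 \<Otimes>\<^sub>M M2) (\<lambda>(x, y). f x * g y) = (LINT x|M1. f x) * (LINT y|M2. g y)"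
    using integral_fst[OF *] by simp
qed

text \<open>Two one-dimensional substitutions: the second coordinate at fixed u, then u = a x + b y,
  with Jacobians D/a and a. This uses a as a pivot; if a = 0, then b and c are nonzero with |b c| =
  1 and each variable is substituted directly.\<close>

lemma nn_integral_linear2:
  assumes f [measurable]: "f \<in> borel_measurable (borel \<Otimes>\<^sub>M borel)" and D: "\<bar>a * d - b * c\<bar> = (1::real)"
  shows "(\<integral>\<^sup>+x. \<integral>\<^sup>+y. f (a * x + b * y, c * x + d * y) \<partial>lborel \<partial>lborel) = (\<integral>\<^sup>+x. \<integral>\<^sup>+y. f (x, y) \<partial>lborel \<partial>lborel)"
proof -
  have swap: "(\<integral>\<^sup>+x. \<integral>\<^sup>+y. g x y \<partial>lborel \<partial>lborel) = (\<integral>\<^sup>+y. \<integral>\<^sup>+x. g x y \<partial>lborel \<partial>lborel)"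
    if [measurable]: "case_prod g \<in> borel_measurable (borel \<Otimes>\<^sub>M borel)" for g :: "real \<Rightarrow> real \<Rightarrow> ennreal"
    by (rule lborel_pair.Fubini'[symmetric]) measurable
  show ?thesis
  proof (cases "a = 0")
    case False
    let ?D = "a * d - b * c"
    have Da: "?D / a \<noteq> 0" using D False by auto
    have "(\<integral>\<^sup>+x. \<integral>\<^sup>+y. f (x, y) \<partial>lborel \<partial>lborel) = (\<integral>\<^sup>+u. ennreal \<bar>?D / a\<bar> * (\<integral>\<^sup>+y. f (u, c / a * u + ?D / a * y) \<partial>lborel) \<partial>lborel)"
      by (intro nn_integral_cong nn_integral_real_affine[OF _ Da]) measurable
    also have "\<dots> = (\<integral>\<^sup>+u. \<integral>\<^sup>+y. ennreal \<bar>?D / a\<bar> * f (u, c / a * u + ?D / a * y) \<partial>lborel \<partial>lborel)"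
      by (intro nn_integral_cong nn_integral_cmult[symmetric]) measurable
    also have "\<dots> = (\<integral>\<^sup>+y. \<integral>\<^sup>+u. ennreal \<bar>?D / a\<bar> * f (u, c / a * u + ?D / a * y) \<partial>lborel \<partial>lborel)"
      by (rule swap) measurable
    also have "\<dots> = (\<integral>\<^sup>+y. ennreal \<bar>?D / a\<bar> * (\<integral>\<^sup>+u. f (u, c / a * u + ?D / a * y) \<partial>lborel) \<partial>lborel)"
      by (intro nn_integral_cong nn_integral_cmult) measurable
    also have "\<dots> = (\<integral>\<^sup>+y. ennreal \<bar>?D / a\<bar> * (ennreal \<bar>a\<bar> * (\<integral>\<^sup>+x. f (b * y + a * x, c / a * (b * y + a * x) + ?D / a * y) \<partial>lborel)) \<partial>lborel)"
      by (intro nn_integral_cong arg_cong[where f="\<lambda>z. _ * z"] nn_integral_real_affine[OF _ False]) measurable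
    also have "\<dots> = (\<integral>\<^sup>+y. \<integral>\<^sup>+x. f (a * x + b * y, c * x + d * y) \<partial>lborel \<partial>lborel)"
    proof (intro nn_integral_cong)
      fix y
      have "ennreal \<bar>?D / a\<bar> * ennreal \<bar>a\<bar> = 1"
        using D False by (subst ennreal_mult[symmetric]) (auto simp: abs_divide)
      moreover have "c / a * (b * y + a * x) + ?D / a * y = c * x + d * y" for x
        using False by (simp add: field_simps)
      ultimately show "ennreal \<bar>?D / a\<bar> * (ennreal \<bar>a\<bar> * (\<integral>\<^sup>+x. f (b * y + a * x, c / a * (b * y + a * x) + ?D / a * y) \<partial>lborel))
         = (\<integral>\<^sup>+x. f (a * x + b * y, c * x + d * y) \<partial>lborel)"
        by (simp add: mult.assoc[symmetric] add.commute)
    qed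
    also have "\<dots> = (\<integral>\<^sup>+x. \<integral>\<^sup>+y. f (a * x + b * y, c * x + d * y) \<partial>lborel \<partial>lborel)"
      by (rule swap[symmetric]) measurable
    finally show ?thesis ..
  next
    case True
    then have bc: "b \<noteq> 0" "c \<noteq> 0" "\<bar>b\<bar> * \<bar>c\<bar> = 1" using D by (auto simp: abs_mult)
    have "(\<integral>\<^sup>+x. \<integral>\<^sup>+y. f (x, y) \<partial>lborel \<partial>lborel) = ennreal \<bar>b\<bar> * (\<integral>\<^sup>+y. \<integral>\<^sup>+v. f (0 + b * y, v) \<partial>lborel \<partial>lborel)"
      by (rule nn_integral_real_affine[OF _ bc(1)]) measurable
    also have "\<dots> = ennreal \<bar>b\<bar> * (\<integral>\<^sup>+y. ennreal \<bar>c\<bar> * (\<integral>\<^sup>+x. f (0 + b * y, d * y + c * x) \<partial>lborel) \<partial>lborel)"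
      by (intro arg_cong[where f="\<lambda>z. _ * z"] nn_integral_cong nn_integral_real_affine[OF _ bc(2)]) measurable
    also have "\<dots> = (ennreal \<bar>b\<bar> * ennreal \<bar>c\<bar>) * (\<integral>\<^sup>+y. \<integral>\<^sup>+x. f (0 + b * y, d * y + c * x) \<partial>lborel \<partial>lborel)"
      by (subst nn_integral_cmult) (auto simp: mult.assoc)
    also have "ennreal \<bar>b\<bar> * ennreal \<bar>c\<bar> = 1"
      using bc by (subst ennreal_mult[symmetric]) auto
    also have "(\<integral>\<^sup>+y. \<integral>\<^sup>+x. f (0 + b * y, d * y + c * x) \<partial>lborel \<partial>lborel) = (\<integral>\<^sup>+x. \<integral>\<^sup>+y. f (0 + b * y, d * y + c * x) \<partial>lborel \<partial>lborel)"
      by (rule swap[symmetric]) measurable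
    finally show ?thesis using True by (simp add: add.commute)
  qed
qed

lemma measurable_ra [measurable (raw)]:
  "f \<in> borel_measurable M \<Longrightarrow> g \<in> borel_measurable M \<Longrightarrow> (\<lambda>x. ra (f x) (g x)) \<in> borel_measurable M"
  "f \<in> borel_measurable M \<Longrightarrow> g \<in> borel_measurable M \<Longrightarrow> (\<lambda>x. rb (f x) (g x)) \<in> borel_measurable M"
  unfolding ra_def rb_def by auto

lemma nn_integral_45:
  assumes f [measurable]: "f \<in> borel_measurable (borel \<Otimes>\<^sub>M borel)"
  shows "(\<integral>\<^sup>+x. \<integral>\<^sup>+y. f (ra x y, rb x y) \<partial>lborel \<partial>lborel) = (\<integral>\<^sup>+x. \<integral>\<^sup>+y. f (x, y) \<partial>lborel \<partial>lborel)"
proof -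
  have "ra x y = 1 / sqrt 2 * x + 1 / sqrt 2 * y" "rb x y = 1 / sqrt 2 * x + (- 1 / sqrt 2) * y" for x y
    by (simp_all add: ra_def rb_def add_divide_distrib diff_divide_distrib)
  then show ?thesis
    using nn_integral_linear2[OF f, of "1 / sqrt 2" "- 1 / sqrt 2" "1 / sqrt 2" "1 / sqrt 2"] by simp
qed

text \<open>The invariance as an equality of measures, which also serves signed integrands.\<close>

lemma distr_45: "distr (lborel \<Otimes>\<^sub>M lborel) (lborel \<Otimes>\<^sub>M lborel) (\<lambda>z. (ra (fst z) (snd z), rb (fst z) (snd z))) = lborel \<Otimes>\<^sub>M lborel"
proof (rule measure_eqI)
  fix A assume "A \<in> sets (distr (lborel \<Otimes>\<^sub>M lborel) (lborel \<Otimes>\<^sub>M lborel) (\<lambda>z::real\<times>real. (ra (fst z) (snd z), rb (fst z) (snd z))))"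
  then have A [measurable]: "A \<in> sets (borel \<Otimes>\<^sub>M borel)"
    by (metis sets_distr sets_lborel sets_pair_measure_cong)
  have "emeasure (distr (lborel \<Otimes>\<^sub>M lborel) (lborel \<Otimes>\<^sub>M lborel) (\<lambda>z. (ra (fst z) (snd z), rb (fst z) (snd z)))) A
    = (\<integral>\<^sup>+z. indicator A z \<partial>distr (lborel \<Otimes>\<^sub>M lborel) (lborel \<Otimes>\<^sub>M lborel) (\<lambda>z. (ra (fst z) (snd z), rb (fst z) (snd z))))"
    by simp
  also have "\<dots> = (\<integral>\<^sup>+z. indicator A (ra (fst z) (snd z), rb (fst z) (snd z)) \<partial>(lborel \<Otimes>\<^sub>M lborel))"
    by (rule nn_integral_distr) measurable
  also have "\<dots> = (\<integral>\<^sup>+x. \<integral>\<^sup>+y. indicator A (ra x y, rb x y) \<partial>lborel \<partial>lborel)"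
  proof -
    have "(\<lambda>z. (ra (fst z) (snd z), rb (fst z) (snd z))) \<in> lborel \<Otimes>\<^sub>M lborel \<rightarrow>\<^sub>M borel \<Otimes>\<^sub>M borel"
      by measurable
    from measurable_compose[OF this borel_measurable_indicator[OF A]]
    show ?thesis by (subst lborel.nn_integral_fst[symmetric]) simp_all
  qed
  also have "\<dots> = (\<integral>\<^sup>+x. \<integral>\<^sup>+y. indicator A (x, y) \<partial>lborel \<partial>lborel)"
    by (rule nn_integral_45) measurable
  also have "\<dots> = (\<integral>\<^sup>+z. indicator A z \<partial>(lborel \<Otimes>\<^sub>M lborel))"
    by (rule lborel.nn_integral_fst) measurable
  also have "\<dots> = emeasure (lborel \<Otimes>\<^sub>M lborel) A" by simp
  finally show "emeasure (distr (lborel \<Otimes>\<^sub>M lborel) (lborel \<Otimes>\<^sub>M lborel) (\<lambda>z. (ra (fst z) (snd z), rb (fst z) (snd z)))) A = emeasure (lborel \<Otimes>\<^sub>M lborel) A" .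
qed simp

text \<open>
  For each angle, \<open>(x, y, c) \<mapsto> (rx, ry, rc)\<close> is the rotation of three-space about the axis
  \<open>(1, 1, 0)\<close>.
\<close>

definition rx :: "real \<Rightarrow> real \<Rightarrow> real \<Rightarrow> real \<Rightarrow> real" where
  "rx x \<theta> y c = ra (ra x y) (cos \<theta> * rb x y + sin \<theta> * c)"
definition ry :: "real \<Rightarrow> real \<Rightarrow> real \<Rightarrow> real \<Rightarrow> real" where
  "ry x \<theta> y c = rb (ra x y) (cos \<theta> * rb x y + sin \<theta> * c)"
definition rc :: "real \<Rightarrow> real \<Rightarrow> real \<Rightarrow> real \<Rightarrow> real" where
  "rc x \<theta> y c = - sin \<theta> * rb x y + cos \<theta> * c"

lemma rotation_sq: "(rx x \<theta> y c)\<^sup>2 + (ry x \<theta> y c)\<^sup>2 + (rc x \<theta> y c)\<^sup>2 = x\<^sup>2 + y\<^sup>2 + c\<^sup>2"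
proof -
  have "(cos \<theta> * rb x y + sin \<theta> * c)\<^sup>2 + (rc x \<theta> y c)\<^sup>2 = ((cos \<theta>)\<^sup>2 + (sin \<theta>)\<^sup>2) * ((rb x y)\<^sup>2 + c\<^sup>2)"
    unfolding rc_def by algebra
  then show ?thesis
    using ra_rb_sq[of "ra x y" "cos \<theta> * rb x y + sin \<theta> * c"] ra_rb_sq[of x y]
    by (simp add: rx_def ry_def)
qed

lemma measurable_rxyc [measurable (raw)]:
  assumes [measurable]: "f \<in> borel_measurable M" "g \<in> borel_measurable M" "h \<in> borel_measurable M" "k \<in> borel_measurable M"
  shows "(\<lambda>x. rx (f x) (g x) (h x) (k x)) \<in> borel_measurable M"
  "(\<lambda>x. ry (f x) (g x) (h x) (k x)) \<in> borel_measurable M"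
  "(\<lambda>x. rc (f x) (g x) (h x) (k x)) \<in> borel_measurable M"
  unfolding rx_def ry_def rc_def by measurable

text \<open>The map is the change to \<open>ra\<close>, \<open>rb\<close>, then a rotation of the
  plane of \<open>rb\<close> and c, then the change back. Each stage preserves the iterated
  integral, and undoing all three leaves a product integrand.\<close>

lemma nn_integral_rotation:
  assumes [measurable]: "A \<in> borel_measurable borel" "B \<in> borel_measurable borel" "C \<in> borel_measurable borel"
  shows "(\<integral>\<^sup>+x. \<integral>\<^sup>+y. \<integral>\<^sup>+c. A (rx x \<theta> y c) * B (ry x \<theta> y c) * C (rc x \<theta> y c) \<partial>lborel \<partial>lborel \<partial>lborel)
    = (\<integral>\<^sup>+x. A x \<partial>lborel) * (\<integral>\<^sup>+x. B x \<partial>lborel) * (\<integral>\<^sup>+x. C x \<partial>lborel)"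
proof -
  define G where "G a b c = A (ra a b) * B (rb a b) * C c" for a b c
  have G [measurable]: "(\<lambda>z. G (f z) (g z) (h z)) \<in> borel_measurable M"
    if [measurable]: "f \<in> borel_measurable M" "g \<in> borel_measurable M" "h \<in> borel_measurable M" for f g h and M :: "'m measure"
    unfolding G_def by measurable
  have "(\<integral>\<^sup>+x. \<integral>\<^sup>+y. \<integral>\<^sup>+c. A (rx x \<theta> y c) * B (ry x \<theta> y c) * C (rc x \<theta> y c) \<partial>lborel \<partial>lborel \<partial>lborel)
    = (\<integral>\<^sup>+x. \<integral>\<^sup>+y. (\<lambda>(a, b). \<integral>\<^sup>+c. G a (cos \<theta> * b + sin \<theta> * c) (- sin \<theta> * b + cos \<theta> * c) \<partial>lborel) (ra x y, rb x y) \<partial>lborel \<partial>lborel)"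
    by (simp add: G_def rx_def ry_def rc_def)
  also have "\<dots> = (\<integral>\<^sup>+a. \<integral>\<^sup>+b. (\<lambda>(a, b). \<integral>\<^sup>+c. G a (cos \<theta> * b + sin \<theta> * c) (- sin \<theta> * b + cos \<theta> * c) \<partial>lborel) (a, b) \<partial>lborel \<partial>lborel)"
    by (rule nn_integral_45) measurable
  also have "\<dots> = (\<integral>\<^sup>+a. \<integral>\<^sup>+b. \<integral>\<^sup>+c. (\<lambda>(b, c). G a b c) (cos \<theta> * b + sin \<theta> * c, - sin \<theta> * b + cos \<theta> * c) \<partial>lborel \<partial>lborel \<partial>lborel)"
    by simp
  also have "\<dots> = (\<integral>\<^sup>+a. \<integral>\<^sup>+b. \<integral>\<^sup>+c. (\<lambda>(b, c). G a b c) (b, c) \<partial>lborel \<partial>lborel \<partial>lborel)"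
  proof (rule nn_integral_cong, rule nn_integral_linear2)
    show "\<bar>cos \<theta> * cos \<theta> - sin \<theta> * - sin \<theta>\<bar> = 1"
      using sin_cos_squared_add[of \<theta>] by (simp add: power2_eq_square add.commute)
  qed measurable
  also have "\<dots> = (\<integral>\<^sup>+a. \<integral>\<^sup>+b. (\<lambda>(a, b). A a * B b * (\<integral>\<^sup>+c. C c \<partial>lborel)) (ra a b, rb a b) \<partial>lborel \<partial>lborel)"
    by (simp add: G_def nn_integral_cmult)
  also have "\<dots> = (\<integral>\<^sup>+a. \<integral>\<^sup>+b. (\<lambda>(a, b). A a * B b * (\<integral>\<^sup>+c. C c \<partial>lborel)) (a, b) \<partial>lborel \<partial>lborel)"
    by (rule nn_integral_45) measurable
  also have "\<dots> = (\<integral>\<^sup>+x. A x \<partial>lborel) * (\<integral>\<^sup>+x. B x \<partial>lborel) * (\<integral>\<^sup>+x. C x \<partial>lborel)"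
    by (simp add: nn_integral_cmult nn_integral_multc)
  finally show ?thesis .
qed

text \<open>The variables are ordered (x, theta, y, c): \<open>nu\<close> integrates all but x, so
  that freezing the first variable of \<open>mu\<close> leaves the integral that defines an
  operator.\<close>

definition nu :: "(real \<times> real \<times> real) measure" where
  "nu = Theta \<Otimes>\<^sub>M (lborel \<Otimes>\<^sub>M lborel)"

definition mu :: "(real \<times> real \<times> real \<times> real) measure" where
  "mu = lborel \<Otimes>\<^sub>M nu"

lemma sets_nu [measurable_cong]: "sets nu = sets (borel \<Otimes>\<^sub>M (borel \<Otimes>\<^sub>M borel))"
  unfolding nu_def by (intro sets_pair_measure_cong) auto

lemma sets_mu [measurable_cong]: "sets mu = sets (borel \<Otimes>\<^sub>M (borel \<Otimes>\<^sub>M (borel \<Otimes>\<^sub>M borel)))"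
  unfolding mu_def by (intro sets_pair_measure_cong sets_nu) auto

lemma sigma_finite_lborel2: "sigma_finite_measure (lborel \<Otimes>\<^sub>M lborel :: (real \<times> real) measure)"
  by unfold_locales

interpretation nu_pair: pair_sigma_finite Theta "lborel \<Otimes>\<^sub>M lborel :: (real \<times> real) measure"
  by unfold_locales

interpretation nu: sigma_finite_measure nu
  unfolding nu_def by unfold_locales

interpretation mu_pair: pair_sigma_finite lborel nu ..

interpretation lT: pair_sigma_finite lborel Theta ..

lemma nn_integral_nu:
  assumes [measurable]: "f \<in> borel_measurable (borel \<Otimes>\<^sub>M (borel \<Otimes>\<^sub>M borel))"
  shows "(\<integral>\<^sup>+z. f z \<partial>nu) = (\<integral>\<^sup>+\<theta>. \<integral>\<^sup>+y. \<integral>\<^sup>+c. f (\<theta>, y, c) \<partial>lborel \<partial>lborel \<partial>Theta)"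
proof -
  have "(\<integral>\<^sup>+z. f z \<partial>nu) = (\<integral>\<^sup>+\<theta>. \<integral>\<^sup>+w. f (\<theta>, w) \<partial>(lborel \<Otimes>\<^sub>M lborel) \<partial>Theta)"
    unfolding nu_def by (rule sigma_finite_measure.nn_integral_fst[OF sigma_finite_lborel2, symmetric]) measurable
  also have "\<dots> = (\<integral>\<^sup>+\<theta>. \<integral>\<^sup>+y. \<integral>\<^sup>+c. f (\<theta>, y, c) \<partial>lborel \<partial>lborel \<partial>Theta)"
    by (intro nn_integral_cong lborel.nn_integral_fst[symmetric]) measurable
  finally show ?thesis .
qed

lemma nn_integral_mu_fst:
  assumes "f \<in> borel_measurable mu"
  shows "(\<integral>\<^sup>+z. f z \<partial>mu) = (\<integral>\<^sup>+x. \<integral>\<^sup>+w. f (x, w) \<partial>nu \<partial>lborel)"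
  using assms unfolding mu_def by (rule nu.nn_integral_fst[symmetric])

text \<open>Moves the angle outermost, so that the rotation invariance at each fixed angle can be
  applied inside.\<close>

lemma nn_integral_mu:
  assumes [measurable]: "f \<in> borel_measurable (borel \<Otimes>\<^sub>M (borel \<Otimes>\<^sub>M (borel \<Otimes>\<^sub>M borel)))"
  shows "(\<integral>\<^sup>+z. f z \<partial>mu) = (\<integral>\<^sup>+\<theta>. \<integral>\<^sup>+x. \<integral>\<^sup>+y. \<integral>\<^sup>+c. f (x, \<theta>, y, c) \<partial>lborel \<partial>lborel \<partial>lborel \<partial>Theta)"
proof -
  have "(\<integral>\<^sup>+z. f z \<partial>mu) = (\<integral>\<^sup>+x. \<integral>\<^sup>+w. f (x, w) \<partial>nu \<partial>lborel)"
    by (rule nn_integral_mu_fst) measurable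
  also have "\<dots> = (\<integral>\<^sup>+x. \<integral>\<^sup>+\<theta>. \<integral>\<^sup>+y. \<integral>\<^sup>+c. f (x, \<theta>, y, c) \<partial>lborel \<partial>lborel \<partial>Theta \<partial>lborel)"
    by (intro nn_integral_cong nn_integral_nu) measurable
  also have "\<dots> = (\<integral>\<^sup>+\<theta>. \<integral>\<^sup>+x. \<integral>\<^sup>+y. \<integral>\<^sup>+c. f (x, \<theta>, y, c) \<partial>lborel \<partial>lborel \<partial>lborel \<partial>Theta)"
    by (rule lT.Fubini'[symmetric]) measurable
  finally show ?thesis .
qed

lemma nn_integral_mu_rotated:
  assumes [measurable]: "A \<in> borel_measurable borel" "B \<in> borel_measurable borel" "C \<in> borel_measurable borel"
  shows "(\<integral>\<^sup>+(x, \<theta>, y, c). A (rx x \<theta> y c) * B (ry x \<theta> y c) * C (rc x \<theta> y c) \<partial>mu)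
    = (\<integral>\<^sup>+x. A x \<partial>lborel) * (\<integral>\<^sup>+x. B x \<partial>lborel) * (\<integral>\<^sup>+x. C x \<partial>lborel)"
  by (subst nn_integral_mu) (simp_all add: nn_integral_rotation Theta.emeasure_space_1[unfolded space_Theta])

text \<open>The Mehler eigenvalue C^l of Gaussian averaging. By orthogonality to H_0, only the term
  of the addition formula that is constant in c survives.\<close>

lemma integral_hermite_addition:
  assumes CS: "C\<^sup>2 + S\<^sup>2 = (1::real)"
  shows "(LINT c|lborel. hermite_poly l (C * b + S * c) * exp (- (c\<^sup>2))) = sqrt pi * C ^ l * hermite_poly l b"
proof -
  obtain \<beta> where \<beta>: "\<beta> l = C ^ l" "\<And>x y. hermite_poly l (C * x + S * y) = (\<Sum>j\<le>l. \<beta> j * (hermite_poly j x * hermite_poly (l - j) y))"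
    using hermite_addition[OF CS] by blast
  have "(LINT c|lborel. hermite_poly l (C * b + S * c) * exp (- (c\<^sup>2)))
      = (LINT c|lborel. (\<Sum>j\<le>l. (\<beta> j * hermite_poly j b) * (hermite_poly (l - j) c * hermite_poly 0 c * exp (- (c\<^sup>2)))))"
    unfolding \<beta>(2) sum_distrib_right by (intro Bochner_Integration.integral_cong sum.cong refl) simp
  also have "\<dots> = (\<Sum>j\<le>l. (\<beta> j * hermite_poly j b) * (if l - j = 0 then hermite_norm (l - j) else 0))"
    by (subst Bochner_Integration.integral_sum)
      (simp_all only: integral_mult_right_zero integral_hermite_product integrable_mult_right integrable_hermite_product)
  also have "\<dots> = (\<Sum>j\<le>l. if j = l then \<beta> l * hermite_poly l b * sqrt pi else 0)"
    by (intro sum.cong refl) (auto simp: hermite_norm_def)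
  finally show ?thesis using \<beta>(1) by (simp add: mult_ac)
qed

section \<open>The rotation form on Hermite functions\<close>

abbreviation gauss :: "real \<Rightarrow> real" where "gauss x \<equiv> exp (- (1/4) * x\<^sup>2)"

lemma integrable_gauss: "integrable lborel gauss"
  by (rule gaussian_has_integral) simp

lemma integrable_gauss2: "integrable (lborel \<Otimes>\<^sub>M lborel) (\<lambda>(y, c). gauss y * gauss c)"
  by (rule lborel_pair.integrable_pair_mult[OF integrable_gauss integrable_gauss])

lemma integrable_gauss_nu: "integrable nu (\<lambda>(\<theta>, y, c). gauss y * gauss c)"
  using nu_pair.integrable_pair_mult(1)[of "\<lambda>_. 1", OF _ integrable_gauss2]
  unfolding nu_def by (simp add: case_prod_unfold)

lemma integrable_gauss_mu: "integrable mu (\<lambda>(x, \<theta>, y, c). gauss x * (gauss y * gauss c))"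
  using mu_pair.integrable_pair_mult(1)[OF integrable_gauss integrable_gauss_nu]
  unfolding mu_def by (simp add: case_prod_unfold)

text \<open>Fubini for signed integrands, bringing the angle outermost and c innermost. The product
  Gaussian dominates every partial integral and so supplies integrability at each exchange.\<close>

lemma integral_mu_gauss_bounded:
  fixes P :: "real \<Rightarrow> real \<Rightarrow> real \<Rightarrow> real \<Rightarrow> real"
  assumes m [measurable]: "(\<lambda>(x, \<theta>, y, c). P x \<theta> y c) \<in> borel_measurable (borel \<Otimes>\<^sub>M (borel \<Otimes>\<^sub>M (borel \<Otimes>\<^sub>M borel)))"
    and bnd: "\<And>x \<theta> y c. \<bar>P x \<theta> y c\<bar> \<le> D * (gauss x * (gauss y * gauss c))"
  shows "integrable mu (\<lambda>(x, \<theta>, y, c). P x \<theta> y c)"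
    and "(LINT (x, \<theta>, y, c)|mu. P x \<theta> y c)
      = (LINT \<theta>|Theta. LINT z|(lborel \<Otimes>\<^sub>M lborel). LINT c|lborel. P (fst z) \<theta> (snd z) c)"
proof -
  have Pm [measurable (raw)]: "(\<lambda>w. P (f w) (g w) (h w) (k w)) \<in> borel_measurable L"
    if [measurable]: "f \<in> borel_measurable L" "g \<in> borel_measurable L" "h \<in> borel_measurable L" "k \<in> borel_measurable L"
    for f g h k and L :: "'l measure"
  proof -
    have "(\<lambda>w. (f w, g w, h w, k w)) \<in> L \<rightarrow>\<^sub>M borel \<Otimes>\<^sub>M (borel \<Otimes>\<^sub>M (borel \<Otimes>\<^sub>M borel))" by measurable
    from measurable_compose[OF this m] show ?thesis by simp
  qed
  have i4: "integrable mu (\<lambda>(x, \<theta>, y, c). P x \<theta> y c)"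
    by (rule Bochner_Integration.integrable_bound[OF integrable_mult_right[OF integrable_gauss_mu, of D]])
      (use bnd in \<open>auto simp del: mult_minus_left intro!: AE_I2 order_trans[OF bnd]\<close>)
  then show "integrable mu (\<lambda>(x, \<theta>, y, c). P x \<theta> y c)" .
  have i3: "integrable nu (\<lambda>(\<theta>, y, c). P x \<theta> y c)" for x
    by (rule Bochner_Integration.integrable_bound[OF integrable_mult_right[OF integrable_gauss_nu, of "D * gauss x"]])
      (auto simp del: mult_minus_left simp: mult.assoc intro!: AE_I2 order_trans[OF bnd])
  have i2: "integrable (lborel \<Otimes>\<^sub>M lborel) (\<lambda>(y, c). P x \<theta> y c)" for x \<theta>
    by (rule Bochner_Integration.integrable_bound[OF integrable_mult_right[OF integrable_gauss2, of "D * gauss x"]])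
      (auto simp del: mult_minus_left simp: mult.assoc intro!: AE_I2 order_trans[OF bnd])
  have i1: "integrable lborel (\<lambda>c. P x \<theta> y c)" for x \<theta> y
    by (rule Bochner_Integration.integrable_bound[OF integrable_mult_right[OF integrable_gauss, of "D * gauss x * gauss y"]])
      (auto simp del: mult_minus_left simp: mult.assoc intro!: AE_I2 order_trans[OF bnd])
  \<comment> \<open>The partial integral \<open>W\<close> serves the exchange of x with the angle,
    and \<open>V\<close> the regrouping of x and y into a pair.\<close>
  define W where "W x \<theta> = (LINT y|lborel. LINT c|lborel. P x \<theta> y c)" for x \<theta>
  define V where "V \<theta> x y = (LINT c|lborel. P x \<theta> y c)" for \<theta> x y
  let ?I = "LINT c|lborel. gauss c"
  have [measurable]: "(\<lambda>(x, \<theta>). W x \<theta>) \<in> borel_measurable (borel \<Otimes>\<^sub>M borel)"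
    unfolding W_def by measurable
  have [measurable]: "(\<lambda>(x, y). V \<theta> x y) \<in> borel_measurable (borel \<Otimes>\<^sub>M borel)" for \<theta>
    unfolding V_def by measurable
  have Vb: "\<bar>V \<theta> x y\<bar> \<le> (D * ?I) * (gauss x * gauss y)" for \<theta> x y
  proof -
    have "\<bar>V \<theta> x y\<bar> \<le> (LINT c|lborel. \<bar>P x \<theta> y c\<bar>)"
      unfolding V_def by (rule integral_abs_bound)
    also have "\<dots> \<le> (LINT c|lborel. (D * gauss x * gauss y) * gauss c)"
      using i1 integrable_gauss bnd by (intro integral_mono integrable_mult_right) (auto simp: mult.assoc simp del: mult_minus_left)
    also have "\<dots> = (D * gauss x * gauss y) * ?I" by (rule integral_mult_right_zero)
    finally show ?thesis by (simp add: mult_ac)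
  qed
  have Vi: "integrable lborel (\<lambda>y. V \<theta> x y)" for \<theta> x
    by (rule Bochner_Integration.integrable_bound[OF integrable_mult_right[OF integrable_gauss, of "D * ?I * gauss x"]])
      (auto simp del: mult_minus_left simp: mult.assoc intro!: AE_I2 order_trans[OF Vb])
  have WV: "W x \<theta> = (LINT y|lborel. V \<theta> x y)" for x \<theta> by (simp add: W_def V_def)
  have Wb: "\<bar>W x \<theta>\<bar> \<le> (D * ?I * ?I) * (gauss x * 1)" for x \<theta>
  proof -
    have "\<bar>W x \<theta>\<bar> \<le> (LINT y|lborel. \<bar>V \<theta> x y\<bar>)"
      unfolding WV by (rule integral_abs_bound)
    also have "\<dots> \<le> (LINT y|lborel. (D * ?I * gauss x) * gauss y)"
      using Vi integrable_gauss Vb by (intro integral_mono integrable_mult_right) (auto simp: mult.assoc simp del: mult_minus_left)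
    also have "\<dots> = (D * ?I * gauss x) * ?I" by (rule integral_mult_right_zero)
    finally show ?thesis by (simp add: mult_ac)
  qed
  have Wi: "integrable (lborel \<Otimes>\<^sub>M Theta) (\<lambda>(x, \<theta>). W x \<theta>)"
    by (rule Bochner_Integration.integrable_bound[OF integrable_mult_right[OF lT.integrable_pair_mult(1)[OF integrable_gauss, of "\<lambda>_. 1"], of "D * ?I * ?I"]])
      (auto simp del: mult_minus_left simp: mult.assoc intro!: AE_I2 order_trans[OF Wb])
  have Vi2: "integrable (lborel \<Otimes>\<^sub>M lborel) (\<lambda>(x, y). V \<theta> x y)" for \<theta>
    by (rule Bochner_Integration.integrable_bound[OF integrable_mult_right[OF integrable_gauss2, of "D * ?I"]])
      (auto simp del: mult_minus_left simp: mult.assoc intro!: AE_I2 order_trans[OF Vb])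
  have "(LINT (x, \<theta>, y, c)|mu. P x \<theta> y c) = (LINT x|lborel. LINT (\<theta>, y, c)|nu. P x \<theta> y c)"
    using mu_pair.integral_fst'[OF i4[unfolded mu_def]] unfolding mu_def by (simp add: case_prod_unfold)
  also have "\<dots> = (LINT x|lborel. LINT \<theta>|Theta. LINT (y, c)|(lborel \<Otimes>\<^sub>M lborel). P x \<theta> y c)"
    using nu_pair.integral_fst'[OF i3[unfolded nu_def]] unfolding nu_def by (simp add: case_prod_unfold)
  also have "\<dots> = (LINT x|lborel. LINT \<theta>|Theta. W x \<theta>)"
    using lborel_pair.integral_fst'[OF i2] unfolding W_def by (simp add: case_prod_unfold)
  also have "\<dots> = (LINT \<theta>|Theta. LINT x|lborel. W x \<theta>)"
    by (rule lT.Fubini_integral[OF Wi, symmetric])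
  also have "\<dots> = (LINT \<theta>|Theta. LINT x|lborel. LINT y|lborel. V \<theta> x y)" unfolding WV ..
  also have "\<dots> = (LINT \<theta>|Theta. LINT z|(lborel \<Otimes>\<^sub>M lborel). V \<theta> (fst z) (snd z))"
    using lborel_pair.integral_fst'[OF Vi2] by (simp add: case_prod_unfold)
  finally show "(LINT (x, \<theta>, y, c)|mu. P x \<theta> y c)
      = (LINT \<theta>|Theta. LINT z|(lborel \<Otimes>\<^sub>M lborel). LINT c|lborel. P (fst z) \<theta> (snd z) c)"
    by (simp add: V_def)
qed

definition rot_hermite :: "nat \<Rightarrow> nat \<Rightarrow> nat \<Rightarrow> nat \<Rightarrow> real \<Rightarrow> real \<Rightarrow> real \<Rightarrow> real \<Rightarrow> real" where
  "rot_hermite m1 m2 m3 m4 x \<theta> y c = hermite_fun m1 (rx x \<theta> y c) * hermite_fun m2 (ry x \<theta> y c) * hermite_fun 0 (rc x \<theta> y c)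
     * (hermite_fun m3 y * hermite_fun m4 x * hermite_fun 0 c)"

lemma measurable_rot_hermite [measurable]:
  "(\<lambda>(x, \<theta>, y, c). rot_hermite m1 m2 m3 m4 x \<theta> y c) \<in> borel_measurable (borel \<Otimes>\<^sub>M (borel \<Otimes>\<^sub>M (borel \<Otimes>\<^sub>M borel)))"
  unfolding rot_hermite_def by measurable

text \<open>The three unrotated factors supply all the decay; the rotated ones are bounded by
  constants.\<close>

lemma rot_hermite_bound: "\<exists>D. \<forall>x \<theta> y c. \<bar>rot_hermite m1 m2 m3 m4 x \<theta> y c\<bar> \<le> D * (gauss x * (gauss y * gauss c))"
proof -
  have b: "\<exists>C\<ge>0. \<forall>x. \<bar>hermite_fun n x\<bar> \<le> C * gauss x" for n
    using hermite_fun_bound[of n] by simp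
  then obtain C where C: "\<And>n. C n \<ge> 0" "\<And>n x. \<bar>hermite_fun n x\<bar> \<le> C n * gauss x" by metis
  have C1: "\<bar>hermite_fun n x\<bar> \<le> C n" for n x
    using C(2)[of n x] mult_left_mono[of "gauss x" 1 "C n"] C(1)[of n] by simp
  have "\<bar>rot_hermite m1 m2 m3 m4 x \<theta> y c\<bar> \<le> (C m1 * C m2 * C 0) * ((C m3 * gauss y) * (C m4 * gauss x) * (C 0 * gauss c))" for x \<theta> y c
    unfolding rot_hermite_def abs_mult using C C1 by (intro mult_mono mult_nonneg_nonneg) auto
  then show ?thesis
    by (intro exI[of _ "C m1 * C m2 * C 0 * C m3 * C m4 * C 0"]) (simp add: mult_ac)
qed

text \<open>Since the rotation preserves the sum of squares, the six Gaussian factors combine to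
  exp(-(x^2 + y^2 + c^2)), and the rotation is felt by the polynomials only.\<close>

lemma rot_hermite_eq:
  "rot_hermite m1 m2 m3 m4 x \<theta> y c =
     (hermite_poly m1 (rx x \<theta> y c) * hermite_poly m2 (ry x \<theta> y c) * (hermite_poly m4 x * hermite_poly m3 y) * exp (- ((ra x y)\<^sup>2 + (rb x y)\<^sup>2)) * exp (- (c\<^sup>2)))
     / (sqrt pi * sqrt (hermite_norm m1 * hermite_norm m2 * hermite_norm m3 * hermite_norm m4))"
proof -
  have "exp (- ((rx x \<theta> y c)\<^sup>2) / 2) * exp (- ((ry x \<theta> y c)\<^sup>2) / 2) * exp (- ((rc x \<theta> y c)\<^sup>2) / 2) * (exp (- (y\<^sup>2) / 2) * exp (- (x\<^sup>2) / 2) * exp (- (c\<^sup>2) / 2))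
    = exp (- (((rx x \<theta> y c)\<^sup>2 + (ry x \<theta> y c)\<^sup>2 + (rc x \<theta> y c)\<^sup>2) + (x\<^sup>2 + y\<^sup>2 + c\<^sup>2)) / 2)"
    by (simp add: exp_add[symmetric] field_simps)
  also have "\<dots> = exp (- ((ra x y)\<^sup>2 + (rb x y)\<^sup>2)) * exp (- (c\<^sup>2))"
    unfolding rotation_sq ra_rb_sq by (simp add: exp_add[symmetric] field_simps)
  finally have e: "exp (- ((rx x \<theta> y c)\<^sup>2) / 2) * exp (- ((ry x \<theta> y c)\<^sup>2) / 2) * exp (- ((rc x \<theta> y c)\<^sup>2) / 2) * (exp (- (y\<^sup>2) / 2) * exp (- (x\<^sup>2) / 2) * exp (- (c\<^sup>2) / 2))
     = exp (- ((ra x y)\<^sup>2 + (rb x y)\<^sup>2)) * exp (- (c\<^sup>2))" .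
  have n: "sqrt (hermite_norm 0) * sqrt (hermite_norm 0) = sqrt pi"
    by (simp add: hermite_norm_def)
  have "rot_hermite m1 m2 m3 m4 x \<theta> y c =
     (hermite_poly m1 (rx x \<theta> y c) * hermite_poly m2 (ry x \<theta> y c) * (hermite_poly m4 x * hermite_poly m3 y) *
      (exp (- ((rx x \<theta> y c)\<^sup>2) / 2) * exp (- ((ry x \<theta> y c)\<^sup>2) / 2) * exp (- ((rc x \<theta> y c)\<^sup>2) / 2) * (exp (- (y\<^sup>2) / 2) * exp (- (x\<^sup>2) / 2) * exp (- (c\<^sup>2) / 2))))
     / ((sqrt (hermite_norm 0) * sqrt (hermite_norm 0)) * sqrt (hermite_norm m1 * hermite_norm m2 * hermite_norm m3 * hermite_norm m4))"
    unfolding rot_hermite_def hermite_fun_eq real_sqrt_mult by (simp add: mult_ac)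
  then show ?thesis unfolding e n by (simp add: mult_ac)
qed

lemma integral_pair_45:
  fixes f :: "real \<Rightarrow> real \<Rightarrow> real"
  assumes "(\<lambda>(a, b). f a b) \<in> borel_measurable (borel \<Otimes>\<^sub>M borel)"
  shows "(LINT z|(lborel \<Otimes>\<^sub>M lborel). f (ra (fst z) (snd z)) (rb (fst z) (snd z))) = (LINT (a, b)|(lborel \<Otimes>\<^sub>M lborel). f a b)"
proof -
  have "(LINT (a, b)|(lborel \<Otimes>\<^sub>M lborel). f a b)
    = (LINT (a, b)|distr (lborel \<Otimes>\<^sub>M lborel) (lborel \<Otimes>\<^sub>M lborel) (\<lambda>z. (ra (fst z) (snd z), rb (fst z) (snd z))). f a b)"
    unfolding distr_45 ..
  also have "\<dots> = (LINT z|(lborel \<Otimes>\<^sub>M lborel). f (ra (fst z) (snd z)) (rb (fst z) (snd z)))"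
    using assms by (subst integral_distr) simp_all
  finally show ?thesis ..
qed

text \<open>
  In the coordinates \<^term>\<open>ra\<close>, \<^term>\<open>rb\<close> only the second variable is rotated. Integrating out \<open>c\<close>
  turns a rotated \<open>H\<^sub>l\<close> into \<open>cos \<theta> ^ l * H\<^sub>l\<close>, and the average of \<open>cos \<theta> ^ l\<close> over the angle is
  proportional to \<open>H\<^sub>l(0)\<^sup>2\<close> over the norm of \<open>H\<^sub>l\<close>; this is the expansion of the product of four
  Hermite functions restricted to the diagonal \<open>rb = 0\<close>.
\<close>

lemma hermite_form_identity:
  "sqrt (8 / pi) * (LINT (x, \<theta>, y, c)|mu. rot_hermite m1 m2 m3 m4 x \<theta> y c)
    = (if m1 + m2 = m3 + m4 then 4 * (LINT x|lborel. hermite_fun m1 x * hermite_fun m2 x * hermite_fun m3 x * hermite_fun m4 x) else 0)"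
proof -
  let ?H = hermite_poly
  define N where "N = m1 + m2"
  define M where "M = m4 + m3"
  define S where "S = sqrt (hermite_norm m1 * hermite_norm m2 * hermite_norm m3 * hermite_norm m4)"
  have S: "S > 0" by (simp add: S_def)
  obtain \<alpha> where \<alpha>: "\<And>x y. ?H m1 x * ?H m2 y = (\<Sum>k\<le>N. \<alpha> k * (?H k (ra x y) * ?H (N - k) (rb x y)))"
    using hermite_product_45[of m1 m2] unfolding N_def by blast
  obtain \<beta> where \<beta>: "\<And>x y. ?H m4 x * ?H m3 y = (\<Sum>k\<le>M. \<beta> k * (?H k (ra x y) * ?H (M - k) (rb x y)))"
    using hermite_product_45[of m4 m3] unfolding M_def by blast
  let ?E = "\<lambda>n m x. ?H n x * ?H m x * exp (- (x\<^sup>2))"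
  have Ei: "integrable lborel (?E n m)" for n m by (rule integrable_hermite_product)
  have cint: "(LINT c|lborel. rot_hermite m1 m2 m3 m4 x \<theta> y c)
      = (\<Sum>k\<le>N. \<Sum>k'\<le>M. (\<alpha> k * \<beta> k' * cos \<theta> ^ (N - k) / S) * (?E k k' (ra x y) * ?E (N - k) (M - k') (rb x y)))" for x \<theta> y
  proof -
    let ?a = "ra x y" and ?b = "rb x y"
    have "rot_hermite m1 m2 m3 m4 x \<theta> y c
      = (\<Sum>k\<le>N. (\<alpha> k * ?H k ?a * (?H m4 x * ?H m3 y) * exp (- (?a\<^sup>2 + ?b\<^sup>2)) / (sqrt pi * S)) * (?H (N - k) (cos \<theta> * ?b + sin \<theta> * c) * exp (- (c\<^sup>2))))" for c
      unfolding rot_hermite_eq \<alpha> rx_def ry_def ra_rb_involution sum_distrib_right sum_divide_distrib S_def[symmetric]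
      by (intro sum.cong refl) (simp add: mult_ac)
    then have "(LINT c|lborel. rot_hermite m1 m2 m3 m4 x \<theta> y c)
      = (LINT c|lborel. (\<Sum>k\<le>N. (\<alpha> k * ?H k ?a * (?H m4 x * ?H m3 y) * exp (- (?a\<^sup>2 + ?b\<^sup>2)) / (sqrt pi * S)) * (?H (N - k) (cos \<theta> * ?b + sin \<theta> * c) * exp (- (c\<^sup>2)))))"
      by presburger
    also have "\<dots> = (\<Sum>k\<le>N. (\<alpha> k * ?H k ?a * (?H m4 x * ?H m3 y) * exp (- (?a\<^sup>2 + ?b\<^sup>2)) / (sqrt pi * S)) * (sqrt pi * cos \<theta> ^ (N - k) * ?H (N - k) ?b))"
    proof (subst Bochner_Integration.integral_sum, goal_cases)
      case (1 k)
      obtain \<gamma> where \<gamma>: "\<And>x y. ?H (N - k) (cos \<theta> * x + sin \<theta> * y) = (\<Sum>j\<le>N - k. \<gamma> j * (?H j x * ?H (N - k - j) y))"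
        using hermite_addition[of "cos \<theta>" "sin \<theta>" "N - k"] by auto
      have "integrable lborel (\<lambda>c. \<Sum>j\<le>N - k. (\<gamma> j * ?H j ?b) * ?E (N - k - j) 0 c)"
        by (intro Bochner_Integration.integrable_sum integrable_mult_right Ei)
      then have "integrable lborel (\<lambda>c. ?H (N - k) (cos \<theta> * ?b + sin \<theta> * c) * exp (- (c\<^sup>2)))"
        unfolding \<gamma> sum_distrib_right by (simp add: mult_ac)
      then show ?case by (rule integrable_mult_right)
    next
      case 2
      show ?case by (intro sum.cong refl) (simp only: integral_mult_right_zero integral_hermite_addition[OF sin_cos_squared_add2])
    qed
    also have "\<dots> = (\<Sum>k\<le>N. \<Sum>k'\<le>M. (\<alpha> k * \<beta> k' * cos \<theta> ^ (N - k) / S) * (?E k k' ?a * ?E (N - k) (M - k') ?b))"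
    proof (rule sum.cong[OF refl])
      fix k
      have ee: "exp (- (?a\<^sup>2 + ?b\<^sup>2)) = exp (- (?a\<^sup>2)) * exp (- (?b\<^sup>2))"
        by (simp add: exp_add[symmetric])
      have "(\<alpha> k * ?H k ?a * (?H m4 x * ?H m3 y) * exp (- (?a\<^sup>2 + ?b\<^sup>2)) / (sqrt pi * S)) * (sqrt pi * cos \<theta> ^ (N - k) * ?H (N - k) ?b)
        = (?H m4 x * ?H m3 y) * (\<alpha> k * ?H k ?a * cos \<theta> ^ (N - k) * ?H (N - k) ?b * (exp (- (?a\<^sup>2)) * exp (- (?b\<^sup>2))) / S)"
        unfolding ee by simp
      also have "\<dots> = (\<Sum>k'\<le>M. (\<alpha> k * \<beta> k' * cos \<theta> ^ (N - k) / S) * (?E k k' ?a * ?E (N - k) (M - k') ?b))"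
        unfolding \<beta> sum_distrib_right by (intro sum.cong refl) (simp add: mult_ac)
      finally show "(\<alpha> k * ?H k ?a * (?H m4 x * ?H m3 y) * exp (- (?a\<^sup>2 + ?b\<^sup>2)) / (sqrt pi * S)) * (sqrt pi * cos \<theta> ^ (N - k) * ?H (N - k) ?b)
        = (\<Sum>k'\<le>M. (\<alpha> k * \<beta> k' * cos \<theta> ^ (N - k) / S) * (?E k k' ?a * ?E (N - k) (M - k') ?b))" .
    qed
    finally show ?thesis .
  qed
  let ?d = "\<lambda>n m. if n = m then hermite_norm n else 0"
  have xyint: "(LINT z|(lborel \<Otimes>\<^sub>M lborel). LINT c|lborel. rot_hermite m1 m2 m3 m4 (fst z) \<theta> (snd z) c)
      = (\<Sum>k\<le>N. \<Sum>k'\<le>M. (\<alpha> k * \<beta> k' * cos \<theta> ^ (N - k) / S) * (?d k k' * ?d (N - k) (M - k')))" for \<theta>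
  proof -
    have "(LINT z|(lborel \<Otimes>\<^sub>M lborel). LINT c|lborel. rot_hermite m1 m2 m3 m4 (fst z) \<theta> (snd z) c)
      = (LINT (a, b)|(lborel \<Otimes>\<^sub>M lborel). (\<Sum>k\<le>N. \<Sum>k'\<le>M. (\<alpha> k * \<beta> k' * cos \<theta> ^ (N - k) / S) * (?E k k' a * ?E (N - k) (M - k') b)))"
      unfolding cint by (rule integral_pair_45) measurable
    also have "\<dots> = (LINT z|(lborel \<Otimes>\<^sub>M lborel). (\<Sum>k\<le>N. \<Sum>k'\<le>M. (\<alpha> k * \<beta> k' * cos \<theta> ^ (N - k) / S) * ((\<lambda>(a, b). ?E k k' a * ?E (N - k) (M - k') b) z)))"
      by (simp add: case_prod_unfold)
    also have "\<dots> = (\<Sum>k\<le>N. \<Sum>k'\<le>M. (\<alpha> k * \<beta> k' * cos \<theta> ^ (N - k) / S) * (LINT z|(lborel \<Otimes>\<^sub>M lborel). (\<lambda>(a, b). ?E k k' a * ?E (N - k) (M - k') b) z))"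
      using lborel_pair.integrable_pair_mult(1)[OF Ei Ei]
      by (simp only: Bochner_Integration.integral_sum Bochner_Integration.integrable_sum integrable_mult_right integral_mult_right_zero)
    also have "\<dots> = (\<Sum>k\<le>N. \<Sum>k'\<le>M. (\<alpha> k * \<beta> k' * cos \<theta> ^ (N - k) / S) * (?d k k' * ?d (N - k) (M - k')))"
      by (simp only: lborel_pair.integrable_pair_mult(2)[OF Ei Ei] integral_hermite_product)
    finally show ?thesis .
  qed
  obtain D where D: "\<And>x \<theta> y c. \<bar>rot_hermite m1 m2 m3 m4 x \<theta> y c\<bar> \<le> D * (gauss x * (gauss y * gauss c))"
    using rot_hermite_bound by blast
  have cosi: "integrable Theta (\<lambda>\<theta>. cos \<theta> ^ l)" for l
    by (rule Theta.integrable_const_bound[where B=1]) (auto simp: power_abs intro!: power_le_one)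
  have "(LINT (x, \<theta>, y, c)|mu. rot_hermite m1 m2 m3 m4 x \<theta> y c)
     = (LINT \<theta>|Theta. (\<Sum>k\<le>N. \<Sum>k'\<le>M. (\<alpha> k * \<beta> k' / S * (?d k k' * ?d (N - k) (M - k'))) * cos \<theta> ^ (N - k)))"
    unfolding integral_mu_gauss_bounded(2)[OF measurable_rot_hermite D] xyint by (simp add: mult_ac)
  also have "\<dots> = (\<Sum>k\<le>N. \<Sum>k'\<le>M. (\<alpha> k * \<beta> k' / S * (?d k k' * ?d (N - k) (M - k'))) * (LINT \<theta>|Theta. cos \<theta> ^ (N - k)))"
    using cosi
    by (simp only: Bochner_Integration.integral_sum Bochner_Integration.integrable_sum integrable_mult_right integral_mult_right_zero)
  finally have R: "(LINT (x, \<theta>, y, c)|mu. rot_hermite m1 m2 m3 m4 x \<theta> y c)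
     = (\<Sum>k\<le>N. \<Sum>k'\<le>M. (\<alpha> k * \<beta> k' / S * (?d k k' * ?d (N - k) (M - k'))) * (LINT \<theta>|Theta. cos \<theta> ^ (N - k)))" .
  show ?thesis
  proof (cases "N = M")
    \<comment> \<open>Orthogonality forces k = k' and N - k = M - k', which is impossible
      here.\<close>
    case False
    have "(\<alpha> k * \<beta> k' / S * (?d k k' * ?d (N - k) (M - k'))) * (LINT \<theta>|Theta. cos \<theta> ^ (N - k)) = 0"
      if "k \<le> N" "k' \<le> M" for k k'
      using False that by (cases "k = k'") auto
    then have "(LINT (x, \<theta>, y, c)|mu. rot_hermite m1 m2 m3 m4 x \<theta> y c) = 0"
      unfolding R by (intro sum.neutral ballI) auto
    then show ?thesis using False by (simp add: N_def M_def add.commute)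
  next
    case True
    have "(LINT (x, \<theta>, y, c)|mu. rot_hermite m1 m2 m3 m4 x \<theta> y c)
      = (\<Sum>k\<le>N. \<Sum>k'\<le>N. if k' = k then \<alpha> k * \<beta> k / S * hermite_norm k * ((LINT \<theta>|Theta. cos \<theta> ^ (N - k)) * hermite_norm (N - k)) else 0)"
      unfolding R True[symmetric] by (intro sum.cong refl) auto
    also have "\<dots> = (\<Sum>k\<le>N. \<alpha> k * \<beta> k / S * hermite_norm k * (sqrt pi * (?H (N - k) 0)\<^sup>2))"
      by (simp add: cos_power_Theta)
    also have "\<dots> = sqrt pi * (\<Sum>k\<le>N. \<alpha> k * \<beta> k / S * hermite_norm k * (?H (N - k) 0)\<^sup>2)"
      unfolding sum_distrib_left by (intro sum.cong refl) simp
    finally have R': "(LINT (x, \<theta>, y, c)|mu. rot_hermite m1 m2 m3 m4 x \<theta> y c)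
      = sqrt pi * (\<Sum>k\<le>N. \<alpha> k * \<beta> k / S * hermite_norm k * (?H (N - k) 0)\<^sup>2)" .
    \<comment> \<open>On the diagonal the four Gaussian factors give exp(-(sqrt 2 x)^2), exactly the
      weight for which the H_k(sqrt 2 x) are orthogonal, so the double sum collapses to k =
      k'.\<close>
    have rr: "ra x x = sqrt 2 * x" "rb x x = 0" for x
      by (simp_all add: ra_def rb_def field_simps)
    have "hermite_fun m1 x * hermite_fun m2 x * hermite_fun m3 x * hermite_fun m4 x
      = (\<Sum>k\<le>N. \<Sum>k'\<le>N. (\<alpha> k * \<beta> k' / S * ?H (N - k) 0 * ?H (N - k') 0) * ?E k k' (0 + sqrt 2 * x))" for x
    proof -
      have e: "exp (- (x\<^sup>2) / 2) * exp (- (x\<^sup>2) / 2) * exp (- (x\<^sup>2) / 2) * exp (- (x\<^sup>2) / 2) = exp (- ((0 + sqrt 2 * x)\<^sup>2))"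
        by (simp add: exp_add[symmetric] power_mult_distrib)
      have "hermite_fun m1 x * hermite_fun m2 x * hermite_fun m3 x * hermite_fun m4 x
        = (?H m1 x * ?H m2 x) * (?H m4 x * ?H m3 x) * (exp (- (x\<^sup>2) / 2) * exp (- (x\<^sup>2) / 2) * exp (- (x\<^sup>2) / 2) * exp (- (x\<^sup>2) / 2)) / S"
        unfolding hermite_fun_eq S_def real_sqrt_mult by (simp add: mult_ac)
      also have "\<dots> = (\<Sum>k\<le>N. \<Sum>k'\<le>N. (\<alpha> k * (?H k (ra x x) * ?H (N - k) (rb x x))) * (\<beta> k' * (?H k' (ra x x) * ?H (N - k') (rb x x)))
             * exp (- ((0 + sqrt 2 * x)\<^sup>2)) / S)"
        unfolding \<alpha> \<beta> e True[symmetric] unfolding sum_product unfolding sum_distrib_right sum_divide_distrib ..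
      also have "\<dots> = (\<Sum>k\<le>N. \<Sum>k'\<le>N. (\<alpha> k * \<beta> k' / S * ?H (N - k) 0 * ?H (N - k') 0) * ?E k k' (0 + sqrt 2 * x))"
        unfolding rr by (intro sum.cong refl) (simp add: mult_ac)
      finally show ?thesis .
    qed
    moreover have Es: "integrable lborel (\<lambda>x. ?E k k' (0 + sqrt 2 * x))" for k k'
      by (rule lborel_integrable_real_affine[OF Ei]) simp
    ultimately have "(LINT x|lborel. hermite_fun m1 x * hermite_fun m2 x * hermite_fun m3 x * hermite_fun m4 x)
      = (LINT x|lborel. (\<Sum>k\<le>N. \<Sum>k'\<le>N. (\<alpha> k * \<beta> k' / S * ?H (N - k) 0 * ?H (N - k') 0) * ?E k k' (0 + sqrt 2 * x)))"
      by presburger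
    also have "\<dots> = (\<Sum>k\<le>N. \<Sum>k'\<le>N. (\<alpha> k * \<beta> k' / S * ?H (N - k) 0 * ?H (N - k') 0) * (LINT x|lborel. ?E k k' (0 + sqrt 2 * x)))"
      using Es
      by (simp only: Bochner_Integration.integral_sum Bochner_Integration.integrable_sum integrable_mult_right integral_mult_right_zero)
    also have "\<dots> = (\<Sum>k\<le>N. \<Sum>k'\<le>N. if k' = k then (1 / sqrt 2) * (\<alpha> k * \<beta> k / S * hermite_norm k * (?H (N - k) 0)\<^sup>2) else 0)"
    proof (intro sum.cong refl)
      fix k k'
      define I where "I = (LINT x|lborel. ?E k k' (0 + sqrt 2 * x))"
      have "?d k k' = \<bar>sqrt 2\<bar> *\<^sub>R I"
        unfolding integral_hermite_product[symmetric] I_def by (rule lborel_integral_real_affine) simp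
      then have "(LINT x|lborel. ?E k k' (0 + sqrt 2 * x)) = (1 / sqrt 2) * ?d k k'"
        unfolding I_def[symmetric] by (simp add: field_simps)
      then show "(\<alpha> k * \<beta> k' / S * ?H (N - k) 0 * ?H (N - k') 0) * (LINT x|lborel. ?E k k' (0 + sqrt 2 * x))
        = (if k' = k then (1 / sqrt 2) * (\<alpha> k * \<beta> k / S * hermite_norm k * (?H (N - k) 0)\<^sup>2) else 0)"
        by (simp only:) (auto simp: power2_eq_square mult_ac)
    qed
    also have "\<dots> = (1 / sqrt 2) * (\<Sum>k\<le>N. \<alpha> k * \<beta> k / S * hermite_norm k * (?H (N - k) 0)\<^sup>2)"
      by (simp add: sum_distrib_left)
    finally have L: "(LINT x|lborel. hermite_fun m1 x * hermite_fun m2 x * hermite_fun m3 x * hermite_fun m4 x)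
      = (1 / sqrt 2) * (\<Sum>k\<le>N. \<alpha> k * \<beta> k / S * hermite_norm k * (?H (N - k) 0)\<^sup>2)" .
    \<comment> \<open>The 1/sqrt 2 is the Jacobian of the diagonal substitution; together with the
      sqrt pi from \<open>cos_power_Theta\<close> it fixes the constant sqrt(8/pi).\<close>
    have "sqrt (8 / pi) * sqrt pi = 4 * (1 / sqrt 2)"
    proof -
      have "sqrt (8 / pi) * sqrt pi = sqrt 8" by (simp add: real_sqrt_divide)
      also have "sqrt 8 = sqrt (4 * 2)" by simp
      also have "\<dots> = 2 * sqrt 2" by (simp only: real_sqrt_mult real_sqrt_four)
      also have "\<dots> = 4 * (1 / sqrt 2)" by (simp add: field_simps)
      finally show ?thesis .
    qed
    then show ?thesis unfolding R' L using True by (simp add: N_def M_def add.commute mult.assoc[symmetric])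
  qed
qed

section \<open>The rotation form on square-integrable functions\<close>

lemma nn_integral_CS:
  assumes [measurable]: "f \<in> borel_measurable M" "g \<in> borel_measurable M"
    and f: "(\<integral>\<^sup>+x. ennreal (f x ^ 2) \<partial>M) \<le> ennreal A" and g: "(\<integral>\<^sup>+x. ennreal (g x ^ 2) \<partial>M) \<le> ennreal B"
    and pos: "A \<ge> 0" "B \<ge> 0" "\<And>x. f x \<ge> 0" "\<And>x. g x \<ge> 0"
  shows "(\<integral>\<^sup>+x. ennreal (f x * g x) \<partial>M) \<le> ennreal (sqrt (A * B))"
proof -
  have "(\<integral>\<^sup>+x. ennreal (f x * g x) \<partial>M)\<^sup>2 = (\<integral>\<^sup>+x. ennreal (f x) * ennreal (g x) \<partial>M)\<^sup>2"
    using pos by (simp add: ennreal_mult)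
  also have "\<dots> \<le> (\<integral>\<^sup>+x. (ennreal (f x))\<^sup>2 \<partial>M) * (\<integral>\<^sup>+x. (ennreal (g x))\<^sup>2 \<partial>M)"
    by (rule Cauchy_Schwarz_nn_integral) measurable
  also have "\<dots> \<le> ennreal A * ennreal B"
    using f g pos by (intro mult_mono) (auto simp: ennreal_power)
  also have "\<dots> = (ennreal (sqrt (A * B)))\<^sup>2"
    using pos by (simp add: ennreal_mult ennreal_power)
  finally have le: "(\<integral>\<^sup>+x. ennreal (f x * g x) \<partial>M)\<^sup>2 \<le> (ennreal (sqrt (A * B)))\<^sup>2" .
  show ?thesis
  proof (cases "\<integral>\<^sup>+x. ennreal (f x * g x) \<partial>M")
    case (real r)
    then have "r\<^sup>2 \<le> A * B" using le pos by (simp add: ennreal_power)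
    then show ?thesis using real pos by (simp add: real_le_rsqrt ennreal_leI)
  next
    case top
    then show ?thesis using le pos by (simp add: ennreal_power top_unique)
  qed
qed

lemma integrable_bound_nn:
  fixes f :: "'a \<Rightarrow> complex"
  assumes [measurable]: "f \<in> borel_measurable M" and "(\<integral>\<^sup>+x. ennreal (norm (f x)) \<partial>M) \<le> ennreal B" "B \<ge> 0"
  shows "integrable M f" "norm (integral\<^sup>L M f) \<le> B"
proof -
  have "(\<integral>\<^sup>+x. ennreal (norm (f x)) \<partial>M) < \<infinity>" using assms(2) by (rule order_le_less_trans) simp
  then show i: "integrable M f" by (intro integrableI_bounded) auto
  have "ennreal (norm (integral\<^sup>L M f)) \<le> ennreal B"
    by (rule order_trans[OF integral_norm_bound_ennreal[OF i] assms(2)])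
  then show "norm (integral\<^sup>L M f) \<le> B" using assms(3) by simp
qed

text \<open>Stated for abstract size predicates because it is applied twice, to the rotation form
  and to the space-time form. In \<open>Q1 f a\<close> the number a plays the part of a squared
  norm, which is why the bound contains a square root.\<close>

lemma quadrilinear_limit:
  fixes u1 u2 u3 u4 :: "'a \<Rightarrow> complex" and v1 v2 v3 v4 :: "nat \<Rightarrow> 'a \<Rightarrow> complex"
    and Q1 Q2 Q3 Q4 :: "('a \<Rightarrow> complex) \<Rightarrow> real \<Rightarrow> bool"
  assumes bnd: "\<And>f1 f2 f3 f4 a1 a2 a3 a4. Q1 f1 a1 \<Longrightarrow> Q2 f2 a2 \<Longrightarrow> Q3 f3 a3 \<Longrightarrow> Q4 f4 a4 \<Longrightarrow>
      a1 \<ge> 0 \<Longrightarrow> a2 \<ge> 0 \<Longrightarrow> a3 \<ge> 0 \<Longrightarrow> a4 \<ge> 0 \<Longrightarrow>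
      (\<lambda>x. f1 x * f2 x * f3 x * f4 x) \<in> borel_measurable M \<and>
      (\<integral>\<^sup>+x. ennreal (norm (f1 x * f2 x * f3 x * f4 x)) \<partial>M) \<le> ennreal (K * sqrt (a1 * a2 * a3 * a4))"
    and K: "K \<ge> 0" and a: "a1 \<ge> 0" "a2 \<ge> 0" "a3 \<ge> 0" "a4 \<ge> 0"
    and d: "\<And>n. d1 n \<ge> 0" "\<And>n. d2 n \<ge> 0" "\<And>n. d3 n \<ge> 0" "\<And>n. d4 n \<ge> 0"
    and d0: "d1 \<longlonglongrightarrow> 0" "d2 \<longlonglongrightarrow> 0" "d3 \<longlonglongrightarrow> 0" "d4 \<longlonglongrightarrow> (0::real)"
    and u: "Q1 u1 a1" "Q2 u2 a2" "Q3 u3 a3" "Q4 u4 a4"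
    and v: "\<And>n. Q1 (v1 n) a1" "\<And>n. Q2 (v2 n) a2" "\<And>n. Q3 (v3 n) a3" "\<And>n. Q4 (v4 n) a4"
    and uv: "\<And>n. Q1 (\<lambda>x. u1 x - v1 n x) (d1 n)" "\<And>n. Q2 (\<lambda>x. u2 x - v2 n x) (d2 n)"
       "\<And>n. Q3 (\<lambda>x. u3 x - v3 n x) (d3 n)" "\<And>n. Q4 (\<lambda>x. u4 x - v4 n x) (d4 n)"
  shows "integrable M (\<lambda>x. u1 x * u2 x * u3 x * u4 x)"
    and "(\<lambda>n. LINT x|M. v1 n x * v2 n x * v3 n x * v4 n x) \<longlonglongrightarrow> (LINT x|M. u1 x * u2 x * u3 x * u4 x)"
proof -
  have I: "integrable M (\<lambda>x. f1 x * f2 x * f3 x * f4 x)" "norm (LINT x|M. f1 x * f2 x * f3 x * f4 x) \<le> K * sqrt (b1 * b2 * b3 * b4)"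
    if "Q1 f1 b1" "Q2 f2 b2" "Q3 f3 b3" "Q4 f4 b4" "b1 \<ge> 0" "b2 \<ge> 0" "b3 \<ge> 0" "b4 \<ge> 0" for f1 f2 f3 f4 b1 b2 b3 b4
    using bnd[OF that] K that(5-8) by (auto intro!: integrable_bound_nn)
  show iu: "integrable M (\<lambda>x. u1 x * u2 x * u3 x * u4 x)" using u a by (rule I)
  let ?e = "\<lambda>n. K * sqrt (d1 n * a2 * a3 * a4) + K * sqrt (a1 * d2 n * a3 * a4) + K * sqrt (a1 * a2 * d3 n * a4) + K * sqrt (a1 * a2 * a3 * d4 n)"
  have le: "norm ((LINT x|M. v1 n x * v2 n x * v3 n x * v4 n x) - (LINT x|M. u1 x * u2 x * u3 x * u4 x)) \<le> ?e n" for n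
  proof -
    note i1 = I[OF uv(1)[of n] u(2-4) d(1) a(2-4)]
    note i2 = I[OF v(1)[of n] uv(2)[of n] u(3,4) a(1) d(2) a(3,4)]
    note i3 = I[OF v(1)[of n] v(2)[of n] uv(3)[of n] u(4) a(1,2) d(3) a(4)]
    note i4 = I[OF v(1)[of n] v(2)[of n] v(3)[of n] uv(4)[of n] a(1,2,3) d(4)]
    have iv: "integrable M (\<lambda>x. v1 n x * v2 n x * v3 n x * v4 n x)" using v a by (rule I)
    have "(LINT x|M. u1 x * u2 x * u3 x * u4 x) - (LINT x|M. v1 n x * v2 n x * v3 n x * v4 n x)
       = (LINT x|M. u1 x * u2 x * u3 x * u4 x - v1 n x * v2 n x * v3 n x * v4 n x)"
      using iu iv by (rule Bochner_Integration.integral_diff[symmetric])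
    \<comment> \<open>Telescoping: one factor is exchanged at a time, so each term contains exactly
      one small difference.\<close>
    also have "\<dots> = (LINT x|M. (((u1 x - v1 n x) * u2 x * u3 x * u4 x + v1 n x * (u2 x - v2 n x) * u3 x * u4 x)
        + v1 n x * v2 n x * (u3 x - v3 n x) * u4 x) + v1 n x * v2 n x * v3 n x * (u4 x - v4 n x))"
      by (intro Bochner_Integration.integral_cong refl) (simp add: algebra_simps)
    also have "\<dots> = (((LINT x|M. (u1 x - v1 n x) * u2 x * u3 x * u4 x) + (LINT x|M. v1 n x * (u2 x - v2 n x) * u3 x * u4 x))
        + (LINT x|M. v1 n x * v2 n x * (u3 x - v3 n x) * u4 x)) + (LINT x|M. v1 n x * v2 n x * v3 n x * (u4 x - v4 n x))"
      using i1(1) i2(1) i3(1) i4(1) by (simp only: Bochner_Integration.integral_add Bochner_Integration.integrable_add)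
    finally have eq: "(LINT x|M. u1 x * u2 x * u3 x * u4 x) - (LINT x|M. v1 n x * v2 n x * v3 n x * v4 n x) = \<dots>" .
    show ?thesis
      unfolding norm_minus_commute[of "LINT x|M. v1 n x * v2 n x * v3 n x * v4 n x"] eq
      by (intro order_trans[OF norm_triangle_ineq] add_mono i1 i2 i3 i4)
  qed
  have "?e \<longlonglongrightarrow> K * sqrt (0 * a2 * a3 * a4) + K * sqrt (a1 * 0 * a3 * a4) + K * sqrt (a1 * a2 * 0 * a4) + K * sqrt (a1 * a2 * a3 * 0)"
    by (intro tendsto_intros d0)
  then have e0: "?e \<longlonglongrightarrow> 0" by simp
  have "(\<lambda>n. (LINT x|M. v1 n x * v2 n x * v3 n x * v4 n x) - (LINT x|M. u1 x * u2 x * u3 x * u4 x)) \<longlonglongrightarrow> 0"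
    by (rule Lim_null_comparison[OF _ e0]) (simp only: le eventually_sequentially, blast)
  then show "(\<lambda>n. LINT x|M. v1 n x * v2 n x * v3 n x * v4 n x) \<longlonglongrightarrow> (LINT x|M. u1 x * u2 x * u3 x * u4 x)"
    by (rule LIM_zero_cancel)
qed

lemma quadrilinear_sum:
  fixes c1 c2 c3 c4 :: "nat \<Rightarrow> complex" and e1 e2 e3 e4 :: "nat \<Rightarrow> 'a \<Rightarrow> complex"
  assumes i: "\<And>m1 m2 m3 m4. integrable M (\<lambda>x. e1 m1 x * e2 m2 x * e3 m3 x * e4 m4 x)"
  shows "(LINT x|M. (\<Sum>m<N. c1 m * e1 m x) * (\<Sum>m<N. c2 m * e2 m x) * (\<Sum>m<N. c3 m * e3 m x) * (\<Sum>m<N. c4 m * e4 m x))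
    = (\<Sum>m1<N. \<Sum>m2<N. \<Sum>m3<N. \<Sum>m4<N. (c1 m1 * c2 m2 * c3 m3 * c4 m4) * (LINT x|M. e1 m1 x * e2 m2 x * e3 m3 x * e4 m4 x))"
proof -
  have eq: "(\<Sum>m<N. c1 m * e1 m x) * (\<Sum>m<N. c2 m * e2 m x) * (\<Sum>m<N. c3 m * e3 m x) * (\<Sum>m<N. c4 m * e4 m x)
    = (\<Sum>m1<N. \<Sum>m2<N. \<Sum>m3<N. \<Sum>m4<N. (c1 m1 * c2 m2 * c3 m3 * c4 m4) * (e1 m1 x * e2 m2 x * e3 m3 x * e4 m4 x))" for x
    unfolding mult.assoc sum_distrib_right
    unfolding sum_distrib_left by (intro sum.cong refl) (simp add: mult_ac)
  show ?thesis
    unfolding eq using i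
    by (simp only: Bochner_Integration.integral_sum Bochner_Integration.integrable_sum integrable_mult_right integral_mult_right_zero)
qed

text \<open>One ground-state factor is attached to \<open>rot1\<close> and the other to
  \<open>rot3\<close>. Cauchy-Schwarz will separate \<open>rot1\<close>, \<open>rot2\<close> from
  \<open>rot3\<close>, \<open>rot4\<close>, and each side then has a Gaussian that makes its
  integral in c equal to 1.\<close>

definition rot1 :: "(real \<Rightarrow> complex) \<Rightarrow> real \<times> real \<times> real \<times> real \<Rightarrow> complex" where
  "rot1 f = (\<lambda>(x, \<theta>, y, c). f (rx x \<theta> y c) * of_real (hermite_fun 0 (rc x \<theta> y c)))"
definition rot2 :: "(real \<Rightarrow> complex) \<Rightarrow> real \<times> real \<times> real \<times> real \<Rightarrow> complex" where
  "rot2 f = (\<lambda>(x, \<theta>, y, c). f (ry x \<theta> y c))"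
definition rot3 :: "(real \<Rightarrow> complex) \<Rightarrow> real \<times> real \<times> real \<times> real \<Rightarrow> complex" where
  "rot3 f = (\<lambda>(x, \<theta>, y, c). cnj (f y) * of_real (hermite_fun 0 c))"
definition rot4 :: "(real \<Rightarrow> complex) \<Rightarrow> real \<times> real \<times> real \<times> real \<Rightarrow> complex" where
  "rot4 f = (\<lambda>(x, \<theta>, y, c). cnj (f x))"

lemmas rot_defs = rot1_def rot2_def rot3_def rot4_def

lemma measurable_rot [measurable]:
  assumes [measurable]: "f \<in> borel_measurable borel"
  shows "rot1 f \<in> borel_measurable mu" "rot2 f \<in> borel_measurable mu"
    "rot3 f \<in> borel_measurable mu" "rot4 f \<in> borel_measurable mu"
  unfolding rot_defs by measurable

definition rotform :: "(real \<Rightarrow> complex) \<Rightarrow> (real \<Rightarrow> complex) \<Rightarrow> (real \<Rightarrow> complex) \<Rightarrow> (real \<Rightarrow> complex) \<Rightarrow> complex" where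
  "rotform f1 f2 f3 f4 = (LINT z|mu. rot1 f1 z * rot2 f2 z * rot3 f3 z * rot4 f4 z)"

lemma nn_integral_hermite0: "(\<integral>\<^sup>+x. ennreal ((hermite_fun 0 x)\<^sup>2) \<partial>lborel) = 1"
  using hermite_fun_orthonormal[of 0 0] integrable_hermite_fun_mult[of 0 0]
  by (subst nn_integral_eq_integral) (auto simp: power2_eq_square)

lemma rot_bound:
  assumes "f1 \<in> L2" "f2 \<in> L2" "f3 \<in> L2" "f4 \<in> L2"
  shows "(\<integral>\<^sup>+z. ennreal (norm (rot1 f1 z * rot2 f2 z * rot3 f3 z * rot4 f4 z)) \<partial>mu)
     \<le> ennreal (sqrt (sqnorm f1 * sqnorm f2 * sqnorm f3 * sqnorm f4))"
proof -
  note [measurable] = assms[THEN L2_measurable]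
  let ?F = "\<lambda>z. norm (rot1 f1 z * rot2 f2 z)" and ?G = "\<lambda>z. norm (rot3 f3 z * rot4 f4 z)"
  have "(\<integral>\<^sup>+z. ennreal (?F z * ?G z) \<partial>mu) \<le> ennreal (sqrt ((sqnorm f1 * sqnorm f2) * (sqnorm f3 * sqnorm f4)))"
  proof (rule nn_integral_CS)
    have "(\<integral>\<^sup>+z. ennreal ((?F z)\<^sup>2) \<partial>mu) = (\<integral>\<^sup>+(x, \<theta>, y, c). ennreal ((norm (f1 (rx x \<theta> y c)))\<^sup>2)
         * ennreal ((norm (f2 (ry x \<theta> y c)))\<^sup>2) * ennreal ((hermite_fun 0 (rc x \<theta> y c))\<^sup>2) \<partial>mu)"
      by (intro nn_integral_cong) (auto simp: rot_defs norm_mult power_mult_distrib ennreal_mult[symmetric] mult_ac)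
    also have "\<dots> = ennreal (sqnorm f1) * ennreal (sqnorm f2) * 1"
      using assms by (subst nn_integral_mu_rotated) (simp_all add: nn_integral_L2 nn_integral_hermite0)
    finally show "(\<integral>\<^sup>+z. ennreal ((?F z)\<^sup>2) \<partial>mu) \<le> ennreal (sqnorm f1 * sqnorm f2)"
      by (simp add: ennreal_mult)
    have "(\<integral>\<^sup>+z. ennreal ((?G z)\<^sup>2) \<partial>mu) = (\<integral>\<^sup>+(x, \<theta>, y, c). ennreal ((norm (f4 x))\<^sup>2) * (ennreal ((norm (f3 y))\<^sup>2) * ennreal ((hermite_fun 0 c)\<^sup>2)) \<partial>mu)"
      by (intro nn_integral_cong) (auto simp: rot_defs norm_mult power_mult_distrib ennreal_mult[symmetric] mult_ac)
    also have "\<dots> = ennreal (sqnorm f3) * ennreal (sqnorm f4)"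
      using assms by (subst nn_integral_mu) (simp_all add: nn_integral_cmult nn_integral_multc nn_integral_L2 nn_integral_hermite0
          Theta.emeasure_space_1[unfolded space_Theta] mult.commute)
    finally show "(\<integral>\<^sup>+z. ennreal ((?G z)\<^sup>2) \<partial>mu) \<le> ennreal (sqnorm f3 * sqnorm f4)"
      by (simp add: ennreal_mult)
  qed auto
  then show ?thesis by (simp add: norm_mult mult.assoc)
qed

lemma rot_measurable_prod:
  assumes "f1 \<in> L2" "f2 \<in> L2" "f3 \<in> L2" "f4 \<in> L2"
  shows "(\<lambda>z. rot1 f1 z * rot2 f2 z * rot3 f3 z * rot4 f4 z) \<in> borel_measurable mu"
proof -
  note [measurable] = assms[THEN L2_measurable]
  show ?thesis by measurable
qed

lemma rot_integrable:
  assumes "f1 \<in> L2" "f2 \<in> L2" "f3 \<in> L2" "f4 \<in> L2"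
  shows "integrable mu (\<lambda>z. rot1 f1 z * rot2 f2 z * rot3 f3 z * rot4 f4 z)"
    "norm (rotform f1 f2 f3 f4) \<le> sqrt (sqnorm f1 * sqnorm f2 * sqnorm f3 * sqnorm f4)"
  unfolding rotform_def
  by (rule integrable_bound_nn[OF rot_measurable_prod[OF assms] rot_bound[OF assms]]; simp)+

lemma rot_diff:
  "rot1 (\<lambda>x. f x - g x) = (\<lambda>z. rot1 f z - rot1 g z)" "rot2 (\<lambda>x. f x - g x) = (\<lambda>z. rot2 f z - rot2 g z)"
  "rot3 (\<lambda>x. f x - g x) = (\<lambda>z. rot3 f z - rot3 g z)" "rot4 (\<lambda>x. f x - g x) = (\<lambda>z. rot4 f z - rot4 g z)"
  by (auto simp: rot_defs algebra_simps)

lemma tail_nonneg_L2: "f \<in> L2 \<Longrightarrow> tail (coef f) N \<ge> 0"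
  by (intro tail_nonneg coef_summable)

lemma tail_tendsto_L2: "f \<in> L2 \<Longrightarrow> tail (coef f) \<longlonglongrightarrow> 0"
  by (intro tail_tendsto coef_summable)

lemma sqnorm_partial_le: "f \<in> L2 \<Longrightarrow> sqnorm (hermite_sum N (coef f)) \<le> sqnorm f"
  by (simp add: sqnorm_hermite_sum Bessel)

lemma rotform_limit:
  assumes f: "f1 \<in> L2" "f2 \<in> L2" "f3 \<in> L2" "f4 \<in> L2"
  shows "(\<lambda>N. rotform (hermite_sum N (coef f1)) (hermite_sum N (coef f2)) (hermite_sum N (coef f3)) (hermite_sum N (coef f4)))
    \<longlonglongrightarrow> rotform f1 f2 f3 f4"
proof -
  \<comment> \<open>An integrand has size a if it is the image of a square-integrable function of
    squared norm at most a.\<close>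
  define Q where "Q r h a \<longleftrightarrow> (\<exists>g\<in>L2. h = r g \<and> sqnorm g \<le> a)"
    for r :: "(real \<Rightarrow> complex) \<Rightarrow> real \<times> real \<times> real \<times> real \<Rightarrow> complex" and h a
  have Q1: "Q r (r f) (sqnorm f)" if "f \<in> L2" for r f using that by (auto simp: Q_def)
  have Q2: "Q r (r (hermite_sum N (coef f))) (sqnorm f)" if "f \<in> L2" for r f N
    unfolding Q_def using that by (intro bexI[OF _ hermite_sum_L2[of N "coef f"]] conjI refl sqnorm_partial_le)
  have Q3: "Q r (r (\<lambda>x. f x - hermite_sum N (coef f) x)) (tail (coef f) N)" if "f \<in> L2" for r f N
    unfolding Q_def
  proof (intro bexI conjI)
    show "(\<lambda>x. f x - hermite_sum N (coef f) x) \<in> L2" using that by auto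
    show "sqnorm (\<lambda>x. f x - hermite_sum N (coef f) x) \<le> tail (coef f) N"
      by (rule eq_refl[OF sqnorm_diff_partial[OF that]])
  qed (rule refl)
  note QL = quadrilinear_limit(2)[where ?Q1.0="Q rot1" and ?Q2.0="Q rot2" and ?Q3.0="Q rot3" and ?Q4.0="Q rot4" and K=1 and M=mu
      and ?a1.0="sqnorm f1" and ?a2.0="sqnorm f2" and ?a3.0="sqnorm f3" and ?a4.0="sqnorm f4"
      and ?d1.0="tail (coef f1)" and ?d2.0="tail (coef f2)" and ?d3.0="tail (coef f3)" and ?d4.0="tail (coef f4)"
      and ?u1.0="rot1 f1" and ?u2.0="rot2 f2" and ?u3.0="rot3 f3" and ?u4.0="rot4 f4"
      and ?v1.0="\<lambda>N. rot1 (hermite_sum N (coef f1))" and ?v2.0="\<lambda>N. rot2 (hermite_sum N (coef f2))"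
      and ?v3.0="\<lambda>N. rot3 (hermite_sum N (coef f3))" and ?v4.0="\<lambda>N. rot4 (hermite_sum N (coef f4))"]
  show ?thesis
    unfolding rotform_def
  proof (rule QL)
    fix h1 h2 h3 h4 and a1 a2 a3 a4 :: real
    assume "Q rot1 h1 a1" "Q rot2 h2 a2" "Q rot3 h3 a3" "Q rot4 h4 a4" and a: "a1 \<ge> 0" "a2 \<ge> 0" "a3 \<ge> 0" "a4 \<ge> 0"
    then obtain g1 g2 g3 g4 where g: "g1 \<in> L2" "g2 \<in> L2" "g3 \<in> L2" "g4 \<in> L2"
      and h: "h1 = rot1 g1" "h2 = rot2 g2" "h3 = rot3 g3" "h4 = rot4 g4"
      and le: "sqnorm g1 \<le> a1" "sqnorm g2 \<le> a2" "sqnorm g3 \<le> a3" "sqnorm g4 \<le> a4" unfolding Q_def by blast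
    have "sqrt (sqnorm g1 * sqnorm g2 * sqnorm g3 * sqnorm g4) \<le> sqrt (a1 * a2 * a3 * a4)"
      using le a by (intro real_sqrt_le_mono mult_mono mult_nonneg_nonneg) auto
    then show "(\<lambda>x. h1 x * h2 x * h3 x * h4 x) \<in> borel_measurable mu \<and>
        (\<integral>\<^sup>+x. ennreal (norm (h1 x * h2 x * h3 x * h4 x)) \<partial>mu) \<le> ennreal (1 * sqrt (a1 * a2 * a3 * a4))"
      using rot_measurable_prod[OF g] rot_bound[OF g] unfolding h by (auto intro: order_trans[OF _ ennreal_leI])
  qed (use f in \<open>auto simp: rot_diff[symmetric] tail_nonneg_L2 tail_tendsto_L2 intro: Q1 Q2 Q3\<close>)
qed

lemma rot_hermite_complex:
  "rot1 (\<lambda>x. of_real (hermite_fun m1 x)) z * rot2 (\<lambda>x. of_real (hermite_fun m2 x)) z *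
   rot3 (\<lambda>x. of_real (hermite_fun m3 x)) z * rot4 (\<lambda>x. of_real (hermite_fun m4 x)) z
   = of_real (case z of (x, \<theta>, y, c) \<Rightarrow> rot_hermite m1 m2 m3 m4 x \<theta> y c)"
  by (cases z) (simp add: rot_defs rot_hermite_def mult_ac)

definition hermite4 :: "nat \<Rightarrow> nat \<Rightarrow> nat \<Rightarrow> nat \<Rightarrow> real" where
  "hermite4 m1 m2 m3 m4 = (LINT x|lborel. hermite_fun m1 x * hermite_fun m2 x * hermite_fun m3 x * hermite_fun m4 x)"

lemma rotform_hermite:
  "of_real (sqrt (8 / pi)) * rotform (\<lambda>x. of_real (hermite_fun m1 x)) (\<lambda>x. of_real (hermite_fun m2 x))
      (\<lambda>x. of_real (hermite_fun m3 x)) (\<lambda>x. of_real (hermite_fun m4 x))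
   = (if m1 + m2 = m3 + m4 then of_real (4 * hermite4 m1 m2 m3 m4) else 0)"
  unfolding rotform_def rot_hermite_complex integral_complex_of_real
  unfolding of_real_mult[symmetric] hermite_form_identity by (simp add: hermite4_def)

lemma rotform_hermite_sum:
  "of_real (sqrt (8 / pi)) * rotform (hermite_sum N c1) (hermite_sum N c2) (hermite_sum N c3) (hermite_sum N c4)
    = (\<Sum>m1<N. \<Sum>m2<N. \<Sum>m3<N. \<Sum>m4<N. (c1 m1 * c2 m2 * cnj (c3 m3) * cnj (c4 m4)) *
        (if m1 + m2 = m3 + m4 then of_real (4 * hermite4 m1 m2 m3 m4) else 0))"
proof -
  let ?h = "\<lambda>n x. complex_of_real (hermite_fun n x)"
  have r: "rot1 (hermite_sum N c1) = (\<lambda>z. \<Sum>m<N. c1 m * rot1 (?h m) z)" "rot2 (hermite_sum N c2) = (\<lambda>z. \<Sum>m<N. c2 m * rot2 (?h m) z)"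
    "rot3 (hermite_sum N c3) = (\<lambda>z. \<Sum>m<N. cnj (c3 m) * rot3 (?h m) z)" "rot4 (hermite_sum N c4) = (\<lambda>z. \<Sum>m<N. cnj (c4 m) * rot4 (?h m) z)"
    by (auto simp: rot_defs hermite_sum_def sum_distrib_right mult.assoc)
  have "of_real (sqrt (8 / pi)) * rotform (hermite_sum N c1) (hermite_sum N c2) (hermite_sum N c3) (hermite_sum N c4)
     = of_real (sqrt (8 / pi)) * (\<Sum>m1<N. \<Sum>m2<N. \<Sum>m3<N. \<Sum>m4<N. (c1 m1 * c2 m2 * cnj (c3 m3) * cnj (c4 m4)) *
        rotform (?h m1) (?h m2) (?h m3) (?h m4))"
    unfolding rotform_def r
    by (subst quadrilinear_sum) (auto intro!: rot_integrable)
  also have "\<dots> = (\<Sum>m1<N. \<Sum>m2<N. \<Sum>m3<N. \<Sum>m4<N. (c1 m1 * c2 m2 * cnj (c3 m3) * cnj (c4 m4)) *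
        (of_real (sqrt (8 / pi)) * rotform (?h m1) (?h m2) (?h m3) (?h m4)))"
    unfolding sum_distrib_left by (intro sum.cong refl) (simp add: mult_ac)
  finally show ?thesis unfolding rotform_hermite .
qed

section \<open>The space-time integral\<close>

text \<open>As a probability measure it absorbs the factor 2/pi of the form.\<close>

definition Time :: "real measure" where "Time = uniform_measure lborel {0..pi/2}"

lemma sets_Time [simp, measurable_cong]: "sets Time = sets borel"
  by (simp add: Time_def)

lemma space_Time [simp]: "space Time = UNIV"
  by (simp add: Time_def)

interpretation Time: prob_space Time
  unfolding Time_def by (rule prob_space_uniform_measure) auto

interpretation tau: pair_sigma_finite Time "lborel :: real measure"
  by unfold_locales

lemma integral_Time:
  fixes f :: "real \<Rightarrow> complex"
  assumes [measurable]: "f \<in> borel_measurable borel"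
  shows "(LINT t|Time. f t) = of_real (2/pi) * (LINT t:{0..pi/2}|lborel. f t)"
proof -
  have "indicator {0..pi/2} x / ennreal (pi/2) = ennreal (indicator {0..pi/2} x / (pi/2))" for x :: real
    using divide_ennreal[of 1 "pi/2"] by (cases "x \<in> {0..pi/2}") (simp_all del: ennreal_half)
  moreover have "emeasure lborel {0..pi/2} = ennreal (pi/2)" by (subst emeasure_lborel_Icc) simp_all
  ultimately have "Time = density lborel (\<lambda>x. ennreal (indicator {0..pi/2} x / (pi/2)))"
    unfolding Time_def uniform_measure_def by simp
  then have "(LINT t|Time. f t) = integral\<^sup>L (density lborel (\<lambda>x. ennreal (indicator {0..pi/2} x / (pi/2)))) f"
    by (simp only:)
  also have "\<dots> = (LINT t|lborel. (indicator {0..pi/2} t / (pi/2)) *\<^sub>R f t)"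
    by (subst integral_density) auto
  also have "\<dots> = (LINT t|lborel. of_real (2/pi) * (indicator {0..pi/2} t *\<^sub>R f t))"
    by (intro Bochner_Integration.integral_cong) (auto simp: scaleR_conv_of_real)
  finally show ?thesis unfolding set_lebesgue_integral_def by (simp only: integral_mult_right_zero)
qed

text \<open>For k nonzero the interval of length pi/2 contains |k| full periods.\<close>

lemma integral_Time_cis:
  fixes k :: int
  shows "(LINT t|Time. cis (4 * of_int k * t)) = (if k = 0 then 1 else 0)"
proof (cases "k = 0")
  case True
  then show ?thesis using Time.prob_space by simp
next
  case False
  define w :: real where "w = 4 * of_int k"
  have w: "w \<noteq> 0" using False by (simp add: w_def)
  have "(LINT t:{0..pi/2}|lborel. cis (w * t)) = cis (w * (pi/2)) / (\<i> * of_real w) - cis (w * 0) / (\<i> * of_real w)"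
    unfolding set_lebesgue_integral_def
  proof (rule integral_FTC_Icc)
    fix t :: real
    have "((\<lambda>t. cis (w * t)) has_vector_derivative (\<i> * of_real w * cis (w * t))) (at t within {0..pi/2})"
    proof -
      have "((\<lambda>z. exp (\<i> * of_real w * z)) has_field_derivative (\<i> * of_real w * exp (\<i> * of_real w * of_real t))) (at (of_real t))"
        by (auto intro!: derivative_eq_intros)
      from has_vector_derivative_real_field[OF this, of "{0..pi/2}"] show ?thesis
        by (simp add: cis_conv_exp mult.assoc)
    qed
    then have "((\<lambda>t. cis (w * t) / (\<i> * of_real w)) has_vector_derivative (\<i> * of_real w * cis (w * t)) / (\<i> * of_real w)) (at t within {0..pi/2})"
      by (rule has_vector_derivative_divide)
    then show "((\<lambda>t. cis (w * t) / (\<i> * of_real w)) has_vector_derivative cis (w * t)) (at t within {0..pi/2})"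
      using w by simp
  qed (auto intro!: continuous_intros)
  also have "cis (w * (pi/2)) = 1"
  proof -
    have "w * (pi/2) = 2 * pi * of_int k" by (simp add: w_def)
    then show ?thesis by (simp only: cis_multiple_2pi Ints_of_int)
  qed
  finally have "(LINT t:{0..pi/2}|lborel. cis (w * t)) = 0" by simp
  moreover have "(\<lambda>t. cis (w * t)) \<in> borel_measurable borel"
    by (intro borel_measurable_continuous_onI continuous_intros)
  ultimately show ?thesis using False integral_Time[of "\<lambda>t. cis (w * t)"] by (simp add: w_def)
qed

lemma hermite_poly_minus: "hermite_poly n (- x) = (-1) ^ n * hermite_poly n x"
  by (induction n rule: induct_nat_012) (simp_all add: algebra_simps)

text \<open>A product of four waves oscillates in time with frequency 2 K, where K = m1 + m2 - m3 -
  m4. For odd K its average over the time interval is not 0, and the vanishing has to come from the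
  parity of the space integral.\<close>

lemma hermite4_odd: assumes "odd (m1 + m2 + m3 + m4)" shows "hermite4 m1 m2 m3 m4 = 0"
proof -
  have e: "hermite_fun n (- x) = (-1) ^ n * hermite_fun n x" for n x
    by (simp add: hermite_fun_eq hermite_poly_minus)
  have "hermite4 m1 m2 m3 m4 = (LINT x|lborel. hermite_fun m1 (0 + - 1 * x) * hermite_fun m2 (0 + - 1 * x) * hermite_fun m3 (0 + - 1 * x) * hermite_fun m4 (0 + - 1 * x))"
    unfolding hermite4_def by (subst lborel_integral_real_affine[of "-1" _ 0]) simp_all
  also have "\<dots> = (LINT x|lborel. (-1) ^ (m1 + m2 + m3 + m4) * (hermite_fun m1 x * hermite_fun m2 x * hermite_fun m3 x * hermite_fun m4 x))"
    by (intro Bochner_Integration.integral_cong refl) (simp add: e power_add mult_ac)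
  also have "\<dots> = (-1) ^ (m1 + m2 + m3 + m4) * hermite4 m1 m2 m3 m4"
    unfolding hermite4_def by (rule integral_mult_right_zero)
  also have "(-1) ^ (m1 + m2 + m3 + m4) = (-1::real)" using assms by simp
  finally show ?thesis by simp
qed

section \<open>Waves as functions of time and space\<close>

definition evol :: "real \<Rightarrow> (nat \<Rightarrow> complex) \<Rightarrow> nat \<Rightarrow> complex" where
  "evol t c n = cis (t * (2 * real n + 1)) * c n"

lemma norm_evol [simp]: "norm (evol t c n) = norm (c n)"
  by (simp add: evol_def norm_mult)

lemma measurable_cis [measurable (raw)]:
  "f \<in> borel_measurable M \<Longrightarrow> (\<lambda>x. cis (f x)) \<in> borel_measurable M"
  by (rule borel_measurable_continuous_on[of cis]) (intro continuous_intros)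

definition wave :: "nat \<Rightarrow> real \<times> real \<Rightarrow> complex" where
  "wave m = (\<lambda>(t, x). cis (t * (2 * real m + 1)) * of_real (hermite_fun m x))"

lemma measurable_wave [measurable]: "wave m \<in> borel_measurable (borel \<Otimes>\<^sub>M borel)"
  unfolding wave_def by measurable

definition wave_sum :: "nat \<Rightarrow> (nat \<Rightarrow> complex) \<Rightarrow> real \<times> real \<Rightarrow> complex" where
  "wave_sum N c = (\<lambda>(t, x). hermite_sum N (evol t c) x)"

lemma wave_sum_eq: "wave_sum N c z = (\<Sum>m<N. c m * wave m z)"
  by (auto simp: wave_sum_def wave_def hermite_sum_def evol_def mult_ac split: prod.splits)

lemma measurable_wave_sum [measurable]: "wave_sum N c \<in> borel_measurable (borel \<Otimes>\<^sub>M borel)"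
  unfolding wave_sum_eq[abs_def] by measurable

definition wave_series :: "(nat \<Rightarrow> nat) \<Rightarrow> (nat \<Rightarrow> complex) \<Rightarrow> real \<times> real \<Rightarrow> complex" where
  "wave_series N c = (\<lambda>(t, x). hermite_series N (evol t c) x)"

lemma wave_series_eq: "wave_series N c z = lim (\<lambda>k. wave_sum (N k) c z)"
  by (simp add: wave_series_def hermite_series_def wave_sum_def split: prod.splits)

lemma measurable_wave_series [measurable]: "wave_series N c \<in> borel_measurable (borel \<Otimes>\<^sub>M borel)"
  unfolding wave_series_eq[abs_def] by measurable

abbreviation "tauM \<equiv> (Time \<Otimes>\<^sub>M lborel :: (real \<times> real) measure)"

lemma sets_tau [measurable_cong]: "sets tauM = sets (borel \<Otimes>\<^sub>M borel)"
  by (intro sets_pair_measure_cong) auto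

lemma integrable_hermite4: "integrable lborel (\<lambda>x. hermite_fun m1 x * hermite_fun m2 x * hermite_fun m3 x * hermite_fun m4 x)"
proof -
  obtain C where C: "\<And>x. \<bar>hermite_fun m1 x\<bar> \<le> C * exp (- (x\<^sup>2) / 4)" "C \<ge> 0" using hermite_fun_bound by blast
  obtain D where D: "\<And>x. \<bar>hermite_fun m2 x\<bar> \<le> D * exp (- (x\<^sup>2) / 4)" "D \<ge> 0" using hermite_fun_bound by blast
  have C1: "\<bar>hermite_fun m1 x\<bar> \<le> C" "\<bar>hermite_fun m2 x\<bar> \<le> D" for x
    using C(1)[of x] D(1)[of x] mult_left_mono[of "exp (- (x\<^sup>2) / 4)" 1 C] mult_left_mono[of "exp (- (x\<^sup>2) / 4)" 1 D] C(2) D(2) by auto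
  show ?thesis
  proof (rule Bochner_Integration.integrable_bound[OF integrable_mult_right[OF integrable_hermite_fun_mult[of m3 m4], of "C * D"]])
    have "\<bar>hermite_fun m1 x * hermite_fun m2 x * hermite_fun m3 x * hermite_fun m4 x\<bar> \<le> C * D * \<bar>hermite_fun m3 x * hermite_fun m4 x\<bar>" for x
      unfolding abs_mult mult.assoc using C1 C(2) D(2)
      by (subst mult.assoc[symmetric], subst (2) mult.assoc[symmetric]) (intro mult_mono; simp)
    then show "AE x in lborel. norm (hermite_fun m1 x * hermite_fun m2 x * hermite_fun m3 x * hermite_fun m4 x) \<le> norm (C * D * (hermite_fun m3 x * hermite_fun m4 x))"
      using C(2) D(2) by (simp add: abs_mult)
  qed measurable
qed

lemma wave4:
  shows "integrable tauM (\<lambda>z. wave m1 z * wave m2 z * cnj (wave m3 z) * cnj (wave m4 z))"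
    and "(LINT z|tauM. wave m1 z * wave m2 z * cnj (wave m3 z) * cnj (wave m4 z))
      = (if m1 + m2 = m3 + m4 then of_real (hermite4 m1 m2 m3 m4) else 0)"
proof -
  define K where "K = int m1 + int m2 - int m3 - int m4"
  let ?h = "\<lambda>x. hermite_fun m1 x * hermite_fun m2 x * hermite_fun m3 x * hermite_fun m4 x"
  have eq: "wave m1 (t, x) * wave m2 (t, x) * cnj (wave m3 (t, x)) * cnj (wave m4 (t, x)) = cis (2 * of_int K * t) * of_real (?h x)" for t x
  proof -
    have "cis (t * (2 * real m1 + 1)) * cis (t * (2 * real m2 + 1)) * cis (- (t * (2 * real m3 + 1))) * cis (- (t * (2 * real m4 + 1)))
      = cis (2 * of_int K * t)"
      unfolding cis_mult by (rule arg_cong[where f=cis]) (simp add: K_def algebra_simps)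
    moreover have "wave m1 (t, x) * wave m2 (t, x) * cnj (wave m3 (t, x)) * cnj (wave m4 (t, x)) =
      (cis (t * (2 * real m1 + 1)) * cis (t * (2 * real m2 + 1)) * cis (- (t * (2 * real m3 + 1))) * cis (- (t * (2 * real m4 + 1)))) * of_real (?h x)"
      by (simp add: wave_def cis_cnj mult_ac)
    ultimately show ?thesis by simp
  qed
  have i0: "integrable tauM (\<lambda>(t, x). 1 * ?h x)"
    by (rule tau.integrable_pair_mult(1)) (simp_all add: integrable_hermite4)
  show i: "integrable tauM (\<lambda>z. wave m1 z * wave m2 z * cnj (wave m3 z) * cnj (wave m4 z))"
  proof (rule Bochner_Integration.integrable_bound[OF i0])
    show "AE z in tauM. norm (wave m1 z * wave m2 z * cnj (wave m3 z) * cnj (wave m4 z)) \<le> norm ((\<lambda>(t, x). 1 * ?h x) z)"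
    proof (rule AE_I2)
      fix z :: "real \<times> real"
      show "norm (wave m1 z * wave m2 z * cnj (wave m3 z) * cnj (wave m4 z)) \<le> norm ((\<lambda>(t, x). 1 * ?h x) z)"
        by (cases z) (simp add: eq norm_mult abs_mult)
    qed
  qed measurable
  have "(LINT z|tauM. wave m1 z * wave m2 z * cnj (wave m3 z) * cnj (wave m4 z))
    = (LINT t|Time. LINT x|lborel. cis (2 * of_int K * t) * of_real (?h x))"
    unfolding tau.integral_fst'[OF i, symmetric] eq ..
  also have "\<dots> = (LINT t|Time. cis (2 * of_int K * t)) * of_real (hermite4 m1 m2 m3 m4)"
    by (simp only: integral_mult_right_zero integral_mult_left_zero integral_complex_of_real hermite4_def)
  also have "\<dots> = (if m1 + m2 = m3 + m4 then of_real (hermite4 m1 m2 m3 m4) else 0)"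
  proof (cases "even K")
    case True
    then obtain k where k: "K = 2 * k" by blast
    have "(LINT t|Time. cis (2 * of_int K * t)) = (if k = 0 then 1 else 0)"
      using integral_Time_cis[of k] by (simp add: k)
    moreover have "k = 0 \<longleftrightarrow> m1 + m2 = m3 + m4" using k by (auto simp: K_def)
    ultimately show ?thesis by simp
  next
    case False
    have "K = int (m1 + m2 + m3 + m4) - 2 * int (m3 + m4)" by (simp add: K_def)
    then have "odd (int (m1 + m2 + m3 + m4))" using False by presburger
    then have "odd (m1 + m2 + m3 + m4)" by (metis even_of_nat)
    from hermite4_odd[OF this] show ?thesis by simp
  qed
  finally show "(LINT z|tauM. wave m1 z * wave m2 z * cnj (wave m3 z) * cnj (wave m4 z))
      = (if m1 + m2 = m3 + m4 then of_real (hermite4 m1 m2 m3 m4) else 0)" .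
qed

lemma wave_sum_prod_integrable:
  "integrable tauM (\<lambda>z. wave_sum N c1 z * wave_sum N c2 z * cnj (wave_sum N c3 z) * cnj (wave_sum N c4 z))"
proof -
  have eq: "wave_sum N c1 z * wave_sum N c2 z * cnj (wave_sum N c3 z) * cnj (wave_sum N c4 z)
    = (\<Sum>m1<N. \<Sum>m2<N. \<Sum>m3<N. \<Sum>m4<N. (c1 m1 * c2 m2 * cnj (c3 m3) * cnj (c4 m4)) * (wave m1 z * wave m2 z * cnj (wave m3 z) * cnj (wave m4 z)))" for z
    unfolding wave_sum_eq cnj_sum complex_cnj_mult mult.assoc sum_distrib_right
    unfolding sum_distrib_left by (intro sum.cong refl) (simp add: mult_ac)
  show ?thesis unfolding eq
    by (intro Bochner_Integration.integrable_sum integrable_mult_right wave4(1))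
qed

text \<open>Both sides expand over the same quadruples of indices. The selection rule m1 + m2 = m3 +
  m4 comes from the time average on one side and from orthogonality in the rotated variables on the
  other.\<close>

lemma wave_sum_form:
  "4 * (LINT z|tauM. wave_sum N c1 z * wave_sum N c2 z * cnj (wave_sum N c3 z) * cnj (wave_sum N c4 z))
    = of_real (sqrt (8 / pi)) * rotform (hermite_sum N c1) (hermite_sum N c2) (hermite_sum N c3) (hermite_sum N c4)"
proof -
  have "4 * (LINT z|tauM. wave_sum N c1 z * wave_sum N c2 z * cnj (wave_sum N c3 z) * cnj (wave_sum N c4 z))
    = 4 * (\<Sum>m1<N. \<Sum>m2<N. \<Sum>m3<N. \<Sum>m4<N. (c1 m1 * c2 m2 * cnj (c3 m3) * cnj (c4 m4)) *
      (LINT z|tauM. wave m1 z * wave m2 z * cnj (wave m3 z) * cnj (wave m4 z)))"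
    unfolding wave_sum_eq cnj_sum complex_cnj_mult by (subst quadrilinear_sum[OF wave4(1)]) (rule refl)
  also have "\<dots> = (\<Sum>m1<N. \<Sum>m2<N. \<Sum>m3<N. \<Sum>m4<N. (c1 m1 * c2 m2 * cnj (c3 m3) * cnj (c4 m4)) *
        (if m1 + m2 = m3 + m4 then of_real (4 * hermite4 m1 m2 m3 m4) else 0))"
    unfolding wave4(2) sum_distrib_left by (intro sum.cong refl) (simp add: mult_ac)
  finally show ?thesis unfolding rotform_hermite_sum .
qed

definition K4 :: real where "K4 = sqrt (8 / pi) / 4"

lemma K4_nonneg [simp]: "K4 \<ge> 0" by (simp add: K4_def)

text \<open>A Strichartz estimate obtained from the identity itself: with four equal arguments the
  space-time form is 4 times the fourth power of the L^4 norm, and Cauchy-Schwarz bounds the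
  rotation form. This accounts for \<open>K4\<close>.\<close>

lemma wave_sum_L4:
  "(\<integral>\<^sup>+z. ennreal ((norm (wave_sum N c z)) ^ 4) \<partial>tauM) \<le> ennreal (K4 * (sqnorm (hermite_sum N c))\<^sup>2)"
proof -
  let ?u = "wave_sum N c"
  have eq: "?u z * ?u z * cnj (?u z) * cnj (?u z) = of_real ((norm (?u z)) ^ 4)" for z
  proof -
    have "?u z * ?u z * cnj (?u z) * cnj (?u z) = (?u z * cnj (?u z)) ^ 2" by (simp add: power2_eq_square)
    also have "\<dots> = of_real (((norm (?u z))\<^sup>2)\<^sup>2)" unfolding complex_norm_square[symmetric] by simp
    finally show ?thesis by (simp add: power_mult[symmetric])
  qed
  have i: "integrable tauM (\<lambda>z. (norm (?u z)) ^ 4)"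
    using wave_sum_prod_integrable[of N c c c c] unfolding eq by (simp only: complex_of_real_integrable_eq)
  have "4 * complex_of_real (LINT z|tauM. (norm (?u z)) ^ 4) = of_real (sqrt (8 / pi)) * rotform (hermite_sum N c) (hermite_sum N c) (hermite_sum N c) (hermite_sum N c)"
    using wave_sum_form[of N c c c c] unfolding eq integral_complex_of_real .
  then have "norm (4 * complex_of_real (LINT z|tauM. (norm (?u z)) ^ 4))
     = sqrt (8 / pi) * norm (rotform (hermite_sum N c) (hermite_sum N c) (hermite_sum N c) (hermite_sum N c))"
    by (simp add: norm_mult)
  also have "\<dots> \<le> sqrt (8 / pi) * sqrt (sqnorm (hermite_sum N c) * sqnorm (hermite_sum N c) * sqnorm (hermite_sum N c) * sqnorm (hermite_sum N c))"
    by (intro mult_left_mono rot_integrable(2)) auto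
  also have "sqrt (sqnorm (hermite_sum N c) * sqnorm (hermite_sum N c) * sqnorm (hermite_sum N c) * sqnorm (hermite_sum N c)) = (sqnorm (hermite_sum N c))\<^sup>2"
  proof -
    have "s * s * s * s = (s\<^sup>2)\<^sup>2" for s :: real by (simp add: power2_eq_square mult_ac)
    then show ?thesis by (simp only: real_sqrt_abs abs_power2)
  qed
  finally have "4 * \<bar>LINT z|tauM. (norm (?u z)) ^ 4\<bar> \<le> sqrt (8 / pi) * (sqnorm (hermite_sum N c))\<^sup>2"
    by (simp add: norm_mult)
  then have "(LINT z|tauM. (norm (?u z)) ^ 4) \<le> K4 * (sqnorm (hermite_sum N c))\<^sup>2"
    by (simp add: K4_def)
  then show ?thesis using i by (subst nn_integral_eq_integral) (auto intro: ennreal_leI)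
qed

lemma summable_evol: "summable (\<lambda>n. (norm (c n))\<^sup>2) \<Longrightarrow> summable (\<lambda>n. (norm (evol t c n))\<^sup>2)"
  by simp

lemma good_seq_evol: "good_seq c N \<Longrightarrow> good_seq (evol t c) N"
  using good_seq_cong[of "evol t c" c] by simp

text \<open>Fatou carries the estimate from differences of partial sums to the limit.\<close>

lemma wave_series_L4:
  assumes s: "summable (\<lambda>n. (norm (c n))\<^sup>2)" and N: "good_seq c N"
  shows "(\<integral>\<^sup>+z. ennreal ((norm (wave_series N c z - wave_sum M c z)) ^ 4) \<partial>tauM) \<le> ennreal (K4 * (tail c M)\<^sup>2)"
proof -
  let ?f = "\<lambda>k z. ennreal ((norm (wave_sum (N k) c z - wave_sum M c z)) ^ 4)"
  have "(\<integral>\<^sup>+z. ennreal ((norm (wave_series N c z - wave_sum M c z)) ^ 4) \<partial>tauM)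
    = (\<integral>\<^sup>+t. \<integral>\<^sup>+x. ennreal ((norm (wave_series N c (t, x) - wave_sum M c (t, x))) ^ 4) \<partial>lborel \<partial>Time)"
    by (rule lborel.nn_integral_fst[symmetric]) measurable
  also have "\<dots> = (\<integral>\<^sup>+t. \<integral>\<^sup>+x. liminf (\<lambda>k. ?f k (t, x)) \<partial>lborel \<partial>Time)"
  \<comment> \<open>The null set where the series fails to converge depends on t, so the exchange is
    made inside the space integral only.\<close>
  proof (rule nn_integral_cong, rule nn_integral_cong_AE)
    fix t
    show "AE x in lborel. ennreal ((norm (wave_series N c (t, x) - wave_sum M c (t, x))) ^ 4) = liminf (\<lambda>k. ?f k (t, x))"
      using hermite_series_AE[OF summable_evol[OF s, of t] good_seq_evol[OF N, of t]]
    proof eventually_elim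
      case (elim x)
      then have "(\<lambda>k. ?f k (t, x)) \<longlonglongrightarrow> ennreal ((norm (wave_series N c (t, x) - wave_sum M c (t, x))) ^ 4)"
        unfolding wave_series_def wave_sum_def prod.case by (intro tendsto_intros)
      then show ?case by (intro lim_imp_Liminf[symmetric]) auto
    qed
  qed
  also have "\<dots> = (\<integral>\<^sup>+z. liminf (\<lambda>k. ?f k z) \<partial>tauM)"
    by (rule lborel.nn_integral_fst) measurable
  also have "\<dots> \<le> liminf (\<lambda>k. \<integral>\<^sup>+z. ?f k z \<partial>tauM)"
    by (rule nn_integral_liminf) measurable
  also have "\<dots> \<le> ennreal (K4 * (tail c M)\<^sup>2)"
  proof (rule Liminf_le)
    show "\<forall>\<^sub>F k in sequentially. (\<integral>\<^sup>+z. ?f k z \<partial>tauM) \<le> ennreal (K4 * (tail c M)\<^sup>2)"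
      using eventually_ge_at_top[of M]
    proof eventually_elim
      case (elim k)
      then have MN: "M \<le> N k" using good_seq_ge[OF N, of k] by linarith
      \<comment> \<open>Deleting the first M coefficients exhibits a difference of two partial sums
        as a single partial sum, to which \<open>wave_sum_L4\<close> applies.\<close>
      define d where "d n = (if n < M then 0 else c n)" for n
      have split: "(\<Sum>n<N k. g n) = (\<Sum>n<M. g n) + (\<Sum>n<N k. if n < M then 0 else g n)" for g :: "nat \<Rightarrow> complex"
      proof -
        have "(\<Sum>n<N k. g n) = (\<Sum>n<N k. (if n < M then g n else 0) + (if n < M then 0 else g n))"
          by (intro sum.cong) auto
        also have "(\<Sum>n<N k. if n < M then g n else 0) = (\<Sum>n<M. g n)"
          using MN by (intro sum.mono_neutral_cong_right) auto
        then have "(\<Sum>n<N k. (if n < M then g n else 0) + (if n < M then 0 else g n)) = (\<Sum>n<M. g n) + (\<Sum>n<N k. if n < M then 0 else g n)"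
          by (simp add: sum.distrib)
        finally show ?thesis .
      qed
      have w: "wave_sum (N k) c z - wave_sum M c z = wave_sum (N k) d z" for z
        unfolding wave_sum_eq split[of "\<lambda>n. c n * wave n z"] by (simp add: d_def if_distrib[of "\<lambda>c. c * _"] cong: if_cong)
      have h: "hermite_sum (N k) c x - hermite_sum M c x = hermite_sum (N k) d x" for x
        unfolding hermite_sum_def split[of "\<lambda>n. c n * of_real (hermite_fun n x)"] by (simp add: d_def if_distrib[of "\<lambda>c. c * _"] cong: if_cong)
      have "sqnorm (hermite_sum (N k) d) \<le> tail c M"
        using sqnorm_hermite_sum_diff[OF s MN] unfolding h .
      then have "K4 * (sqnorm (hermite_sum (N k) d))\<^sup>2 \<le> K4 * (tail c M)\<^sup>2"
        by (intro mult_left_mono power_mono) auto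
      then show ?case unfolding w using wave_sum_L4[of "N k" d] by (meson ennreal_leI order_trans)
    qed
  qed simp
  finally show ?thesis .
qed

text \<open>Cauchy-Schwarz twice, in pairs. The fourth powers are bounded by K a^2, so that a again
  behaves like a squared L^2 norm and \<open>quadrilinear_limit\<close> fits.\<close>

lemma nn_integral_Holder4:
  fixes f1 f2 f3 f4 :: "'a \<Rightarrow> complex"
  assumes m [measurable]: "f1 \<in> borel_measurable M" "f2 \<in> borel_measurable M" "f3 \<in> borel_measurable M" "f4 \<in> borel_measurable M"
    and f: "(\<integral>\<^sup>+z. ennreal ((norm (f1 z)) ^ 4) \<partial>M) \<le> ennreal (K * a1\<^sup>2)" "(\<integral>\<^sup>+z. ennreal ((norm (f2 z)) ^ 4) \<partial>M) \<le> ennreal (K * a2\<^sup>2)"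
      "(\<integral>\<^sup>+z. ennreal ((norm (f3 z)) ^ 4) \<partial>M) \<le> ennreal (K * a3\<^sup>2)" "(\<integral>\<^sup>+z. ennreal ((norm (f4 z)) ^ 4) \<partial>M) \<le> ennreal (K * a4\<^sup>2)"
    and pos: "K \<ge> 0" "a1 \<ge> 0" "a2 \<ge> 0" "a3 \<ge> 0" "a4 \<ge> 0"
  shows "(\<integral>\<^sup>+z. ennreal (norm (f1 z * f2 z * f3 z * f4 z)) \<partial>M) \<le> ennreal (K * sqrt (a1 * a2 * a3 * a4))"
proof -
  have p: "(\<integral>\<^sup>+z. ennreal ((norm (g1 z) * norm (g2 z))\<^sup>2) \<partial>M) \<le> ennreal (K * (b1 * b2))"
    if [measurable]: "g1 \<in> borel_measurable M" "g2 \<in> borel_measurable M"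
      and g: "(\<integral>\<^sup>+z. ennreal ((norm (g1 z)) ^ 4) \<partial>M) \<le> ennreal (K * b1\<^sup>2)" "(\<integral>\<^sup>+z. ennreal ((norm (g2 z)) ^ 4) \<partial>M) \<le> ennreal (K * b2\<^sup>2)"
      and b: "b1 \<ge> 0" "b2 \<ge> 0" for g1 g2 :: "'a \<Rightarrow> complex" and b1 b2
  proof -
    have e: "(r\<^sup>2)\<^sup>2 = r ^ 4" for r :: real by (simp add: power_mult[symmetric])
    have "(\<integral>\<^sup>+z. ennreal ((norm (g1 z))\<^sup>2 * (norm (g2 z))\<^sup>2) \<partial>M) \<le> ennreal (sqrt ((K * b1\<^sup>2) * (K * b2\<^sup>2)))"
      using g pos by (intro nn_integral_CS) (auto simp: e)
    also have "sqrt ((K * b1\<^sup>2) * (K * b2\<^sup>2)) = K * (b1 * b2)"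
    proof -
      have "(K * b1\<^sup>2) * (K * b2\<^sup>2) = (K * (b1 * b2))\<^sup>2" by (simp add: power2_eq_square)
      then show ?thesis using pos b by (simp add: real_sqrt_abs)
    qed
    finally show ?thesis by (simp add: power_mult_distrib)
  qed
  have "(\<integral>\<^sup>+z. ennreal ((norm (f1 z) * norm (f2 z)) * (norm (f3 z) * norm (f4 z))) \<partial>M) \<le> ennreal (sqrt ((K * (a1 * a2)) * (K * (a3 * a4))))"
    using pos by (intro nn_integral_CS p f m) auto
  also have "sqrt ((K * (a1 * a2)) * (K * (a3 * a4))) = K * sqrt (a1 * a2 * a3 * a4)"
  proof -
    have "(K * (a1 * a2)) * (K * (a3 * a4)) = K\<^sup>2 * (a1 * a2 * a3 * a4)" by (simp add: power2_eq_square)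
    then show ?thesis using pos by (simp add: real_sqrt_mult)
  qed
  finally show ?thesis by (simp add: norm_mult mult.assoc)
qed

text \<open>Both sides are limits of truncated expansions, for which \<open>wave_sum_form\<close>
  holds. The left side converges by the L^4 estimates, the right side by the L^2 bound of the
  rotation form.\<close>

lemma wave_form_identity:
  assumes f: "f1 \<in> L2" "f2 \<in> L2" "f3 \<in> L2" "f4 \<in> L2"
    and N: "good_seq (coef f1) N1" "good_seq (coef f2) N2" "good_seq (coef f3) N3" "good_seq (coef f4) N4"
  shows "integrable tauM (\<lambda>z. wave_series N1 (coef f1) z * wave_series N2 (coef f2) z * cnj (wave_series N3 (coef f3) z) * cnj (wave_series N4 (coef f4) z))"
    and "4 * (LINT z|tauM. wave_series N1 (coef f1) z * wave_series N2 (coef f2) z * cnj (wave_series N3 (coef f3) z) * cnj (wave_series N4 (coef f4) z))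
      = of_real (sqrt (8 / pi)) * rotform f1 f2 f3 f4"
proof -
  define Q where "Q h a \<longleftrightarrow> h \<in> borel_measurable tauM \<and> (\<integral>\<^sup>+z. ennreal ((norm (h z)) ^ 4) \<partial>tauM) \<le> ennreal (K4 * a\<^sup>2)"
    for h :: "real \<times> real \<Rightarrow> complex" and a
  have Qc: "Q (\<lambda>z. cnj (h z)) a" if "Q h a" for h a using that by (auto simp: Q_def intro: borel_measurable_cnj)
  have t0: "tail (coef g) 0 = sqnorm g" if "g \<in> L2" for g using Parseval[OF that] by (simp add: tail_def)
  have w0: "wave_sum 0 c z = 0" for c z by (simp add: wave_sum_eq)
  have Q1: "Q (wave_series N (coef g)) (sqnorm g)" if "g \<in> L2" "good_seq (coef g) N" for g N
    using wave_series_L4[OF coef_summable[OF that(1)] that(2), of 0] t0[OF that(1)] by (simp add: Q_def w0)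
  have Q2: "Q (wave_sum M (coef g)) (sqnorm g)" if "g \<in> L2" for g M
  proof -
    have "K4 * (sqnorm (hermite_sum M (coef g)))\<^sup>2 \<le> K4 * (sqnorm g)\<^sup>2"
      using that by (intro mult_left_mono power_mono sqnorm_partial_le) auto
    then show ?thesis unfolding Q_def using wave_sum_L4[of M "coef g"] by (auto intro: order_trans[OF _ ennreal_leI])
  qed
  have Q3: "Q (\<lambda>z. wave_series N (coef g) z - wave_sum M (coef g) z) (tail (coef g) M)" if "g \<in> L2" "good_seq (coef g) N" for g N M
    using wave_series_L4[OF coef_summable[OF that(1)] that(2), of M] by (simp add: Q_def)
  have Q3': "Q (\<lambda>z. cnj (wave_series N (coef g) z) - cnj (wave_sum M (coef g) z)) (tail (coef g) M)" if "g \<in> L2" "good_seq (coef g) N" for g N M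
    using Qc[OF Q3[OF that]] by simp
  have bnd: "(\<lambda>x. h1 x * h2 x * h3 x * h4 x) \<in> borel_measurable tauM \<and>
        (\<integral>\<^sup>+x. ennreal (norm (h1 x * h2 x * h3 x * h4 x)) \<partial>tauM) \<le> ennreal (K4 * sqrt (a1 * a2 * a3 * a4))"
    if "Q h1 a1" "Q h2 a2" "Q h3 a3" "Q h4 a4" "a1 \<ge> 0" "a2 \<ge> 0" "a3 \<ge> 0" "a4 \<ge> 0" for h1 h2 h3 h4 a1 a2 a3 a4
    using that unfolding Q_def by (intro conjI borel_measurable_times nn_integral_Holder4) auto
  note QL = quadrilinear_limit[where ?Q1.0=Q and ?Q2.0=Q and ?Q3.0=Q and ?Q4.0=Q and K=K4 and M=tauM
      and ?a1.0="sqnorm f1" and ?a2.0="sqnorm f2" and ?a3.0="sqnorm f3" and ?a4.0="sqnorm f4"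
      and ?d1.0="tail (coef f1)" and ?d2.0="tail (coef f2)" and ?d3.0="tail (coef f3)" and ?d4.0="tail (coef f4)"
      and ?u1.0="wave_series N1 (coef f1)" and ?u2.0="wave_series N2 (coef f2)" and ?u3.0="\<lambda>z. cnj (wave_series N3 (coef f3) z)" and ?u4.0="\<lambda>z. cnj (wave_series N4 (coef f4) z)"
      and ?v1.0="\<lambda>N. wave_sum N (coef f1)" and ?v2.0="\<lambda>N. wave_sum N (coef f2)"
      and ?v3.0="\<lambda>N z. cnj (wave_sum N (coef f3) z)" and ?v4.0="\<lambda>N z. cnj (wave_sum N (coef f4) z)",
      OF bnd K4_nonneg sqnorm_nonneg sqnorm_nonneg sqnorm_nonneg sqnorm_nonneg
      tail_nonneg_L2[OF f(1)] tail_nonneg_L2[OF f(2)] tail_nonneg_L2[OF f(3)] tail_nonneg_L2[OF f(4)]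
      tail_tendsto_L2[OF f(1)] tail_tendsto_L2[OF f(2)] tail_tendsto_L2[OF f(3)] tail_tendsto_L2[OF f(4)]
      Q1[OF f(1) N(1)] Q1[OF f(2) N(2)] Qc[OF Q1[OF f(3) N(3)]] Qc[OF Q1[OF f(4) N(4)]]
      Q2[OF f(1)] Q2[OF f(2)] Qc[OF Q2[OF f(3)]] Qc[OF Q2[OF f(4)]]
      Q3[OF f(1) N(1)] Q3[OF f(2) N(2)] Q3'[OF f(3) N(3)] Q3'[OF f(4) N(4)]]
  show "integrable tauM (\<lambda>z. wave_series N1 (coef f1) z * wave_series N2 (coef f2) z * cnj (wave_series N3 (coef f3) z) * cnj (wave_series N4 (coef f4) z))"
    by (rule QL(1))
  have "(\<lambda>N. 4 * (LINT z|tauM. wave_sum N (coef f1) z * wave_sum N (coef f2) z * cnj (wave_sum N (coef f3) z) * cnj (wave_sum N (coef f4) z)))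
     \<longlonglongrightarrow> 4 * (LINT z|tauM. wave_series N1 (coef f1) z * wave_series N2 (coef f2) z * cnj (wave_series N3 (coef f3) z) * cnj (wave_series N4 (coef f4) z))"
    by (intro tendsto_mult_left QL(2))
  moreover have "(\<lambda>N. 4 * (LINT z|tauM. wave_sum N (coef f1) z * wave_sum N (coef f2) z * cnj (wave_sum N (coef f3) z) * cnj (wave_sum N (coef f4) z)))
     \<longlonglongrightarrow> of_real (sqrt (8 / pi)) * rotform f1 f2 f3 f4"
    unfolding wave_sum_form by (intro tendsto_mult_left rotform_limit f)
  ultimately show "4 * (LINT z|tauM. wave_series N1 (coef f1) z * wave_series N2 (coef f2) z * cnj (wave_series N3 (coef f3) z) * cnj (wave_series N4 (coef f4) z))
      = of_real (sqrt (8 / pi)) * rotform f1 f2 f3 f4"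
    by (rule LIMSEQ_unique)
qed

section \<open>Almost-everywhere representatives\<close>

lemma lebesgue_borel_rep:
  fixes f :: "real \<Rightarrow> complex"
  assumes "f \<in> borel_measurable lebesgue"
  shows "\<exists>g\<in>borel_measurable borel. AE x in lborel. f x = g x"
proof -
  have "(\<lambda>x. Re (f x)) \<in> borel_measurable (completion lborel)" "(\<lambda>x. Im (f x)) \<in> borel_measurable (completion lborel)"
    using assms by measurable
  from this[THEN completion_ex_borel_measurable_real] obtain a b where
    [measurable]: "a \<in> borel_measurable borel" "b \<in> borel_measurable borel"
    and ae: "AE x in lborel. Re (f x) = a x" "AE x in lborel. Im (f x) = b x" by auto
  show ?thesis
  proof (rule bexI[where x="\<lambda>x. of_real (a x) + \<i> * of_real (b x)"])
    show "AE x in lborel. f x = of_real (a x) + \<i> * of_real (b x)"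
      using ae by eventually_elim (metis complex_eq)
  qed measurable
qed

lemma measurable_lebesgueI [intro]: "f \<in> borel_measurable borel \<Longrightarrow> f \<in> borel_measurable lebesgue"
  by (rule measurable_completion) simp

lemma measurable_lebesgue_AE:
  fixes f :: "real \<Rightarrow> complex"
  assumes "g \<in> borel_measurable borel" "AE x in lborel. f x = g x"
  shows "f \<in> borel_measurable lebesgue"
  using assms by (intro borel_measurable_AE[of g f] measurable_lebesgueI) (auto simp: AE_completion_iff elim: AE_mp)

lemma integral_lebesgue_AE:
  fixes f g :: "real \<Rightarrow> 'b::{banach, second_countable_topology}"
  assumes "g \<in> borel_measurable borel" "f \<in> borel_measurable lebesgue" "AE x in lborel. f x = g x"
  shows "integrable lebesgue f = integrable lborel g" "integral\<^sup>L lebesgue f = integral\<^sup>L lborel g"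
proof -
  have ae: "AE x in lebesgue. f x = g x" using assms(3) by (rule AE_completion)
  have gm: "g \<in> borel_measurable lebesgue" using assms(1) by auto
  show "integrable lebesgue f = integrable lborel g"
    using integrable_cong_AE[OF assms(2) gm ae] integrable_completion[of g lborel] assms(1) by simp
  show "integral\<^sup>L lebesgue f = integral\<^sup>L lborel g"
    using integral_cong_AE[OF assms(2) gm ae] integral_completion[of g lborel] assms(1) by simp
qed

lemma Lp_AE:
  assumes g [measurable]: "g \<in> borel_measurable borel" and ae: "AE x in lborel. f x = g x"
  shows "f \<in> Lp_space p \<longleftrightarrow> integrable lborel (\<lambda>x. norm (g x) powr p)"
    and "Lp_norm p f = (LINT x|lborel. norm (g x) powr p) powr (1 / p)"
proof -
  have [measurable]: "f \<in> borel_measurable lebesgue" by (rule measurable_lebesgue_AE[OF assms])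
  have m: "(\<lambda>x. norm (g x) powr p) \<in> borel_measurable borel" "(\<lambda>x. norm (f x) powr p) \<in> borel_measurable lebesgue"
    by measurable
  have a: "AE x in lborel. norm (f x) powr p = norm (g x) powr p" using ae by eventually_elim simp
  show "f \<in> Lp_space p \<longleftrightarrow> integrable lborel (\<lambda>x. norm (g x) powr p)"
    using integral_lebesgue_AE(1)[OF m a] by (simp add: Lp_space_def)
  show "Lp_norm p f = (LINT x|lborel. norm (g x) powr p) powr (1 / p)"
    using integral_lebesgue_AE(2)[OF m a] by (simp add: Lp_norm_def)
qed

lemma Lp2_AE:
  assumes g: "g \<in> borel_measurable borel" and ae: "AE x in lborel. f x = g x"
  shows "f \<in> Lp_space 2 \<longleftrightarrow> g \<in> L2" "Lp_norm 2 f = sqrt (sqnorm g)"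
  using Lp_AE[OF assms, of 2] assms(1)
  by (simp_all add: L2_def sqnorm_def powr_half_sqrt)

lemma Lp2_rep:
  assumes "f \<in> Lp_space 2"
  obtains g where "g \<in> L2" "AE x in lborel. f x = g x"
proof -
  have "f \<in> borel_measurable lebesgue" using assms by (simp add: Lp_space_def)
  then obtain g where g: "g \<in> borel_measurable borel" "AE x in lborel. f x = g x"
    using lebesgue_borel_rep by blast
  then show thesis using Lp2_AE(1)[OF g] assms by (intro that) auto
qed

lemma L2_inner_AE:
  assumes [measurable]: "f' \<in> borel_measurable borel" "g' \<in> borel_measurable borel"
    and "AE x in lborel. f x = f' x" "AE x in lborel. g x = g' x"
  shows "L2_inner f g = (LINT x|lborel. f' x * cnj (g' x))"
proof -
  have [measurable]: "f \<in> borel_measurable lebesgue" "g \<in> borel_measurable lebesgue"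
    using measurable_lebesgue_AE[OF assms(1,3)] measurable_lebesgue_AE[OF assms(2,4)] by auto
  show ?thesis
    unfolding L2_inner_def
  proof (rule integral_lebesgue_AE(2))
    show "AE x in lborel. f x * cnj (g x) = f' x * cnj (g' x)"
      using assms(3,4) by eventually_elim simp
  qed measurable
qed

section \<open>The propagator and the four-linear form on representatives\<close>

lemma L2_inner_hermite:
  assumes "f' \<in> borel_measurable borel" "AE x in lborel. f x = f' x"
  shows "L2_inner f (\<lambda>y. of_real (hermite_fun n y)) = coef f' n"
  using L2_inner_AE[OF assms(1) _ assms(2), of "\<lambda>y. of_real (hermite_fun n y)" "\<lambda>y. of_real (hermite_fun n y)"]
  by (simp add: coef_def)

lemma propagator_partial_eq:
  assumes "f' \<in> borel_measurable borel" "AE x in lborel. f x = f' x"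
  shows "propagator_partial N t f = hermite_sum N (evol t (coef f'))"
  by (intro ext) (simp add: propagator_partial_def L2_inner_hermite[OF assms] hermite_sum_def evol_def)

lemma sqnorm_triangle: "f \<in> L2 \<Longrightarrow> g \<in> L2 \<Longrightarrow> h \<in> L2 \<Longrightarrow>
  sqnorm (\<lambda>x. f x - g x) \<le> 2 * sqnorm (\<lambda>x. f x - h x) + 2 * sqnorm (\<lambda>x. g x - h x)"
proof -
  assume f: "f \<in> L2" and g: "g \<in> L2" and h: "h \<in> L2"
  have i: "integrable lborel (\<lambda>x. (norm (f x - h x))\<^sup>2)" "integrable lborel (\<lambda>x. (norm (g x - h x))\<^sup>2)" "integrable lborel (\<lambda>x. (norm (f x - g x))\<^sup>2)"
    using f g h by (auto intro!: L2_integrable)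
  have "sqnorm (\<lambda>x. f x - g x) \<le> (LINT x|lborel. 2 * (norm (f x - h x))\<^sup>2 + 2 * (norm (g x - h x))\<^sup>2)"
    unfolding sqnorm_def
  proof (rule integral_mono)
    fix x
    show "(norm (f x - g x))\<^sup>2 \<le> 2 * (norm (f x - h x))\<^sup>2 + 2 * (norm (g x - h x))\<^sup>2"
      using norm_add_sq_le[of "f x - h x" "h x - g x"] by (simp add: norm_minus_commute)
  qed (use i in auto)
  also have "\<dots> = 2 * sqnorm (\<lambda>x. f x - h x) + 2 * sqnorm (\<lambda>x. g x - h x)"
    unfolding sqnorm_def using i by simp
  finally show ?thesis .
qed

lemma sqnorm_eq_0_AE:
  assumes "f \<in> L2" "sqnorm f = 0" shows "AE x in lborel. f x = 0"
proof -
  have "AE x in lborel. (norm (f x))\<^sup>2 = 0"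
    using assms integral_nonneg_eq_0_iff_AE[OF L2_integrable[OF assms(1)]] by (simp add: sqnorm_def)
  then show ?thesis by simp
qed

lemma L2_limit_unique:
  assumes u: "u \<in> L2" and v: "v \<in> L2" and S: "\<And>n. S n \<in> L2" and F: "F \<noteq> bot"
    and lu: "((\<lambda>n. sqnorm (\<lambda>x. u x - S n x)) \<longlongrightarrow> 0) F" and lv: "((\<lambda>n. sqnorm (\<lambda>x. v x - S n x)) \<longlongrightarrow> 0) F"
  shows "AE x in lborel. u x = v x"
proof -
  have "((\<lambda>n. 2 * sqnorm (\<lambda>x. u x - S n x) + 2 * sqnorm (\<lambda>x. v x - S n x)) \<longlongrightarrow> 2 * 0 + 2 * 0) F"
    by (intro tendsto_intros lu lv)
  then have "sqnorm (\<lambda>x. u x - v x) \<le> 2 * 0 + 2 * 0"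
    by (rule tendsto_lowerbound) (use F in \<open>auto intro!: always_eventually sqnorm_triangle u v S\<close>)
  then have "sqnorm (\<lambda>x. u x - v x) = 0"
    using sqnorm_nonneg[of "\<lambda>x. u x - v x"] by linarith
  then have "AE x in lborel. u x - v x = 0"
    using u v by (intro sqnorm_eq_0_AE) auto
  then show ?thesis by simp
qed

text \<open>Serves both objects that are chosen as L^2 limits: the propagator, along the natural
  numbers, and the Fourier transform, along real cut-offs tending to infinity; hence the general
  filter. Uniqueness of limits makes the choice harmless.\<close>

lemma L2_limit_AE:
  assumes S: "\<And>n. S n \<in> L2" and F: "F \<noteq> bot"
    and v: "v \<in> L2" "((\<lambda>n. sqnorm (\<lambda>x. v x - S n x)) \<longlongrightarrow> 0) F"
    and u: "u = (SOME u. u \<in> Lp_space 2 \<and> ((\<lambda>n. Lp_norm 2 (\<lambda>x. u x - S n x)) \<longlongrightarrow> 0) F)"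
  shows "u \<in> Lp_space 2 \<and> (AE x in lborel. u x = v x)"
proof -
  have eq: "Lp_norm 2 (\<lambda>x. w x - S n x) = sqrt (sqnorm (\<lambda>x. w' x - S n x))" if "w' \<in> L2" "AE x in lborel. w x = w' x" for w w' n
  proof (rule Lp2_AE(2))
    show "(\<lambda>x. w' x - S n x) \<in> borel_measurable borel"
      using L2_diff[OF that(1) S] by (rule L2_measurable)
    show "AE x in lborel. w x - S n x = w' x - S n x" using that(2) by eventually_elim simp
  qed
  define P where "P w \<longleftrightarrow> w \<in> Lp_space 2 \<and> ((\<lambda>n. Lp_norm 2 (\<lambda>x. w x - S n x)) \<longlongrightarrow> 0) F" for w
  have "P v"
    unfolding P_def
  proof
    show "v \<in> Lp_space 2" using Lp2_AE(1)[of v v] v(1) by auto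
    show "((\<lambda>n. Lp_norm 2 (\<lambda>x. v x - S n x)) \<longlongrightarrow> 0) F"
      using tendsto_real_sqrt[OF v(2)] by (simp add: eq[OF v(1)])
  qed
  then have "P (SOME w. P w)" by (rule someI[of P v])
  then have "P u" unfolding u P_def .
  then have "u \<in> Lp_space 2 \<and> ((\<lambda>n. Lp_norm 2 (\<lambda>x. u x - S n x)) \<longlongrightarrow> 0) F" by (simp only: P_def)
  then have u1: "u \<in> Lp_space 2" and u2: "((\<lambda>n. Lp_norm 2 (\<lambda>x. u x - S n x)) \<longlongrightarrow> 0) F" by auto
  obtain u' where u': "u' \<in> L2" "AE x in lborel. u x = u' x" using Lp2_rep[OF u1] by blast
  have "((\<lambda>n. (sqrt (sqnorm (\<lambda>x. u' x - S n x)))\<^sup>2) \<longlongrightarrow> 0\<^sup>2) F"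
    using u2 unfolding eq[OF u'] by (rule tendsto_power)
  then have "((\<lambda>n. sqnorm (\<lambda>x. u' x - S n x)) \<longlongrightarrow> 0) F" by simp
  from L2_limit_unique[OF u'(1) v(1) S F this v(2)] u'(2) have "AE x in lborel. u x = v x"
    by eventually_elim simp
  then show ?thesis using u1 by simp
qed

lemma propagator_AE:
  assumes f: "f' \<in> L2" "AE x in lborel. f x = f' x" and N: "good_seq (coef f') N"
  shows "propagator t f \<in> Lp_space 2 \<and> (AE x in lborel. propagator t f x = hermite_series N (evol t (coef f')) x)"
proof (rule L2_limit_AE)
  note s = summable_evol[OF coef_summable[OF f(1)], of t]
  note h = hermite_series_L2[OF s good_seq_evol[OF N, of t]]
  show "propagator t f = (SOME u. u \<in> Lp_space 2 \<and> (\<lambda>N. Lp_norm 2 (\<lambda>x. u x - hermite_sum N (evol t (coef f')) x)) \<longlonglongrightarrow> 0)"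
    unfolding propagator_def propagator_partial_eq[OF L2_measurable[OF f(1)] f(2)] ..
  show "hermite_series N (evol t (coef f')) \<in> L2" by (rule h)
  show "(\<lambda>n. sqnorm (\<lambda>x. hermite_series N (evol t (coef f')) x - hermite_sum n (evol t (coef f')) x)) \<longlonglongrightarrow> 0"
    by (rule tendsto_sandwich[OF _ _ tendsto_const tail_tendsto[OF s]]) (auto intro!: always_eventually h(2))
qed auto

text \<open>At each fixed time the chosen propagated functions are exchanged for the jointly
  measurable \<open>wave_series\<close> inside the space integral; only then can the iterated
  integral become one over the product measure.\<close>

lemma T4_form_eq:
  assumes f: "f1' \<in> L2" "f2' \<in> L2" "f3' \<in> L2" "f4' \<in> L2"
    and ae: "AE x in lborel. f1 x = f1' x" "AE x in lborel. f2 x = f2' x" "AE x in lborel. f3 x = f3' x" "AE x in lborel. f4 x = f4' x"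
  shows "\<T>4_form f1 f2 f3 f4 = of_real (sqrt (8 / pi)) * rotform f1' f2' f3' f4'"
proof -
  obtain N1 N2 N3 N4 where N: "good_seq (coef f1') N1" "good_seq (coef f2') N2" "good_seq (coef f3') N3" "good_seq (coef f4') N4"
    using good_seq_exists[OF coef_summable[OF f(1)]] good_seq_exists[OF coef_summable[OF f(2)]]
      good_seq_exists[OF coef_summable[OF f(3)]] good_seq_exists[OF coef_summable[OF f(4)]] by blast
  define W where "W z = wave_series N1 (coef f1') z * wave_series N2 (coef f2') z * cnj (wave_series N3 (coef f3') z) * cnj (wave_series N4 (coef f4') z)" for z
  have [measurable]: "W \<in> borel_measurable (borel \<Otimes>\<^sub>M borel)" unfolding W_def[abs_def] by measurable
  note p = propagator_AE[OF f(1) ae(1) N(1)] propagator_AE[OF f(2) ae(2) N(2)] propagator_AE[OF f(3) ae(3) N(3)] propagator_AE[OF f(4) ae(4) N(4)]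
  have [measurable]: "propagator t f1 \<in> borel_measurable lebesgue" "propagator t f2 \<in> borel_measurable lebesgue"
    "propagator t f3 \<in> borel_measurable lebesgue" "propagator t f4 \<in> borel_measurable lebesgue" for t
    using p[of t] by (auto simp: Lp_space_def)
  have x: "(LINT x|lebesgue. propagator t f1 x * propagator t f2 x * cnj (propagator t f3 x * propagator t f4 x)) = (LINT x|lborel. W (t, x))" for t
  proof (rule integral_lebesgue_AE(2))
    show "AE x in lborel. propagator t f1 x * propagator t f2 x * cnj (propagator t f3 x * propagator t f4 x) = W (t, x)"
      using p[of t, THEN conjunct2] by eventually_elim (simp add: W_def wave_series_def)
  qed measurable
  have [measurable]: "(\<lambda>t. LINT x|lborel. W (t, x)) \<in> borel_measurable borel" by measurable
  have "(LINT t:{0..pi/2}|lebesgue. LINT x|lborel. W (t, x)) = (LINT t:{0..pi/2}|lborel. LINT x|lborel. W (t, x))"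
    unfolding set_lebesgue_integral_def by (rule integral_completion) measurable
  then have "\<T>4_form f1 f2 f3 f4 = 4 * (of_real (2 / pi) * (LINT t:{0..pi/2}|lborel. LINT x|lborel. W (t, x)))"
    unfolding \<T>4_form_def x by simp
  also have "\<dots> = 4 * (LINT t|Time. LINT x|lborel. W (t, x))"
    by (subst integral_Time) auto
  also have "\<dots> = 4 * (LINT z|tauM. W z)"
    using wave_form_identity(1)[OF f N] unfolding W_def[symmetric] by (subst tau.integral_fst') auto
  also have "\<dots> = of_real (sqrt (8 / pi)) * rotform f1' f2' f3' f4'"
    using wave_form_identity(2)[OF f N] unfolding W_def[symmetric] .
  finally show ?thesis .
qed

section \<open>The kernel representation\<close>

text \<open>The form with the factor of g removed and x kept fixed: the candidate for the operator
  itself.\<close>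

definition rotop :: "(real \<Rightarrow> complex) \<Rightarrow> (real \<Rightarrow> complex) \<Rightarrow> (real \<Rightarrow> complex) \<Rightarrow> real \<Rightarrow> complex" where
  "rotop f1 f2 f3 x = of_real (sqrt (8 / pi)) * (LINT w|nu. rot1 f1 (x, w) * rot2 f2 (x, w) * rot3 f3 (x, w))"

lemma measurable_rotop [measurable]:
  assumes [measurable]: "f1 \<in> borel_measurable borel" "f2 \<in> borel_measurable borel" "f3 \<in> borel_measurable borel"
  shows "rotop f1 f2 f3 \<in> borel_measurable borel"
proof -
  have [measurable]: "(\<lambda>z. rot1 f1 z * rot2 f2 z * rot3 f3 z) \<in> borel_measurable (lborel \<Otimes>\<^sub>M nu)"
    unfolding mu_def[symmetric] by measurable
  show ?thesis unfolding rotop_def[abs_def] by measurable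
qed

lemma norm_rotop_le:
  "ennreal (norm (rotop f1 f2 f3 x)) \<le> ennreal (sqrt (8 / pi)) * (\<integral>\<^sup>+w. ennreal (norm (rot1 f1 (x, w) * rot2 f2 (x, w) * rot3 f3 (x, w))) \<partial>nu)"
proof -
  have "ennreal (norm (LINT w|nu. rot1 f1 (x, w) * rot2 f2 (x, w) * rot3 f3 (x, w)))
    \<le> (\<integral>\<^sup>+w. ennreal (norm (rot1 f1 (x, w) * rot2 f2 (x, w) * rot3 f3 (x, w))) \<partial>nu)"
    \<comment> \<open>Where the integral diverges, the Bochner integral takes the default value 0,
      which respects the bound as well.\<close>
    by (cases "integrable nu (\<lambda>w. rot1 f1 (x, w) * rot2 f2 (x, w) * rot3 f3 (x, w))")
      (auto intro: integral_norm_bound_ennreal simp: not_integrable_integral_eq)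
  then show ?thesis
    unfolding rotop_def norm_mult by (simp add: ennreal_mult mult_left_mono)
qed

text \<open>Positive majorant of \<open>rotop\<close>. The Gaussian at \<open>rc\<close> becomes a
  free slot P, so that a weight can be moved onto it.\<close>

definition Sop :: "(real \<Rightarrow> real) \<Rightarrow> (real \<Rightarrow> real) \<Rightarrow> (real \<Rightarrow> real) \<Rightarrow> (real \<Rightarrow> real) \<Rightarrow> real \<Rightarrow> ennreal" where
  "Sop A B P C x = (\<integral>\<^sup>+(\<theta>, y, c). ennreal (A (rx x \<theta> y c) * B (ry x \<theta> y c) * P (rc x \<theta> y c) * (C y * hermite_fun 0 c)) \<partial>nu)"

lemma hermite_fun_0_nonneg [simp]: "hermite_fun 0 x \<ge> 0"
  by (simp add: hermite_fun_def)

lemma measurable_Sop [measurable]: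
  assumes [measurable]: "A \<in> borel_measurable borel" "B \<in> borel_measurable borel" "P \<in> borel_measurable borel" "C \<in> borel_measurable borel"
  shows "Sop A B P C \<in> borel_measurable borel"
  unfolding Sop_def[abs_def] by measurable

definition nsq :: "(real \<Rightarrow> real) \<Rightarrow> ennreal" where "nsq A = (\<integral>\<^sup>+x. ennreal ((A x)\<^sup>2) \<partial>lborel)"

text \<open>Cauchy-Schwarz at fixed x against the unrotated factor, whose square integral does not
  depend on x. What remains is an integral over all four variables, where rotation invariance
  applies.\<close>

lemma Sop_sq_bound:
  assumes [measurable]: "A \<in> borel_measurable borel" "B \<in> borel_measurable borel" "P \<in> borel_measurable borel" "C \<in> borel_measurable borel"
    and pos: "\<And>x. A x \<ge> 0" "\<And>x. B x \<ge> 0" "\<And>x. P x \<ge> 0" "\<And>x. C x \<ge> 0"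
  shows "(\<integral>\<^sup>+x. (Sop A B P C x)\<^sup>2 \<partial>lborel) \<le> nsq A * nsq B * nsq P * nsq C"
proof -
  let ?F = "\<lambda>x (\<theta>, y, c). ennreal (A (rx x \<theta> y c) * B (ry x \<theta> y c) * P (rc x \<theta> y c))"
  let ?G = "\<lambda>(\<theta>::real, y, c). ennreal (C y * hermite_fun 0 c)"
  have G: "(\<integral>\<^sup>+w. (?G w)\<^sup>2 \<partial>nu) = nsq C"
  proof -
    have "(\<integral>\<^sup>+w. (?G w)\<^sup>2 \<partial>nu) = (\<integral>\<^sup>+(\<theta>, y, c). ennreal ((C y)\<^sup>2) * ennreal ((hermite_fun 0 c)\<^sup>2) \<partial>nu)"
      using pos by (intro nn_integral_cong) (auto simp: ennreal_power ennreal_mult[symmetric] power_mult_distrib)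
    also have "\<dots> = nsq C"
      by (subst nn_integral_nu) (simp_all add: nn_integral_cmult nn_integral_multc nn_integral_hermite0 nsq_def
          Theta.emeasure_space_1[unfolded space_Theta])
    finally show ?thesis .
  qed
  have "(Sop A B P C x)\<^sup>2 \<le> (\<integral>\<^sup>+w. (?F x w)\<^sup>2 \<partial>nu) * nsq C" for x
  proof -
    have "Sop A B P C x = (\<integral>\<^sup>+w. ?F x w * ?G w \<partial>nu)"
      unfolding Sop_def using pos by (intro nn_integral_cong) (auto simp: ennreal_mult[symmetric])
    moreover have "(\<integral>\<^sup>+w. ?F x w * ?G w \<partial>nu)\<^sup>2 \<le> (\<integral>\<^sup>+w. (?F x w)\<^sup>2 \<partial>nu) * (\<integral>\<^sup>+w. (?G w)\<^sup>2 \<partial>nu)"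
      by (rule Cauchy_Schwarz_nn_integral) measurable
    ultimately show ?thesis by (simp add: G)
  qed
  then have "(\<integral>\<^sup>+x. (Sop A B P C x)\<^sup>2 \<partial>lborel) \<le> (\<integral>\<^sup>+x. (\<integral>\<^sup>+w. (?F x w)\<^sup>2 \<partial>nu) * nsq C \<partial>lborel)"
    by (intro nn_integral_mono) auto
  also have "\<dots> = (\<integral>\<^sup>+x. (\<integral>\<^sup>+w. (?F x w)\<^sup>2 \<partial>nu) \<partial>lborel) * nsq C"
    by (rule nn_integral_multc) measurable
  also have "(\<integral>\<^sup>+x. (\<integral>\<^sup>+w. (?F x w)\<^sup>2 \<partial>nu) \<partial>lborel) = (\<integral>\<^sup>+z. (?F (fst z) (snd z))\<^sup>2 \<partial>mu)"
    by (subst nn_integral_mu_fst) (simp_all add: case_prod_unfold)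
  also have "\<dots> = (\<integral>\<^sup>+(x, \<theta>, y, c). ennreal ((A (rx x \<theta> y c))\<^sup>2) * ennreal ((B (ry x \<theta> y c))\<^sup>2) * ennreal ((P (rc x \<theta> y c))\<^sup>2) \<partial>mu)"
    using pos by (intro nn_integral_cong) (auto simp: ennreal_power ennreal_mult[symmetric] power_mult_distrib)
  also have "\<dots> = nsq A * nsq B * nsq P"
    by (subst nn_integral_mu_rotated) (simp_all add: nsq_def)
  finally show ?thesis .
qed

lemma norm_rotop_le_Sop:
  "ennreal (norm (rotop f1 f2 f3 x)) \<le> ennreal (sqrt (8 / pi)) * Sop (\<lambda>x. norm (f1 x)) (\<lambda>x. norm (f2 x)) (hermite_fun 0) (\<lambda>x. norm (f3 x)) x"
proof -
  have "(\<integral>\<^sup>+w. ennreal (norm (rot1 f1 (x, w) * rot2 f2 (x, w) * rot3 f3 (x, w))) \<partial>nu)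
    = Sop (\<lambda>x. norm (f1 x)) (\<lambda>x. norm (f2 x)) (hermite_fun 0) (\<lambda>x. norm (f3 x)) x"
    unfolding Sop_def by (intro nn_integral_cong) (auto simp: rot_defs norm_mult mult_ac)
  then show ?thesis using norm_rotop_le[of f1 f2 f3 x] by simp
qed

lemma nsq_L2: "f \<in> L2 \<Longrightarrow> nsq (\<lambda>x. norm (f x)) = ennreal (sqnorm f)"
  by (simp add: nsq_def nn_integral_L2)

lemma nsq_hermite0: "nsq (hermite_fun 0) = 1"
  by (simp add: nsq_def nn_integral_hermite0)

lemma rotop_L2:
  assumes f: "f1 \<in> L2" "f2 \<in> L2" "f3 \<in> L2"
  shows "rotop f1 f2 f3 \<in> L2" "sqnorm (rotop f1 f2 f3) \<le> (8 / pi) * (sqnorm f1 * sqnorm f2 * sqnorm f3)"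
proof -
  note [measurable] = f[THEN L2_measurable]
  let ?S = "Sop (\<lambda>x. norm (f1 x)) (\<lambda>x. norm (f2 x)) (hermite_fun 0) (\<lambda>x. norm (f3 x))"
  have "(\<integral>\<^sup>+x. ennreal ((norm (rotop f1 f2 f3 x))\<^sup>2) \<partial>lborel) \<le> (\<integral>\<^sup>+x. (ennreal (sqrt (8 / pi)) * ?S x)\<^sup>2 \<partial>lborel)"
    by (intro nn_integral_mono) (simp add: ennreal_power[symmetric] power_mono norm_rotop_le_Sop)
  also have "\<dots> = ennreal (8 / pi) * (\<integral>\<^sup>+x. (?S x)\<^sup>2 \<partial>lborel)"
    unfolding power_mult_distrib by (subst nn_integral_cmult) (auto simp: ennreal_power)
  also have "\<dots> \<le> ennreal (8 / pi) * (nsq (\<lambda>x. norm (f1 x)) * nsq (\<lambda>x. norm (f2 x)) * nsq (hermite_fun 0) * nsq (\<lambda>x. norm (f3 x)))"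
    by (intro mult_left_mono Sop_sq_bound) auto
  also have "\<dots> = ennreal ((8 / pi) * (sqnorm f1 * sqnorm f2 * sqnorm f3))"
    unfolding nsq_L2[OF f(1)] nsq_L2[OF f(2)] nsq_L2[OF f(3)] nsq_hermite0 by (simp add: ennreal_mult[symmetric])
  finally have le: "(\<integral>\<^sup>+x. ennreal ((norm (rotop f1 f2 f3 x))\<^sup>2) \<partial>lborel) \<le> ennreal ((8 / pi) * (sqnorm f1 * sqnorm f2 * sqnorm f3))" .
  show "rotop f1 f2 f3 \<in> L2" "sqnorm (rotop f1 f2 f3) \<le> (8 / pi) * (sqnorm f1 * sqnorm f2 * sqnorm f3)"
    by (rule L2_I[OF _ le]; simp)+
qed

lemma rotop_pairing:
  assumes f: "f1 \<in> L2" "f2 \<in> L2" "f3 \<in> L2" "g \<in> L2"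
  shows "(LINT x|lborel. rotop f1 f2 f3 x * cnj (g x)) = of_real (sqrt (8 / pi)) * rotform f1 f2 f3 g"
proof -
  have i: "integrable (lborel \<Otimes>\<^sub>M nu) (\<lambda>z. rot1 f1 z * rot2 f2 z * rot3 f3 z * rot4 g z)"
    using rot_integrable(1)[OF f] by (simp add: mu_def)
  have "rotform f1 f2 f3 g = (LINT x|lborel. LINT w|nu. rot1 f1 (x, w) * rot2 f2 (x, w) * rot3 f3 (x, w) * rot4 g (x, w))"
    unfolding rotform_def mu_def by (rule mu_pair.integral_fst'[OF i, symmetric])
  also have "\<dots> = (LINT x|lborel. (LINT w|nu. rot1 f1 (x, w) * rot2 f2 (x, w) * rot3 f3 (x, w)) * cnj (g x))"
    by (simp add: rot4_def case_prod_unfold)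
  finally have "of_real (sqrt (8 / pi)) * rotform f1 f2 f3 g
    = (LINT x|lborel. of_real (sqrt (8 / pi)) * ((LINT w|nu. rot1 f1 (x, w) * rot2 f2 (x, w) * rot3 f3 (x, w)) * cnj (g x)))"
    by (simp only: integral_mult_right_zero)
  then show ?thesis by (simp add: rotop_def mult.assoc)
qed

text \<open>The function \<open>rotop\<close> has the prescribed pairings, so the choice defining
  the operator is realised. Whatever is chosen has the same Hermite coefficients, read off by
  testing with Hermite functions, and so agrees with \<open>rotop\<close> almost everywhere.\<close>

lemma T4_AE:
  assumes f: "f1' \<in> L2" "f2' \<in> L2" "f3' \<in> L2"
    and ae: "AE x in lborel. f1 x = f1' x" "AE x in lborel. f2 x = f2' x" "AE x in lborel. f3 x = f3' x"
  shows "\<T>4 f1 f2 f3 \<in> Lp_space 2" "AE x in lborel. \<T>4 f1 f2 f3 x = rotop f1' f2' f3' x"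
proof -
  let ?K = "rotop f1' f2' f3'"
  define P where "P h \<longleftrightarrow> h \<in> Lp_space 2 \<and> (\<forall>g\<in>Lp_space 2. L2_inner h g = \<T>4_form f1 f2 f3 g)" for h
  have K: "?K \<in> L2" by (rule rotop_L2[OF f])
  have form: "\<T>4_form f1 f2 f3 g = of_real (sqrt (8 / pi)) * rotform f1' f2' f3' g'" if "g' \<in> L2" "AE x in lborel. g x = g' x" for g g'
    by (rule T4_form_eq[OF f that(1) ae that(2)])
  have "P ?K"
    unfolding P_def
  proof (intro conjI ballI)
    show "?K \<in> Lp_space 2" using Lp2_AE(1)[of ?K ?K] K by auto
    fix g assume "g \<in> Lp_space 2"
    then obtain g' where g: "g' \<in> L2" "AE x in lborel. g x = g' x" by (rule Lp2_rep)
    have "L2_inner ?K g = (LINT x|lborel. ?K x * cnj (g' x))"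
      using K g by (intro L2_inner_AE) auto
    then show "L2_inner ?K g = \<T>4_form f1 f2 f3 g"
      unfolding form[OF g] rotop_pairing[OF f g(1)] .
  qed
  then have "P (SOME h. P h)" by (rule someI[of P ?K])
  then have PT: "P (\<T>4 f1 f2 f3)" unfolding \<T>4_def P_def .
  then show T: "\<T>4 f1 f2 f3 \<in> Lp_space 2" by (simp add: P_def)
  then obtain h where h: "h \<in> L2" "AE x in lborel. \<T>4 f1 f2 f3 x = h x" by (rule Lp2_rep)
  have "AE x in lborel. h x = ?K x"
  proof (rule L2_coef_unique[OF h(1) K])
    fix n
    let ?g = "\<lambda>x. complex_of_real (hermite_fun n x)"
    have g: "?g \<in> L2" by (rule hermite_fun_L2)
    have "?g \<in> Lp_space 2" using Lp2_AE(1)[of ?g ?g] g by auto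
    then have "coef h n = \<T>4_form f1 f2 f3 ?g"
      using PT L2_inner_hermite[OF L2_measurable[OF h(1)] h(2), of n] by (simp add: P_def)
    also have "\<dots> = coef ?K n"
      using form[OF g] rotop_pairing[OF f g] by (simp add: coef_def)
    finally show "coef h n = coef ?K n" .
  qed
  with h(2) show "AE x in lborel. \<T>4 f1 f2 f3 x = ?K x" by eventually_elim simp
qed

theorem T4_bound_L2: "trilinear_bound \<T>4 (Lp_space 2) (Lp_norm 2) (sqrt (8 / pi))"
  unfolding trilinear_bound_def
proof (intro ballI conjI)
  fix f1 f2 f3 assume "f1 \<in> Lp_space 2" "f2 \<in> Lp_space 2" "f3 \<in> Lp_space 2"
  then obtain g1 g2 g3 where g: "g1 \<in> L2" "g2 \<in> L2" "g3 \<in> L2"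
    and ae: "AE x in lborel. f1 x = g1 x" "AE x in lborel. f2 x = g2 x" "AE x in lborel. f3 x = g3 x"
    by (metis Lp2_rep)
  note T = T4_AE[OF g ae]
  show "\<T>4 f1 f2 f3 \<in> Lp_space 2" by (rule T(1))
  have "Lp_norm 2 (\<T>4 f1 f2 f3) = sqrt (sqnorm (rotop g1 g2 g3))"
    using rotop_L2(1)[OF g] T(2) by (intro Lp2_AE(2)) auto
  also have "\<dots> \<le> sqrt ((8 / pi) * (sqnorm g1 * sqnorm g2 * sqnorm g3))"
    by (intro real_sqrt_le_mono rotop_L2 g)
  also have "\<dots> = sqrt (8 / pi) * (sqrt (sqnorm g1) * sqrt (sqnorm g2) * sqrt (sqnorm g3))"
    by (simp only: real_sqrt_mult)
  also have "sqrt (sqnorm g1) = Lp_norm 2 f1" using Lp2_AE(2)[OF L2_measurable[OF g(1)] ae(1)] ..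
  also have "sqrt (sqnorm g2) = Lp_norm 2 f2" using Lp2_AE(2)[OF L2_measurable[OF g(2)] ae(2)] ..
  also have "sqrt (sqnorm g3) = Lp_norm 2 f3" using Lp2_AE(2)[OF L2_measurable[OF g(3)] ae(3)] ..
  finally show "Lp_norm 2 (\<T>4 f1 f2 f3) \<le> sqrt (8 / pi) * (Lp_norm 2 f1 * Lp_norm 2 f2 * Lp_norm 2 f3)" .
qed

section \<open>Weights and pointwise bounds\<close>

lemma japanese_ge_1: "japanese x \<ge> 1"
  by (simp add: japanese_def)

lemma japanese_pos [simp]: "japanese x > 0"
  using japanese_ge_1[of x] by linarith

lemma measurable_japanese [measurable]: "japanese \<in> borel_measurable borel"
  unfolding japanese_def[abs_def] by measurable

lemma japanese_powr_ge_1: "s \<ge> 0 \<Longrightarrow> japanese x powr s \<ge> 1"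
  by (rule ge_one_powr_ge_zero[OF japanese_ge_1])

text \<open>The three squared weights at the rotated point add up to at least the squared weight at
  x, so the largest of them is at least a third of it. Passing through the maximum treats all powers
  s >= 0 alike and explains the constant.\<close>

lemma japanese_rotation:
  assumes "s \<ge> 0"
  shows "japanese x powr s \<le> 3 powr (s / 2) * (japanese (rx x \<theta> y c) powr s + japanese (ry x \<theta> y c) powr s + japanese (rc x \<theta> y c) powr s)"
proof -
  let ?J = "\<lambda>u. japanese u powr s"
  let ?m = "max (japanese (rx x \<theta> y c)) (max (japanese (ry x \<theta> y c)) (japanese (rc x \<theta> y c)))"
  have sq: "(japanese u)\<^sup>2 = 1 + u\<^sup>2" for u by (simp add: japanese_def)
  have le: "(japanese (rx x \<theta> y c))\<^sup>2 \<le> ?m\<^sup>2" "(japanese (ry x \<theta> y c))\<^sup>2 \<le> ?m\<^sup>2" "(japanese (rc x \<theta> y c))\<^sup>2 \<le> ?m\<^sup>2"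
    by (intro power_mono; simp add: less_imp_le)+
  have "(japanese x)\<^sup>2 \<le> 3 * ?m\<^sup>2"
    using le rotation_sq[of x \<theta> y c] zero_le_power2[of y] zero_le_power2[of c] unfolding sq by linarith
  also have "\<dots> = (sqrt 3 * ?m)\<^sup>2" by (simp add: power_mult_distrib)
  finally have "japanese x \<le> sqrt 3 * ?m"
    by (rule power2_le_imp_le) (simp add: le_max_iff_disj less_imp_le)
  then have "?J x \<le> (sqrt 3 * ?m) powr s"
    using assms by (intro powr_mono2) (auto simp: less_imp_le)
  also have "\<dots> = 3 powr (s / 2) * ?m powr s"
    by (simp add: powr_mult powr_half_sqrt[symmetric] powr_powr le_max_iff_disj less_imp_le)
  also have "?m powr s \<le> ?J (rx x \<theta> y c) + ?J (ry x \<theta> y c) + ?J (rc x \<theta> y c)"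
    by (auto simp: max_def)
  finally show ?thesis by simp
qed

text \<open>The weight falls on f1, on f2 or on the ground state, never on f3, which sits at the
  unrotated point y.\<close>

lemma Sop_weight:
  fixes f1 f2 f3 :: "real \<Rightarrow> complex"
  assumes s: "s \<ge> 0" and [measurable]: "f1 \<in> borel_measurable borel" "f2 \<in> borel_measurable borel" "f3 \<in> borel_measurable borel"
  shows "ennreal (norm (weighted s (rotop f1 f2 f3) x)) \<le> ennreal (sqrt (8 / pi) * 3 powr (s / 2)) *
    (Sop (\<lambda>x. norm (weighted s f1 x)) (\<lambda>x. norm (f2 x)) (hermite_fun 0) (\<lambda>x. norm (f3 x)) x
     + Sop (\<lambda>x. norm (f1 x)) (\<lambda>x. norm (weighted s f2 x)) (hermite_fun 0) (\<lambda>x. norm (f3 x)) x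
     + Sop (\<lambda>x. norm (f1 x)) (\<lambda>x. norm (f2 x)) (\<lambda>x. japanese x powr s * hermite_fun 0 x) (\<lambda>x. norm (f3 x)) x)"
proof -
  have [measurable]: "weighted s f \<in> borel_measurable borel" if [measurable]: "f \<in> borel_measurable borel" for f
    unfolding weighted_def by measurable
  let ?J = "\<lambda>u. japanese u powr s"
  let ?i = "\<lambda>A B P (\<theta>, y, c). A (rx x \<theta> y c) * B (ry x \<theta> y c) * P (rc x \<theta> y c) * (norm (f3 y) * hermite_fun 0 c)"
  have eq: "norm (weighted s f x) = ?J x * norm (f x)" for f x
    by (simp add: weighted_def norm_mult)
  have "ennreal (norm (weighted s (rotop f1 f2 f3) x)) \<le> ennreal (?J x) * (ennreal (sqrt (8 / pi)) * Sop (\<lambda>x. norm (f1 x)) (\<lambda>x. norm (f2 x)) (hermite_fun 0) (\<lambda>x. norm (f3 x)) x)"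
    unfolding eq by (simp add: ennreal_mult mult_left_mono norm_rotop_le_Sop)
  also have "\<dots> = ennreal (sqrt (8 / pi)) * (ennreal (?J x) * Sop (\<lambda>x. norm (f1 x)) (\<lambda>x. norm (f2 x)) (hermite_fun 0) (\<lambda>x. norm (f3 x)) x)"
    by (simp add: mult_ac)
  also have "ennreal (?J x) * Sop (\<lambda>x. norm (f1 x)) (\<lambda>x. norm (f2 x)) (hermite_fun 0) (\<lambda>x. norm (f3 x)) x
    = (\<integral>\<^sup>+w. ennreal (?J x * ?i (\<lambda>x. norm (f1 x)) (\<lambda>x. norm (f2 x)) (hermite_fun 0) w) \<partial>nu)"
    unfolding Sop_def by (subst nn_integral_cmult[symmetric]) (auto intro!: nn_integral_cong simp: ennreal_mult[symmetric])
  also have "\<dots> \<le> (\<integral>\<^sup>+w. ennreal (3 powr (s / 2)) * (ennreal (?i (\<lambda>x. norm (weighted s f1 x)) (\<lambda>x. norm (f2 x)) (hermite_fun 0) w)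
     + ennreal (?i (\<lambda>x. norm (f1 x)) (\<lambda>x. norm (weighted s f2 x)) (hermite_fun 0) w)
     + ennreal (?i (\<lambda>x. norm (f1 x)) (\<lambda>x. norm (f2 x)) (\<lambda>x. ?J x * hermite_fun 0 x) w)) \<partial>nu)"
  proof (rule nn_integral_mono)
    fix w :: "real \<times> real \<times> real"
    obtain \<theta> y c where w: "w = (\<theta>, y, c)" by (cases w)
    let ?p = "norm (f1 (rx x \<theta> y c)) * norm (f2 (ry x \<theta> y c)) * hermite_fun 0 (rc x \<theta> y c) * (norm (f3 y) * hermite_fun 0 c)"
    have "?J x * ?p \<le> (3 powr (s / 2) * (?J (rx x \<theta> y c) + ?J (ry x \<theta> y c) + ?J (rc x \<theta> y c))) * ?p"
      using s by (intro mult_right_mono japanese_rotation) auto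
    also have "\<dots> = 3 powr (s / 2) * (?i (\<lambda>x. norm (weighted s f1 x)) (\<lambda>x. norm (f2 x)) (hermite_fun 0) w
     + ?i (\<lambda>x. norm (f1 x)) (\<lambda>x. norm (weighted s f2 x)) (hermite_fun 0) w
     + ?i (\<lambda>x. norm (f1 x)) (\<lambda>x. norm (f2 x)) (\<lambda>x. ?J x * hermite_fun 0 x) w)"
      unfolding w eq by (simp add: algebra_simps)
    finally show "ennreal (?J x * ?i (\<lambda>x. norm (f1 x)) (\<lambda>x. norm (f2 x)) (hermite_fun 0) w)
       \<le> ennreal (3 powr (s / 2)) * (ennreal (?i (\<lambda>x. norm (weighted s f1 x)) (\<lambda>x. norm (f2 x)) (hermite_fun 0) w)
     + ennreal (?i (\<lambda>x. norm (f1 x)) (\<lambda>x. norm (weighted s f2 x)) (hermite_fun 0) w)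
     + ennreal (?i (\<lambda>x. norm (f1 x)) (\<lambda>x. norm (f2 x)) (\<lambda>x. ?J x * hermite_fun 0 x) w))"
      unfolding w by (simp add: ennreal_plus[symmetric] ennreal_mult[symmetric] ennreal_leI del: ennreal_plus)
  qed
  also have "\<dots> = ennreal (3 powr (s / 2)) * (Sop (\<lambda>x. norm (weighted s f1 x)) (\<lambda>x. norm (f2 x)) (hermite_fun 0) (\<lambda>x. norm (f3 x)) x
     + Sop (\<lambda>x. norm (f1 x)) (\<lambda>x. norm (weighted s f2 x)) (hermite_fun 0) (\<lambda>x. norm (f3 x)) x
     + Sop (\<lambda>x. norm (f1 x)) (\<lambda>x. norm (f2 x)) (\<lambda>x. ?J x * hermite_fun 0 x) (\<lambda>x. norm (f3 x)) x)"
    unfolding Sop_def by (subst nn_integral_cmult, measurable, subst nn_integral_add, measurable, subst nn_integral_add, measurable)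
      (simp add: case_prod_unfold)
  finally show ?thesis by (simp add: ennreal_mult mult.assoc mult_left_mono)
qed

text \<open>Hoelder's inequality for the density w, with upper bounds in place of the exact
  integrals. Young's inequality is applied to F / l pointwise and then integrated.\<close>

lemma nn_integral_powr_Jensen:
  fixes F w :: "'a \<Rightarrow> real"
  assumes [measurable]: "F \<in> borel_measurable M" "w \<in> borel_measurable M"
    and pos: "\<And>x. F x \<ge> 0" "\<And>x. w x \<ge> 0" and q: "q \<ge> 1" and AV: "A \<ge> 0" "V \<ge> 0"
    and A: "(\<integral>\<^sup>+x. ennreal (F x powr q * w x) \<partial>M) \<le> ennreal A" and V: "(\<integral>\<^sup>+x. ennreal (w x) \<partial>M) \<le> ennreal V"
  shows "(\<integral>\<^sup>+x. ennreal (F x * w x) \<partial>M) \<le> ennreal (A powr (1 / q) * V powr (1 - 1 / q))"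
\<comment> \<open>If one bound is 0, the scale l used below degenerates; the integrand then vanishes
  almost everywhere.\<close>
proof (cases "A = 0 \<or> V = 0")
  case True
  have "AE x in M. F x * w x = 0"
    using True
  proof
    assume "A = 0"
    then have "AE x in M. ennreal (F x powr q * w x) = 0"
      using A by (subst nn_integral_0_iff_AE[symmetric]) auto
    then show ?thesis
    proof eventually_elim
      case (elim x)
      then have "F x powr q * w x \<le> 0" by (simp add: ennreal_eq_0_iff)
      moreover have "F x powr q * w x \<ge> 0" using pos by simp
      ultimately have "F x powr q * w x = 0" by linarith
      then show ?case by auto
    qed
  next
    assume "V = 0"
    then have "AE x in M. ennreal (w x) = 0"
      using V by (subst nn_integral_0_iff_AE[symmetric]) auto
    then show ?thesis by eventually_elim (use pos in \<open>auto simp: ennreal_eq_0_iff intro: antisym\<close>)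
  qed
  then have "(\<integral>\<^sup>+x. ennreal (F x * w x) \<partial>M) = 0"
    by (subst nn_integral_0_iff_AE) auto
  then show ?thesis by simp
next
  case False
  then have AV0: "A > 0" "V > 0" using AV by auto
  \<comment> \<open>The scale at which the two terms of Young's inequality balance: they become l V
    / q and (1 - 1/q) l V.\<close>
  define l where "l = (A / V) powr (1 / q)"
  have l: "l > 0" using AV0 by (simp add: l_def)
  have young: "r \<le> (1 / q) * r powr q + (1 - 1 / q)" if "r \<ge> 0" for r :: real
  proof (cases "r = 0")
    case False
    with that have "(r powr q) powr (1 / q) * 1 powr (1 - 1 / q) \<le> 1 / q * (r powr q) + (1 - 1 / q) * 1"
      using q by (intro Youngs_inequality_0) auto
    then show ?thesis using False that q by (simp add: powr_powr)
  qed (use q in auto)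
  have pw: "F x * w x \<le> (l powr (1 - q) / q) * (F x powr q * w x) + (l * (1 - 1 / q)) * w x" for x
  proof -
    have "F x / l \<le> (1 / q) * (F x / l) powr q + (1 - 1 / q)" using young[of "F x / l"] pos l by simp
    then have "F x \<le> ((1 / q) * (F x / l) powr q + (1 - 1 / q)) * l" using l by (simp add: pos_divide_le_eq)
    also have "\<dots> = (l powr (1 - q) / q) * F x powr q + l * (1 - 1 / q)"
      using l pos by (simp add: powr_divide powr_diff field_simps)
    finally have "F x * w x \<le> ((l powr (1 - q) / q) * F x powr q + l * (1 - 1 / q)) * w x"
      using pos by (intro mult_right_mono) auto
    then show ?thesis by (simp add: algebra_simps)
  qed
  have nn: "l powr (1 - q) / q \<ge> 0" "l * (1 - 1 / q) \<ge> 0" using l q by auto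
  have en: "ennreal (a * X + b * Y) = ennreal a * ennreal X + ennreal b * ennreal Y"
    if "a \<ge> 0" "b \<ge> 0" "X \<ge> 0" "Y \<ge> 0" for a b X Y :: real
    using that by (simp add: ennreal_mult)
  have "(\<integral>\<^sup>+x. ennreal (F x * w x) \<partial>M)
    \<le> (\<integral>\<^sup>+x. ennreal (l powr (1 - q) / q) * ennreal (F x powr q * w x) + ennreal (l * (1 - 1 / q)) * ennreal (w x) \<partial>M)"
  proof (rule nn_integral_mono)
    fix x
    from en[OF nn, of "F x powr q * w x" "w x"] ennreal_leI[OF pw[of x]]
    show "ennreal (F x * w x) \<le> ennreal (l powr (1 - q) / q) * ennreal (F x powr q * w x) + ennreal (l * (1 - 1 / q)) * ennreal (w x)"
      using pos by simp
  qed
  also have "\<dots> = ennreal (l powr (1 - q) / q) * (\<integral>\<^sup>+x. ennreal (F x powr q * w x) \<partial>M) + ennreal (l * (1 - 1 / q)) * (\<integral>\<^sup>+x. ennreal (w x) \<partial>M)"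
    by (simp add: nn_integral_add nn_integral_cmult)
  also have "\<dots> \<le> ennreal (l powr (1 - q) / q) * ennreal A + ennreal (l * (1 - 1 / q)) * ennreal V"
    by (intro add_mono mult_left_mono A V) auto
  also have "\<dots> = ennreal ((l powr (1 - q) / q) * A + (l * (1 - 1 / q)) * V)"
    by (rule en[OF nn AV, symmetric])
  also have "(l powr (1 - q) / q) * A + (l * (1 - 1 / q)) * V = A powr (1 / q) * V powr (1 - 1 / q)"
  proof -
    have 1: "l * V = A powr (1 / q) * V powr (1 - 1 / q)"
      using AV0 by (simp add: l_def powr_divide powr_diff field_simps)
    have lq: "l powr q = A / V" using AV0 q by (simp add: l_def powr_powr)
    have "l powr (1 - q) * A = l * V"
      unfolding powr_diff lq using l AV0 by simp
    then have "(l powr (1 - q) / q) * A + (l * (1 - 1 / q)) * V = (l * V) / q + (1 - 1 / q) * (l * V)"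
      by (simp add: field_simps)
    also have "\<dots> = l * V" using q by (simp add: field_simps)
    finally show ?thesis unfolding 1 .
  qed
  finally show ?thesis .
qed

lemma sin_ge_half: assumes "0 \<le> \<theta>" "\<theta> \<le> pi / 2" shows "sin \<theta> \<ge> \<theta> / 2"
proof -
  let ?u = "\<theta> / 2"
  have c: "cos ?u > 0" using assms by (intro cos_gt_zero_pi) (use assms pi_gt_zero in linarith)+
  have "\<theta> < pi" using assms pi_gt_zero by linarith
  then have "?u \<le> \<bar>tan ?u\<bar>" using abs_tan_ge[of ?u] assms by auto
  also have "\<bar>tan ?u\<bar> = sin ?u / cos ?u" using assms c sin_ge_zero[of ?u] by (simp add: tan_def)
  finally have "?u * cos ?u \<le> sin ?u" using c by (simp add: pos_le_divide_eq)
  then have "2 * (?u * cos ?u) * cos ?u \<le> 2 * sin ?u * cos ?u" using c by simp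
  also have "2 * sin ?u * cos ?u = sin \<theta>" using sin_double[of ?u] by simp
  also have "2 * (?u * cos ?u) * cos ?u = ?u * (1 + cos \<theta>)"
    using cos_double_cos[of ?u] by (simp add: power2_eq_square algebra_simps)
  finally have "?u * (1 + cos \<theta>) \<le> sin \<theta>" .
  moreover have "?u * 1 \<le> ?u * (1 + cos \<theta>)" using assms cos_ge_zero[of \<theta>] by (intro mult_left_mono) auto
  ultimately show ?thesis by simp
qed

text \<open>Near each end of the interval the sine is comparable with the distance to that end, and
  the power exceeds -1; the reflection pi - x exchanges the ends.\<close>

lemma sin_powr_Theta_finite:
  assumes k: "0 \<le> \<kappa>" "\<kappa> < 1"
  shows "\<exists>Z\<ge>0. (\<integral>\<^sup>+\<theta>. ennreal (sin \<theta> powr (- \<kappa>)) \<partial>Theta) \<le> ennreal Z"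
proof -
  let ?Z = "pi powr (1 - \<kappa>) / (1 - \<kappa>)"
  have i: "((\<lambda>x. x powr (- \<kappa>)) has_integral ?Z) {0..pi}"
    using has_integral_powr_from_0[of "-\<kappa>" pi] k by simp
  have I1: "(\<integral>\<^sup>+x. ennreal (x powr (- \<kappa>)) * indicator {0..pi} x \<partial>lborel) = ennreal ?Z"
    using i by (intro nn_integral_has_integral_lebesgue') auto
  have I2: "(\<integral>\<^sup>+x. ennreal ((pi - x) powr (- \<kappa>)) * indicator {0..pi} x \<partial>lborel) = ennreal ?Z"
  proof -
    have "(\<integral>\<^sup>+x. ennreal (x powr (- \<kappa>)) * indicator {0..pi} x \<partial>lborel)
      = ennreal \<bar>-1\<bar> * (\<integral>\<^sup>+x. ennreal ((pi + -1 * x) powr (- \<kappa>)) * indicator {0..pi} (pi + -1 * x) \<partial>lborel)"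
      by (rule nn_integral_real_affine) auto
    also have "\<dots> = (\<integral>\<^sup>+x. ennreal ((pi - x) powr (- \<kappa>)) * indicator {0..pi} x \<partial>lborel)"
      by (simp, intro nn_integral_cong) (auto simp: indicator_def)
    finally show ?thesis using I1 by simp
  qed
  let ?h = "\<lambda>x. (1/2) powr (- \<kappa>) * (x powr (- \<kappa>) + (pi - x) powr (- \<kappa>))"
  have pw: "sin x powr (- \<kappa>) \<le> ?h x" if x: "x \<in> {0..pi}" for x
  proof -
    have a: "sin y powr (- \<kappa>) \<le> (1/2) powr (- \<kappa>) * y powr (- \<kappa>)" if y: "0 \<le> y" "y \<le> pi / 2" for y
    proof (cases "y = 0")
      case False
      have "sin y powr (- \<kappa>) \<le> ((1/2) * y) powr (- \<kappa>)"
        using k sin_ge_half[OF y] False y by (intro powr_mono2') auto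
      then show ?thesis using y by (simp only: powr_mult)
    qed simp
    show ?thesis
    proof (cases "x \<le> pi / 2")
      case True
      with a[of x] x have "sin x powr (- \<kappa>) \<le> (1/2) powr (- \<kappa>) * x powr (- \<kappa>) + 0" by simp
      also have "\<dots> \<le> (1/2) powr (- \<kappa>) * x powr (- \<kappa>) + (1/2) powr (- \<kappa>) * (pi - x) powr (- \<kappa>)"
        by (intro add_mono) auto
      finally show ?thesis by (simp add: algebra_simps)
    next
      case False
      have "sin x powr (- \<kappa>) = sin (pi - x) powr (- \<kappa>)" by simp
      also have "\<dots> \<le> (1/2) powr (- \<kappa>) * (pi - x) powr (- \<kappa>)" using a[of "pi - x"] False x by simp
      also have "\<dots> \<le> (1/2) powr (- \<kappa>) * x powr (- \<kappa>) + (1/2) powr (- \<kappa>) * (pi - x) powr (- \<kappa>)" by simp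
      finally show ?thesis by (simp add: algebra_simps)
    qed
  qed
  have "(\<integral>\<^sup>+x. ennreal (sin x powr (- \<kappa>)) * indicator {0..pi} x \<partial>lborel)
    \<le> (\<integral>\<^sup>+x. ennreal ((1/2) powr (- \<kappa>)) * (ennreal (x powr (- \<kappa>)) * indicator {0..pi} x + ennreal ((pi - x) powr (- \<kappa>)) * indicator {0..pi} x) \<partial>lborel)"
    using pw by (intro nn_integral_mono)
      (auto simp: indicator_def ennreal_mult[symmetric] ennreal_plus[symmetric] intro!: ennreal_leI simp del: ennreal_plus)
  also have "\<dots> = ennreal ((1/2) powr (- \<kappa>)) * (ennreal ?Z + ennreal ?Z)"
  proof -
    have m: "(\<lambda>x. ennreal (x powr (- \<kappa>)) * indicator {0..pi} x) \<in> borel_measurable lborel"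
      "(\<lambda>x. ennreal ((pi - x) powr (- \<kappa>)) * indicator {0..pi} x) \<in> borel_measurable lborel"
      by measurable
    show ?thesis
      by (simp only: nn_integral_cmult[OF borel_measurable_add[OF m]] nn_integral_add[OF m] I1 I2)
  qed
  finally have "ennreal (1 / pi) * (\<integral>\<^sup>+x. ennreal (sin x powr (- \<kappa>)) * indicator {0..pi} x \<partial>lborel)
      \<le> ennreal (1 / pi) * (ennreal ((1/2) powr (- \<kappa>)) * (ennreal ?Z + ennreal ?Z))"
    by (rule mult_left_mono) simp
  moreover have "(\<integral>\<^sup>+\<theta>. ennreal (sin \<theta> powr (- \<kappa>)) \<partial>Theta) = ennreal (1 / pi) * (\<integral>\<^sup>+x. ennreal (sin x powr (- \<kappa>)) * indicator {0..pi} x \<partial>lborel)"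
    by (rule nn_integral_Theta) measurable
  ultimately have "(\<integral>\<^sup>+\<theta>. ennreal (sin \<theta> powr (- \<kappa>)) \<partial>Theta) \<le> ennreal (1 / pi) * (ennreal ((1/2) powr (- \<kappa>)) * (ennreal ?Z + ennreal ?Z))"
    by (simp only:)
  also have "\<dots> = ennreal (1 / pi * ((1/2) powr (- \<kappa>) * (?Z + ?Z)))"
    using k by (simp add: ennreal_mult[symmetric] ennreal_plus[symmetric] del: ennreal_plus)
  finally show ?thesis using k by (intro exI[of _ "1 / pi * ((1/2) powr (- \<kappa>) * (?Z + ?Z))"]) auto
qed

section \<open>Gaussian bound for the kernel and supremum estimate\<close>

lemma nn_integral_gaussian:
  assumes "a > (0::real)"
  shows "(\<integral>\<^sup>+x. ennreal (exp (- a * x\<^sup>2)) \<partial>lborel) = ennreal (sqrt (pi / a))"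
  using gaussian_has_integral[OF assms] by (subst nn_integral_eq_integral) auto

lemma nn_integral_shift_gaussian:
  assumes "a > (0::real)"
  shows "(\<integral>\<^sup>+y. ennreal (exp (- a * (x - y)\<^sup>2)) \<partial>lborel) = ennreal (sqrt (pi / a))"
proof -
  have "ennreal (sqrt (pi / a)) = (\<integral>\<^sup>+y. ennreal (exp (- a * y\<^sup>2)) \<partial>lborel)"
    by (rule nn_integral_gaussian[OF assms, symmetric])
  also have "\<dots> = ennreal \<bar>-1\<bar> * (\<integral>\<^sup>+y. ennreal (exp (- a * (x + -1 * y)\<^sup>2)) \<partial>lborel)"
    by (rule nn_integral_real_affine) auto
  finally show ?thesis by simp
qed

text \<open>As \<open>rc\<close> is cos theta c - sin theta \<open>rb\<close>, both
  \<open>rc\<close> and c can be small only if sin theta (x - y) is small. Half of both Gaussian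
  exponents, 1/8 each, pays for the decay in x - y and produces the 1/32; the other half in c is
  kept for the integration over c.\<close>

lemma Sop_kernel_gaussian:
  assumes "\<And>u. P u \<le> D * gauss u" "D \<ge> 0"
  shows "P (rc x \<theta> y c) * hermite_fun 0 c \<le> D * (exp (- ((sin \<theta>)\<^sup>2 / 32) * (x - y)\<^sup>2) * exp (- (1/8) * c\<^sup>2))"
proof -
  have h: "hermite_fun 0 c \<le> gauss c"
  proof -
    have "exp (- (c\<^sup>2) / 2) / sqrt (sqrt pi) \<le> exp (- (c\<^sup>2) / 2) / 1"
      using pi_ge_two by (intro divide_left_mono) auto
    also have "\<dots> \<le> gauss c" by simp
    finally show ?thesis by (simp add: hermite_fun_def)
  qed
  have "(sin \<theta> * rb x y)\<^sup>2 \<le> 2 * c\<^sup>2 + 2 * (rc x \<theta> y c)\<^sup>2"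
  proof -
    have "sin \<theta> * rb x y = cos \<theta> * c - rc x \<theta> y c" by (simp add: rc_def)
    then have "(sin \<theta> * rb x y)\<^sup>2 \<le> 2 * (cos \<theta> * c)\<^sup>2 + 2 * (rc x \<theta> y c)\<^sup>2"
      using zero_le_power2[of "cos \<theta> * c + rc x \<theta> y c"] by (simp add: power2_sum power2_diff)
    moreover have "(cos \<theta> * c)\<^sup>2 \<le> c\<^sup>2"
      using mult_right_mono[of "(cos \<theta>)\<^sup>2" 1 "c\<^sup>2"] by (simp add: power_mult_distrib abs_square_le_1)
    ultimately show ?thesis by linarith
  qed
  moreover define X where "X = (sin \<theta>)\<^sup>2 * (x - y)\<^sup>2"
  moreover have "(sin \<theta> * rb x y)\<^sup>2 = X / 2"
    by (simp add: rb_def power_mult_distrib power_divide X_def)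
  moreover have "- ((sin \<theta>)\<^sup>2 / 32) * (x - y)\<^sup>2 = - (X / 32)" by (simp add: X_def)
  ultimately have e: "- (1/4) * (rc x \<theta> y c)\<^sup>2 + - (1/4) * c\<^sup>2 \<le> - ((sin \<theta>)\<^sup>2 / 32) * (x - y)\<^sup>2 + - (1/8) * c\<^sup>2"
    using zero_le_power2[of "rc x \<theta> y c"] by linarith
  have "P (rc x \<theta> y c) * hermite_fun 0 c \<le> (D * gauss (rc x \<theta> y c)) * gauss c"
    using assms h by (intro mult_mono) auto
  also have "\<dots> = D * exp (- (1/4) * (rc x \<theta> y c)\<^sup>2 + - (1/4) * c\<^sup>2)" by (simp only: exp_add mult.assoc)
  also have "\<dots> \<le> D * exp (- ((sin \<theta>)\<^sup>2 / 32) * (x - y)\<^sup>2 + - (1/8) * c\<^sup>2)"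
    using e assms(2) by (intro mult_left_mono) auto
  finally show ?thesis by (simp only: exp_add)
qed

text \<open>
  One bound serves for both \<^term>\<open>rx\<close> and \<^term>\<open>ry\<close>: as functions of \<open>c\<close>, both move
  with speed \<open>sin \<theta> / sqrt 2\<close>.
\<close>

definition sup_const :: "real \<Rightarrow> real \<Rightarrow> bool" where
  "sup_const p c0 \<longleftrightarrow> c0 \<ge> 0 \<and> (\<forall>B P C D bp c2 x m. B \<in> borel_measurable borel \<longrightarrow> P \<in> borel_measurable borel \<longrightarrow> C \<in> borel_measurable borel \<longrightarrow>
     (\<forall>u. B u \<ge> 0) \<longrightarrow> (\<forall>u. P u \<ge> 0) \<longrightarrow> (\<forall>u. C u \<ge> 0) \<longrightarrow> D \<ge> 0 \<longrightarrow> bp \<ge> 0 \<longrightarrow> c2 \<ge> 0 \<longrightarrow>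
     (\<forall>u. P u \<le> D * gauss u) \<longrightarrow> (\<integral>\<^sup>+u. ennreal (B u powr p) \<partial>lborel) \<le> ennreal bp \<longrightarrow>
     nsq C \<le> ennreal c2 \<longrightarrow> m = rx \<or> m = ry \<longrightarrow>
     (\<integral>\<^sup>+(\<theta>, y, c). ennreal (B (m x \<theta> y c) * (P (rc x \<theta> y c) * (C y * hermite_fun 0 c))) \<partial>nu)
       \<le> ennreal (c0 * D * bp powr (1 / p) * sqrt c2))"

lemmas sup_const_nonneg = sup_const_def[THEN iffD1, THEN conjunct1]
lemmas sup_constD = sup_const_def[THEN iffD1, THEN conjunct2, rule_format]

text \<open>At a fixed angle the substitution in c costs sin^(-1/p), and integrating C in y against
  a Gaussian of width of order 1/sin theta costs sin^(-1/2). The total exponent 1/p + 1/2 lies below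
  1 exactly when p > 2, and then the average over the angle is finite.\<close>

lemma Sop_sup_bound:
  assumes p: "p > 2"
  shows "\<exists>c0. sup_const p c0"
proof -
  define \<kappa> where "\<kappa> = 1 / p + 1 / 2"
  have k: "0 \<le> \<kappa>" "\<kappa> < 1" using p by (auto simp: \<kappa>_def field_simps)
  obtain Z where Z: "Z \<ge> 0" "(\<integral>\<^sup>+\<theta>. ennreal (sin \<theta> powr (- \<kappa>)) \<partial>Theta) \<le> ennreal Z"
    using sin_powr_Theta_finite[OF k] by blast
  \<comment> \<open>Total mass of exp(-c^2/8).\<close>
  define V where "V = sqrt (8 * pi)"
  define G where "G = (sqrt 2) powr (1 / p) * V powr (1 - 1 / p) * (sqrt (32 * pi)) powr (1 / 2)"
  have G: "G \<ge> 0" by (simp add: G_def)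
  show ?thesis
    unfolding sup_const_def
  proof (intro exI[of _ "G * Z"] conjI allI impI)
    show "0 \<le> G * Z" using G Z by simp
    fix B P C :: "real \<Rightarrow> real" and D bp c2 x :: real and m
    assume [measurable]: "B \<in> borel_measurable borel" "P \<in> borel_measurable borel" "C \<in> borel_measurable borel"
      and pos': "\<forall>u. B u \<ge> 0" "\<forall>u. P u \<ge> 0" "\<forall>u. C u \<ge> 0" and nn: "D \<ge> 0" "bp \<ge> 0" "c2 \<ge> 0"
      and P: "\<forall>u. P u \<le> D * gauss u" and B: "(\<integral>\<^sup>+u. ennreal (B u powr p) \<partial>lborel) \<le> ennreal bp"
      and C: "nsq C \<le> ennreal c2" and m: "m = rx \<or> m = ry"
    have pos: "B u \<ge> 0" "P u \<ge> 0" "C u \<ge> 0" for u using pos' by auto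
    have [measurable (raw)]: "(\<lambda>w. m (a w) (b w) (c w) (d w)) \<in> borel_measurable L"
      if [measurable]: "a \<in> borel_measurable L" "b \<in> borel_measurable L" "c \<in> borel_measurable L" "d \<in> borel_measurable L"
      for a b c d and L :: "'l measure"
      using m by (elim disjE) (simp_all add: that measurable_rxyc)
    have inner: "(\<integral>\<^sup>+y. \<integral>\<^sup>+c. ennreal (B (m x \<theta> y c) * (P (rc x \<theta> y c) * (C y * hermite_fun 0 c))) \<partial>lborel \<partial>lborel)
      \<le> ennreal (G * D * bp powr (1 / p) * sqrt c2) * ennreal (sin \<theta> powr (- \<kappa>))" if \<theta>: "sin \<theta> > 0" for \<theta>
    proof -
      let ?\<sigma> = "sin \<theta>"
      define b1 where "b1 = (sqrt 2 / ?\<sigma> * bp) powr (1 / p) * V powr (1 - 1 / p)"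
      have b1: "b1 \<ge> 0" by (simp add: b1_def)
      define E where "E y = exp (- (?\<sigma>\<^sup>2 / 32) * (x - y)\<^sup>2)" for y
      have [measurable]: "E \<in> borel_measurable borel" unfolding E_def[abs_def] by measurable
      have cstep: "(\<integral>\<^sup>+c. ennreal (B (m x \<theta> y c) * exp (- (1/8) * c\<^sup>2)) \<partial>lborel) \<le> ennreal b1" for y
        unfolding b1_def
      proof (rule nn_integral_powr_Jensen)
        \<comment> \<open>The rotated coordinate is affine in c; the sign e distinguishes
          \<open>rx\<close> from \<open>ry\<close> and disappears in the Jacobian.\<close>
        obtain k0 e where ke: "\<And>c. m x \<theta> y c = k0 + (e * ?\<sigma> / sqrt 2) * c" "\<bar>e\<bar> = 1"
        proof (cases "m = rx")
          case True
          then have "m x \<theta> y c = (ra x y + cos \<theta> * rb x y) / sqrt 2 + (1 * ?\<sigma> / sqrt 2) * c" for c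
            by (simp add: rx_def ra_def[of "ra x y"] add_divide_distrib)
          then show ?thesis by (rule that) simp
        next
          case False
          then have "m x \<theta> y c = (ra x y - cos \<theta> * rb x y) / sqrt 2 + (- 1 * ?\<sigma> / sqrt 2) * c" for c
            using m by (simp add: ry_def rb_def[of "ra x y"] add_divide_distrib diff_divide_distrib)
          then show ?thesis by (rule that) simp
        qed
        let ?\<kappa> = "e * ?\<sigma> / sqrt 2"
        have k0: "?\<kappa> \<noteq> 0" "\<bar>?\<kappa>\<bar> = ?\<sigma> / sqrt 2" using \<theta> ke(2) by (auto simp: abs_mult)
        have "(\<integral>\<^sup>+c. ennreal (B (m x \<theta> y c) powr p * exp (- (1/8) * c\<^sup>2)) \<partial>lborel) \<le> (\<integral>\<^sup>+c. ennreal (B (k0 + ?\<kappa> * c) powr p) \<partial>lborel)"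
          unfolding ke(1) by (intro nn_integral_mono ennreal_leI mult_left_le) auto
        also have "\<dots> = ennreal (sqrt 2 / ?\<sigma>) * (ennreal (?\<sigma> / sqrt 2) * (\<integral>\<^sup>+c. ennreal (B (k0 + ?\<kappa> * c) powr p) \<partial>lborel))"
          using \<theta> by (simp add: mult.assoc[symmetric] ennreal_mult[symmetric])
        also have "ennreal (?\<sigma> / sqrt 2) * (\<integral>\<^sup>+c. ennreal (B (k0 + ?\<kappa> * c) powr p) \<partial>lborel) = (\<integral>\<^sup>+c. ennreal (B c powr p) \<partial>lborel)"
          unfolding k0(2)[symmetric] by (rule nn_integral_real_affine[OF _ k0(1), symmetric]) measurable
        also have "ennreal (sqrt 2 / ?\<sigma>) * (\<integral>\<^sup>+c. ennreal (B c powr p) \<partial>lborel) \<le> ennreal (sqrt 2 / ?\<sigma>) * ennreal bp"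
          by (intro mult_left_mono B) auto
        also have "\<dots> = ennreal (sqrt 2 / ?\<sigma> * bp)" using \<theta> nn by (simp add: ennreal_mult[symmetric])
        finally show "(\<integral>\<^sup>+c. ennreal (B (m x \<theta> y c) powr p * exp (- (1/8) * c\<^sup>2)) \<partial>lborel) \<le> ennreal (sqrt 2 / ?\<sigma> * bp)" .
        show "(\<integral>\<^sup>+c. ennreal (exp (- (1/8) * c\<^sup>2)) \<partial>lborel) \<le> ennreal V"
          using nn_integral_gaussian[of "1/8"] by (simp add: V_def mult.commute)
      qed (use pos p \<theta> nn in \<open>auto simp: V_def\<close>)
      \<comment> \<open>Exponent 2, so only the square root of the mass of the Gaussian is lost;
        that mass is of order 1/sin theta.\<close>
      have ystep: "(\<integral>\<^sup>+y. ennreal (C y * E y) \<partial>lborel) \<le> ennreal (c2 powr (1 / 2) * (sqrt (32 * pi) / ?\<sigma>) powr (1 - 1 / 2))"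
      proof (rule nn_integral_powr_Jensen)
        have "(\<integral>\<^sup>+y. ennreal (C y powr 2 * E y) \<partial>lborel) \<le> nsq C"
          unfolding nsq_def using pos by (intro nn_integral_mono ennreal_leI) (auto simp: E_def intro!: mult_left_le)
        with C show "(\<integral>\<^sup>+y. ennreal (C y powr 2 * E y) \<partial>lborel) \<le> ennreal c2" by (rule order_trans[rotated])
        have "sqrt (pi / (?\<sigma>\<^sup>2 / 32)) = sqrt (32 * pi) / ?\<sigma>"
          using \<theta> by (simp add: real_sqrt_divide real_sqrt_mult)
        then show "(\<integral>\<^sup>+y. ennreal (E y) \<partial>lborel) \<le> ennreal (sqrt (32 * pi) / ?\<sigma>)"
          unfolding E_def using nn_integral_shift_gaussian[of "?\<sigma>\<^sup>2 / 32" x] \<theta> by simp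
      qed (use pos \<theta> nn in \<open>auto simp: E_def\<close>)
      have "(\<integral>\<^sup>+y. \<integral>\<^sup>+c. ennreal (B (m x \<theta> y c) * (P (rc x \<theta> y c) * (C y * hermite_fun 0 c))) \<partial>lborel \<partial>lborel)
        \<le> (\<integral>\<^sup>+y. \<integral>\<^sup>+c. ennreal (D * C y * E y) * ennreal (B (m x \<theta> y c) * exp (- (1/8) * c\<^sup>2)) \<partial>lborel \<partial>lborel)"
      proof (intro nn_integral_mono)
        fix y c
        have "(P (rc x \<theta> y c) * hermite_fun 0 c) * (B (m x \<theta> y c) * C y) \<le> (D * (E y * exp (- (1/8) * c\<^sup>2))) * (B (m x \<theta> y c) * C y)"
          unfolding E_def using P nn pos by (intro mult_right_mono Sop_kernel_gaussian) auto
        then show "ennreal (B (m x \<theta> y c) * (P (rc x \<theta> y c) * (C y * hermite_fun 0 c))) \<le> ennreal (D * C y * E y) * ennreal (B (m x \<theta> y c) * exp (- (1/8) * c\<^sup>2))"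
          using pos nn by (subst ennreal_mult[symmetric]) (auto intro!: ennreal_leI simp: E_def mult_ac)
      qed
      also have "\<dots> = (\<integral>\<^sup>+y. ennreal (D * C y * E y) * (\<integral>\<^sup>+c. ennreal (B (m x \<theta> y c) * exp (- (1/8) * c\<^sup>2)) \<partial>lborel) \<partial>lborel)"
        by (intro nn_integral_cong nn_integral_cmult) measurable
      also have "\<dots> \<le> (\<integral>\<^sup>+y. ennreal (D * b1) * ennreal (C y * E y) \<partial>lborel)"
      proof (rule nn_integral_mono)
        fix y
        have "ennreal (D * C y * E y) * (\<integral>\<^sup>+c. ennreal (B (m x \<theta> y c) * exp (- (1/8) * c\<^sup>2)) \<partial>lborel) \<le> ennreal (D * C y * E y) * ennreal b1"
          by (intro mult_left_mono cstep) auto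
        also have "\<dots> = ennreal (D * b1) * ennreal (C y * E y)"
          using pos nn b1 by (simp add: ennreal_mult[symmetric] E_def mult_ac)
        finally show "ennreal (D * C y * E y) * (\<integral>\<^sup>+c. ennreal (B (m x \<theta> y c) * exp (- (1/8) * c\<^sup>2)) \<partial>lborel) \<le> ennreal (D * b1) * ennreal (C y * E y)" .
      qed
      also have "\<dots> = ennreal (D * b1) * (\<integral>\<^sup>+y. ennreal (C y * E y) \<partial>lborel)"
        by (rule nn_integral_cmult) measurable
      also have "\<dots> \<le> ennreal (D * b1) * ennreal (c2 powr (1 / 2) * (sqrt (32 * pi) / ?\<sigma>) powr (1 - 1 / 2))"
        by (intro mult_left_mono ystep) auto
      also have "\<dots> = ennreal ((D * b1) * (c2 powr (1 / 2) * (sqrt (32 * pi) / ?\<sigma>) powr (1 - 1 / 2)))"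
        using nn b1 by (simp add: ennreal_mult[symmetric])
      also have "(D * b1) * (c2 powr (1 / 2) * (sqrt (32 * pi) / ?\<sigma>) powr (1 - 1 / 2)) = (G * D * bp powr (1 / p) * sqrt c2) * ?\<sigma> powr (- \<kappa>)"
      proof -
        have e1: "?\<sigma> powr (- \<kappa>) = inverse (?\<sigma> powr (1 / p) * ?\<sigma> powr (1 / 2))"
          unfolding \<kappa>_def powr_minus powr_add ..
        have e2: "b1 = (sqrt 2) powr (1 / p) / ?\<sigma> powr (1 / p) * bp powr (1 / p) * V powr (1 - 1 / p)"
          unfolding b1_def using \<theta> nn by (simp add: powr_mult powr_divide)
        have e3: "(sqrt (32 * pi) / ?\<sigma>) powr (1 - 1 / 2) = (sqrt (32 * pi)) powr (1 / 2) / ?\<sigma> powr (1 / 2)"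
          using \<theta> by (simp add: powr_divide)
        have e4: "c2 powr (1 / 2) = sqrt c2" using nn by (simp add: powr_half_sqrt)
        show ?thesis unfolding e1 e2 e3 e4 G_def by (simp only: divide_inverse inverse_mult_distrib mult_ac)
      qed
      finally show ?thesis using G nn by (simp add: ennreal_mult)
    qed
    have "AE \<theta> in Theta. sin \<theta> > 0"
      unfolding Theta_def
    proof (rule AE_uniform_measureI)
      have "AE \<theta> in lborel. \<theta> \<noteq> 0 \<and> \<theta> \<noteq> pi" using AE_lborel_singleton[of "0::real"] AE_lborel_singleton[of pi] by auto
      then show "AE \<theta> in lborel. \<theta> \<in> {0..pi} \<longrightarrow> 0 < sin \<theta>" by eventually_elim (auto intro: sin_gt_zero)
    qed simp
    then have "(\<integral>\<^sup>+\<theta>. \<integral>\<^sup>+y. \<integral>\<^sup>+c. ennreal (B (m x \<theta> y c) * (P (rc x \<theta> y c) * (C y * hermite_fun 0 c))) \<partial>lborel \<partial>lborel \<partial>Theta)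
       \<le> (\<integral>\<^sup>+\<theta>. ennreal (G * D * bp powr (1 / p) * sqrt c2) * ennreal (sin \<theta> powr (- \<kappa>)) \<partial>Theta)"
    proof (rule nn_integral_mono_AE[OF AE_mp[OF _ AE_I2]], safe)
      fix \<theta> assume "sin \<theta> > (0::real)"
      then show "(\<integral>\<^sup>+y. \<integral>\<^sup>+c. ennreal (B (m x \<theta> y c) * (P (rc x \<theta> y c) * (C y * hermite_fun 0 c))) \<partial>lborel \<partial>lborel)
         \<le> ennreal (G * D * bp powr (1 / p) * sqrt c2) * ennreal (sin \<theta> powr (- \<kappa>))" by (rule inner)
    qed
    also have "\<dots> = ennreal (G * D * bp powr (1 / p) * sqrt c2) * (\<integral>\<^sup>+\<theta>. ennreal (sin \<theta> powr (- \<kappa>)) \<partial>Theta)"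
      by (rule nn_integral_cmult) measurable
    also have "\<dots> \<le> ennreal (G * D * bp powr (1 / p) * sqrt c2) * ennreal Z"
      by (intro mult_left_mono Z) auto
    also have "\<dots> = ennreal (G * Z * D * bp powr (1 / p) * sqrt c2)"
      using G Z nn by (simp add: ennreal_mult[symmetric] mult_ac)
    finally show "(\<integral>\<^sup>+(\<theta>, y, c). ennreal (B (m x \<theta> y c) * (P (rc x \<theta> y c) * (C y * hermite_fun 0 c))) \<partial>nu)
       \<le> ennreal (G * Z * D * bp powr (1 / p) * sqrt c2)"
      by (subst nn_integral_nu) simp_all
  qed
qed

text \<open>Interpolation between a supremum bound and an L^2 bound, using positivity: Jensen at
  fixed x with exponent p/2 and total weight at most V, then the L^2 bound with Fm^(p/2) as
  argument. Squaring the Jensen factor V^(p/2 - 1) gives V^(p - 2).\<close>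

lemma nn_interpolation:
  fixes Fm wt :: "real \<Rightarrow> real \<times> real \<times> real \<Rightarrow> real"
  assumes [measurable]: "case_prod Fm \<in> borel_measurable (borel \<Otimes>\<^sub>M nu)" "case_prod wt \<in> borel_measurable (borel \<Otimes>\<^sub>M nu)"
    and pos: "\<And>x w. Fm x w \<ge> 0" "\<And>x w. wt x w \<ge> 0" and p: "p \<ge> 2" and VK: "V \<ge> 0" "K \<ge> 0"
    and V: "\<And>x. (\<integral>\<^sup>+w. ennreal (wt x w) \<partial>nu) \<le> ennreal V"
    and K: "(\<integral>\<^sup>+x. (\<integral>\<^sup>+w. ennreal (Fm x w powr (p / 2) * wt x w) \<partial>nu)\<^sup>2 \<partial>lborel) \<le> ennreal K"
  shows "AE x in lborel. (\<integral>\<^sup>+w. ennreal (Fm x w * wt x w) \<partial>nu) < \<infinity>"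
    and "(\<integral>\<^sup>+x. ennreal (enn2real (\<integral>\<^sup>+w. ennreal (Fm x w * wt x w) \<partial>nu) powr p) \<partial>lborel) \<le> ennreal (V powr (p - 2) * K)"
proof -
  let ?S = "\<lambda>x. \<integral>\<^sup>+w. ennreal (Fm x w * wt x w) \<partial>nu"
  let ?S' = "\<lambda>x. \<integral>\<^sup>+w. ennreal (Fm x w powr (p / 2) * wt x w) \<partial>nu"
  have m1: "(\<lambda>w. Fm x w) \<in> borel_measurable nu" "(\<lambda>w. wt x w) \<in> borel_measurable nu" for x
    by measurable
  have S' [measurable]: "?S' \<in> borel_measurable borel" by measurable
  have "AE x in lborel. (?S' x)\<^sup>2 \<noteq> \<infinity>"
    using K by (intro nn_integral_PInf_AE) (auto simp: top_unique)
  then have AE': "AE x in lborel. ?S x < \<infinity> \<and> ennreal (enn2real (?S x) powr p) \<le> ennreal (V powr (p - 2)) * (?S' x)\<^sup>2"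
  proof eventually_elim
    case (elim x)
    then have "?S' x \<noteq> top" by (auto simp: power2_eq_square ennreal_mult_eq_top_iff)
    then obtain \<alpha> where \<alpha>: "?S' x = ennreal \<alpha>" "\<alpha> \<ge> 0" by (cases "?S' x") auto
    have "?S x \<le> ennreal (\<alpha> powr (1 / (p / 2)) * V powr (1 - 1 / (p / 2)))"
      using p VK \<alpha> V[of x] pos by (intro nn_integral_powr_Jensen m1) auto
    also have "1 / (p / 2) = 2 / p" by simp
    finally have le: "?S x \<le> ennreal (\<alpha> powr (2 / p) * V powr (1 - 2 / p))" .
    have "enn2real (?S x) \<le> \<alpha> powr (2 / p) * V powr (1 - 2 / p)"
      using enn2real_mono[OF le] by simp
    then have "enn2real (?S x) powr p \<le> (\<alpha> powr (2 / p) * V powr (1 - 2 / p)) powr p"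
      using p by (intro powr_mono2) auto
    also have "\<dots> = \<alpha>\<^sup>2 * V powr (p - 2)"
    proof -
      have "(2 / p) * p = 2" "(1 - 2 / p) * p = p - 2" using p by (auto simp: field_simps)
      then have "(\<alpha> powr (2 / p) * V powr (1 - 2 / p)) powr p = \<alpha> powr 2 * V powr (p - 2)"
        by (simp add: powr_mult powr_powr)
      then show ?thesis using \<alpha>(2) by simp
    qed
    finally have "ennreal (enn2real (?S x) powr p) \<le> ennreal (V powr (p - 2)) * (?S' x)\<^sup>2"
      using \<alpha> by (simp add: ennreal_power ennreal_mult[symmetric] ennreal_leI mult.commute)
    moreover have "?S x < \<infinity>" using le by (rule order_le_less_trans) simp
    ultimately show ?case by simp
  qed
  then show "AE x in lborel. ?S x < \<infinity>" by eventually_elim simp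
  have "(\<integral>\<^sup>+x. ennreal (enn2real (?S x) powr p) \<partial>lborel) \<le> (\<integral>\<^sup>+x. ennreal (V powr (p - 2)) * (?S' x)\<^sup>2 \<partial>lborel)"
    by (rule nn_integral_mono_AE) (use AE' in eventually_elim, simp)
  also have "\<dots> = ennreal (V powr (p - 2)) * (\<integral>\<^sup>+x. (?S' x)\<^sup>2 \<partial>lborel)"
    by (rule nn_integral_cmult) measurable
  also have "\<dots> \<le> ennreal (V powr (p - 2)) * ennreal K"
    by (intro mult_left_mono K) auto
  finally show "(\<integral>\<^sup>+x. ennreal (enn2real (?S x) powr p) \<partial>lborel) \<le> ennreal (V powr (p - 2) * K)"
    using VK by (simp add: ennreal_mult)
qed

text \<open>The numbers \<open>\<alpha>\<close>, \<open>\<beta>\<close>, \<open>\<gamma>\<close>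
  stand for p-th powers of weighted norms, and \<open>H * \<beta> powr (2 / p)\<close> for the
  squared L^2 norm that such a norm controls. F, which will usually carry the weight, may occupy
  either rotated slot. The bound is linear in each of the three numbers, as a trilinear estimate for
  p-th powers has to be.\<close>

definition interpolation_const :: "real \<Rightarrow> real \<Rightarrow> bool" where
  "interpolation_const p c0 \<longleftrightarrow> c0 \<ge> 0 \<and> (\<forall>F B P C D M H \<alpha> \<beta> \<gamma>. F \<in> borel_measurable borel \<longrightarrow> B \<in> borel_measurable borel \<longrightarrow> P \<in> borel_measurable borel \<longrightarrow> C \<in> borel_measurable borel \<longrightarrow>
     (\<forall>u. F u \<ge> 0) \<longrightarrow> (\<forall>u. B u \<ge> 0) \<longrightarrow> (\<forall>u. P u \<ge> 0) \<longrightarrow> (\<forall>u. C u \<ge> 0) \<longrightarrow> D \<ge> 0 \<longrightarrow> M \<ge> 0 \<longrightarrow> H \<ge> 0 \<longrightarrow> \<alpha> \<ge> 0 \<longrightarrow> \<beta> \<ge> 0 \<longrightarrow> \<gamma> \<ge> 0 \<longrightarrow>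
     (\<forall>u. P u \<le> D * gauss u) \<longrightarrow> nsq P \<le> ennreal M \<longrightarrow>
     (\<integral>\<^sup>+u. ennreal (F u powr p) \<partial>lborel) \<le> ennreal \<alpha> \<longrightarrow> (\<integral>\<^sup>+u. ennreal (B u powr p) \<partial>lborel) \<le> ennreal \<beta> \<longrightarrow>
     nsq B \<le> ennreal (H * \<beta> powr (2 / p)) \<longrightarrow> nsq C \<le> ennreal (H * \<gamma> powr (2 / p)) \<longrightarrow>
     (\<forall>S\<in>{Sop F B P C, Sop B F P C}. (AE x in lborel. S x < \<infinity>) \<and>
       (\<integral>\<^sup>+x. ennreal (enn2real (S x) powr p) \<partial>lborel) \<le> ennreal ((c0 * D * sqrt H) powr (p - 2) * M * H\<^sup>2 * (\<alpha> * \<beta> * \<gamma>))))"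

lemmas interpolation_constD = interpolation_const_def[THEN iffD1, THEN conjunct2, rule_format]

lemma Sop_interpolation:
  assumes p: "p > 2"
  shows "\<exists>c0. interpolation_const p c0"
proof -
  obtain c0 where sc: "sup_const p c0" using Sop_sup_bound[OF p] by blast
  note c0 = sup_const_nonneg[OF sc] and sup = sup_constD[OF sc]
  show ?thesis
    unfolding interpolation_const_def
  proof (intro exI[of _ c0] conjI allI impI c0)
    fix F B P C :: "real \<Rightarrow> real" and D M H \<alpha> \<beta> \<gamma> :: real
    assume [measurable]: "F \<in> borel_measurable borel" "B \<in> borel_measurable borel" "P \<in> borel_measurable borel" "C \<in> borel_measurable borel"
      and pos': "\<forall>u. F u \<ge> 0" "\<forall>u. B u \<ge> 0" "\<forall>u. P u \<ge> 0" "\<forall>u. C u \<ge> 0" and nn: "D \<ge> 0" "M \<ge> 0" "H \<ge> 0" "\<alpha> \<ge> 0" "\<beta> \<ge> 0" "\<gamma> \<ge> 0"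
      and P: "\<forall>u. P u \<le> D * gauss u" and M: "nsq P \<le> ennreal M"
      and Fp: "(\<integral>\<^sup>+u. ennreal (F u powr p) \<partial>lborel) \<le> ennreal \<alpha>" and Bp: "(\<integral>\<^sup>+u. ennreal (B u powr p) \<partial>lborel) \<le> ennreal \<beta>"
      and B2: "nsq B \<le> ennreal (H * \<beta> powr (2 / p))" and C2: "nsq C \<le> ennreal (H * \<gamma> powr (2 / p))"
    have pos: "F u \<ge> 0" "B u \<ge> 0" "P u \<ge> 0" "C u \<ge> 0" for u using pos' by auto
    \<comment> \<open>V bounds the kernel built from B, P and C uniformly in x; K is the quadratic
      bound with F^(p/2) in the remaining slot.\<close>
    define V where "V = c0 * D * \<beta> powr (1 / p) * sqrt (H * \<gamma> powr (2 / p))"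
    define K where "K = \<alpha> * (H * \<beta> powr (2 / p)) * M * (H * \<gamma> powr (2 / p))"
    have VK: "V \<ge> 0" "K \<ge> 0" using c0 nn by (auto simp: V_def K_def)
    have V: "(\<integral>\<^sup>+(\<theta>, y, c). ennreal (B (m x \<theta> y c) * (P (rc x \<theta> y c) * (C y * hermite_fun 0 c))) \<partial>nu) \<le> ennreal V" if "m = rx \<or> m = ry" for m x
      unfolding V_def using sup[of B P C D \<beta> "H * \<gamma> powr (2 / p)" m x] pos nn P Bp C2 that by simp
    have Fq: "nsq (\<lambda>u. F u powr (p / 2)) \<le> ennreal \<alpha>"
    proof -
      have "(F u powr (p / 2))\<^sup>2 = F u powr p" for u
        by (simp add: power2_eq_square powr_add[symmetric])
      then show ?thesis using Fp by (simp add: nsq_def)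
    qed
    have prod: "nsq (\<lambda>u. F u powr (p / 2)) * nsq B * nsq P * nsq C \<le> ennreal K"
    proof -
      have "nsq (\<lambda>u. F u powr (p / 2)) * nsq B * nsq P * nsq C \<le> ennreal \<alpha> * ennreal (H * \<beta> powr (2 / p)) * ennreal M * ennreal (H * \<gamma> powr (2 / p))"
        by (intro mult_mono Fq B2 M C2) auto
      also have "\<dots> = ennreal K" unfolding K_def using nn by (simp add: ennreal_mult)
      finally show ?thesis .
    qed
    \<comment> \<open>Both \<open>\<beta>\<close> and \<open>\<gamma>\<close> enter V^(p - 2) with
      exponent (p - 2)/p and K with exponent 2/p, hence with total exponent 1.\<close>
    have VKe: "V powr (p - 2) * K = (c0 * D * sqrt H) powr (p - 2) * M * H\<^sup>2 * (\<alpha> * \<beta> * \<gamma>)"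
    proof -
      have g: "sqrt (\<gamma> powr (2 / p)) = \<gamma> powr (1 / p)" using nn by (simp add: powr_half_sqrt[symmetric] powr_powr)
      have e: "(1 / p) * (p - 2) + 2 / p = 1" using p by (simp add: field_simps)
      have one: "z powr ((1 / p) * (p - 2)) * z powr (2 / p) = z" if "z \<ge> 0" for z :: real
        unfolding powr_add[symmetric] e using that by simp
      have "V = (c0 * D * sqrt H) * (\<beta> powr (1 / p) * \<gamma> powr (1 / p))"
        unfolding V_def real_sqrt_mult g by simp
      then have "V powr (p - 2) = (c0 * D * sqrt H) powr (p - 2) * (\<beta> powr ((1 / p) * (p - 2)) * \<gamma> powr ((1 / p) * (p - 2)))"
        by (simp only: powr_mult powr_powr)
      then have "V powr (p - 2) * K = (c0 * D * sqrt H) powr (p - 2) * M * H\<^sup>2 * (\<alpha> * (\<beta> powr ((1 / p) * (p - 2)) * \<beta> powr (2 / p)) * (\<gamma> powr ((1 / p) * (p - 2)) * \<gamma> powr (2 / p)))"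
        unfolding K_def by (simp only: power2_eq_square mult_ac)
      then show ?thesis by (simp only: one nn)
    qed
    have S1: "(AE x in lborel. S x < \<infinity>) \<and> (\<integral>\<^sup>+x. ennreal (enn2real (S x) powr p) \<partial>lborel) \<le> ennreal (V powr (p - 2) * K)"
      if S: "S = Sop F B P C" for S
    proof -
      let ?Fm = "\<lambda>x (\<theta>, y, c). F (rx x \<theta> y c)"
      let ?wt = "\<lambda>x (\<theta>, y, c). B (ry x \<theta> y c) * (P (rc x \<theta> y c) * (C y * hermite_fun 0 c))"
      have Se: "S x = (\<integral>\<^sup>+w. ennreal (?Fm x w * ?wt x w) \<partial>nu)" for x
        unfolding S Sop_def by (intro nn_integral_cong) (auto simp: mult_ac)
      have Se': "Sop (\<lambda>u. F u powr (p / 2)) B P C x = (\<integral>\<^sup>+w. ennreal (?Fm x w powr (p / 2) * ?wt x w) \<partial>nu)" for x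
        unfolding Sop_def by (intro nn_integral_cong) (auto simp: mult_ac)
      have K': "(\<integral>\<^sup>+x. (\<integral>\<^sup>+w. ennreal (?Fm x w powr (p / 2) * ?wt x w) \<partial>nu)\<^sup>2 \<partial>lborel) \<le> ennreal K"
        unfolding Se'[symmetric] by (rule order_trans[OF Sop_sq_bound prod]) (use pos in auto)
      have V': "(\<integral>\<^sup>+w. ennreal (?wt x w) \<partial>nu) \<le> ennreal V" for x
        using V[of ry x] by (simp add: case_prod_unfold)
      have m: "case_prod ?Fm \<in> borel_measurable (borel \<Otimes>\<^sub>M nu)" "case_prod ?wt \<in> borel_measurable (borel \<Otimes>\<^sub>M nu)"
        by measurable
      note I = nn_interpolation[OF m _ _ less_imp_le[OF p] VK V' K']
      show ?thesis unfolding Se by (intro conjI I) (auto simp: pos)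
    qed
    have S2: "(AE x in lborel. S x < \<infinity>) \<and> (\<integral>\<^sup>+x. ennreal (enn2real (S x) powr p) \<partial>lborel) \<le> ennreal (V powr (p - 2) * K)"
      if S: "S = Sop B F P C" for S
    proof -
      let ?Fm = "\<lambda>x (\<theta>, y, c). F (ry x \<theta> y c)"
      let ?wt = "\<lambda>x (\<theta>, y, c). B (rx x \<theta> y c) * (P (rc x \<theta> y c) * (C y * hermite_fun 0 c))"
      have Se: "S x = (\<integral>\<^sup>+w. ennreal (?Fm x w * ?wt x w) \<partial>nu)" for x
        unfolding S Sop_def by (intro nn_integral_cong) (auto simp: mult_ac)
      have Se': "Sop B (\<lambda>u. F u powr (p / 2)) P C x = (\<integral>\<^sup>+w. ennreal (?Fm x w powr (p / 2) * ?wt x w) \<partial>nu)" for x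
        unfolding Sop_def by (intro nn_integral_cong) (auto simp: mult_ac)
      have prod': "nsq B * nsq (\<lambda>u. F u powr (p / 2)) * nsq P * nsq C \<le> ennreal K"
        using prod by (simp add: mult_ac)
      have K': "(\<integral>\<^sup>+x. (\<integral>\<^sup>+w. ennreal (?Fm x w powr (p / 2) * ?wt x w) \<partial>nu)\<^sup>2 \<partial>lborel) \<le> ennreal K"
        unfolding Se'[symmetric] by (rule order_trans[OF Sop_sq_bound prod']) (use pos in auto)
      have V': "(\<integral>\<^sup>+w. ennreal (?wt x w) \<partial>nu) \<le> ennreal V" for x
        using V[of rx x] by (simp add: case_prod_unfold)
      have m: "case_prod ?Fm \<in> borel_measurable (borel \<Otimes>\<^sub>M nu)" "case_prod ?wt \<in> borel_measurable (borel \<Otimes>\<^sub>M nu)"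
        by measurable
      note I = nn_interpolation[OF m _ _ less_imp_le[OF p] VK V' K']
      show ?thesis unfolding Se by (intro conjI I) (auto simp: pos)
    qed
    show "\<forall>S\<in>{Sop F B P C, Sop B F P C}. (AE x in lborel. S x < \<infinity>) \<and>
       (\<integral>\<^sup>+x. ennreal (enn2real (S x) powr p) \<partial>lborel) \<le> ennreal ((c0 * D * sqrt H) powr (p - 2) * M * H\<^sup>2 * (\<alpha> * \<beta> * \<gamma>))"
      using S1 S2 unfolding VKe by blast
  qed
qed

text \<open>In the constant 9, one factor 3 passes from a sum to a maximum; the other absorbs the
  three integrals, since 3 <= 3^p for p >= 1.\<close>

lemma three_term_Lp_bound:
  fixes S1 S2 S3 :: "real \<Rightarrow> ennreal" and h :: "real \<Rightarrow> real"
  assumes p: "p \<ge> 1" and c: "c \<ge> 0" and R: "R \<ge> 0"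
    and [measurable]: "h \<in> borel_measurable borel" "S1 \<in> borel_measurable borel" "S2 \<in> borel_measurable borel" "S3 \<in> borel_measurable borel"
    and h0: "\<And>x. h x \<ge> 0" and le: "\<And>x. ennreal (h x) \<le> ennreal c * (S1 x + S2 x + S3 x)"
    and fin: "AE x in lborel. S1 x < \<infinity>" "AE x in lborel. S2 x < \<infinity>" "AE x in lborel. S3 x < \<infinity>"
    and S: "(\<integral>\<^sup>+x. ennreal (enn2real (S1 x) powr p) \<partial>lborel) \<le> ennreal (R powr p)"
      "(\<integral>\<^sup>+x. ennreal (enn2real (S2 x) powr p) \<partial>lborel) \<le> ennreal (R powr p)"
      "(\<integral>\<^sup>+x. ennreal (enn2real (S3 x) powr p) \<partial>lborel) \<le> ennreal (R powr p)"
  shows "integrable lborel (\<lambda>x. h x powr p)" "(LINT x|lborel. h x powr p) powr (1 / p) \<le> 9 * c * R"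
proof -
  let ?k = "(3 * c) powr p"
  have pw: "AE x in lborel. ennreal (h x powr p) \<le> ennreal ?k * (ennreal (enn2real (S1 x) powr p) + ennreal (enn2real (S2 x) powr p) + ennreal (enn2real (S3 x) powr p))"
    using fin
  proof eventually_elim
    case (elim x)
    obtain a1 a2 a3 where a: "S1 x = ennreal a1" "S2 x = ennreal a2" "S3 x = ennreal a3" and pos: "a1 \<ge> 0" "a2 \<ge> 0" "a3 \<ge> 0"
      using elim by (metis enn2real_nonneg ennreal_enn2real infinity_ennreal_def)
    have "h x \<le> c * (a1 + a2 + a3)"
      using le[of x] c pos unfolding a by (simp add: ennreal_plus[symmetric] ennreal_mult[symmetric] del: ennreal_plus)
    also have "\<dots> \<le> c * (3 * max a1 (max a2 a3))" using c by (intro mult_left_mono) auto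
    finally have "h x powr p \<le> ((3 * c) * max a1 (max a2 a3)) powr p"
      using p h0 by (intro powr_mono2) (auto simp: mult_ac)
    also have "\<dots> = ?k * max a1 (max a2 a3) powr p" by (rule powr_mult)
    also have "max a1 (max a2 a3) powr p \<le> a1 powr p + a2 powr p + a3 powr p" by (auto simp: max_def)
    finally have "h x powr p \<le> ?k * (a1 powr p + a2 powr p + a3 powr p)" by (simp add: mult_left_mono)
    then have "ennreal (h x powr p) \<le> ennreal (?k * (a1 powr p + a2 powr p + a3 powr p))" by (rule ennreal_leI)
    also have "\<dots> = ennreal ?k * (ennreal (a1 powr p) + ennreal (a2 powr p) + ennreal (a3 powr p))"
      by (subst ennreal_mult) (auto simp: add.assoc)
    finally show ?case unfolding a using pos by simp
  qed
  have "(\<integral>\<^sup>+x. ennreal (h x powr p) \<partial>lborel) \<le> (\<integral>\<^sup>+x. ennreal ?k * (ennreal (enn2real (S1 x) powr p) + ennreal (enn2real (S2 x) powr p) + ennreal (enn2real (S3 x) powr p)) \<partial>lborel)"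
    by (rule nn_integral_mono_AE[OF pw])
  also have "\<dots> = ennreal ?k * ((\<integral>\<^sup>+x. ennreal (enn2real (S1 x) powr p) \<partial>lborel) + (\<integral>\<^sup>+x. ennreal (enn2real (S2 x) powr p) \<partial>lborel) + (\<integral>\<^sup>+x. ennreal (enn2real (S3 x) powr p) \<partial>lborel))"
    by (simp add: nn_integral_cmult nn_integral_add)
  also have "\<dots> \<le> ennreal ?k * (ennreal (R powr p) + ennreal (R powr p) + ennreal (R powr p))"
    by (intro mult_left_mono add_mono S) auto
  also have "\<dots> = ennreal (?k * (3 * R powr p))"
    by (simp add: ennreal_mult[symmetric] ennreal_plus[symmetric] del: ennreal_plus)
  also have "\<dots> \<le> ennreal ((9 * c * R) powr p)"
  proof (rule ennreal_leI)
    have "3 powr 1 \<le> 3 powr p" using p by (intro powr_mono) auto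
    then have "?k * (3 * R powr p) \<le> ?k * (3 powr p * R powr p)" by (intro mult_left_mono mult_right_mono) auto
    also have "\<dots> = ((3 * c) * (3 * R)) powr p" by (simp only: powr_mult)
    finally show "?k * (3 * R powr p) \<le> (9 * c * R) powr p" by (simp add: mult_ac)
  qed
  finally have fin: "(\<integral>\<^sup>+x. ennreal (h x powr p) \<partial>lborel) \<le> ennreal ((9 * c * R) powr p)" .
  show i: "integrable lborel (\<lambda>x. h x powr p)"
    using order_le_less_trans[OF fin ennreal_less_top] by (intro integrableI_bounded) auto
  have "(LINT x|lborel. h x powr p) \<le> (9 * c * R) powr p"
    using fin i by (subst (asm) nn_integral_eq_integral) auto
  then have "(LINT x|lborel. h x powr p) powr (1 / p) \<le> ((9 * c * R) powr p) powr (1 / p)"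
    using p by (intro powr_mono2) auto
  also have "\<dots> = 9 * c * R" using p c R by (simp add: powr_powr)
  finally show "(LINT x|lborel. h x powr p) powr (1 / p) \<le> 9 * c * R" .
qed

section \<open>Weighted Lebesgue spaces\<close>

lemma measurable_weighted [measurable]:
  "f \<in> borel_measurable borel \<Longrightarrow> weighted s f \<in> borel_measurable borel"
  unfolding weighted_def by measurable

lemma norm_weighted: "norm (weighted s f x) = japanese x powr s * norm (f x)"
  by (simp add: weighted_def norm_mult)

lemma norm_le_weighted: "s \<ge> 0 \<Longrightarrow> norm (f x) \<le> norm (weighted s f x)"
  unfolding norm_weighted using mult_right_mono[OF japanese_powr_ge_1[of s x], of "norm (f x)"] by simp

lemma weighted_inverse: "weighted s (\<lambda>x. of_real (japanese x powr (- s)) * g x) = g"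
  by (rule ext) (simp add: weighted_def of_real_mult[symmetric] mult.assoc[symmetric] powr_add[symmetric] less_imp_neq[symmetric] del: of_real_mult)

text \<open>Only the weighted function is known to be measurable; dividing its Borel version by the
  positive weight gives a Borel version of f itself.\<close>

lemma weighted_rep:
  assumes "weighted s f \<in> borel_measurable lebesgue"
  obtains g where "g \<in> borel_measurable borel" "AE x in lborel. f x = g x" "AE x in lborel. weighted s f x = weighted s g x"
proof -
  obtain G where [measurable]: "G \<in> borel_measurable borel" and ae: "AE x in lborel. weighted s f x = G x"
    using lebesgue_borel_rep[OF assms] by blast
  define g where "g x = of_real (japanese x powr (- s)) * G x" for x
  have wg: "weighted s g = G" unfolding g_def[abs_def] by (rule weighted_inverse)
  show thesis
  proof (rule that[of g])
    show "g \<in> borel_measurable borel" unfolding g_def[abs_def] by measurable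
    show "AE x in lborel. weighted s f x = weighted s g x" unfolding wg by (rule ae)
    show "AE x in lborel. f x = g x"
      using ae unfolding wg[symmetric] by eventually_elim (simp add: weighted_def less_imp_neq[symmetric])
  qed
qed

definition wint :: "real \<Rightarrow> real \<Rightarrow> (real \<Rightarrow> complex) \<Rightarrow> real" where
  "wint p s f = (LINT x|lborel. norm (weighted s f x) powr p)"

definition wL :: "real \<Rightarrow> real \<Rightarrow> (real \<Rightarrow> complex) set" where
  "wL p s = {f \<in> borel_measurable borel. integrable lborel (\<lambda>x. norm (weighted s f x) powr p)}"

lemma wint_nonneg [simp]: "wint p s f \<ge> 0" by (simp add: wint_def)

lemma nn_wint: "f \<in> wL p s \<Longrightarrow> (\<integral>\<^sup>+x. ennreal (norm (weighted s f x) powr p) \<partial>lborel) = ennreal (wint p s f)"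
  unfolding wint_def wL_def by (intro nn_integral_eq_integral) auto

text \<open>Reduces a weighted bound to Borel representatives and the explicit kernel. The inclusion
  in \<open>L2\<close> is what allows the operator to be identified with
  \<open>rotop\<close>.\<close>

lemma trilinear_bound_weightedI:
  assumes incl: "wL p s \<subseteq> L2"
    and bnd: "\<And>g1 g2 g3. g1 \<in> wL p s \<Longrightarrow> g2 \<in> wL p s \<Longrightarrow> g3 \<in> wL p s \<Longrightarrow>
      rotop g1 g2 g3 \<in> wL p s \<and> wint p s (rotop g1 g2 g3) powr (1 / p) \<le> C * (wint p s g1 powr (1 / p) * wint p s g2 powr (1 / p) * wint p s g3 powr (1 / p))"
  shows "trilinear_bound \<T>4 (wLp_space p s) (wLp_norm p s) C"
  unfolding trilinear_bound_def
proof (intro ballI)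
  have rep: "\<exists>g\<in>wL p s. (AE x in lborel. f x = g x) \<and> wLp_norm p s f = wint p s g powr (1 / p)" if "f \<in> wLp_space p s" for f
  proof -
    have "weighted s f \<in> borel_measurable lebesgue" using that by (simp add: wLp_space_def Lp_space_def)
    then obtain g where g: "g \<in> borel_measurable borel" "AE x in lborel. f x = g x" "AE x in lborel. weighted s f x = weighted s g x"
      by (rule weighted_rep)
    note L = Lp_AE[OF measurable_weighted[OF g(1)] g(3), of p]
    show ?thesis using that g L by (intro bexI[of _ g]) (auto simp: wLp_space_def wL_def wLp_norm_def wint_def)
  qed
  fix f1 f2 f3 assume f: "f1 \<in> wLp_space p s" "f2 \<in> wLp_space p s" "f3 \<in> wLp_space p s"
  obtain g1 where g1: "g1 \<in> wL p s" "AE x in lborel. f1 x = g1 x" "wLp_norm p s f1 = wint p s g1 powr (1 / p)"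
    using rep[OF f(1)] by blast
  obtain g2 where g2: "g2 \<in> wL p s" "AE x in lborel. f2 x = g2 x" "wLp_norm p s f2 = wint p s g2 powr (1 / p)"
    using rep[OF f(2)] by blast
  obtain g3 where g3: "g3 \<in> wL p s" "AE x in lborel. f3 x = g3 x" "wLp_norm p s f3 = wint p s g3 powr (1 / p)"
    using rep[OF f(3)] by blast
  note g = g1(1) g2(1) g3(1) and ae = g1(2) g2(2) g3(2) and n = g1(3) g2(3) g3(3)
  have gL: "g1 \<in> L2" "g2 \<in> L2" "g3 \<in> L2" using g incl by auto
  note b = bnd[OF g]
  have "AE x in lborel. weighted s (\<T>4 f1 f2 f3) x = weighted s (rotop g1 g2 g3) x"
    using T4_AE(2)[OF gL ae] by eventually_elim (simp add: weighted_def)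
  from Lp_AE[OF _ this, of p] b
  show "\<T>4 f1 f2 f3 \<in> wLp_space p s \<and> wLp_norm p s (\<T>4 f1 f2 f3) \<le> C * (wLp_norm p s f1 * wLp_norm p s f2 * wLp_norm p s f3)"
    unfolding n by (auto simp: wLp_space_def wL_def wLp_norm_def wint_def)
qed

lemma japanese_hermite0_bound:
  assumes s: "s \<ge> 0"
  shows "\<exists>D\<ge>1. \<forall>u. japanese u powr s * hermite_fun 0 u \<le> D * gauss u \<and> hermite_fun 0 u \<le> D * gauss u"
proof -
  \<comment> \<open>Small enough that the weight costs at most exp(u^2/4), half of the Gaussian
    exponent of the ground state. D collects the factor (1/e)^(s/2) from 1 + u^2 <= exp(e u^2) /
    e.\<close>
  define e where "e = 1 / (2 * (s + 1))"
  have e: "0 < e" "e \<le> 1" "e * s / 2 \<le> 1 / 4" using s by (auto simp: e_def field_simps)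
  define D where "D = (1 / e) powr (s / 2)"
  have D: "D \<ge> 1" unfolding D_def using e s by (intro ge_one_powr_ge_zero) auto
  have "japanese u powr s * hermite_fun 0 u \<le> D * gauss u" for u
  proof -
    have "1 + u\<^sup>2 \<le> (1 / e) * (1 + e * u\<^sup>2)" using e by (simp add: field_simps)
    also have "\<dots> \<le> (1 / e) * exp (e * u\<^sup>2)" using e by (intro mult_left_mono exp_ge_add_one_self) auto
    finally have "(1 + u\<^sup>2) powr (s / 2) \<le> ((1 / e) * exp (e * u\<^sup>2)) powr (s / 2)"
      using s by (intro powr_mono2) auto
    also have "\<dots> = D * exp (e * s / 2 * u\<^sup>2)"
      using e unfolding powr_mult D_def by (simp add: exp_powr_real mult_ac)
    also have "\<dots> \<le> D * exp (1 / 4 * u\<^sup>2)"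
    proof (intro mult_left_mono)
      have "e * s / 2 * u\<^sup>2 \<le> 1 / 4 * u\<^sup>2" by (rule mult_right_mono[OF e(3)]) simp
      then show "exp (e * s / 2 * u\<^sup>2) \<le> exp (1 / 4 * u\<^sup>2)" by (simp only: exp_le_cancel_iff)
    qed (use D in simp)
    also have "(1 + u\<^sup>2) powr (s / 2) = japanese u powr s"
      by (simp add: japanese_def powr_half_sqrt[symmetric] powr_powr)
    finally have J: "japanese u powr s \<le> D * exp (1 / 4 * u\<^sup>2)" .
    have "exp (- (u\<^sup>2) / 2) / sqrt (sqrt pi) \<le> exp (- (u\<^sup>2) / 2) / 1"
      using pi_ge_two by (intro divide_left_mono) auto
    then have "hermite_fun 0 u \<le> exp (- (u\<^sup>2) / 2)" by (simp add: hermite_fun_def)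
    then have "japanese u powr s * hermite_fun 0 u \<le> (D * exp (1 / 4 * u\<^sup>2)) * exp (- (u\<^sup>2) / 2)"
      using D by (intro mult_mono J) auto
    also have "\<dots> = D * gauss u" by (simp add: mult.assoc exp_add[symmetric])
    finally show ?thesis .
  qed
  moreover have "hermite_fun 0 u \<le> japanese u powr s * hermite_fun 0 u" for u
    using mult_right_mono[OF japanese_powr_ge_1[OF s, of u], of "hermite_fun 0 u"] by simp
  ultimately show ?thesis using D by (meson order_trans)
qed

lemma nsq_gauss_bound:
  assumes "D \<ge> 0" "\<And>u. 0 \<le> P u" "\<And>u. P u \<le> D * gauss u"
  shows "nsq P \<le> ennreal (D\<^sup>2 * sqrt (2 * pi))"
proof -
  have "nsq P \<le> (\<integral>\<^sup>+u. ennreal (D\<^sup>2) * ennreal (exp (- (1/2) * u\<^sup>2)) \<partial>lborel)"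
    unfolding nsq_def
  proof (intro nn_integral_mono)
    fix u
    have "(P u)\<^sup>2 \<le> (D * gauss u)\<^sup>2" using assms by (intro power_mono) auto
    also have "\<dots> = D\<^sup>2 * exp (- (1/2) * u\<^sup>2)" unfolding power_mult_distrib exp_double[symmetric] by simp
    finally show "ennreal ((P u)\<^sup>2) \<le> ennreal (D\<^sup>2) * ennreal (exp (- (1/2) * u\<^sup>2))"
      by (simp add: ennreal_mult[symmetric] ennreal_leI)
  qed
  also have "\<dots> = ennreal (D\<^sup>2) * ennreal (sqrt (pi / (1/2)))"
    by (subst nn_integral_cmult, measurable) (simp only: nn_integral_gaussian)
  finally show ?thesis by (simp add: ennreal_mult mult.commute)
qed

text \<open>Each of the three terms is covered by \<open>Sop_sq_bound\<close>. The case is separate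
  from p > 2 because at p = 2 the angular exponent 1/p + 1/2 reaches 1 and the supremum estimate
  breaks down.\<close>

theorem T4_bound_weighted_L2:
  assumes s: "s \<ge> 0"
  shows "\<exists>C. trilinear_bound \<T>4 (wLp_space 2 s) (wLp_norm 2 s) C"
proof -
  obtain D where D: "D \<ge> 1" "\<And>u. japanese u powr s * hermite_fun 0 u \<le> D * gauss u" using japanese_hermite0_bound[OF s] by blast
  \<comment> \<open>Taken to be at least 1, so that it also bounds the squared norm of the ground
    state without weight.\<close>
  define M where "M = max 1 (D\<^sup>2 * sqrt (2 * pi))"
  have M: "M \<ge> 1" by (simp add: M_def)
  let ?Jh = "\<lambda>x. japanese x powr s * hermite_fun 0 x"
  have nM: "nsq ?Jh \<le> ennreal M" "nsq (hermite_fun 0) \<le> ennreal M"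
  proof -
    have "nsq ?Jh \<le> ennreal (D\<^sup>2 * sqrt (2 * pi))" using D by (intro nsq_gauss_bound) auto
    also have "\<dots> \<le> ennreal M" unfolding M_def by (intro ennreal_leI) simp
    finally show "nsq ?Jh \<le> ennreal M" .
    show "nsq (hermite_fun 0) \<le> ennreal M" using M by (simp add: nsq_hermite0)
  qed
  let ?c = "sqrt (8 / pi) * 3 powr (s / 2)"
  have w2: "nsq (\<lambda>x. norm (weighted s g x)) = ennreal (wint 2 s g)" if "g \<in> wL 2 s" for g
    using nn_wint[OF that] by (simp add: nsq_def)
  have n2: "nsq (\<lambda>x. norm (g x)) \<le> ennreal (wint 2 s g)" if "g \<in> wL 2 s" for g
    unfolding w2[OF that, symmetric] nsq_def using s by (intro nn_integral_mono ennreal_leI power_mono norm_le_weighted) auto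
  have incl: "wL 2 s \<subseteq> L2"
  proof
    fix g assume g: "g \<in> wL 2 s"
    show "g \<in> L2" using n2[OF g] g by (intro L2_I(1)[of g "wint 2 s g"]) (auto simp: wL_def nsq_def)
  qed
  have "trilinear_bound \<T>4 (wLp_space 2 s) (wLp_norm 2 s) (9 * ?c * sqrt M)"
  proof (rule trilinear_bound_weightedI[OF incl])
    fix g1 g2 g3 assume g: "g1 \<in> wL 2 s" "g2 \<in> wL 2 s" "g3 \<in> wL 2 s"
    then have [measurable]: "g1 \<in> borel_measurable borel" "g2 \<in> borel_measurable borel" "g3 \<in> borel_measurable borel"
      by (auto simp: wL_def)
    define R where "R = sqrt M * (sqrt (wint 2 s g1) * sqrt (wint 2 s g2) * sqrt (wint 2 s g3))"
    have R2: "R\<^sup>2 = wint 2 s g1 * wint 2 s g2 * M * wint 2 s g3"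
      unfolding R_def power_mult_distrib using M by simp
    have R: "R \<ge> 0" using M by (simp add: R_def)
    have S: "(AE x in lborel. S x < \<infinity>) \<and> (\<integral>\<^sup>+x. ennreal (enn2real (S x) powr 2) \<partial>lborel) \<le> ennreal (R powr 2)"
      if S: "S = Sop A B P C" and [measurable]: "A \<in> borel_measurable borel" "B \<in> borel_measurable borel" "P \<in> borel_measurable borel" "C \<in> borel_measurable borel"
        and pos: "\<And>x. A x \<ge> 0" "\<And>x. B x \<ge> 0" "\<And>x. P x \<ge> 0" "\<And>x. C x \<ge> 0"
        and n: "nsq A \<le> ennreal (wint 2 s g1)" "nsq B \<le> ennreal (wint 2 s g2)" "nsq P \<le> ennreal M" "nsq C \<le> ennreal (wint 2 s g3)"
      for S A B P C
    proof -
      have [measurable]: "S \<in> borel_measurable borel" unfolding S by measurable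
      have "(\<integral>\<^sup>+x. (S x)\<^sup>2 \<partial>lborel) \<le> nsq A * nsq B * nsq P * nsq C"
        unfolding S by (rule Sop_sq_bound) (auto simp: pos)
      also have "\<dots> \<le> ennreal (wint 2 s g1) * ennreal (wint 2 s g2) * ennreal M * ennreal (wint 2 s g3)"
        by (intro mult_mono n) auto
      also have "\<dots> = ennreal (R\<^sup>2)" unfolding R2 using M by (simp add: ennreal_mult)
      finally have le: "(\<integral>\<^sup>+x. (S x)\<^sup>2 \<partial>lborel) \<le> ennreal (R\<^sup>2)" .
      then have "AE x in lborel. (S x)\<^sup>2 \<noteq> \<infinity>"
        by (intro nn_integral_PInf_AE) (auto simp: top_unique)
      then have fin: "AE x in lborel. S x < \<infinity>"
      proof eventually_elim
        case (elim x)
        then show ?case by (cases "S x") (auto simp: power2_eq_square)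
      qed
      have "(\<integral>\<^sup>+x. ennreal (enn2real (S x) powr 2) \<partial>lborel) = (\<integral>\<^sup>+x. (S x)\<^sup>2 \<partial>lborel)"
        by (rule nn_integral_cong_AE) (use fin in eventually_elim, simp add: ennreal_power[symmetric])
      then show ?thesis using fin le R by simp
    qed
    let ?h = "\<lambda>x. norm (weighted s (rotop g1 g2 g3) x)"
    let ?S1 = "Sop (\<lambda>x. norm (weighted s g1 x)) (\<lambda>x. norm (g2 x)) (hermite_fun 0) (\<lambda>x. norm (g3 x))"
    let ?S2 = "Sop (\<lambda>x. norm (g1 x)) (\<lambda>x. norm (weighted s g2 x)) (hermite_fun 0) (\<lambda>x. norm (g3 x))"
    let ?S3 = "Sop (\<lambda>x. norm (g1 x)) (\<lambda>x. norm (g2 x)) ?Jh (\<lambda>x. norm (g3 x))"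
    have s1: "(AE x in lborel. ?S1 x < \<infinity>) \<and> (\<integral>\<^sup>+x. ennreal (enn2real (?S1 x) powr 2) \<partial>lborel) \<le> ennreal (R powr 2)"
      by (rule S[OF refl]) (auto simp: w2 n2 g nM)
    have s2: "(AE x in lborel. ?S2 x < \<infinity>) \<and> (\<integral>\<^sup>+x. ennreal (enn2real (?S2 x) powr 2) \<partial>lborel) \<le> ennreal (R powr 2)"
      by (rule S[OF refl]) (auto simp: w2 n2 g nM)
    have s3: "(AE x in lborel. ?S3 x < \<infinity>) \<and> (\<integral>\<^sup>+x. ennreal (enn2real (?S3 x) powr 2) \<partial>lborel) \<le> ennreal (R powr 2)"
      by (rule S[OF refl]) (auto simp: w2 n2 g nM)
    have "integrable lborel (\<lambda>x. ?h x powr 2)" "(LINT x|lborel. ?h x powr 2) powr (1 / 2) \<le> 9 * ?c * R"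
      by (rule three_term_Lp_bound[where ?S1.0="?S1" and ?S2.0="?S2" and ?S3.0="?S3" and c="?c" and R=R and p=2 and h="?h",
            OF _ _ R _ _ _ _ _ Sop_weight[OF s] s1[THEN conjunct1] s2[THEN conjunct1] s3[THEN conjunct1]
            s1[THEN conjunct2] s2[THEN conjunct2] s3[THEN conjunct2]]; (measurable | simp))+
    then show "rotop g1 g2 g3 \<in> wL 2 s \<and> wint 2 s (rotop g1 g2 g3) powr (1 / 2)
       \<le> 9 * ?c * sqrt M * (wint 2 s g1 powr (1 / 2) * wint 2 s g2 powr (1 / 2) * wint 2 s g3 powr (1 / 2))"
      unfolding wL_def wint_def[of 2 s "rotop g1 g2 g3"] by (auto simp: R_def powr_half_sqrt mult_ac)
  qed
  then show ?thesis by blast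
qed

section \<open>Weighted L^p for p > 2\<close>

lemma japanese_powr_integral:
  assumes r: "r > 1"
  shows "\<exists>I\<ge>0. (\<integral>\<^sup>+x. ennreal (japanese x powr (- r)) \<partial>lborel) \<le> ennreal I"
proof -
  define t where "t = - (1 powr (- r + 1)) / (- r + 1)"
  have t: "t \<ge> 0" using r by (simp add: t_def field_simps)
  have i: "((\<lambda>x. x powr (- r)) has_integral t) {1..}"
    unfolding t_def using r by (intro has_integral_powr_to_inf) auto
  have I1: "(\<integral>\<^sup>+x. ennreal (x powr (- r)) * indicator {1..} x \<partial>lborel) = ennreal t"
    using i by (intro nn_integral_has_integral_lebesgue') auto
  have "(\<integral>\<^sup>+x. ennreal (x powr (- r)) * indicator {1..} x \<partial>lborel)
      = ennreal \<bar>-1\<bar> * (\<integral>\<^sup>+x. ennreal ((0 + -1 * x) powr (- r)) * indicator {1..} (0 + -1 * x) \<partial>lborel)"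
    by (rule nn_integral_real_affine) auto
  then have I2: "(\<integral>\<^sup>+x. ennreal ((- x) powr (- r)) * indicator {1..} (- x) \<partial>lborel) = ennreal t"
    unfolding I1 by simp
  have pw: "ennreal (japanese x powr (- r)) \<le> indicator {-1..1} x + (ennreal (x powr (- r)) * indicator {1..} x + ennreal ((- x) powr (- r)) * indicator {1..} (- x))" for x
  proof -
    have J: "japanese x \<ge> \<bar>x\<bar>" unfolding japanese_def by (rule real_le_rsqrt) simp
    have c1: "japanese x powr (- r) \<le> 1"
      using powr_mono2'[of "-r" 1 "japanese x"] japanese_ge_1[of x] r by simp
    have c2: "japanese x powr (- r) \<le> \<bar>x\<bar> powr (- r)" if "\<bar>x\<bar> > 1"
      using J that r by (intro powr_mono2') auto
    consider (small) "x \<in> {-1..1}" | (large) "x > 1" | (neg) "x < -1"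
      by (cases "x < -1"; cases "x > 1") auto
    then show "ennreal (japanese x powr (- r)) \<le> indicator {-1..1} x + (ennreal (x powr (- r)) * indicator {1..} x + ennreal ((- x) powr (- r)) * indicator {1..} (- x))"
    proof cases
      case small
      then show ?thesis using c1 by (intro add_increasing2) simp_all
    next
      case large
      then show ?thesis using c2 by (simp add: indicator_def ennreal_leI)
    next
      case neg
      then show ?thesis using c2 by (simp add: indicator_def ennreal_leI)
    qed
  qed
  have "(\<integral>\<^sup>+x. ennreal (japanese x powr (- r)) \<partial>lborel)
    \<le> (\<integral>\<^sup>+x. indicator {-1..1} x + (ennreal (x powr (- r)) * indicator {1..} x + ennreal ((- x) powr (- r)) * indicator {1..} (- x)) \<partial>lborel)"
    by (intro nn_integral_mono pw)
  also have "\<dots> = (\<integral>\<^sup>+x. indicator {-1..1::real} x \<partial>lborel) + ((\<integral>\<^sup>+x. ennreal (x powr (- r)) * indicator {1..} x \<partial>lborel)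
      + (\<integral>\<^sup>+x. ennreal ((- x) powr (- r)) * indicator {1..} (- x) \<partial>lborel))"
  proof -
    have m: "(\<lambda>x. ennreal (x powr (- r)) * indicator {1..} x) \<in> borel_measurable lborel"
      "(\<lambda>x. ennreal ((- x) powr (- r)) * indicator {1..} (- x)) \<in> borel_measurable lborel"
      "(indicator {-1..1} :: real \<Rightarrow> ennreal) \<in> borel_measurable lborel"
      by measurable
    show ?thesis by (simp only: nn_integral_add[OF m(3) borel_measurable_add[OF m(1,2)]] nn_integral_add[OF m(1,2)])
  qed
  also have "\<dots> = ennreal (2 + (t + t))"
  proof -
    have "ennreal (2 + (t + t)) = ennreal 2 + (ennreal t + ennreal t)"
      using t by (simp only: ennreal_plus add_nonneg_nonneg zero_le_numeral)
    then show ?thesis unfolding I1 I2 by simp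
  qed
  finally show ?thesis using t by (intro exI[of _ "2 + (t + t)"]) auto
qed

text \<open>The source of the threshold for s: factors that receive no weight must still be square
  integrable.\<close>

lemma weighted_Lp_Hoelder:
  assumes p: "p > 2" and s: "s > 1 / 2 - 1 / p"
  shows "\<exists>H\<ge>0. \<forall>g\<in>wL p s. nsq (\<lambda>x. norm (g x)) \<le> ennreal (H * wint p s g powr (2 / p))"
proof -
  \<comment> \<open>Chosen with r p/2 - r = s p, so that Hoelder with exponent p/2 and density
    <x>^(-r) returns the weighted L^p norm. The density is integrable for r > 1, which is the
    condition s > 1/2 - 1/p.\<close>
  define r where "r = 2 * s * p / (p - 2)"
  have r: "r > 1"
  proof -
    have "(1 / 2 - 1 / p) * (2 * p) < s * (2 * p)" using s p by (intro mult_strict_right_mono) auto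
    moreover have "(1 / 2 - 1 / p) * (2 * p) = p - 2" using p by (simp add: field_simps)
    ultimately show ?thesis using p by (simp add: r_def pos_less_divide_eq)
  qed
  obtain I where I: "I \<ge> 0" "(\<integral>\<^sup>+x. ennreal (japanese x powr (- r)) \<partial>lborel) \<le> ennreal I"
    using japanese_powr_integral[OF r] by blast
  show ?thesis
  proof (intro exI[of _ "I powr (1 - 1 / (p / 2))"] conjI ballI)
    fix g assume g: "g \<in> wL p s"
    then have [measurable]: "g \<in> borel_measurable borel" by (simp add: wL_def)
    have "(\<integral>\<^sup>+x. ennreal (((norm (g x))\<^sup>2 * japanese x powr r) * japanese x powr (- r)) \<partial>lborel)
       \<le> ennreal (wint p s g powr (1 / (p / 2)) * I powr (1 - 1 / (p / 2)))"
    proof (rule nn_integral_powr_Jensen)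
      have "((norm (g x))\<^sup>2 * japanese x powr r) powr (p / 2) * japanese x powr (- r) = norm (weighted s g x) powr p" for x
      proof -
        have e: "r * (p / 2) - r = s * p"
        proof -
          have "r * (p / 2) - r = r * (p - 2) / 2" by (simp add: field_simps)
          also have "\<dots> = s * p" using p by (simp add: r_def)
          finally show ?thesis .
        qed
        have "((norm (g x))\<^sup>2) powr (p / 2) = norm (g x) powr p"
          by (cases "g x = 0") (simp_all add: powr_numeral[symmetric] powr_powr del: powr_numeral)
        then have "((norm (g x))\<^sup>2 * japanese x powr r) powr (p / 2) * japanese x powr (- r) = norm (g x) powr p * (japanese x powr (r * (p / 2)) * japanese x powr (- r))"
          by (simp add: powr_mult powr_powr)
        also have "japanese x powr (r * (p / 2)) * japanese x powr (- r) = japanese x powr (s * p)"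
          unfolding powr_add[symmetric] using e by simp
        finally show ?thesis by (simp add: norm_weighted powr_mult powr_powr mult.commute)
      qed
      then show "(\<integral>\<^sup>+x. ennreal (((norm (g x))\<^sup>2 * japanese x powr r) powr (p / 2) * japanese x powr (- r)) \<partial>lborel) \<le> ennreal (wint p s g)"
        using nn_wint[OF g] by simp
    qed (use p I in auto)
    also have "(\<lambda>x. ennreal (((norm (g x))\<^sup>2 * japanese x powr r) * japanese x powr (- r))) = (\<lambda>x. ennreal ((norm (g x))\<^sup>2))"
      by (intro ext) (simp add: mult.assoc powr_add[symmetric] less_imp_neq[symmetric])
    finally show "nsq (\<lambda>x. norm (g x)) \<le> ennreal (I powr (1 - 1 / (p / 2)) * wint p s g powr (2 / p))"
      by (simp add: nsq_def mult.commute)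
  qed simp
qed

theorem T4_bound_weighted_Lp:
  assumes p: "p > 2" and s: "s > 1 / 2 - 1 / p"
  shows "\<exists>C. trilinear_bound \<T>4 (wLp_space p s) (wLp_norm p s) C"
proof -
  have "1 / p < 1 / 2" using p by (simp add: field_simps)
  then have s0: "s \<ge> 0" using s by linarith
  obtain D where D: "D \<ge> 1" "\<And>u. japanese u powr s * hermite_fun 0 u \<le> D * gauss u" "\<And>u. hermite_fun 0 u \<le> D * gauss u"
    using japanese_hermite0_bound[OF s0] by blast
  obtain H where H: "H \<ge> 0" "\<And>g. g \<in> wL p s \<Longrightarrow> nsq (\<lambda>x. norm (g x)) \<le> ennreal (H * wint p s g powr (2 / p))"
    using weighted_Lp_Hoelder[OF p s] by blast
  define M where "M = D\<^sup>2 * sqrt (2 * pi)"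
  have M: "M \<ge> 0" by (simp add: M_def)
  let ?Jh = "\<lambda>x. japanese x powr s * hermite_fun 0 x"
  have nM: "nsq ?Jh \<le> ennreal M" "nsq (hermite_fun 0) \<le> ennreal M"
    unfolding M_def using D by (intro nsq_gauss_bound; simp)+
  obtain c0 where ic: "interpolation_const p c0" using Sop_interpolation[OF p] by blast
  note interp = interpolation_constD[OF ic]
  let ?c = "sqrt (8 / pi) * 3 powr (s / 2)"
  define k where "k = (c0 * D * sqrt H) powr (p - 2) * M * H\<^sup>2"
  have k: "k \<ge> 0" using M by (simp add: k_def)
  have np: "(\<integral>\<^sup>+u. ennreal (norm (g u) powr p) \<partial>lborel) \<le> ennreal (wint p s g)" if "g \<in> wL p s" for g
    unfolding nn_wint[OF that, symmetric] using s0 p by (intro nn_integral_mono ennreal_leI powr_mono2 norm_le_weighted) auto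
  have incl: "wL p s \<subseteq> L2"
  proof
    fix g assume g: "g \<in> wL p s"
    show "g \<in> L2" using H(2)[OF g] g H(1) by (intro L2_I(1)[of g "H * wint p s g powr (2 / p)"]) (auto simp: wL_def nsq_def)
  qed
  have "trilinear_bound \<T>4 (wLp_space p s) (wLp_norm p s) (9 * ?c * k powr (1 / p))"
  proof (rule trilinear_bound_weightedI[OF incl])
    fix g1 g2 g3 assume g: "g1 \<in> wL p s" "g2 \<in> wL p s" "g3 \<in> wL p s"
    then have [measurable]: "g1 \<in> borel_measurable borel" "g2 \<in> borel_measurable borel" "g3 \<in> borel_measurable borel"
      by (auto simp: wL_def)
    define R where "R = (k * (wint p s g1 * wint p s g2 * wint p s g3)) powr (1 / p)"
    have R: "R \<ge> 0" by (simp add: R_def)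
    have Rp: "R powr p = k * (wint p s g1 * wint p s g2 * wint p s g3)" using k p by (simp add: R_def powr_powr)
    let ?h = "\<lambda>x. norm (weighted s (rotop g1 g2 g3) x)"
    let ?n = "\<lambda>g x. norm (g x)" and ?w = "\<lambda>g x. norm (weighted s g x)"
    let ?S1 = "Sop (?w g1) (?n g2) (hermite_fun 0) (?n g3)"
    let ?S2 = "Sop (?n g1) (?w g2) (hermite_fun 0) (?n g3)"
    let ?S3 = "Sop (?n g1) (?n g2) ?Jh (?n g3)"
    have s1: "(AE x in lborel. ?S1 x < \<infinity>) \<and> (\<integral>\<^sup>+x. ennreal (enn2real (?S1 x) powr p) \<partial>lborel) \<le> ennreal (R powr p)"
      unfolding Rp k_def
      by (rule interp[where S="?S1" and F="?w g1" and B="?n g2" and P="hermite_fun 0" and C="?n g3"])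
        (use D H M nM g in \<open>simp_all add: nn_wint np\<close>)
    \<comment> \<open>The weighted factor is now in the second slot, the other member of the pair in
      \<open>interpolation_const\<close>.\<close>
    have s2: "(AE x in lborel. ?S2 x < \<infinity>) \<and> (\<integral>\<^sup>+x. ennreal (enn2real (?S2 x) powr p) \<partial>lborel) \<le> ennreal (R powr p)"
      unfolding Rp mult.commute[of "wint p s g1" "wint p s g2"] k_def
      by (rule interp[where S="?S2" and F="?w g2" and B="?n g1" and P="hermite_fun 0" and C="?n g3"])
        (use D H M nM g in \<open>simp_all add: nn_wint np\<close>)
    \<comment> \<open>Here the weight sits on the Gaussian, and g1 takes the place of F without a
      weight.\<close>
    have s3: "(AE x in lborel. ?S3 x < \<infinity>) \<and> (\<integral>\<^sup>+x. ennreal (enn2real (?S3 x) powr p) \<partial>lborel) \<le> ennreal (R powr p)"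
      unfolding Rp k_def
      by (rule interp[where S="?S3" and F="?n g1" and B="?n g2" and P="?Jh" and C="?n g3"])
        (use D H M nM g in \<open>simp_all add: nn_wint np\<close>)
    have p1: "p \<ge> 1" using p by simp
    have "integrable lborel (\<lambda>x. ?h x powr p)" "(LINT x|lborel. ?h x powr p) powr (1 / p) \<le> 9 * ?c * R"
      by (rule three_term_Lp_bound[where ?S1.0="?S1" and ?S2.0="?S2" and ?S3.0="?S3" and c="?c" and R=R and p=p and h="?h",
            OF p1 _ R _ _ _ _ _ Sop_weight[OF s0] s1[THEN conjunct1] s2[THEN conjunct1] s3[THEN conjunct1]
            s1[THEN conjunct2] s2[THEN conjunct2] s3[THEN conjunct2]]; (measurable | simp))+
    then show "rotop g1 g2 g3 \<in> wL p s \<and> wint p s (rotop g1 g2 g3) powr (1 / p)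
       \<le> 9 * ?c * k powr (1 / p) * (wint p s g1 powr (1 / p) * wint p s g2 powr (1 / p) * wint p s g3 powr (1 / p))"
      unfolding wL_def wint_def[of p s "rotop g1 g2 g3"] by (auto simp: R_def powr_mult mult_ac)
  qed
  then show ?thesis by blast
qed

section \<open>Weighted L^infinity\<close>

lemma esssup_norm_nonneg:
  fixes f :: "real \<Rightarrow> complex"
  assumes [measurable]: "f \<in> borel_measurable lebesgue"
  shows "esssup lebesgue (\<lambda>x. ereal (norm (f x))) \<ge> 0"
proof -
  \<comment> \<open>For the zero measure every essential supremum would be minus infinity; this
    rules that out.\<close>
  have "emeasure lebesgue (space lebesgue :: real set) \<noteq> 0" by simp
  then have "esssup lebesgue (\<lambda>x::real. 0::ereal) = 0" by (rule esssup_const)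
  moreover have "esssup lebesgue (\<lambda>x::real. 0::ereal) \<le> esssup lebesgue (\<lambda>x. ereal (norm (f x)))"
    by (intro esssup_mono) auto
  ultimately show ?thesis by simp
qed

lemma Linf_norm_bound:
  assumes "f \<in> Linf_space"
  shows "Linf_norm f \<ge> 0" "AE x in lborel. norm (f x) \<le> Linf_norm f"
proof -
  let ?e = "esssup lebesgue (\<lambda>x. ereal (norm (f x)))"
  have m [measurable]: "f \<in> borel_measurable lebesgue" and fin: "?e < \<infinity>" using assms by (auto simp: Linf_space_def)
  have e0: "?e \<ge> 0" by (rule esssup_norm_nonneg[OF m])
  then show "Linf_norm f \<ge> 0" by (simp add: Linf_norm_def real_of_ereal_pos)
  have r: "?e = ereal (Linf_norm f)" using e0 fin by (simp add: Linf_norm_def ereal_real)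
  have "AE x in lebesgue. ereal (norm (f x)) \<le> ?e" by (rule esssup_AE)
  then have "AE x in lebesgue. norm (f x) \<le> Linf_norm f" unfolding r by simp
  then show "AE x in lborel. norm (f x) \<le> Linf_norm f" by (simp add: AE_completion_iff)
qed

lemma Linf_norm_leI:
  assumes g: "g \<in> borel_measurable borel" "AE x in lborel. f x = g x" and le: "\<And>x. norm (g x) \<le> K"
  shows "f \<in> Linf_space" "Linf_norm f \<le> K"
proof -
  have m [measurable]: "f \<in> borel_measurable lebesgue" by (rule measurable_lebesgue_AE[OF g])
  have "AE x in lborel. norm (f x) \<le> K" using g(2) le by (auto elim: AE_mp)
  then have "AE x in lebesgue. ereal (norm (f x)) \<le> ereal K" by (simp add: AE_completion_iff)
  then have e: "esssup lebesgue (\<lambda>x. ereal (norm (f x))) \<le> ereal K" by (intro esssup_I) auto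
  show "f \<in> Linf_space" using e m unfolding Linf_space_def by (auto intro: order_le_less_trans)
  have "0 \<le> esssup lebesgue (\<lambda>x. ereal (norm (f x)))" by (rule esssup_norm_nonneg[OF m])
  then show "Linf_norm f \<le> K" using e unfolding Linf_norm_def
    by (cases "esssup lebesgue (\<lambda>x. ereal (norm (f x)))") auto
qed

text \<open>The weighted factor is bounded pointwise and taken out of the integral; the rest is the
  supremum estimate, used with exponent 4 as a convenient value above 2. The L^2 and L^4 norms it
  asks for are finite because <x>^(-2s) and <x>^(-4s) are integrable for s > 1/2.\<close>

theorem T4_bound_weighted_Linf:
  assumes s: "s > 1 / 2"
  shows "\<exists>C. trilinear_bound \<T>4 (wLinf_space s) (wLinf_norm s) C"
proof -
  have s0: "s \<ge> 0" using s by simp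
  obtain D where D: "D \<ge> 1" "\<And>u. japanese u powr s * hermite_fun 0 u \<le> D * gauss u" "\<And>u. hermite_fun 0 u \<le> D * gauss u"
    using japanese_hermite0_bound[OF s0] by blast
  let ?Jh = "\<lambda>x. japanese x powr s * hermite_fun 0 x"
  obtain I2 where I2: "I2 \<ge> 0" "(\<integral>\<^sup>+x. ennreal (japanese x powr (- (2 * s))) \<partial>lborel) \<le> ennreal I2"
    using japanese_powr_integral[of "2 * s"] s by auto
  obtain I4 where I4: "I4 \<ge> 0" "(\<integral>\<^sup>+x. ennreal (japanese x powr (- (4 * s))) \<partial>lborel) \<le> ennreal I4"
    using japanese_powr_integral[of "4 * s"] s by auto
  obtain c0 where sc: "sup_const 4 c0" using Sop_sup_bound[of 4] by auto
  note c0 = sup_const_nonneg[OF sc] and sup = sup_constD[OF sc]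
  let ?c = "sqrt (8 / pi) * 3 powr (s / 2)"
  define k where "k = c0 * D * I4 powr (1 / 4) * sqrt I2"
  have k: "k \<ge> 0" using c0 D I2 by (simp add: k_def)
  have rep: "\<exists>g. g \<in> borel_measurable borel \<and> (AE x in lborel. f x = g x) \<and> (\<forall>x. norm (weighted s g x) \<le> wLinf_norm s f)" if "f \<in> wLinf_space s" for f
  proof -
    have f: "weighted s f \<in> Linf_space" using that by (simp add: wLinf_space_def)
    then have "weighted s f \<in> borel_measurable lebesgue" by (simp add: Linf_space_def)
    then obtain G where [measurable]: "G \<in> borel_measurable borel" and ae: "AE x in lborel. f x = G x" "AE x in lborel. weighted s f x = weighted s G x"
      by (rule weighted_rep)
    note b = Linf_norm_bound[OF f, folded wLinf_norm_def]
    \<comment> \<open>Setting the representative to 0 where the essential bound fails makes the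
      bound hold everywhere, so it can be used at rotated points without null sets.\<close>
    define g where "g x = (if norm (weighted s G x) \<le> wLinf_norm s f then G x else 0)" for x
    have "g \<in> borel_measurable borel" unfolding g_def[abs_def] by measurable
    moreover have "AE x in lborel. f x = g x"
      using ae b(2) by eventually_elim (simp add: g_def)
    moreover have "norm (weighted s g x) \<le> wLinf_norm s f" for x
      using b(1) by (cases "norm (weighted s G x) \<le> wLinf_norm s f") (simp_all add: g_def weighted_def)
    ultimately show ?thesis by blast
  qed
  have n2: "nsq (\<lambda>x. norm (g x)) \<le> ennreal (a\<^sup>2 * I2)" "(\<integral>\<^sup>+x. ennreal (norm (g x) powr 4) \<partial>lborel) \<le> ennreal (a ^ 4 * I4)"
    if [measurable]: "g \<in> borel_measurable borel" and le: "\<And>x. norm (weighted s g x) \<le> a" and a: "a \<ge> 0" for g a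
  proof -
    have b: "norm (g x) \<le> a * japanese x powr (- s)" for x
    proof -
      have "norm (g x) = (japanese x powr s * norm (g x)) * japanese x powr (- s)"
        by (simp add: powr_minus field_simps less_imp_neq[symmetric])
      also have "\<dots> \<le> a * japanese x powr (- s)" using le[of x] unfolding norm_weighted by (intro mult_right_mono) auto
      finally show ?thesis .
    qed
    have pw: "norm (g x) ^ n \<le> a ^ n * japanese x powr (- (real n * s))" for x n
    proof -
      have "norm (g x) ^ n \<le> (a * japanese x powr (- s)) ^ n" by (intro power_mono b) auto
      also have "\<dots> = a ^ n * japanese x powr (- (real n * s))"
        by (simp add: power_mult_distrib powr_power less_imp_neq[symmetric] mult.commute)
      finally show ?thesis .
    qed
    have "nsq (\<lambda>x. norm (g x)) \<le> (\<integral>\<^sup>+x. ennreal (a\<^sup>2) * ennreal (japanese x powr (- (2 * s))) \<partial>lborel)"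
      unfolding nsq_def using pw[of _ 2] by (intro nn_integral_mono) (simp add: ennreal_mult[symmetric] ennreal_leI)
    also have "\<dots> \<le> ennreal (a\<^sup>2) * ennreal I2"
      by (subst nn_integral_cmult) (auto intro!: mult_left_mono I2)
    finally show "nsq (\<lambda>x. norm (g x)) \<le> ennreal (a\<^sup>2 * I2)" by (simp add: ennreal_mult I2)
    have "(\<integral>\<^sup>+x. ennreal (norm (g x) powr 4) \<partial>lborel) \<le> (\<integral>\<^sup>+x. ennreal (a ^ 4) * ennreal (japanese x powr (- (4 * s))) \<partial>lborel)"
      using pw[of _ 4] by (intro nn_integral_mono) (simp add: ennreal_mult[symmetric] ennreal_leI)
    also have "\<dots> \<le> ennreal (a ^ 4) * ennreal I4"
      by (subst nn_integral_cmult) (auto intro!: mult_left_mono I4)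
    finally show "(\<integral>\<^sup>+x. ennreal (norm (g x) powr 4) \<partial>lborel) \<le> ennreal (a ^ 4 * I4)" by (simp add: ennreal_mult I4)
  qed
  have "trilinear_bound \<T>4 (wLinf_space s) (wLinf_norm s) (3 * ?c * k)"
    unfolding trilinear_bound_def
  proof (intro ballI)
    fix f1 f2 f3 assume f: "f1 \<in> wLinf_space s" "f2 \<in> wLinf_space s" "f3 \<in> wLinf_space s"
    define a1 where "a1 = wLinf_norm s f1"
    define a2 where "a2 = wLinf_norm s f2"
    define a3 where "a3 = wLinf_norm s f3"
    have a: "a1 \<ge> 0" "a2 \<ge> 0" "a3 \<ge> 0"
      using f by (auto simp: a1_def a2_def a3_def wLinf_norm_def wLinf_space_def intro: Linf_norm_bound)
    obtain g1 where g1 [measurable]: "g1 \<in> borel_measurable borel" and ae1: "AE x in lborel. f1 x = g1 x" and b1: "\<And>x. norm (weighted s g1 x) \<le> a1"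
      using rep[OF f(1)] unfolding a1_def by blast
    obtain g2 where g2 [measurable]: "g2 \<in> borel_measurable borel" and ae2: "AE x in lborel. f2 x = g2 x" and b2: "\<And>x. norm (weighted s g2 x) \<le> a2"
      using rep[OF f(2)] unfolding a2_def by blast
    obtain g3 where g3 [measurable]: "g3 \<in> borel_measurable borel" and ae3: "AE x in lborel. f3 x = g3 x" and b3: "\<And>x. norm (weighted s g3 x) \<le> a3"
      using rep[OF f(3)] unfolding a3_def by blast
    have gL: "g1 \<in> L2" "g2 \<in> L2" "g3 \<in> L2"
      using n2(1)[OF g1 b1 a(1)] n2(1)[OF g2 b2 a(2)] n2(1)[OF g3 b3 a(3)] I2(1)
      by (auto simp: nsq_def intro!: L2_I(1))
    let ?n = "\<lambda>g x. norm (g x)" and ?w = "\<lambda>g x. norm (weighted s g x)"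
    have K: "(\<integral>\<^sup>+(\<theta>, y, c). ennreal (norm (g (m x \<theta> y c)) * (P (rc x \<theta> y c) * (norm (g3 y) * hermite_fun 0 c))) \<partial>nu) \<le> ennreal (k * (b * a3))"
      if [measurable]: "g \<in> borel_measurable borel" "P \<in> borel_measurable borel" and le: "\<And>x. norm (weighted s g x) \<le> b" and b: "b \<ge> 0"
        and P: "\<And>u. P u \<ge> 0" "\<And>u. P u \<le> D * gauss u" and m: "m = rx \<or> m = ry" for g P b m x
    proof -
      have "(\<integral>\<^sup>+(\<theta>, y, c). ennreal (norm (g (m x \<theta> y c)) * (P (rc x \<theta> y c) * (norm (g3 y) * hermite_fun 0 c))) \<partial>nu)
        \<le> ennreal (c0 * D * (b ^ 4 * I4) powr (1 / 4) * sqrt (a3\<^sup>2 * I2))"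
        using sup[of "?n g" P "?n g3" D "b ^ 4 * I4" "a3\<^sup>2 * I2" m x] n2(2)[OF _ le b] n2(1)[OF g3 b3 a(3)] D P m I2 I4 b by simp
      also have "(b ^ 4 * I4) powr (1 / 4) = b * I4 powr (1 / 4)"
      proof -
        have "(b ^ 4) powr (1 / 4) = b"
        proof (cases "b = 0")
          case False
          then have "(b ^ 4) powr (1 / 4) = (b powr 4) powr (1 / 4)" using b by (simp add: powr_numeral)
          also have "\<dots> = b" using False b by (simp only: powr_powr) simp
          finally show ?thesis .
        qed simp
        then show ?thesis by (simp add: powr_mult)
      qed
      also have "sqrt (a3\<^sup>2 * I2) = a3 * sqrt I2" using a by (simp add: real_sqrt_mult)
      finally show ?thesis by (simp add: k_def mult_ac)
    qed
    have bound: "(\<integral>\<^sup>+(\<theta>, y, c). ennreal (uu \<theta> y c) \<partial>nu) \<le> ennreal (k * (a1 * a2 * a3))"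
      if vvm: "(\<lambda>(\<theta>, y, c). vv \<theta> y c) \<in> borel_measurable nu" and le: "\<And>\<theta> y c. uu \<theta> y c \<le> ee * vv \<theta> y c" and ee: "ee \<ge> 0" and vv: "\<And>\<theta> y c. vv \<theta> y c \<ge> 0"
        and K: "(\<integral>\<^sup>+(\<theta>, y, c). ennreal (vv \<theta> y c) \<partial>nu) \<le> ennreal (k * (bb * a3))" and bb: "bb \<ge> 0" "ee * bb = a1 * a2"
      for uu vv :: "real \<Rightarrow> real \<Rightarrow> real \<Rightarrow> real" and ee bb
    proof -
      have m: "(\<lambda>(\<theta>, y, c). ennreal (vv \<theta> y c)) \<in> borel_measurable nu"
        using measurable_compose[OF vvm measurable_ennreal] by (simp add: case_prod_unfold)
      have "(\<integral>\<^sup>+(\<theta>, y, c). ennreal (uu \<theta> y c) \<partial>nu) \<le> (\<integral>\<^sup>+w. ennreal ee * (case w of (\<theta>, y, c) \<Rightarrow> ennreal (vv \<theta> y c)) \<partial>nu)"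
        using le ee vv by (intro nn_integral_mono) (auto simp: ennreal_mult[symmetric] ennreal_leI)
      also have "\<dots> = ennreal ee * (\<integral>\<^sup>+(\<theta>, y, c). ennreal (vv \<theta> y c) \<partial>nu)" by (rule nn_integral_cmult[OF m])
      also have "\<dots> \<le> ennreal ee * ennreal (k * (bb * a3))" by (intro mult_left_mono K) auto
      also have "\<dots> = ennreal (k * ((ee * bb) * a3))" using ee k bb a by (simp add: ennreal_mult[symmetric] mult_ac)
      finally show ?thesis unfolding bb(2) .
    qed
    have h: "norm (weighted s (rotop g1 g2 g3) x) \<le> 3 * ?c * k * (a1 * a2 * a3)" for x
    proof -
      let ?v = "\<lambda>g m P \<theta> y c. norm (g (m x \<theta> y c)) * (P (rc x \<theta> y c) * (norm (g3 y) * hermite_fun 0 c))"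
      \<comment> \<open>In the third term the weight is on the Gaussian, so g1 is bounded without
        it.\<close>
      have le1: "norm (g1 u) \<le> a1" for u using b1[of u] norm_le_weighted[OF s0, of g1 u] by linarith
      have s1: "Sop (?w g1) (?n g2) (hermite_fun 0) (?n g3) x \<le> ennreal (k * (a1 * a2 * a3))"
        unfolding Sop_def
      proof (rule bound[OF _ _ a(1) _ K[OF g2 _ b2 a(2), of "hermite_fun 0" ry] a(2) refl])
        show "norm (weighted s g1 (rx x \<theta> y c)) * norm (g2 (ry x \<theta> y c)) * hermite_fun 0 (rc x \<theta> y c) * (norm (g3 y) * hermite_fun 0 c)
           \<le> a1 * ?v g2 ry (hermite_fun 0) \<theta> y c" for \<theta> y c
          using mult_right_mono[OF b1, of "?v g2 ry (hermite_fun 0) \<theta> y c" "rx x \<theta> y c"] by (simp add: mult_ac)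
        show "(\<lambda>(\<theta>, y, c). ?v g2 ry (hermite_fun 0) \<theta> y c) \<in> borel_measurable nu" by measurable
        show "0 \<le> ?v g2 ry (hermite_fun 0) \<theta> y c" for \<theta> y c by simp
        show "hermite_fun 0 \<in> borel_measurable borel" by measurable
        show "0 \<le> hermite_fun 0 u" "hermite_fun 0 u \<le> D * gauss u" for u using D(3) by auto
      qed simp
      have s2: "Sop (?n g1) (?w g2) (hermite_fun 0) (?n g3) x \<le> ennreal (k * (a1 * a2 * a3))"
        unfolding Sop_def
      proof (rule bound[OF _ _ a(2) _ K[OF g1 _ b1 a(1), of "hermite_fun 0" rx] a(1) mult.commute])
        show "norm (g1 (rx x \<theta> y c)) * norm (weighted s g2 (ry x \<theta> y c)) * hermite_fun 0 (rc x \<theta> y c) * (norm (g3 y) * hermite_fun 0 c)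
           \<le> a2 * ?v g1 rx (hermite_fun 0) \<theta> y c" for \<theta> y c
          using mult_right_mono[OF b2, of "?v g1 rx (hermite_fun 0) \<theta> y c" "ry x \<theta> y c"] by (simp add: mult_ac)
        show "(\<lambda>(\<theta>, y, c). ?v g1 rx (hermite_fun 0) \<theta> y c) \<in> borel_measurable nu" by measurable
        show "0 \<le> ?v g1 rx (hermite_fun 0) \<theta> y c" for \<theta> y c by simp
        show "hermite_fun 0 \<in> borel_measurable borel" by measurable
        show "0 \<le> hermite_fun 0 u" "hermite_fun 0 u \<le> D * gauss u" for u using D(3) by auto
      qed simp
      have s3: "Sop (?n g1) (?n g2) ?Jh (?n g3) x \<le> ennreal (k * (a1 * a2 * a3))"
        unfolding Sop_def
      proof (rule bound[OF _ _ a(1) _ K[OF g2 _ b2 a(2), of ?Jh ry] a(2) refl])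
        show "norm (g1 (rx x \<theta> y c)) * norm (g2 (ry x \<theta> y c)) * ?Jh (rc x \<theta> y c) * (norm (g3 y) * hermite_fun 0 c)
           \<le> a1 * ?v g2 ry ?Jh \<theta> y c" for \<theta> y c
          using mult_right_mono[OF le1, of "?v g2 ry ?Jh \<theta> y c" "rx x \<theta> y c"] by (simp add: mult_ac)
        show "(\<lambda>(\<theta>, y, c). ?v g2 ry ?Jh \<theta> y c) \<in> borel_measurable nu" by measurable
        show "0 \<le> ?v g2 ry ?Jh \<theta> y c" for \<theta> y c by simp
        show "?Jh \<in> borel_measurable borel" by measurable
        show "0 \<le> ?Jh u" "?Jh u \<le> D * gauss u" for u using D(2) by auto
      qed simp
      have "ennreal (norm (weighted s (rotop g1 g2 g3) x)) \<le> ennreal ?c * (ennreal (k * (a1 * a2 * a3)) + ennreal (k * (a1 * a2 * a3)) + ennreal (k * (a1 * a2 * a3)))"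
        by (rule order_trans[OF Sop_weight[OF s0 g1 g2 g3]]) (intro mult_left_mono add_mono s1 s2 s3; simp)
      also have "\<dots> = ennreal (3 * ?c * k * (a1 * a2 * a3))"
        using k a by (simp add: ennreal_mult[symmetric] ennreal_plus[symmetric] mult_ac del: ennreal_plus)
      finally show ?thesis using k a by (simp add: ennreal_le_iff)
    qed
    have "AE x in lborel. weighted s (\<T>4 f1 f2 f3) x = weighted s (rotop g1 g2 g3) x"
      using T4_AE(2)[OF gL ae1 ae2 ae3] by eventually_elim (simp add: weighted_def)
    from Linf_norm_leI[OF _ this h]
    show "\<T>4 f1 f2 f3 \<in> wLinf_space s \<and> wLinf_norm s (\<T>4 f1 f2 f3) \<le> 3 * ?c * k * (wLinf_norm s f1 * wLinf_norm s f2 * wLinf_norm s f3)"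
      unfolding a1_def a2_def a3_def by (auto simp: wLinf_space_def wLinf_norm_def)
  qed
  then show ?thesis by blast
qed

section \<open>Sobolev spaces\<close>

lemma integrable_hermite_fun: "integrable lborel (hermite_fun n)"
proof -
  obtain C where "\<And>x. \<bar>hermite_fun n x\<bar> \<le> C * exp (- (x\<^sup>2) / 4)" using hermite_fun_bound by blast
  then show ?thesis by (intro integrable_gaussian_bound[where a="1/4" and C=C]) auto
qed

definition fourier_L1 :: "(real \<Rightarrow> complex) \<Rightarrow> real \<Rightarrow> complex" where
  "fourier_L1 f \<xi> = of_real (1 / sqrt (2 * pi)) * (LINT x|lborel. cis (- (x * \<xi>)) * f x)"

lemma measurable_fourier_L1 [measurable]:
  assumes [measurable]: "f \<in> borel_measurable borel"
  shows "fourier_L1 f \<in> borel_measurable borel"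
  unfolding fourier_L1_def[abs_def] by measurable

lemma fourier_L1_bounded:
  assumes f: "integrable lborel f"
  shows "norm (fourier_L1 f \<xi>) \<le> (1 / sqrt (2 * pi)) * (LINT x|lborel. norm (f x))"
proof -
  have "norm (LINT x|lborel. cis (- (x * \<xi>)) * f x) \<le> (LINT x|lborel. norm (cis (- (x * \<xi>)) * f x))"
    by (rule integral_norm_bound)
  then have "norm (LINT x|lborel. cis (- (x * \<xi>)) * f x) \<le> (LINT x|lborel. norm (f x))"
    by (simp add: norm_mult)
  moreover have "norm (complex_of_real (1 / sqrt (2 * pi))) = 1 / sqrt (2 * pi)"
    unfolding norm_of_real by simp
  ultimately show ?thesis unfolding fourier_L1_def norm_mult by (metis mult_left_mono norm_ge_zero)
qed

text \<open>Fubini moves the transform onto the Hermite function, an eigenfunction with eigenvalue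
  (-i)^n.\<close>

lemma fourier_L1_coef:
  assumes f: "integrable lborel f"
  shows "(LINT \<xi>|lborel. fourier_L1 f \<xi> * of_real (hermite_fun n \<xi>)) = (- \<i>) ^ n * coef f n"
proof -
  have [measurable]: "f \<in> borel_measurable borel" using f by auto
  let ?F = "\<lambda>\<xi> x. cis (- (x * \<xi>)) * f x * of_real (hermite_fun n \<xi>)"
  have "integrable (lborel \<Otimes>\<^sub>M lborel) (\<lambda>(\<xi>, x). \<bar>hermite_fun n \<xi>\<bar> * norm (f x))"
    by (intro lborel_pair.integrable_pair_mult integrable_abs integrable_hermite_fun integrable_norm f)
  then have i: "integrable (lborel \<Otimes>\<^sub>M lborel) (\<lambda>(\<xi>, x). ?F \<xi> x)"
  proof (rule Bochner_Integration.integrable_bound)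
    show "AE z in lborel \<Otimes>\<^sub>M lborel. norm (case z of (\<xi>, x) \<Rightarrow> ?F \<xi> x) \<le> norm (case z of (\<xi>, x) \<Rightarrow> \<bar>hermite_fun n \<xi>\<bar> * norm (f x))"
      by (intro AE_I2) (auto simp: norm_mult)
  qed measurable
  have "(LINT \<xi>|lborel. fourier_L1 f \<xi> * of_real (hermite_fun n \<xi>))
    = (LINT \<xi>|lborel. of_real (1 / sqrt (2 * pi)) * (LINT x|lborel. ?F \<xi> x))"
    unfolding fourier_L1_def mult.assoc[of "of_real _"] integral_mult_left_zero ..
  also have "\<dots> = of_real (1 / sqrt (2 * pi)) * (LINT \<xi>|lborel. LINT x|lborel. ?F \<xi> x)"
    by (rule integral_mult_right_zero)
  also have "(LINT \<xi>|lborel. LINT x|lborel. ?F \<xi> x) = (LINT x|lborel. LINT \<xi>|lborel. ?F \<xi> x)"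
    by (rule lborel_pair.Fubini_integral[OF i, symmetric])
  also have "\<dots> = (LINT x|lborel. f x * (LINT \<xi>|lborel. cis (- (\<xi> * x)) * of_real (hermite_fun n \<xi>)))"
    by (simp add: mult_ac)
  also have "\<dots> = (LINT x|lborel. (of_real (sqrt (2 * pi)) * (- \<i>) ^ n) * (f x * of_real (hermite_fun n x)))"
    unfolding fourier_hermite_fun by (intro Bochner_Integration.integral_cong refl) (simp add: mult_ac)
  also have "\<dots> = (of_real (sqrt (2 * pi)) * (- \<i>) ^ n) * coef f n"
    unfolding coef_def by (rule integral_mult_right_zero)
  also have "of_real (1 / sqrt (2 * pi)) * ((of_real (sqrt (2 * pi)) * (- \<i>) ^ n) * coef f n) = (- \<i>) ^ n * coef f n"
    by (simp add: mult.assoc[symmetric] flip: of_real_mult)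
  finally show ?thesis .
qed

definition fourier_coef :: "(nat \<Rightarrow> complex) \<Rightarrow> nat \<Rightarrow> complex" where
  "fourier_coef c n = (- \<i>) ^ n * c n"

lemma norm_fourier_coef [simp]: "norm (fourier_coef c n) = norm (c n)"
  by (simp add: fourier_coef_def norm_mult norm_power)

text \<open>Constructs the Plancherel transform of f from its Hermite coefficients.\<close>

lemma fourier_coef_realised:
  assumes "f \<in> L2"
  obtains h where "h \<in> L2" "coef h = fourier_coef (coef f)"
proof -
  have s: "summable (\<lambda>n. (norm (fourier_coef (coef f) n))\<^sup>2)" using coef_summable[OF assms] by simp
  then obtain N where N: "good_seq (fourier_coef (coef f)) N" using good_seq_exists by blast
  show thesis by (rule that[OF hermite_series_L2(1)[OF s N]]) (rule ext, rule coef_hermite_series[OF s N])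
qed

text \<open>So far \<open>fourier_L1 f\<close> is known to be bounded but not to be square
  integrable, so \<open>L2_coef_unique\<close> cannot be applied. Completeness under a Gaussian
  weight covers the difference of a bounded and a square-integrable function.\<close>

lemma fourier_L1_L2:
  assumes f: "integrable lborel f" "f \<in> L2" and h: "h \<in> L2" "coef h = fourier_coef (coef f)"
  shows "AE \<xi> in lborel. fourier_L1 f \<xi> = h \<xi>"
proof -
  have [measurable]: "f \<in> borel_measurable borel" "h \<in> borel_measurable borel" using f h by auto
  define B where "B = (1 / sqrt (2 * pi)) * (LINT x|lborel. norm (f x))"
  have i1: "integrable lborel (\<lambda>\<xi>. fourier_L1 f \<xi> * of_real (g \<xi>))" if "integrable lborel g" for g :: "real \<Rightarrow> real"
  proof (rule Bochner_Integration.integrable_bound[OF integrable_mult_right[OF that, of B]])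
    have [measurable]: "g \<in> borel_measurable borel" using that by auto
    show "(\<lambda>\<xi>. fourier_L1 f \<xi> * of_real (g \<xi>)) \<in> borel_measurable lborel" by measurable
    show "AE \<xi> in lborel. norm (fourier_L1 f \<xi> * of_real (g \<xi>)) \<le> norm (B * g \<xi>)"
    proof (rule AE_I2)
      fix \<xi>
      have "norm (fourier_L1 f \<xi>) \<le> \<bar>B\<bar>" using fourier_L1_bounded[OF f(1), of \<xi>] unfolding B_def by linarith
      then show "norm (fourier_L1 f \<xi> * of_real (g \<xi>)) \<le> norm (B * g \<xi>)"
        by (simp add: norm_mult abs_mult mult_right_mono)
    qed
  qed
  have "AE \<xi> in lborel. fourier_L1 f \<xi> - h \<xi> = 0"
  proof (rule hermite_complete)
    show "integrable lborel (\<lambda>\<xi>. (fourier_L1 f \<xi> - h \<xi>) * of_real (gauss \<xi>))"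
      unfolding left_diff_distrib
      by (intro Bochner_Integration.integrable_diff i1 integrable_gauss L2_mult_integrable h gauss_L2)
    fix n
    have "(LINT \<xi>|lborel. (fourier_L1 f \<xi> - h \<xi>) * of_real (hermite_fun n \<xi>))
      = (LINT \<xi>|lborel. fourier_L1 f \<xi> * of_real (hermite_fun n \<xi>)) - coef h n"
      unfolding left_diff_distrib coef_def
      by (intro Bochner_Integration.integral_diff i1 integrable_hermite_fun L2_mult_integrable h hermite_fun_L2)
    also have "\<dots> = 0" unfolding fourier_L1_coef[OF f(1)] h(2) by (simp add: fourier_coef_def)
    finally show "(LINT \<xi>|lborel. (fourier_L1 f \<xi> - h \<xi>) * of_real (hermite_fun n \<xi>)) = 0" .
  qed measurable
  then show ?thesis by simp
qed

section \<open>The L^2 Fourier transform as a limit of truncations\<close>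

lemma sqnorm_truncation_tendsto:
  assumes f: "f \<in> L2"
  shows "((\<lambda>R. sqnorm (\<lambda>x. f x - of_real (indicator {-R..R} x) * f x)) \<longlongrightarrow> 0) at_top"
proof -
  have [measurable]: "f \<in> borel_measurable borel" using f by auto
  let ?s = "\<lambda>R x. (norm (f x - of_real (indicator {-R..R} x) * f x))\<^sup>2"
  have 1: "\<forall>\<^sub>F R in at_top. AE x in lborel. norm (?s R x) \<le> (norm (f x))\<^sup>2"
    by (intro always_eventually allI AE_I2) (auto simp: indicator_def)
  have 2: "AE x in lborel. ((\<lambda>R. ?s R x) \<longlongrightarrow> 0) at_top"
  proof (rule AE_I2)
    fix x :: real
    have "\<forall>\<^sub>F R in at_top. ?s R x = 0"
      using eventually_ge_at_top[of "\<bar>x\<bar>"] by eventually_elim (auto simp: indicator_def)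
    then show "((\<lambda>R. ?s R x) \<longlongrightarrow> 0) at_top" by (rule tendsto_eventually)
  qed
  have 3: "?s R \<in> borel_measurable lborel" for R by measurable
  have "((\<lambda>R. integral\<^sup>L lborel (?s R)) \<longlongrightarrow> integral\<^sup>L lborel (\<lambda>x::real. 0)) at_top"
    by (rule integral_dominated_convergence_at_top[OF _ 3 L2_integrable[OF f] 2 1]) simp
  then show ?thesis by (simp add: sqnorm_def)
qed

lemma fourier_AE:
  assumes f: "f' \<in> L2" "AE x in lborel. f x = f' x" and h: "h \<in> L2" "coef h = fourier_coef (coef f')"
  shows "fourier f \<in> Lp_space 2 \<and> (AE \<xi> in lborel. fourier f \<xi> = h \<xi>)"
proof -
  have [measurable]: "f' \<in> borel_measurable borel" "h \<in> borel_measurable borel" using f h by auto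
  have fm [measurable]: "f \<in> borel_measurable lebesgue" by (rule measurable_lebesgue_AE[OF _ f(2)]) measurable
  have [measurable]: "(\<lambda>x::real. x) \<in> borel_measurable lebesgue" by (rule measurable_completion) simp
  let ?fR = "\<lambda>R x. complex_of_real (indicator {-R..R} x) * f' x"
  have ind: "(\<lambda>x. complex_of_real (indicator {-R..R} x)) \<in> L2" for R :: real
  proof -
    have "(norm (complex_of_real (indicator {-R..R} x)))\<^sup>2 = indicator {-R..R} x" for x by (simp add: indicator_def)
    moreover have "integrable lborel (indicator {-R..R} :: real \<Rightarrow> real)"
      by (intro integrable_real_indicator) (auto simp: emeasure_lborel_Icc_eq)
    ultimately show ?thesis by (simp add: L2_def)
  qed
  have fR1: "integrable lborel (?fR R)" for R by (rule L2_mult_integrable[OF ind f(1)])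
  have fR2: "?fR R \<in> L2" for R
  proof -
    have "(\<integral>\<^sup>+x. ennreal ((norm (?fR R x))\<^sup>2) \<partial>lborel) \<le> (\<integral>\<^sup>+x. ennreal ((norm (f' x))\<^sup>2) \<partial>lborel)"
      by (intro nn_integral_mono ennreal_leI power_mono) (auto simp: indicator_def)
    then show ?thesis unfolding nn_integral_L2[OF f(1)] by (intro L2_I(1)) auto
  qed
  have trunc: "fourier_trunc R f = fourier_L1 (?fR R)" for R
  proof
    fix \<xi>
    have "(LINT x|lebesgue. indicator {-R..R} x *\<^sub>R (cis (- (x * \<xi>)) * f x)) = (LINT x|lborel. cis (- (x * \<xi>)) * ?fR R x)"
    proof (rule integral_lebesgue_AE(2))
      show "AE x in lborel. indicator {-R..R} x *\<^sub>R (cis (- (x * \<xi>)) * f x) = cis (- (x * \<xi>)) * ?fR R x"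
        using f(2) by eventually_elim (simp add: scaleR_conv_of_real)
    qed measurable
    then show "fourier_trunc R f \<xi> = fourier_L1 (?fR R) \<xi>"
      by (simp add: fourier_trunc_def fourier_L1_def set_lebesgue_integral_def)
  qed
  \<comment> \<open>The factors (-i)^n have modulus 1, so Parseval turns the distance between the
    transforms into the distance between f' and its truncation.\<close>
  have key: "fourier_trunc R f \<in> L2 \<and> sqnorm (\<lambda>\<xi>. h \<xi> - fourier_trunc R f \<xi>) = sqnorm (\<lambda>x. f' x - ?fR R x)" for R
  proof -
    obtain w where w: "w \<in> L2" "coef w = fourier_coef (coef (?fR R))" using fourier_coef_realised[OF fR2] by blast
    have [measurable]: "w \<in> borel_measurable borel" using w by auto
    have ae: "AE \<xi> in lborel. fourier_trunc R f \<xi> = w \<xi>"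
      unfolding trunc by (rule fourier_L1_L2[OF fR1 fR2 w])
    have [measurable]: "fourier_trunc R f \<in> borel_measurable borel" unfolding trunc by measurable
    have "(\<integral>\<^sup>+x. ennreal ((norm (fourier_trunc R f x))\<^sup>2) \<partial>lborel) = (\<integral>\<^sup>+x. ennreal ((norm (w x))\<^sup>2) \<partial>lborel)"
      by (rule nn_integral_cong_AE) (use ae in eventually_elim, simp)
    then have L: "fourier_trunc R f \<in> L2" unfolding nn_integral_L2[OF w(1)] by (intro L2_I(1)) auto
    have "sqnorm (\<lambda>\<xi>. h \<xi> - fourier_trunc R f \<xi>) = sqnorm (\<lambda>\<xi>. h \<xi> - w \<xi>)"
      by (rule sqnorm_cong_AE) (use ae in \<open>eventually_elim, simp\<close>, measurable)
    also have "\<dots> = (\<Sum>n. (norm (coef (\<lambda>\<xi>. h \<xi> - w \<xi>) n))\<^sup>2)" using h w by (intro Parseval) auto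
    also have "(\<lambda>n. (norm (coef (\<lambda>\<xi>. h \<xi> - w \<xi>) n))\<^sup>2) = (\<lambda>n. (norm (coef (\<lambda>x. f' x - ?fR R x) n))\<^sup>2)"
    proof
      fix n
      have "coef (\<lambda>\<xi>. h \<xi> - w \<xi>) n = fourier_coef (coef (\<lambda>x. f' x - ?fR R x)) n"
        using h w f(1) fR2 by (simp add: coef_diff fourier_coef_def right_diff_distrib)
      then show "(norm (coef (\<lambda>\<xi>. h \<xi> - w \<xi>) n))\<^sup>2 = (norm (coef (\<lambda>x. f' x - ?fR R x) n))\<^sup>2" by simp
    qed
    also have "(\<Sum>n. (norm (coef (\<lambda>x. f' x - ?fR R x) n))\<^sup>2) = sqnorm (\<lambda>x. f' x - ?fR R x)"
      using f(1) fR2 by (intro Parseval[symmetric]) auto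
    finally show ?thesis using L by simp
  qed
  show ?thesis
  proof (rule L2_limit_AE[where S="\<lambda>R. fourier_trunc R f" and F="at_top :: real filter"])
    show "((\<lambda>R. sqnorm (\<lambda>\<xi>. h \<xi> - fourier_trunc R f \<xi>)) \<longlongrightarrow> 0) at_top"
      using sqnorm_truncation_tendsto[OF f(1)] by (simp add: key)
    show "fourier f = (SOME u. u \<in> Lp_space 2 \<and> ((\<lambda>R. Lp_norm 2 (\<lambda>x. u x - fourier_trunc R f x)) \<longlongrightarrow> 0) at_top)"
      by (rule fourier_def)
  qed (use key h in auto)
qed

text \<open>
  The Fourier transform multiplies the \<open>n\<close>-th Hermite coefficient by \<open>(-\<i>) ^ n\<close>, and only the
  resonant terms \<open>m1 + m2 = m3 + m4\<close> survive in the form.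
\<close>

lemma rotform_fourier:
  assumes f: "f1 \<in> L2" "f2 \<in> L2" "f3 \<in> L2" "f4 \<in> L2"
    and h: "h1 \<in> L2" "h2 \<in> L2" "h3 \<in> L2" "h4 \<in> L2"
    and c: "coef h1 = fourier_coef (coef f1)" "coef h2 = fourier_coef (coef f2)"
      "coef h3 = fourier_coef (coef f3)" "coef h4 = fourier_coef (coef f4)"
  shows "rotform h1 h2 h3 h4 = rotform f1 f2 f3 f4"
proof -
  \<comment> \<open>The conjugated factors contribute powers of i, which cancel those of -i on
    resonance.\<close>
  have res: "(- \<i>) ^ m1 * (- \<i>) ^ m2 * cnj ((- \<i>) ^ m3) * cnj ((- \<i>) ^ m4) = 1" if "m1 + m2 = m3 + m4" for m1 m2 m3 m4
  proof -
    have "(- \<i>) ^ m1 * (- \<i>) ^ m2 * cnj ((- \<i>) ^ m3) * cnj ((- \<i>) ^ m4) = (- \<i>) ^ (m1 + m2) * \<i> ^ (m3 + m4)"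
      by (simp add: power_add)
    also have "\<dots> = (- \<i> * \<i>) ^ (m3 + m4)" unfolding that by (rule power_mult_distrib[symmetric])
    finally show ?thesis by simp
  qed
  have eq: "rotform (hermite_sum N (coef h1)) (hermite_sum N (coef h2)) (hermite_sum N (coef h3)) (hermite_sum N (coef h4))
    = rotform (hermite_sum N (coef f1)) (hermite_sum N (coef f2)) (hermite_sum N (coef f3)) (hermite_sum N (coef f4))" for N
  proof -
    have "of_real (sqrt (8 / pi)) * rotform (hermite_sum N (coef h1)) (hermite_sum N (coef h2)) (hermite_sum N (coef h3)) (hermite_sum N (coef h4))
      = of_real (sqrt (8 / pi)) * rotform (hermite_sum N (coef f1)) (hermite_sum N (coef f2)) (hermite_sum N (coef f3)) (hermite_sum N (coef f4))"
      unfolding rotform_hermite_sum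
    proof (intro sum.cong refl)
      fix m1 m2 m3 m4
      have "coef h1 m1 * coef h2 m2 * cnj (coef h3 m3) * cnj (coef h4 m4)
        = ((- \<i>) ^ m1 * (- \<i>) ^ m2 * cnj ((- \<i>) ^ m3) * cnj ((- \<i>) ^ m4)) * (coef f1 m1 * coef f2 m2 * cnj (coef f3 m3) * cnj (coef f4 m4))"
        unfolding c fourier_coef_def by (simp add: mult_ac)
      then show "coef h1 m1 * coef h2 m2 * cnj (coef h3 m3) * cnj (coef h4 m4) * (if m1 + m2 = m3 + m4 then of_real (4 * hermite4 m1 m2 m3 m4) else 0)
        = coef f1 m1 * coef f2 m2 * cnj (coef f3 m3) * cnj (coef f4 m4) * (if m1 + m2 = m3 + m4 then of_real (4 * hermite4 m1 m2 m3 m4) else 0)"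
        using res[of m1 m2 m3 m4] by (cases "m1 + m2 = m3 + m4") simp_all
    qed
    then show ?thesis by simp
  qed
  show ?thesis
    using rotform_limit[OF h] rotform_limit[OF f] unfolding eq by (rule LIMSEQ_unique)
qed

text \<open>The n-th coefficient is the form tested with phi_n, and phi_n is the transform of i^n
  phi_n. Invariance of the form brings all four arguments back, and conjugation turns i^n into
  (-i)^n.\<close>

lemma rotop_fourier:
  assumes f: "f1 \<in> L2" "f2 \<in> L2" "f3 \<in> L2" and h: "h1 \<in> L2" "h2 \<in> L2" "h3 \<in> L2"
    and c: "coef h1 = fourier_coef (coef f1)" "coef h2 = fourier_coef (coef f2)" "coef h3 = fourier_coef (coef f3)"
  shows "coef (rotop h1 h2 h3) = fourier_coef (coef (rotop f1 f2 f3))"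
proof
  fix n
  let ?h = "\<lambda>x. complex_of_real (hermite_fun n x)"
  let ?g = "\<lambda>x. \<i> ^ n * ?h x"
  have gL: "?g \<in> L2" and hL: "?h \<in> L2" by auto
  have "coef ?h = fourier_coef (coef ?g)"
  proof
    fix m
    have d: "coef ?h m = (if n = m then 1 else 0)"
      unfolding coef_def of_real_mult[symmetric] integral_complex_of_real hermite_fun_orthonormal by simp
    have "(- \<i>) ^ n * \<i> ^ n = 1" unfolding power_mult_distrib[symmetric] by simp
    then show "coef ?h m = fourier_coef (coef ?g) m"
      unfolding fourier_coef_def coef_cmult d by (cases "n = m") auto
  qed
  then have r: "rotform h1 h2 h3 ?h = rotform f1 f2 f3 ?g" by (intro rotform_fourier f h c gL hL)
  have "coef (rotop h1 h2 h3) n = of_real (sqrt (8 / pi)) * rotform h1 h2 h3 ?h"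
    using rotop_pairing[OF h hL] by (simp add: coef_def)
  also have "\<dots> = (LINT x|lborel. rotop f1 f2 f3 x * cnj (?g x))"
    unfolding r by (rule rotop_pairing[OF f gL, symmetric])
  also have "\<dots> = (LINT x|lborel. (- \<i>) ^ n * (rotop f1 f2 f3 x * ?h x))"
    by (intro Bochner_Integration.integral_cong refl) (simp add: mult_ac)
  also have "\<dots> = (- \<i>) ^ n * coef (rotop f1 f2 f3) n"
    unfolding coef_def by (rule integral_mult_right_zero)
  finally show "coef (rotop h1 h2 h3) n = fourier_coef (coef (rotop f1 f2 f3)) n"
    by (simp add: fourier_coef_def)
qed

theorem T4_bound_Hs:
  assumes s: "s \<ge> 0"
  shows "\<exists>C. trilinear_bound \<T>4 (Hs_space s) (Hs_norm s) C"
proof -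
  obtain C where C: "trilinear_bound \<T>4 (wLp_space 2 s) (wLp_norm 2 s) C"
    using T4_bound_weighted_L2[OF s] by blast
  have "trilinear_bound \<T>4 (Hs_space s) (Hs_norm s) C"
    unfolding trilinear_bound_def
  proof (intro ballI)
    have rep: "\<exists>g h. g \<in> L2 \<and> h \<in> L2 \<and> (AE x in lborel. f x = g x) \<and> coef h = fourier_coef (coef g) \<and> (AE x in lborel. fourier f x = h x)"
      if f: "f \<in> Lp_space 2" for f
    proof -
      obtain g where g: "g \<in> L2" "AE x in lborel. f x = g x" using Lp2_rep[OF f] by blast
      obtain h where h: "h \<in> L2" "coef h = fourier_coef (coef g)" using fourier_coef_realised[OF g(1)] by blast
      show ?thesis using fourier_AE[OF g h] g h by blast
    qed
    fix f1 f2 f3 assume f: "f1 \<in> Hs_space s" "f2 \<in> Hs_space s" "f3 \<in> Hs_space s"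
    then have f2s: "f1 \<in> Lp_space 2" "f2 \<in> Lp_space 2" "f3 \<in> Lp_space 2"
      and fs: "fourier f1 \<in> wLp_space 2 s" "fourier f2 \<in> wLp_space 2 s" "fourier f3 \<in> wLp_space 2 s"
      by (auto simp: Hs_space_def)
    obtain g1 h1 where 1: "g1 \<in> L2" "h1 \<in> L2" "AE x in lborel. f1 x = g1 x" "coef h1 = fourier_coef (coef g1)" "AE x in lborel. fourier f1 x = h1 x"
      using rep[OF f2s(1)] by blast
    obtain g2 h2 where 2: "g2 \<in> L2" "h2 \<in> L2" "AE x in lborel. f2 x = g2 x" "coef h2 = fourier_coef (coef g2)" "AE x in lborel. fourier f2 x = h2 x"
      using rep[OF f2s(2)] by blast
    obtain g3 h3 where 3: "g3 \<in> L2" "h3 \<in> L2" "AE x in lborel. f3 x = g3 x" "coef h3 = fourier_coef (coef g3)" "AE x in lborel. fourier f3 x = h3 x"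
      using rep[OF f2s(3)] by blast
    let ?K = "rotop g1 g2 g3" and ?K' = "rotop h1 h2 h3"
    note T = T4_AE[OF 1(1) 2(1) 3(1) 1(3) 2(3) 3(3)]
    \<comment> \<open>The operator applied to the Fourier transforms is represented by
      \<open>?K'\<close>, which turns out to be the transform of \<open>?K\<close>. The Sobolev
      bound therefore has the constant of the weighted one.\<close>
    note T' = T4_AE[OF 1(2) 2(2) 3(2) 1(5) 2(5) 3(5)]
    have K: "?K \<in> L2" and K': "?K' \<in> L2" by (intro rotop_L2 1 2 3)+
    have "coef ?K' = fourier_coef (coef ?K)"
      by (rule rotop_fourier[OF 1(1) 2(1) 3(1) 1(2) 2(2) 3(2) 1(4) 2(4) 3(4)])
    then have F: "AE x in lborel. fourier (\<T>4 f1 f2 f3) x = ?K' x"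
      using fourier_AE[OF K T(2) K'] by blast
    have m: "weighted s ?K' \<in> borel_measurable borel" using K' by (auto intro: measurable_weighted)
    have w: "AE x in lborel. weighted s (fourier (\<T>4 f1 f2 f3)) x = weighted s ?K' x"
      "AE x in lborel. weighted s (\<T>4 (fourier f1) (fourier f2) (fourier f3)) x = weighted s ?K' x"
      using F by (eventually_elim, simp add: weighted_def) (use T'(2) in eventually_elim, simp add: weighted_def)
    have eq: "fourier (\<T>4 f1 f2 f3) \<in> wLp_space 2 s \<longleftrightarrow> \<T>4 (fourier f1) (fourier f2) (fourier f3) \<in> wLp_space 2 s"
      "wLp_norm 2 s (fourier (\<T>4 f1 f2 f3)) = wLp_norm 2 s (\<T>4 (fourier f1) (fourier f2) (fourier f3))"
      unfolding wLp_space_def wLp_norm_def mem_Collect_eq using Lp_AE[OF m w(1), of 2] Lp_AE[OF m w(2), of 2] by simp_all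
    show "\<T>4 f1 f2 f3 \<in> Hs_space s \<and> Hs_norm s (\<T>4 f1 f2 f3) \<le> C * (Hs_norm s f1 * Hs_norm s f2 * Hs_norm s f3)"
      using C fs T(1) unfolding trilinear_bound_def Hs_space_def Hs_norm_def mem_Collect_eq eq by blast
  qed
  then show ?thesis by blast
qed

theorem theorem4p8:
  shows "trilinear_bound \<T>4 (Lp_space 2) (Lp_norm 2) (sqrt (8 / pi))
    \<and> (\<forall>\<sigma>::real. \<sigma> \<ge> 0 \<longrightarrow> (\<exists>C. trilinear_bound \<T>4 (wLp_space 2 \<sigma>) (wLp_norm 2 \<sigma>) C))
    \<and> (\<forall>\<sigma>::real. \<sigma> \<ge> 0 \<longrightarrow> (\<exists>C. trilinear_bound \<T>4 (Hs_space \<sigma>) (Hs_norm \<sigma>) C))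
    \<and> (\<forall>s::real. s > 1 / 2 \<longrightarrow> (\<exists>C. trilinear_bound \<T>4 (wLinf_space s) (wLinf_norm s) C))
    \<and> (\<forall>(p::real) (s::real). p \<ge> 2 \<and> s > 1 / 2 - 1 / p \<longrightarrow>
         (\<exists>C. trilinear_bound \<T>4 (wLp_space p s) (wLp_norm p s) C))"
proof (intro conjI allI impI)
  fix p s :: real assume ps: "p \<ge> 2 \<and> s > 1 / 2 - 1 / p"
  show "\<exists>C. trilinear_bound \<T>4 (wLp_space p s) (wLp_norm p s) C"
  \<comment> \<open>At p = 2 the condition on s reads s > 0, which the weighted L^2 bound
    covers.\<close>
  proof (cases "p = 2")
    case True
    then show ?thesis using T4_bound_weighted_L2[of s] ps by simp
  next
    case False
    then show ?thesis using T4_bound_weighted_Lp[of p s] ps by simp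
  qed
qed (auto intro: T4_bound_L2 T4_bound_weighted_L2 T4_bound_Hs T4_bound_weighted_Linf)

end
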